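(* Consider the continuous-time Markov decision process (CTMDP) model described in the context, and suppose Condition 1 and Condition 2 are satisfied. Then the constrained total undiscounted CTMDP problem (minimize $E^\pi_\gamma[\int_0^\infty\int_A c_0(\xi_t,a)\pi(da|\omega,t)dt]$ over $\pi\in\Pi$ subject to $E^\pi_\gamma[\int_0^\infty\int_A c_j(\xi_t,a)\pi(da|\omega,t)dt]\le d_j$, $j=1,\dots,N$) admits an optimal policy which is stationary.
   Context: CTMDP model. $S$ and $A$ are nonempty Borel spaces, $\gamma$ is a probability measure on $\mathcal B(S)$, and $q(dy|x,a)$ is a signed kernel on $\mathcal B(S)$ given $(x,a)\in S\times A$ such that $\tilde q(\Gamma|x,a):=q(\Gamma\setminus\{x\}|x,a)\ge0$ for all $\Gamma\in\mathcal B(S)$, $q(S|x,a)=0$, and, with $q_x(a):=-q(\{x\}|x,a)\ge0$, $\sup_{a\in A}q_x(a)<\infty$ for each $x\in S$ (no bound uniform in $x$ is assumed). Conventions: $0/0:=0$, $0\cdot\infty:=0$, $c/0:=+\infty$ for $c>0$. Let $x_\infty\notin S$ be an isolated point. The sample space $\Omega$ consists of sequences $\omega=(x_0,\theta_1,x_1,\theta_2,\dots)$ with $x_n\in S$, $\theta_n\in(0,\infty)$, together with sequences $(x_0,\theta_1,\dots,\theta_n,x_n,\infty,x_\infty,\infty,x_\infty,\dots)$; $t_0:=0$, $t_n:=t_{n-1}+\theta_n$, $t_\infty:=\lim_n t_n$, $\xi_t:=\sum_{n\ge0}I\{t_n\le t<t_{n+1}\}x_n+I\{t_\infty\le t\}x_\infty$.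 A policy $\pi=(\pi_n)_{n\ge1}$ is a sequence of stochastic kernels $\pi_n(da|x_0,\theta_1,\dots,x_{n-1},s)$ on $A$ ($s>0$ is the time since the last jump), and $\pi(da|\omega,t):=\sum_{n\ge0}I\{t_n<t\le t_{n+1}\}\pi_{n+1}(da|x_0,\theta_1,\dots,x_n,t-t_n)$ for $t<t_\infty$ (after $t_\infty$ a dummy action at which all rates and costs vanish is used). A policy is stationary if $\pi_n(da|x_0,\dots,x_{n-1},s)=\varphi(da|x_{n-1})$ for one stochastic kernel $\varphi$ from $S$ to $A$. $\Pi$ denotes the set of all policies. Under $\pi$, $P^\pi_\gamma$ is the unique probability on $\Omega$ such that $x_0\sim\gamma$, $P^\pi_\gamma(\theta_{n+1}\ge t|x_0,\theta_1,\dots,x_n)=\exp(-\int_0^t\int_A q_{x_n}(a)\pi_{n+1}(da|x_0,\dots,x_n,s)ds)$, and $P^\pi_\gamma(x_{n+1}\in\Gamma|x_0,\dots,x_n,\theta_{n+1})=\frac{\int_A\tilde q(\Gamma|x_n,a)\pi_{n+1}(da|x_0,\dots,x_n,\theta_{n+1})}{\int_A q_{x_n}(a)\pi_{n+1}(da|x_0,\dots,x_n,\theta_{n+1})}$ for $\Gamma\in\mathcal B(S)$, the remaining probability going to $x_\infty$ (in particular $x_{n+1}=x_\infty$ when $\theta_{n+1}=\infty$); $E^\pi_\gamma$ is its expectation. Costs: measurable $c_0,\dots,c_N:S\times A\to[0,\infty)$, with $c_i(x_\infty,\cdot):=0$; constants $d_1,\dots,d_N\in[0,\infty)$. A policy is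 feasible if it satisfies the constraints, feasible with a finite value if moreover its $c_0$-objective is finite, and optimal if it is feasible and its objective equals the infimum of the objective over all feasible policies. Condition 1: (a) $A$ is compact; (b) for each bounded continuous $f$ on $S$, $(x,a)\mapsto\int_S f(y)\tilde q(dy|x,a)/q_x(a)$ is continuous on $S\times A$; (c) $(x,a)\mapsto q_x(a)$ is continuous; (d) each $c_i$, $i=0,\dots,N$, is lower semicontinuous on $S\times A$. Condition 2: there exists a feasible policy with a finite value. *)

theory Defs
  imports "HOL-Analysis.Analysis" "HOL-Probability.Probability"
begin

definition SM :: "'s::topological_space set \<Rightarrow> 's measure" where
  "SM S = restrict_space borel S"

definition posR :: "real measure" where
  "posR = restrict_space borel {0<..}"

text \<open>Measurable space on S extended by the isolated point x_inf (represented by None).\<close>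
definition optM :: "'s measure \<Rightarrow> 's option measure" where
  "optM M = sigma UNIV (insert {None} ((\<lambda>B. Some ` B) ` sets M))"

text \<open>History (x_0,theta_1,...,x_{n-1},theta_n) as pairs (x_k,theta_{k+1}), k<n, together with x_n.\<close>
definition histM :: "'s::topological_space set \<Rightarrow> nat \<Rightarrow> ((nat \<Rightarrow> 's \<times> real) \<times> 's) measure" where
  "histM S n = PiM {..<n} (\<lambda>_. SM S \<Otimes>\<^sub>M posR) \<Otimes>\<^sub>M SM S"

definition qt :: "('s \<Rightarrow> 'b \<Rightarrow> 's set \<Rightarrow> real) \<Rightarrow> 's \<Rightarrow> 'b \<Rightarrow> 's set \<Rightarrow> real" where
  "qt q x a \<Gamma> = q x a (\<Gamma> - {x})"

definition qx :: "('s \<Rightarrow> 'b \<Rightarrow> 's set \<Rightarrow> real) \<Rightarrow> 's \<Rightarrow> 'b \<Rightarrow> real" where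
  "qx q x a = - q x a {x}"

definition qtM :: "('s::topological_space \<Rightarrow> 'b \<Rightarrow> 's set \<Rightarrow> real) \<Rightarrow> 's set \<Rightarrow> 's \<Rightarrow> 'b \<Rightarrow> 's measure" where
  "qtM q S x a = measure_of S (sets (SM S)) (\<lambda>\<Gamma>. ennreal (qt q x a \<Gamma>))"

definition signed_kernel :: "'s::topological_space set \<Rightarrow> 'b::topological_space set \<Rightarrow> ('s \<Rightarrow> 'b \<Rightarrow> 's set \<Rightarrow> real) \<Rightarrow> bool" where
  "signed_kernel S A q \<longleftrightarrow>
     (\<forall>x\<in>S. \<forall>a\<in>A. \<forall>F. range F \<subseteq> sets (SM S) \<longrightarrow> disjoint_family F \<longrightarrow>
         (\<lambda>i. q x a (F i)) sums q x a (\<Union>i. F i)) \<and>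
     (\<forall>\<Gamma>\<in>sets (SM S). (\<lambda>(x,a). q x a \<Gamma>) \<in> borel_measurable (SM S \<Otimes>\<^sub>M SM A))"

definition lsc_on :: "'a::topological_space set \<Rightarrow> ('a \<Rightarrow> real) \<Rightarrow> bool" where
  "lsc_on T f \<longleftrightarrow> (\<forall>r. openin (top_of_set T) {z\<in>T. r < f z})"

type_synonym ('s,'b) policy = "nat \<Rightarrow> ((nat \<Rightarrow> 's \<times> real) \<times> 's) \<times> real \<Rightarrow> 'b measure"

text \<open>pol n is pi_{n+1}(da | x_0,theta_1,...,x_n, s).\<close>
definition is_policy :: "'s::topological_space set \<Rightarrow> 'b::topological_space set \<Rightarrow> ('s,'b) policy \<Rightarrow> bool" where
  "is_policy S A pol \<longleftrightarrow> (\<forall>n. pol n \<in> measurable (histM S n \<Otimes>\<^sub>M posR) (prob_algebra (SM A)))"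

definition stationary :: "'s::topological_space set \<Rightarrow> 'b::topological_space set \<Rightarrow> ('s,'b) policy \<Rightarrow> bool" where
  "stationary S A pol \<longleftrightarrow> (\<exists>\<phi>. \<phi> \<in> measurable (SM S) (prob_algebra (SM A)) \<and>
      (\<forall>n h x s. ((h,x),s) \<in> space (histM S n \<Otimes>\<^sub>M posR) \<longrightarrow> pol n ((h,x),s) = \<phi> x))"

type_synonym 's path = "nat \<Rightarrow> 's option \<times> ennreal"

text \<open>omega n = (x_n, theta_n); theta_0 = 0 is a dummy; None is x_inf; top is theta = infinity.\<close>
definition xs :: "'s path \<Rightarrow> nat \<Rightarrow> 's option" where "xs \<omega> n = fst (\<omega> n)"
definition th :: "'s path \<Rightarrow> nat \<Rightarrow> ennreal" where "th \<omega> n = snd (\<omega> n)"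

definition OmegaM :: "'s::topological_space set \<Rightarrow> 's path measure" where
  "OmegaM S = PiM UNIV (\<lambda>_. optM (SM S) \<Otimes>\<^sub>M (borel :: ennreal measure))"

definition Omega :: "'s set \<Rightarrow> 's path set" where
  "Omega S = {\<omega>. th \<omega> 0 = 0 \<and> xs \<omega> 0 \<in> Some ` S \<and>
      (\<forall>n. xs \<omega> n \<in> Some ` S \<or> xs \<omega> n = None) \<and>
      (\<forall>n. 0 < th \<omega> (Suc n)) \<and>
      (\<forall>n. th \<omega> (Suc n) = \<top> \<longleftrightarrow> xs \<omega> (Suc n) = None) \<and>
      (\<forall>n. th \<omega> (Suc n) = \<top> \<longrightarrow> th \<omega> (Suc (Suc n)) = \<top>)}"

definition jt :: "'s path \<Rightarrow> nat \<Rightarrow> ennreal" where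
  "jt \<omega> n = (\<Sum>k\<in>{1..n}. th \<omega> k)"

definition jinf :: "'s path \<Rightarrow> ennreal" where
  "jinf \<omega> = (SUP n. jt \<omega> n)"

definition state_at :: "'s path \<Rightarrow> real \<Rightarrow> 's option" where
  "state_at \<omega> t = (if \<exists>n. jt \<omega> n \<le> ennreal t \<and> ennreal t < jt \<omega> (Suc n)
      then xs \<omega> (THE n. jt \<omega> n \<le> ennreal t \<and> ennreal t < jt \<omega> (Suc n)) else None)"

definition alive :: "nat \<Rightarrow> 's path \<Rightarrow> bool" where
  "alive n \<omega> \<longleftrightarrow> (\<forall>k\<le>n. xs \<omega> k \<noteq> None)"

definition hist :: "nat \<Rightarrow> 's path \<Rightarrow> (nat \<Rightarrow> 's \<times> real) \<times> 's" where
  "hist n \<omega> = (restrict (\<lambda>k. (the (xs \<omega> k), enn2real (th \<omega> (Suc k)))) {..<n}, the (xs \<omega> n))"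

definition polAt :: "('s,'b) policy \<Rightarrow> 's path \<Rightarrow> real \<Rightarrow> 'b measure" where
  "polAt pol \<omega> t = (let n = (THE n. jt \<omega> n < ennreal t \<and> ennreal t \<le> jt \<omega> (Suc n))
      in pol n (hist n \<omega>, t - enn2real (jt \<omega> n)))"

definition cost_rate :: "('s \<times> 'b \<Rightarrow> real) \<Rightarrow> ('s,'b) policy \<Rightarrow> 's path \<Rightarrow> real \<Rightarrow> ennreal" where
  "cost_rate c pol \<omega> t = (if ennreal t < jinf \<omega> \<and> (\<exists>n. jt \<omega> n < ennreal t \<and> ennreal t \<le> jt \<omega> (Suc n))
      then \<integral>\<^sup>+ a. ennreal (c (the (state_at \<omega> t), a)) \<partial>(polAt pol \<omega> t) else 0)"

definition path_cost :: "('s \<times> 'b \<Rightarrow> real) \<Rightarrow> ('s,'b) policy \<Rightarrow> 's path \<Rightarrow> ennreal" where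
  "path_cost c pol \<omega> = (\<integral>\<^sup>+ t\<in>{0..}. cost_rate c pol \<omega> t \<partial>lborel)"

definition jump_ratio :: "('s \<Rightarrow> 'b \<Rightarrow> 's set \<Rightarrow> real) \<Rightarrow> 's \<Rightarrow> 'b measure \<Rightarrow> 's set \<Rightarrow> real" where
  "jump_ratio q x \<mu> \<Gamma> = (\<integral>a. qt q x a \<Gamma> \<partial>\<mu>) / (\<integral>a. qx q x a \<partial>\<mu>)"

definition strategic ::
  "'s::topological_space set \<Rightarrow> 's measure \<Rightarrow> ('s \<Rightarrow> 'b \<Rightarrow> 's set \<Rightarrow> real) \<Rightarrow> ('s,'b) policy \<Rightarrow> 's path measure \<Rightarrow> bool" where
  "strategic S \<gamma> q pol P \<longleftrightarrow>
     sets P = sets (OmegaM S) \<and> prob_space P \<and> (AE \<omega> in P. \<omega> \<in> Omega S) \<and>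
     (\<forall>\<Gamma>\<in>sets (SM S). emeasure P {\<omega>\<in>space P. xs \<omega> 0 \<in> Some ` \<Gamma>} = emeasure \<gamma> \<Gamma>) \<and>
     (\<forall>n. \<forall>H\<in>sets (histM S n). \<forall>t>0.
        emeasure P {\<omega>\<in>space P. alive n \<omega> \<and> hist n \<omega> \<in> H \<and> ennreal t \<le> th \<omega> (Suc n)} =
        (\<integral>\<^sup>+ \<omega>\<in>{\<omega>\<in>space P. alive n \<omega> \<and> hist n \<omega> \<in> H}.
           ennreal (exp (- (LINT s:{0<..t}|lborel. (\<integral>a. qx q (snd (hist n \<omega>)) a \<partial>(pol n (hist n \<omega>, s)))))) \<partial>P)) \<and>
     (\<forall>n. \<forall>H\<in>sets (histM S n). \<forall>B\<in>sets (borel :: real measure). B \<subseteq> {0<..} \<longrightarrow> (\<forall>\<Gamma>\<in>sets (SM S).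
        emeasure P {\<omega>\<in>space P. alive n \<omega> \<and> hist n \<omega> \<in> H \<and> th \<omega> (Suc n) \<in> ennreal ` B \<and> xs \<omega> (Suc n) \<in> Some ` \<Gamma>} =
        (\<integral>\<^sup>+ \<omega>\<in>{\<omega>\<in>space P. alive n \<omega> \<and> hist n \<omega> \<in> H \<and> th \<omega> (Suc n) \<in> ennreal ` B}.
           ennreal (jump_ratio q (snd (hist n \<omega>)) (pol n (hist n \<omega>, enn2real (th \<omega> (Suc n)))) \<Gamma>) \<partial>P)))"

definition Pstrat :: "'s::topological_space set \<Rightarrow> 's measure \<Rightarrow> ('s \<Rightarrow> 'b \<Rightarrow> 's set \<Rightarrow> real) \<Rightarrow> ('s,'b) policy \<Rightarrow> 's path measure" where
  "Pstrat S \<gamma> q pol = (THE P. strategic S \<gamma> q pol P)"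

definition objective ::
  "'s::topological_space set \<Rightarrow> 's measure \<Rightarrow> ('s \<Rightarrow> 'b \<Rightarrow> 's set \<Rightarrow> real) \<Rightarrow> ('s \<times> 'b \<Rightarrow> real) \<Rightarrow> ('s,'b) policy \<Rightarrow> ennreal" where
  "objective S \<gamma> q c pol = (\<integral>\<^sup>+ \<omega>. path_cost c pol \<omega> \<partial>(Pstrat S \<gamma> q pol))"

definition feasible ::
  "'s::topological_space set \<Rightarrow> 'b::topological_space set \<Rightarrow> 's measure \<Rightarrow> ('s \<Rightarrow> 'b \<Rightarrow> 's set \<Rightarrow> real) \<Rightarrow>
   (nat \<Rightarrow> 's \<times> 'b \<Rightarrow> real) \<Rightarrow> nat \<Rightarrow> (nat \<Rightarrow> real) \<Rightarrow> ('s,'b) policy \<Rightarrow> bool" where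
  "feasible S A \<gamma> q c N d pol \<longleftrightarrow> is_policy S A pol \<and>
     (\<forall>j\<in>{1..N}. objective S \<gamma> q (c j) pol \<le> ennreal (d j))"

end

theory Submission
  imports Defs
begin

text \<open>
  With the jump kernel \<open>Q = q~ / q\<close> and the costs per jump \<open>c\<^sub>i / q\<close>, a policy of finite cost induces measures \<open>\<mu>\<^sub>n\<close>
  on state-action pairs, the \<open>n\<close>-th one describing the \<open>n\<close>-th sojourn: the state marginal of \<open>\<mu>\<^sub>0\<close> is \<open>\<gamma>\<close>, that of
  \<open>\<mu>\<^sub>n\<^sub>+\<^sub>1\<close> is \<open>\<mu>\<^sub>n Q\<close>, and the integrals of \<open>c\<^sub>i / q\<close> against \<open>\<Sum>n. \<mu>\<^sub>n\<close> are bounded by the objectives. Since the action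
  space is compact and \<open>Q\<close> is weakly continuous, sequences of such measures are weakly compact, and since \<open>c\<^sub>i / q\<close> is lower
  semicontinuous, a limit along a minimizing sequence of policies is at least as good.

  To return to a stationary policy, let \<open>V\<close> be the limit of value iteration for the sum of all costs. On \<open>V = 0\<close> there is
  a measurable selector which costs nothing and never leaves \<open>V = 0\<close>. On \<open>V > 0\<close> the measure \<open>\<Sum>n. \<mu>\<^sub>n / q\<close> is \<open>\<sigma>\<close>-finite,
  because the \<open>n\<close>-th iterate has a finite integral, and its disintegration over the state space is the policy sought: the
  occupation measure which it generates is dominated by \<open>\<Sum>n. \<mu>\<^sub>n\<close>.
\<close>

section \<open>Measures from positive functionals\<close>

text \<open>Rates have no bound common to all states, and without discounting the total occupation
  measure need not even be sigma-finite. Compactness is therefore used sojourn by sojourn: each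
  measure has mass at most 1, and the state law of a step converges as soon as the preceding step
  does, so tightness in the state comes for free. Two obstacles remain. A path may stop jumping with
  positive probability, and such mass belongs to no jump; a finite cost forces a free action of rate
  zero to exist at that state. And \<open>c / q\<close> explodes where \<open>q\<close> vanishes;
  Condition 1(b) for the constant function 1 makes the pairs of rate zero an open and closed set,
  which saves the semicontinuity of \<open>c / q\<close> and bounds the nonzero rates at each state
  away from 0. Weak compactness, selection and disintegration are carried to the real line by a
  Borel code on which the tent functions depend continuously. The path measure is given by a
  definite description, so it first has to be constructed and shown to be unique.\<close>

definition pos_functional :: "'a measure \<Rightarrow> (('a \<Rightarrow> ennreal) \<Rightarrow> ennreal) \<Rightarrow> bool" where
  "pos_functional M \<Phi> \<longleftrightarrow>
    (\<forall>f g. (\<forall>x\<in>space M. f x = g x) \<longrightarrow> \<Phi> f = \<Phi> g) \<and>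
    (\<forall>f\<in>borel_measurable M. \<forall>g\<in>borel_measurable M. \<Phi> (\<lambda>x. f x + g x) = \<Phi> f + \<Phi> g) \<and>
    (\<forall>f\<in>borel_measurable M. \<forall>c. \<Phi> (\<lambda>x. c * f x) = c * \<Phi> f) \<and>
    (\<forall>F. (\<forall>i::nat. F i \<in> borel_measurable M) \<longrightarrow> incseq F \<longrightarrow> \<Phi> (\<lambda>x. SUP i. F i x) = (SUP i. \<Phi> (F i)))"

text \<open>The measure represented by \<open>\<Phi>\<close>. Laws of histories, transition kernels
  and occupation measures are introduced below as iterated integrals of a test function: the closure
  rules show that such an expression is a \<open>pos_functional\<close>, and integrating against its
  measure returns the expression.\<close>

definition functional_measure :: "'a measure \<Rightarrow> (('a \<Rightarrow> ennreal) \<Rightarrow> ennreal) \<Rightarrow> 'a measure" where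
  "functional_measure M \<Phi> = measure_of (space M) (sets M) (\<lambda>E. \<Phi> (indicator E))"

lemma pos_functionalD:
  assumes "pos_functional M \<Phi>"
  shows "(\<And>x. x \<in> space M \<Longrightarrow> f x = g x) \<Longrightarrow> \<Phi> f = \<Phi> g"
    and "f \<in> borel_measurable M \<Longrightarrow> g \<in> borel_measurable M \<Longrightarrow> \<Phi> (\<lambda>x. f x + g x) = \<Phi> f + \<Phi> g"
    and "f \<in> borel_measurable M \<Longrightarrow> \<Phi> (\<lambda>x. c * f x) = c * \<Phi> f"
    and "(\<And>i::nat. F i \<in> borel_measurable M) \<Longrightarrow> incseq F \<Longrightarrow> \<Phi> (\<lambda>x. SUP i. F i x) = (SUP i. \<Phi> (F i))"
  using assms by (simp_all add: pos_functional_def)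

lemma pos_functional_zero: "pos_functional M \<Phi> \<Longrightarrow> \<Phi> (\<lambda>x. 0) = 0"
  using pos_functionalD(3)[of M \<Phi> "\<lambda>x. 0" 0] by simp

lemma sets_functional_measure[simp, measurable_cong]: "sets (functional_measure M \<Phi>) = sets M"
  and space_functional_measure[simp]: "space (functional_measure M \<Phi>) = space M"
  by (simp_all add: functional_measure_def)

lemma emeasure_functional_measure:
  assumes \<Phi>: "pos_functional M \<Phi>" and E: "E \<in> sets M"
  shows "emeasure (functional_measure M \<Phi>) E = \<Phi> (indicator E)"
  unfolding functional_measure_def
proof (rule emeasure_measure_of_sigma)
  note D = pos_functionalD[OF \<Phi>]
  show "sigma_algebra (space M) (sets M)" ..
  show pos: "positive (sets M) (\<lambda>E. \<Phi> (indicator E))"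
    using pos_functional_zero[OF \<Phi>] by (simp add: positive_def indicator_def[abs_def])
  have add: "additive (sets M) (\<lambda>E. \<Phi> (indicator E))"
    unfolding additive_def
  proof safe
    fix A B assume [measurable]: "A \<in> sets M" "B \<in> sets M" and dis: "A \<inter> B = {}"
    have "\<Phi> (indicator (A \<union> B)) = \<Phi> (\<lambda>x. indicator A x + indicator B x)"
      using dis by (intro D(1)) (auto split: split_indicator)
    then show "\<Phi> (indicator (A \<union> B)) = \<Phi> (indicator A) + \<Phi> (indicator B)"
      by (simp add: D(2))
  qed
  show "countably_additive (sets M) (\<lambda>E. \<Phi> (indicator E))"
  proof (subst sets.countably_additive_iff_continuous_from_below[OF pos add], safe)
    fix F :: "nat \<Rightarrow> 'a set" assume F: "range F \<subseteq> sets M" "incseq F"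
    have "(\<lambda>i. \<Phi> (indicator (F i))) \<longlonglongrightarrow> (SUP i. \<Phi> (indicator (F i)))"
    proof (rule LIMSEQ_SUP, rule incseq_SucI)
      fix i
      have [measurable]: "F i \<in> sets M" "F (Suc i) - F i \<in> sets M" using F by auto
      have "\<Phi> (indicator (F (Suc i))) = \<Phi> (\<lambda>x. indicator (F i) x + indicator (F (Suc i) - F i) x)"
        using incseq_SucD[OF F(2), of i] by (intro D(1)) (auto split: split_indicator)
      then show "\<Phi> (indicator (F i)) \<le> \<Phi> (indicator (F (Suc i)))" by (simp add: D(2))
    qed
    also have "(SUP i. \<Phi> (indicator (F i))) = \<Phi> (\<lambda>x. SUP i. indicator (F i) x)"
      using F by (intro D(4)[symmetric]) (auto simp: incseq_def le_fun_def split: split_indicator)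
    also have "\<dots> = \<Phi> (indicator (\<Union>i. F i))"
    proof (rule D(1))
      fix x show "(SUP i. indicator (F i) x) = (indicator (\<Union>i. F i) x :: ennreal)"
      proof (cases "x \<in> (\<Union>i. F i)")
        case True
        then obtain i where "x \<in> F i" by auto
        then show ?thesis using True by (intro antisym SUP_least) (auto intro: SUP_upper2 split: split_indicator)
      qed auto
    qed
    finally show "(\<lambda>i. \<Phi> (indicator (F i))) \<longlonglongrightarrow> \<Phi> (indicator (\<Union>i. F i))" .
  qed
qed fact

lemma nn_integral_functional_measure:
  assumes \<Phi>: "pos_functional M \<Phi>" and f: "f \<in> borel_measurable M"
  shows "(\<integral>\<^sup>+x. f x \<partial>functional_measure M \<Phi>) = \<Phi> f"
  using f
proof (induction rule: borel_measurable_induct)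
  case (cong f g)
  then show ?case using pos_functionalD(1)[OF \<Phi>, of f g] nn_integral_cong[of "functional_measure M \<Phi>" f g] by simp
next
  case (set A)
  then show ?case by (simp add: emeasure_functional_measure[OF \<Phi>])
next
  case (mult u c)
  then show ?case by (simp add: nn_integral_cmult pos_functionalD(3)[OF \<Phi>])
next
  case (add u v)
  then show ?case by (simp add: nn_integral_add pos_functionalD(2)[OF \<Phi>])
next
  case (seq U)
  have "(\<integral>\<^sup>+x. (SUP i. U i) x \<partial>functional_measure M \<Phi>) = (\<integral>\<^sup>+x. (SUP i. U i x) \<partial>functional_measure M \<Phi>)"
    by (simp add: image_comp)
  also have "\<dots> = (SUP i. \<Phi> (U i))"
    using seq by (subst nn_integral_monotone_convergence_SUP) auto
  also have "\<dots> = \<Phi> (\<lambda>x. SUP i. U i x)"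
    using seq by (simp add: pos_functionalD(4)[OF \<Phi>])
  finally show ?case by (simp add: image_comp SUP_apply[abs_def])
qed

lemma pos_functional_nn_integral: "sets N = sets M \<Longrightarrow> pos_functional M (\<lambda>f. \<integral>\<^sup>+x. f x \<partial>N)"
  unfolding pos_functional_def
  by (auto simp: nn_integral_add nn_integral_cmult measurable_cong_sets[of N M] sets_eq_imp_space_eq[of N M]
    nn_integral_monotone_convergence_SUP intro!: nn_integral_cong)

lemma pos_functional_eval: "x \<in> space M \<Longrightarrow> pos_functional M (\<lambda>f. f x)"
  unfolding pos_functional_def by auto

text \<open>Monotonicity is not among the defining clauses; it comes from additivity, applied to
  \<open>F i\<close> and the increment \<open>F (Suc i) - F i\<close>.\<close>

lemma incseq_pos_functional:
  assumes \<Phi>: "pos_functional M \<Phi>" and F: "\<And>i::nat. F i \<in> borel_measurable M" "incseq F"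
  shows "incseq (\<lambda>i. \<Phi> (F i))"
proof (rule incseq_SucI)
  fix i
  have [measurable]: "F i \<in> borel_measurable M" for i by fact
  have "\<Phi> (F (Suc i)) = \<Phi> (\<lambda>x. F i x + (F (Suc i) x - F i x))"
    using incseq_SucD[OF F(2), of i] by (intro pos_functionalD(1)[OF \<Phi>]) (simp add: le_fun_def add_diff_inverse_ennreal)
  also have "\<dots> = \<Phi> (F i) + \<Phi> (\<lambda>x. F (Suc i) x - F i x)" by (rule pos_functionalD(2)[OF \<Phi>]) simp_all
  finally show "\<Phi> (F i) \<le> \<Phi> (F (Suc i))" by simp
qed

lemma pos_functional_integral:
  assumes \<Phi>: "\<And>h. h \<in> space L \<Longrightarrow> pos_functional M (\<Phi> h)"
    and meas: "\<And>f. f \<in> borel_measurable M \<Longrightarrow> (\<lambda>h. \<Phi> h f) \<in> borel_measurable L"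
  shows "pos_functional M (\<lambda>f. \<integral>\<^sup>+h. \<Phi> h f \<partial>L)"
  unfolding pos_functional_def
proof (intro conjI allI ballI impI)
  fix f g :: "_ \<Rightarrow> ennreal" assume "\<forall>x\<in>space M. f x = g x"
  then show "(\<integral>\<^sup>+h. \<Phi> h f \<partial>L) = (\<integral>\<^sup>+h. \<Phi> h g \<partial>L)"
    by (intro nn_integral_cong pos_functionalD(1)[OF \<Phi>]) simp_all
next
  fix f g :: "_ \<Rightarrow> ennreal" assume f: "f \<in> borel_measurable M" and g: "g \<in> borel_measurable M"
  have "(\<integral>\<^sup>+h. \<Phi> h (\<lambda>x. f x + g x) \<partial>L) = (\<integral>\<^sup>+h. \<Phi> h f + \<Phi> h g \<partial>L)"
    using pos_functionalD(2)[OF \<Phi> f g] by (intro nn_integral_cong) auto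
  then show "(\<integral>\<^sup>+h. \<Phi> h (\<lambda>x. f x + g x) \<partial>L) = (\<integral>\<^sup>+h. \<Phi> h f \<partial>L) + (\<integral>\<^sup>+h. \<Phi> h g \<partial>L)"
    using meas f g by (simp add: nn_integral_add)
next
  fix f :: "_ \<Rightarrow> ennreal" and c :: ennreal assume f: "f \<in> borel_measurable M"
  have "(\<integral>\<^sup>+h. \<Phi> h (\<lambda>x. c * f x) \<partial>L) = (\<integral>\<^sup>+h. c * \<Phi> h f \<partial>L)"
    using pos_functionalD(3)[OF \<Phi> f] by (intro nn_integral_cong) auto
  then show "(\<integral>\<^sup>+h. \<Phi> h (\<lambda>x. c * f x) \<partial>L) = c * (\<integral>\<^sup>+h. \<Phi> h f \<partial>L)"
    using meas f by (simp add: nn_integral_cmult)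
next
  fix F :: "nat \<Rightarrow> _ \<Rightarrow> ennreal" assume F: "\<forall>i. F i \<in> borel_measurable M" "incseq F"
  have "(\<integral>\<^sup>+h. \<Phi> h (\<lambda>x. SUP i. F i x) \<partial>L) = (\<integral>\<^sup>+h. (SUP i. \<Phi> h (F i)) \<partial>L)"
    using pos_functionalD(4)[OF \<Phi>] F by (intro nn_integral_cong) auto
  \<comment> \<open>Monotonicity in \<open>i\<close> is known only for \<open>h\<close> in the space
    of \<open>L\<close>, hence the almost-everywhere form of monotone convergence.\<close>
  also have "\<dots> = (SUP i. \<integral>\<^sup>+h. \<Phi> h (F i) \<partial>L)"
    using meas F incseq_pos_functional[OF \<Phi>, of _ F]
    by (intro nn_integral_monotone_convergence_SUP_AE) (auto simp: incseq_Suc_iff)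
  finally show "(\<integral>\<^sup>+h. \<Phi> h (\<lambda>x. SUP i. F i x) \<partial>L) = (SUP i. \<integral>\<^sup>+h. \<Phi> h (F i) \<partial>L)" .
qed

lemma pos_functional_cmult: "pos_functional M \<Phi> \<Longrightarrow> pos_functional M (\<lambda>f. c * \<Phi> f)"
  unfolding pos_functional_def
  by (intro conjI allI impI ballI; elim conjE)
    (simp_all add: distrib_left SUP_mult_left_ennreal mult.left_commute, metis)

lemma pos_functional_add:
  assumes "pos_functional M \<Phi>" "pos_functional M \<Psi>"
  shows "pos_functional M (\<lambda>f. \<Phi> f + \<Psi> f)"
  unfolding pos_functional_def
proof (intro conjI allI ballI impI)
  fix f g :: "_ \<Rightarrow> ennreal" assume "\<forall>x\<in>space M. f x = g x"
  then show "\<Phi> f + \<Psi> f = \<Phi> g + \<Psi> g" 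
    using pos_functionalD(1)[OF assms(1), of f g] pos_functionalD(1)[OF assms(2), of f g] by simp
next
  fix F :: "nat \<Rightarrow> _ \<Rightarrow> ennreal" assume F: "\<forall>i. F i \<in> borel_measurable M" "incseq F"
  show "\<Phi> (\<lambda>x. SUP i. F i x) + \<Psi> (\<lambda>x. SUP i. F i x) = (SUP i. \<Phi> (F i) + \<Psi> (F i))"
    using F by (simp add: pos_functionalD(4)[OF assms(1)] pos_functionalD(4)[OF assms(2)]
       ennreal_SUP_add[symmetric] incseq_pos_functional[OF assms(1)] incseq_pos_functional[OF assms(2)])
qed (simp_all add: pos_functionalD(2-3)[OF assms(1)] pos_functionalD(2-3)[OF assms(2)] distrib_left ac_simps)

text \<open>A series is an integral over the counting measure.\<close>

lemma pos_functional_suminf: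
  assumes "\<And>n::nat. pos_functional M (\<Phi> n)"
  shows "pos_functional M (\<lambda>f. \<Sum>n. \<Phi> n f)"
  using pos_functional_integral[of "count_space UNIV" M \<Phi>] assms
  by (simp add: nn_integral_count_space_nat)

lemma pos_functional_map:
  assumes \<Phi>: "pos_functional M \<Phi>" and T: "T \<in> measurable M N"
  shows "pos_functional N (\<lambda>f. \<Phi> (\<lambda>x. f (T x)))"
  unfolding pos_functional_def
proof (intro conjI allI ballI impI)
  fix f g :: "_ \<Rightarrow> ennreal" assume "\<forall>x\<in>space N. f x = g x"
  then show "\<Phi> (\<lambda>x. f (T x)) = \<Phi> (\<lambda>x. g (T x))"
    using measurable_space[OF T] by (intro pos_functionalD(1)[OF \<Phi>]) auto
next
  fix F :: "nat \<Rightarrow> _ \<Rightarrow> ennreal" assume F: "\<forall>i. F i \<in> borel_measurable N" "incseq F"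
  have [measurable]: "F i \<in> borel_measurable N" "T \<in> measurable M N" for i using F T by auto
  show "\<Phi> (\<lambda>x. SUP i. F i (T x)) = (SUP i. \<Phi> (\<lambda>x. F i (T x)))"
    using F(2) by (intro pos_functionalD(4)[OF \<Phi>]) (auto simp: incseq_def le_fun_def)
qed (use T in \<open>simp_all add: pos_functionalD(2-3)[OF \<Phi>]\<close>)

lemma pos_functional_density:
  assumes \<Phi>: "pos_functional M \<Phi>" and w: "w \<in> borel_measurable M"
  shows "pos_functional M (\<lambda>f. \<Phi> (\<lambda>x. w x * f x))"
  unfolding pos_functional_def
proof (intro conjI allI ballI impI)
  fix f :: "_ \<Rightarrow> ennreal" and c :: ennreal assume f: "f \<in> borel_measurable M"
  show "\<Phi> (\<lambda>x. w x * (c * f x)) = c * \<Phi> (\<lambda>x. w x * f x)"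
    using pos_functionalD(3)[OF \<Phi>, of "\<lambda>x. w x * f x" c] f w by (simp add: ac_simps)
next
  fix F :: "nat \<Rightarrow> _ \<Rightarrow> ennreal" assume F: "\<forall>i. F i \<in> borel_measurable M" "incseq F"
  have [measurable]: "F i \<in> borel_measurable M" "w \<in> borel_measurable M" for i using F w by auto
  have "\<Phi> (\<lambda>x. w x * (SUP i. F i x)) = \<Phi> (\<lambda>x. SUP i. w x * F i x)"
    by (simp add: SUP_mult_left_ennreal)
  also have "\<dots> = (SUP i. \<Phi> (\<lambda>x. w x * F i x))"
    using F(2) by (intro pos_functionalD(4)[OF \<Phi>]) (auto simp: incseq_def le_fun_def intro!: mult_left_mono)
  finally show "\<Phi> (\<lambda>x. w x * (SUP i. F i x)) = (SUP i. \<Phi> (\<lambda>x. w x * F i x))" .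
next
  fix f g :: "_ \<Rightarrow> ennreal" assume "\<forall>x\<in>space M. f x = g x"
  then show "\<Phi> (\<lambda>x. w x * f x) = \<Phi> (\<lambda>x. w x * g x)" by (intro pos_functionalD(1)[OF \<Phi>]) simp
qed (use w in \<open>simp_all add: pos_functionalD(2)[OF \<Phi>] distrib_left\<close>)

text \<open>Rectangles are stable under intersection and the whole space is one of them, so
  finiteness of \<open>N1\<close> carries over to \<open>N2\<close>.\<close>

lemma measure_eqI_pair_finite:
  assumes N: "sets N1 = sets (A \<Otimes>\<^sub>M B)" "sets N2 = sets (A \<Otimes>\<^sub>M B)"
    and fin: "emeasure N1 (space N1) \<noteq> \<infinity>"
    and eq: "\<And>a b. a \<in> sets A \<Longrightarrow> b \<in> sets B \<Longrightarrow> emeasure N1 (a \<times> b) = emeasure N2 (a \<times> b)"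
  shows "N1 = N2"
proof (rule measure_eqI_generator_eq[where E="{a \<times> b |a b. a \<in> sets A \<and> b \<in> sets B}" and \<Omega>="space A \<times> space B"
      and A="\<lambda>_. space A \<times> space B"])
  show "Int_stable {a \<times> b |a b. a \<in> sets A \<and> b \<in> sets B}" by (rule Int_stable_pair_measure_generator)
  show "{a \<times> b |a b. a \<in> sets A \<and> b \<in> sets B} \<subseteq> Pow (space A \<times> space B)"
    by (rule pair_measure_closed)
  show "emeasure N1 (space A \<times> space B) \<noteq> \<infinity>" 
    using fin sets_eq_imp_space_eq[OF N(1)] by (simp add: space_pair_measure)
qed (use N eq in \<open>auto simp: sets_pair_measure\<close>)

text \<open>Increments of second order force a zero derivative everywhere. This stands in for the
  chain rule: the primitive of a merely measurable intensity need not be differentiable at every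
  point, but second-order comparisons of increments hold at all of them.\<close>

lemma constant_of_quadratic_increments:
  fixes F :: "real \<Rightarrow> real"
  assumes inc: "\<And>a b. 0 \<le> a \<Longrightarrow> a \<le> b \<Longrightarrow> \<bar>F b - F a\<bar> \<le> K * (b - a)\<^sup>2" and t: "0 \<le> t"
  shows "F t = F 0"
proof -
  have sym: "\<bar>F y - F x\<bar> \<le> K * (y - x)\<^sup>2" if "0 \<le> x" "0 \<le> y" for x y
    using inc[of x y] inc[of y x] that by (cases "x \<le> y") (auto simp: abs_minus_commute power2_commute)
  have "(F has_field_derivative 0) (at x within {0..})" if x: "x \<in> {0..}" for x
    unfolding has_field_derivative_iff
  proof (rule Lim_null_comparison[where g="\<lambda>y. \<bar>K\<bar> * \<bar>y - x\<bar>"])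
    show "\<forall>\<^sub>F y in at x within {0..}. norm ((F y - F x) / (y - x)) \<le> \<bar>K\<bar> * \<bar>y - x\<bar>"
      unfolding eventually_at
    proof (intro exI[of _ 1] conjI ballI impI)
      fix y assume y: "y \<in> {0..}" "y \<noteq> x \<and> dist y x < 1"
      have "\<bar>F y - F x\<bar> \<le> K * (y - x)\<^sup>2" using sym x y by auto
      also have "\<dots> \<le> \<bar>K\<bar> * (y - x)\<^sup>2" by (intro mult_right_mono) auto
      finally show "norm ((F y - F x) / (y - x)) \<le> \<bar>K\<bar> * \<bar>y - x\<bar>"
        using y by (simp add: abs_divide divide_le_eq power2_eq_square abs_mult flip: abs_mult)
    qed simp
    have "((\<lambda>y. \<bar>K\<bar> * \<bar>y - x\<bar>) \<longlongrightarrow> \<bar>K\<bar> * \<bar>x - x\<bar>) (at x within {0..})" by (intro tendsto_intros)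
    then show "((\<lambda>y. \<bar>K\<bar> * \<bar>y - x\<bar>) \<longlongrightarrow> 0) (at x within {0..})" by simp
  qed
  then have "\<exists>c. \<forall>x\<in>{0..}. F x = c" by (intro has_field_derivative_zero_constant) auto
  then show ?thesis using t by auto
qed

lemma exp_neg_diff_bounds:
  fixes x y :: real assumes "x \<le> y"
  shows "exp (- y) * (y - x) \<le> exp (- x) - exp (- y)" "exp (- x) - exp (- y) \<le> exp (- x) * (y - x)"
proof -
  have "exp (-x) = exp (-y) * exp (y - x)" by (simp flip: exp_add)
  moreover have "exp (-y) * (1 + (y - x)) \<le> exp (-y) * exp (y - x)" by (intro mult_left_mono exp_ge_add_one_self) auto
  ultimately show "exp (- y) * (y - x) \<le> exp (- x) - exp (- y)" by (simp add: algebra_simps)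
  have "exp (-y) = exp (-x) * exp (x - y)" by (simp flip: exp_add)
  moreover have "exp (-x) * (1 + (x - y)) \<le> exp (-x) * exp (x - y)" by (intro mult_left_mono exp_ge_add_one_self) auto
  ultimately show "exp (- x) - exp (- y) \<le> exp (- x) * (y - x)" by (simp add: algebra_simps)
qed

text \<open>A lifetime with bounded measurable intensity \<open>l\<close> has density
  \<open>l * exp (- \<Lambda>)\<close>. From \<open>a\<close> to \<open>b\<close> the increments of
  both sides lie between \<open>exp (- \<Lambda> b) * d\<close> and
  \<open>exp (- \<Lambda> a) * d\<close> with
  \<open>d = \<Lambda> b - \<Lambda> a \<le> L * (b - a)\<close>; the gap between these bounds is at
  most \<open>d\<close> squared.\<close>

lemma hazard_integral:
  fixes l :: "real \<Rightarrow> real"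
  assumes l[measurable]: "l \<in> borel_measurable borel" and l0: "\<And>s. 0 \<le> l s" and lL: "\<And>s. l s \<le> L" and t: "0 \<le> t"
  defines "\<Lambda> \<equiv> \<lambda>t. LINT s:{0<..t}|lborel. l s"
  shows "(\<integral>\<^sup>+s\<in>{0<..t}. ennreal (l s * exp (- \<Lambda> s)) \<partial>lborel) = ennreal (1 - exp (- \<Lambda> t))"
    and "0 \<le> \<Lambda> t" and "\<Lambda> \<in> borel_measurable borel" and "mono \<Lambda>"
proof -
  have L: "0 \<le> L" using l0[of 0] lL[of 0] by simp
  have ii: "integrable lborel (indicat_real {a<..b})" for a b :: real
    by (cases "a \<le> b") (auto intro!: integrable_real_indicator)
  have si: "set_integrable lborel {a<..b} g" if "g \<in> borel_measurable borel" "\<And>s. \<bar>g s\<bar> \<le> L" for g :: "real \<Rightarrow> real" and a b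
    unfolding set_integrable_def
    by (rule Bochner_Integration.integrable_bound[where f="\<lambda>s. indicator {a<..b} s *\<^sub>R L"])
      (use that L ii[of a b] in \<open>auto split: split_indicator\<close>)
  have sil: "set_integrable lborel {a<..b} l" for a b using l0 lL by (intro si) auto
  have split: "(LINT s:{0<..b}|lborel. g s) - (LINT s:{0<..a}|lborel. g s) = (LINT s:{a<..b}|lborel. g s)"
    if "g \<in> borel_measurable borel" "\<And>s. \<bar>g s\<bar> \<le> L" "0 \<le> a" "a \<le> b" for g :: "real \<Rightarrow> real" and a b
  proof -
    have "{0<..b} = {0<..a} \<union> {a<..b}" using that by auto
    then have "(LINT s:{0<..b}|lborel. g s) = (LINT s:{0<..a}|lborel. g s) + (LINT s:{a<..b}|lborel. g s)"
      using that by (simp add: set_integral_Un si)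
    then show ?thesis by simp
  qed
  show mono: "mono \<Lambda>"
  proof
    fix a b :: real assume "a \<le> b"
    then show "\<Lambda> a \<le> \<Lambda> b" unfolding \<Lambda>_def set_lebesgue_integral_def
      by (intro integral_mono) (use sil l0 in \<open>auto simp: set_integrable_def split: split_indicator\<close>)
  qed
  show pos: "0 \<le> \<Lambda> t" for t
    unfolding \<Lambda>_def set_lebesgue_integral_def using l0 by (intro integral_nonneg_AE) auto
  show meas[measurable]: "\<Lambda> \<in> borel_measurable borel" using mono by (rule borel_measurable_mono)
  define g where "g s = l s * exp (- \<Lambda> s)" for s
  have [measurable]: "g \<in> borel_measurable borel" unfolding g_def by measurable
  have g0: "0 \<le> g s" for s using l0 by (simp add: g_def)
  have gl: "g s \<le> l s" for s using l0[of s] pos[of s] by (simp add: g_def mult_left_le)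
  have gL: "\<bar>g s\<bar> \<le> L" for s using g0[of s] gl[of s] lL[of s] by simp
  define \<Psi> where "\<Psi> t = (LINT s:{0<..t}|lborel. g s)" for t
  \<comment> \<open>The defect of the claimed identity; second-order increments will make it
    constant, and it starts at 0.\<close>
  define F where "F t = 1 - exp (- \<Lambda> t) - \<Psi> t" for t
  have "F t = F 0"
  proof (rule constant_of_quadratic_increments[of _ "L\<^sup>2", OF _ t])
    fix a b :: real assume ab: "0 \<le> a" "a \<le> b"
    define d where "d = \<Lambda> b - \<Lambda> a"
    have d: "d = (LINT s:{a<..b}|lborel. l s)" unfolding d_def \<Lambda>_def using ab l0 lL by (intro split) auto
    have "d \<le> (LINT s:{a<..b}|lborel. L)" unfolding d set_lebesgue_integral_def
      by (intro integral_mono) (use sil[of a b] lL L ii[of a b] in \<open>auto simp: set_integrable_def split: split_indicator\<close>)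
    then have dL: "d \<le> L * (b - a)" using ab by (simp add: set_lebesgue_integral_def mult.commute)
    have d0: "0 \<le> d" using mono ab by (simp add: d_def monoD)
    have \<Psi>: "\<Psi> b - \<Psi> a = (LINT s:{a<..b}|lborel. g s)" unfolding \<Psi>_def using ab gL by (intro split) auto
    have "(LINT s:{a<..b}|lborel. exp (- \<Lambda> b) * l s) \<le> \<Psi> b - \<Psi> a"
      unfolding \<Psi> set_lebesgue_integral_def
      using si[OF \<open>g \<in> borel_measurable borel\<close> gL, of a b] set_integrable_mult_right[of "exp (- \<Lambda> b)" lborel "{a<..b}" l] sil[of a b] l0 monoD[OF mono]
      by (intro integral_mono) (auto simp: set_integrable_def g_def mult.commute split: split_indicator intro!: mult_left_mono)
    then have lo: "exp (- \<Lambda> b) * d \<le> \<Psi> b - \<Psi> a" by (simp add: d)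
    have "\<Psi> b - \<Psi> a \<le> (LINT s:{a<..b}|lborel. exp (- \<Lambda> a) * l s)"
      unfolding \<Psi> set_lebesgue_integral_def
      using si[OF \<open>g \<in> borel_measurable borel\<close> gL, of a b] set_integrable_mult_right[of "exp (- \<Lambda> a)" lborel "{a<..b}" l] sil[of a b] l0 monoD[OF mono]
      by (intro integral_mono) (auto simp: set_integrable_def g_def mult.commute split: split_indicator intro!: mult_left_mono)
    then have hi: "\<Psi> b - \<Psi> a \<le> exp (- \<Lambda> a) * d" by (simp add: d)
    have e: "exp (- \<Lambda> b) * d \<le> exp (- \<Lambda> a) - exp (- \<Lambda> b)" "exp (- \<Lambda> a) - exp (- \<Lambda> b) \<le> exp (- \<Lambda> a) * d"
      unfolding d_def using d0 by (auto intro!: exp_neg_diff_bounds simp: d_def)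
    have "\<bar>F b - F a\<bar> \<le> exp (- \<Lambda> a) * d - exp (- \<Lambda> b) * d"
      using lo hi e by (simp add: F_def abs_le_iff)
    also have "\<dots> = (exp (- \<Lambda> a) - exp (- \<Lambda> b)) * d" by (simp add: algebra_simps)
    also have "\<dots> \<le> (exp (- \<Lambda> a) * d) * d" using e(2) d0 by (rule mult_right_mono)
    also have "\<dots> \<le> (1 * d) * d" using d0 pos[of a] by (intro mult_right_mono) auto
    also have "\<dots> \<le> (L * (b - a)) * (L * (b - a))" using dL d0 by (auto intro!: mult_mono)
    finally show "\<bar>F b - F a\<bar> \<le> L\<^sup>2 * (b - a)\<^sup>2" by (simp add: power2_eq_square ac_simps)
  qed
  moreover have "F 0 = 0" by (simp add: F_def \<Lambda>_def \<Psi>_def set_lebesgue_integral_def)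
  ultimately have eq: "\<Psi> t = 1 - exp (- \<Lambda> t)" by (simp add: F_def)
  have "(\<integral>\<^sup>+s\<in>{0<..t}. ennreal (l s * exp (- \<Lambda> s)) \<partial>lborel) = (\<integral>\<^sup>+s. ennreal (indicator {0<..t} s *\<^sub>R g s) \<partial>lborel)"
    by (intro nn_integral_cong) (auto simp: g_def split: split_indicator)
  also have "\<dots> = ennreal (\<Psi> t)"
    unfolding \<Psi>_def set_lebesgue_integral_def
    using si[of g, OF _ gL] g0 by (intro nn_integral_eq_integral) (auto simp: set_integrable_def split: split_indicator)
  finally show "(\<integral>\<^sup>+s\<in>{0<..t}. ennreal (l s * exp (- \<Lambda> s)) \<partial>lborel) = ennreal (1 - exp (- \<Lambda> t))"
    by (simp add: eq)
qed

section \<open>Lower semicontinuous functions\<close>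

text \<open>Relative to \<open>T\<close>, because the model is semicontinuous only on
  \<open>S \<times> A\<close>, and with values in \<open>ennreal\<close>, because a cost per jump
  can be infinite.\<close>

definition lsc :: "'a::topological_space set \<Rightarrow> ('a \<Rightarrow> ennreal) \<Rightarrow> bool" where
  "lsc T f \<longleftrightarrow> (\<forall>r. openin (top_of_set T) {z\<in>T. r < f z})"

lemma lscD: "lsc T f \<Longrightarrow> openin (top_of_set T) {z\<in>T. r < f z}"
  by (simp add: lsc_def)

lemma lsc_cong: "(\<And>z. z \<in> T \<Longrightarrow> f z = g z) \<Longrightarrow> lsc T f \<longleftrightarrow> lsc T g"
  unfolding lsc_def by (auto intro!: arg_cong[where f="openin _"] cong: conj_cong)

lemma lsc_SUP: "(\<And>i. i \<in> I \<Longrightarrow> lsc T (f i)) \<Longrightarrow> lsc T (\<lambda>z. SUP i\<in>I. f i z)"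
proof (unfold lsc_def, intro allI)
  fix r :: ennreal assume *: "\<And>i. i \<in> I \<Longrightarrow> \<forall>r. openin (top_of_set T) {z \<in> T. r < f i z}"
  have "{z \<in> T. r < (SUP i\<in>I. f i z)} = (\<Union>i\<in>I. {z \<in> T. r < f i z})" by (auto simp: less_SUP_iff)
  then show "openin (top_of_set T) {z \<in> T. r < (SUP i\<in>I. f i z)}" using * by auto
qed

lemma continuous_imp_lsc:
  fixes f :: "'a::topological_space \<Rightarrow> real"
  assumes "continuous_on T f" shows "lsc T (\<lambda>z. ennreal (f z))"
  unfolding lsc_def
proof
  fix r
  have "continuous_on T (\<lambda>z. ennreal (f z))" using assms by (intro continuous_on_ennreal)
  then have "openin (top_of_set T) (T \<inter> (\<lambda>z. ennreal (f z)) -` {r<..})"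
    by (rule continuous_openin_preimage_gen) simp
  moreover have "T \<inter> (\<lambda>z. ennreal (f z)) -` {r<..} = {z\<in>T. r < ennreal (f z)}" by auto
  ultimately show "openin (top_of_set T) {z\<in>T. r < ennreal (f z)}" by simp
qed

lemma lsc_subset: "lsc T f \<Longrightarrow> U \<subseteq> T \<Longrightarrow> lsc U f"
  unfolding lsc_def
proof
  fix r assume *: "\<forall>r. openin (top_of_set T) {z \<in> T. r < f z}" "U \<subseteq> T"
  then obtain V where V: "open V" "{z \<in> T. r < f z} = T \<inter> V" by (metis openin_open)
  then have "{z \<in> U. r < f z} = U \<inter> V" using *(2) by blast
  then show "openin (top_of_set U) {z \<in> U. r < f z}" using V by (auto simp: openin_open)
qed

lemma lsc_compose:
  assumes f: "lsc T f" and g: "continuous_on U g" "g \<in> U \<rightarrow> T"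
  shows "lsc U (\<lambda>x. f (g x))"
  unfolding lsc_def
proof
  fix r
  have "openin (top_of_set U) (U \<inter> g -` {z\<in>T. r < f z})"
    by (rule continuous_openin_preimage[OF g lscD[OF f]])
  moreover have "U \<inter> g -` {z\<in>T. r < f z} = {x\<in>U. r < f (g x)}" using g(2) by auto
  ultimately show "openin (top_of_set U) {x\<in>U. r < f (g x)}" by simp
qed

lemma closedin_fst_image:
  assumes "compact K" "closedin (top_of_set (T \<times> K)) F"
  shows "closedin (top_of_set T) (fst ` F)"
proof -
  have "compact_space (top_of_set K)" using assms(1) by (simp add: compact_space_subtopology)
  then have "closed_map (prod_topology (top_of_set T) (top_of_set K)) (top_of_set T) fst"
    by (rule Abstract_Topological_Spaces.closed_map_fst)
  moreover have "closedin (prod_topology (top_of_set T) (top_of_set K)) F"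
    using assms(2) by simp
  ultimately show ?thesis by (auto simp: closed_map_def)
qed

text \<open>If the infimum were not attained, the sets on which \<open>f\<close> exceeds one of its
  own values would cover \<open>K\<close>; but in a finite subcover the generating point of least
  value lies in none of the sets.\<close>

lemma lsc_attains_INF:
  assumes f: "lsc K f" and K: "compact K" "K \<noteq> {}"
  shows "\<exists>y\<in>K. f y = (INF y\<in>K. f y)"
proof (rule ccontr)
  assume "\<not> ?thesis"
  then have gt: "y \<in> K \<Longrightarrow> (INF y\<in>K. f y) < f y" for y
    by (metis INF_lower order_le_less)
  define m where "m = (INF y\<in>K. f y)"
  define \<C> where "\<C> = (\<lambda>y0. {y\<in>K. f y0 < f y}) ` K"
  have "\<exists>y0\<in>K. f y0 < f y" if "y \<in> K" for y using gt[OF that] by (auto simp: INF_less_iff)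
  then have cov: "K \<subseteq> \<Union>\<C>" by (auto simp: \<C>_def)
  have "\<exists>\<D>. finite \<D> \<and> \<D> \<subseteq> \<C> \<and> K \<subseteq> \<Union>\<D>"
  proof -
    have "\<forall>c\<in>\<C>. \<exists>U. open U \<and> c = K \<inter> U" using lscD[OF f] by (auto simp: \<C>_def openin_open)
    then obtain U where U: "\<And>c. c \<in> \<C> \<Longrightarrow> open (U c) \<and> c = K \<inter> U c" by metis
    have "K \<subseteq> \<Union>(U ` \<C>)" using cov U by blast
    then obtain D where D: "D \<subseteq> \<C>" "finite D" "K \<subseteq> (\<Union>c\<in>D. U c)"
      using compactE_image[OF K(1), of \<C> U] U by blast
    then have "K \<subseteq> \<Union>D" using U by blast
    then show ?thesis using D by blast
  qed
  then obtain \<D> where \<D>: "finite \<D>" "\<D> \<subseteq> (\<lambda>y0. {y\<in>K. f y0 < f y}) ` K" "K \<subseteq> \<Union>\<D>"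
    unfolding \<C>_def by blast
  from finite_subset_image[OF \<D>(1,2)]
  obtain Y where Y: "Y \<subseteq> K" "finite Y" "\<D> = (\<lambda>y0. {y\<in>K. f y0 < f y}) ` Y" by blast
  have KY: "K \<subseteq> (\<Union>y0\<in>Y. {y\<in>K. f y0 < f y})" using \<D>(3) by (simp add: Y(3))
  then have "Y \<noteq> {}" using K by auto
  then have "Min (f ` Y) \<in> f ` Y" using Y(2) by (intro Min_in) auto
  then obtain y1 where y1: "y1 \<in> Y" "f y1 = Min (f ` Y)" by auto
  then have "y1 \<in> K" using Y(1) by auto
  then obtain y0 where "y0 \<in> Y" "f y0 < f y1" using KY by auto
  moreover have "f y1 \<le> f y0" using \<open>y0 \<in> Y\<close> Y(2) y1(2) by simp
  ultimately show False by simp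
qed

text \<open>Since the infimum over \<open>K\<close> is attained, the complement of a superlevel set
  is the projection of a closed set along the compact \<open>K\<close>, and such projections are
  closed.\<close>

lemma lsc_INF:
  assumes f: "lsc (T \<times> K) f" and K: "compact K" "K \<noteq> {}"
  shows "lsc T (\<lambda>x. INF y\<in>K. f (x, y))"
  unfolding lsc_def
proof
  fix r
  have cl: "closedin (top_of_set (T \<times> K)) (T \<times> K - {z \<in> T \<times> K. r < f z})"
    using closedin_diff[OF closedin_topspace lscD[OF f, of r]] by simp
  have "r < (INF y\<in>K. f (x, y)) \<longleftrightarrow> (\<forall>y\<in>K. r < f (x, y))" if "x \<in> T" for x
  proof -
    have "lsc K (\<lambda>y. f (x, y))" using that by (intro lsc_compose[OF f] continuous_intros) auto
    from lsc_attains_INF[OF this K] show ?thesis by (metis INF_lower less_le_trans)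
  qed
  then have "{x \<in> T. r < (INF y\<in>K. f (x, y))} = T - fst ` (T \<times> K - {z \<in> T \<times> K. r < f z})"
    by (force simp: image_iff)
  then show "openin (top_of_set T) {x \<in> T. r < (INF y\<in>K. f (x, y))}"
    using openin_diff[OF openin_topspace closedin_fst_image[OF K(1) cl]] by simp
qed

subsection \<open>Tent functions\<close>

definition dense_seq :: "nat \<Rightarrow> 'a::{metric_space,second_countable_topology}" where
  "dense_seq = (SOME f. \<forall>X. open X \<longrightarrow> X \<noteq> {} \<longrightarrow> (\<exists>n. f n \<in> X))"

lemma dense_seq: "open X \<Longrightarrow> X \<noteq> {} \<Longrightarrow> \<exists>n. dense_seq n \<in> X"
proof -
  obtain D :: "'a set" where D: "countable D" "\<And>X. open X \<Longrightarrow> X \<noteq> {} \<Longrightarrow> \<exists>d\<in>D. d \<in> X"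
    by (rule countable_dense_setE) blast
  have "D \<noteq> {}" using D(2)[of UNIV] by auto
  then have "range (from_nat_into D) = D" using D(1) by (rule range_from_nat_into)
  then have "\<exists>f::nat\<Rightarrow>'a. \<forall>X. open X \<longrightarrow> X \<noteq> {} \<longrightarrow> (\<exists>n. f n \<in> X)"
    using D(2) by (intro exI[of _ "from_nat_into D"]) (metis imageE)
  from someI_ex[OF this] show "open X \<Longrightarrow> X \<noteq> {} \<Longrightarrow> \<exists>n. dense_seq n \<in> X"
    unfolding dense_seq_def by blast
qed

text \<open>A cone of height 1 around a point of a dense sequence, with \<open>l\<close> coding the
  point and the slope. This one countable family approximates lower semicontinuous functions from
  below, separates points, and supplies the coordinates of the real codes.\<close>

definition tent :: "nat \<Rightarrow> 'a::{metric_space,second_countable_topology} \<Rightarrow> real" where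
  "tent l z = max 0 (1 - real (snd (prod_decode l)) * dist z (dense_seq (fst (prod_decode l))))"

lemma tent_nonneg: "0 \<le> tent l z" and tent_le_1: "tent l z \<le> 1"
  by (auto simp: tent_def)

lemma continuous_on_tent[continuous_intros]: "continuous_on X f \<Longrightarrow> continuous_on X (\<lambda>x. tent l (f x))"
  unfolding tent_def by (intro continuous_intros)

lemma measurable_tent[measurable]: "tent l \<in> borel_measurable borel"
  by (intro borel_measurable_continuous_onI continuous_intros)

text \<open>The slope is a component of the pair coded by \<open>l\<close>, hence at most
  \<open>l\<close>. The explicit constant calibrates the neighbourhoods in the compactness
  proof.\<close>

lemma tent_lipschitz: "\<bar>tent l y - tent l z\<bar> \<le> real l * dist y z"
proof -
  let ?n = "real (snd (prod_decode l))" and ?d = "dense_seq (fst (prod_decode l)) :: 'a"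
  have "snd (prod_decode l) \<le> l" by (metis le_prod_encode_2 prod.collapse prod_decode_inverse)
  then have n: "?n * dist y z \<le> real l * dist y z" by (intro mult_right_mono) auto
  have "\<bar>tent l y - tent l z\<bar> \<le> \<bar>?n * dist z ?d - ?n * dist y ?d\<bar>" unfolding tent_def by auto
  also have "\<dots> = ?n * \<bar>dist z ?d - dist y ?d\<bar>" by (simp add: abs_mult flip: right_diff_distrib)
  also have "\<dots> \<le> ?n * dist y z" 
    using dist_triangle[of z ?d y] dist_triangle[of y ?d z] by (intro mult_left_mono) (auto simp: dist_commute)
  finally show ?thesis using n by simp
qed

lemma tent_local:
  assumes "0 < \<delta>" "c < 1"
  shows "\<exists>l. c < tent l z \<and> (\<forall>y. 0 < tent l y \<longrightarrow> dist y z < \<delta>)"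
proof -
  obtain n :: nat where n: "2 / \<delta> < real n" using reals_Archimedean2 by blast
  then have n0: "0 < real n" using assms(1) by (meson divide_pos_pos less_trans zero_less_numeral)
  \<comment> \<open>The first bound keeps the support within \<open>\<delta>\<close> of
    \<open>z\<close>, the second keeps the value at \<open>z\<close> above \<open>c\<close>.\<close>
  define \<epsilon> where "\<epsilon> = min (\<delta> / 2) ((1 - c) / real n)"
  have "0 < \<epsilon>" using assms n0 by (simp add: \<epsilon>_def)
  then obtain i where i: "dense_seq i \<in> ball z \<epsilon>" using dense_seq[of "ball z \<epsilon>"] by auto
  define l where "l = prod_encode (i, n)"
  have t: "tent l y = max 0 (1 - real n * dist y (dense_seq i))" for y :: 'a by (simp add: tent_def l_def)
  have "real n * dist z (dense_seq i) < real n * ((1 - c) / real n)"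
    using i n0 by (intro mult_strict_left_mono) (auto simp: \<epsilon>_def)
  then have "c < tent l z" using n0 by (simp add: t)
  moreover have "dist y z < \<delta>" if "0 < tent l y" for y
  proof -
    have "real n * dist y (dense_seq i) < 1" using that by (simp add: t)
    then have "dist y (dense_seq i) < 1 / real n" using n0 by (simp add: field_simps)
    also have "\<dots> < \<delta> / 2" using n n0 assms(1) by (simp add: field_simps)
    finally have "dist y (dense_seq i) < \<delta> / 2" .
    moreover have "dist z (dense_seq i) < \<delta> / 2" using i by (simp add: \<epsilon>_def)
    ultimately show ?thesis by (metis dist_triangle_half_l dist_commute)
  qed
  ultimately show ?thesis by auto
qed

lemma tent_separates: "(\<And>l. tent l y = tent l z) \<Longrightarrow> y = z"
  using tent_local[of "dist y z" 0 z] by (metis dist_commute less_irrefl zero_less_dist_iff zero_less_one)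

text \<open>Running maxima turn a countable supremum of continuous functions into an increasing one,
  as monotone convergence and sums of suprema require.\<close>

primrec run_max :: "(nat \<Rightarrow> 'a \<Rightarrow> real) \<Rightarrow> nat \<Rightarrow> 'a \<Rightarrow> real" where
  "run_max u 0 z = u 0 z"
| "run_max u (Suc n) z = max (run_max u n z) (u (Suc n) z)"

lemma run_max_le: "k \<le> n \<Longrightarrow> u k z \<le> run_max u n z"
  by (induction n) (auto simp: le_Suc_eq max.coboundedI1)

lemma run_max_cases: "\<exists>k\<le>n. run_max u n z = u k z"
  by (induction n) (auto simp: max_def intro: le_SucI)

lemma run_max_mono: "m \<le> n \<Longrightarrow> run_max u m z \<le> run_max u n z"
  by (induction n) (auto simp: le_Suc_eq max.coboundedI1)

lemma SUP_run_max: "(SUP n. ennreal (run_max u n z)) = (SUP n. ennreal (u n z))"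
proof (rule antisym; rule SUP_least)
  fix n show "ennreal (run_max u n z) \<le> (SUP n. ennreal (u n z))"
    using run_max_cases[of n u z] by (metis UNIV_I SUP_upper)
  show "ennreal (u n z) \<le> (SUP n. ennreal (run_max u n z))"
    using run_max_le[of n n u z] by (intro SUP_upper2[of n]) (auto intro: ennreal_leI)
qed

lemma continuous_on_run_max: "(\<And>k. continuous_on X (u k)) \<Longrightarrow> continuous_on X (run_max u n)"
  by (induction n) (auto intro!: continuous_intros)

text \<open>\<open>h\<close> is the supremum of the nonnegative rational multiples of tents lying
  below it on \<open>T\<close>: near a point where \<open>h\<close> exceeds \<open>w\<close>, a
  narrow tent scaled by \<open>w\<close> fits under \<open>h\<close>.\<close>

lemma lsc_eq_SUP_tent:
  fixes h :: "'a::{metric_space,second_countable_topology} \<Rightarrow> ennreal"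
  assumes h: "lsc T h"
  shows "\<exists>(r :: nat \<Rightarrow> real) (j :: nat \<Rightarrow> nat). (\<forall>k. 0 \<le> r k) \<and> (\<forall>z\<in>T. h z = (SUP k. ennreal (r k * tent (j k) z)))"
proof -
  define j where "j k = fst (prod_decode k)" for k
  define r0 where "r0 k = (let (p, s) = prod_decode (snd (prod_decode k)) in real p / real (Suc s))" for k
  \<comment> \<open>The index \<open>k\<close> runs through all pairs of a tent and a nonnegative
    rational; multiples that do not stay below \<open>h\<close> are replaced by 0.\<close>
  define r where "r k = (if \<forall>z\<in>T. ennreal (r0 k * tent (j k) z) \<le> h z then r0 k else 0)" for k
  have r: "0 \<le> r k" for k by (auto simp: r_def r0_def split: prod.split)
  have eq: "h z = (SUP k. ennreal (r k * tent (j k) z))" if z: "z \<in> T" for z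
  proof (rule antisym)
    show "(SUP k. ennreal (r k * tent (j k) z)) \<le> h z" using z by (auto simp: r_def intro!: SUP_least)
    show "h z \<le> (SUP k. ennreal (r k * tent (j k) z))"
    proof (rule dense_le)
      fix y assume y: "y < h z"
      then obtain y' where y': "y < y'" "y' < h z" using dense by blast
      then obtain b where b: "y' = ennreal b" "0 \<le> b" by (cases y') auto
      then obtain a where a: "y = ennreal a" "0 \<le> a" using y' by (cases y) auto
      have ab: "a < b" using y' a b by (simp add: ennreal_less_iff)
      obtain w where w: "a < w" "w < b" "w \<in> \<rat>" using Rats_dense_in_real[OF ab] by blast
      then obtain m n :: nat where mn: "n \<noteq> 0" "\<bar>w\<bar> = real m / real n" using Rats_abs_nat_div_natE by metis
      have w': "w = real m / real (Suc (n - 1))" using mn w a by simp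
      have wh: "ennreal w < h z" using w y' b a by (meson ennreal_leI le_less_trans less_imp_le)
      obtain U where U: "open U" "{z\<in>T. ennreal w < h z} = T \<inter> U" using lscD[OF h, of "ennreal w"] by (auto simp: openin_open)
      then have "z \<in> U" using z wh by auto
      then obtain \<delta> where \<delta>: "0 < \<delta>" "ball z \<delta> \<subseteq> U" using U openE by blast
      obtain l where l: "a / w < tent l z" "\<And>y. 0 < tent l y \<Longrightarrow> dist y z < \<delta>"
        using tent_local[OF \<delta>(1), of "a / w" z] w a by auto
      define k where "k = prod_encode (l, prod_encode (m, n - 1))"
      have jk: "j k = l" "r0 k = w" by (simp_all add: j_def k_def r0_def w')
      have "ennreal (w * tent l y) \<le> h y" if "y \<in> T" for y
      proof (cases "0 < tent l y")
        case True
        then have "ennreal w < h y" using l(2) \<delta>(2) U(2) that by (auto simp: dist_commute subset_iff)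
        moreover have "ennreal (w * tent l y) \<le> ennreal w"
          using w a tent_le_1[of l y] by (intro ennreal_leI) (simp add: mult_left_le)
        ultimately show ?thesis by simp
      next
        case False then show ?thesis using tent_nonneg[of l y] by simp
      qed
      then have "r k = w" by (simp add: r_def jk)
      moreover have "a \<le> w * tent l z" using l(1) w a by (simp add: divide_less_eq mult.commute)
      ultimately have "y \<le> ennreal (r k * tent (j k) z)" unfolding a jk by (simp add: ennreal_leI)
      then show "y \<le> (SUP k. ennreal (r k * tent (j k) z))" by (rule SUP_upper2[OF UNIV_I])
    qed
  qed
  show ?thesis using r eq by blast
qed

lemma lsc_eq_SUP_run_max:
  fixes h :: "'a::{metric_space,second_countable_topology} \<Rightarrow> ennreal"
  assumes h: "lsc T h"
  obtains r j where "\<And>k. (0::real) \<le> r k" "\<And>z. z \<in> T \<Longrightarrow> h z = (SUP n. ennreal (run_max (\<lambda>k z. r k * tent (j k) z) n z))"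
  using lsc_eq_SUP_tent[OF h] unfolding SUP_run_max by blast

lemma run_max_tent_bounds:
  assumes "\<And>k. (0::real) \<le> r k"
  shows "0 \<le> run_max (\<lambda>k z. r k * tent (j k) z) n z" "\<exists>B. \<forall>z. run_max (\<lambda>k z. r k * tent (j k) z) n z \<le> B"
proof -
  show "0 \<le> run_max (\<lambda>k z. r k * tent (j k) z) n z"
    using run_max_le[of 0 n "\<lambda>k z. r k * tent (j k) z" z] assms[of 0] tent_nonneg[of "j 0" z]
    by (meson le0 mult_nonneg_nonneg order_trans)
  have "run_max (\<lambda>k z. r k * tent (j k) z) n z \<le> (\<Sum>k\<le>n. r k)" for z
  proof -
    obtain k where "k \<le> n" "run_max (\<lambda>k z. r k * tent (j k) z) n z = r k * tent (j k) z"
      using run_max_cases[of n "\<lambda>k z. r k * tent (j k) z" z] by auto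
    moreover have "r k * tent (j k) z \<le> r k" using assms[of k] tent_le_1[of "j k" z] by (simp add: mult_left_le)
    moreover have "r k \<le> (\<Sum>k\<le>n. r k)" using assms \<open>k \<le> n\<close> by (intro member_le_sum) auto
    ultimately show ?thesis by simp
  qed
  then show "\<exists>B. \<forall>z. run_max (\<lambda>k z. r k * tent (j k) z) n z \<le> B" by auto
qed

lemma lsc_borel_measurable:
  fixes h :: "'a::{metric_space,second_countable_topology} \<Rightarrow> ennreal"
  assumes h: "lsc T h" and M: "space M \<subseteq> T" "(\<lambda>z. z) \<in> measurable M borel"
  shows "h \<in> borel_measurable M"
proof -
  obtain r :: "nat \<Rightarrow> real" and j where rj: "\<And>z. z \<in> T \<Longrightarrow> h z = (SUP k. ennreal (r k * tent (j k) z))"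
    using lsc_eq_SUP_tent[OF h] by blast
  note [measurable] = M(2)
  have [measurable]: "tent l \<in> borel_measurable M" for l using measurable_compose[OF M(2) measurable_tent] by simp
  have "(\<lambda>z. SUP k. ennreal (r k * tent (j k) z)) \<in> borel_measurable M" by measurable
  then show ?thesis using M(1) rj by (subst measurable_cong[of _ _ "\<lambda>z. SUP k. ennreal (r k * tent (j k) z)"]) auto
qed

text \<open>A sum of suprema is the supremum of the sums only along increasing sequences, hence the
  passage through \<open>run_max\<close>.\<close>

lemma lsc_add:
  fixes f g :: "'a::{metric_space,second_countable_topology} \<Rightarrow> ennreal"
  assumes f: "lsc T f" and g: "lsc T g"
  shows "lsc T (\<lambda>z. f z + g z)"
proof -
  obtain r j where rj: "\<And>k. (0::real) \<le> r k" "\<And>z. z \<in> T \<Longrightarrow> f z = (SUP n. ennreal (run_max (\<lambda>k z. r k * tent (j k) z) n z))"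
    using lsc_eq_SUP_run_max[OF f] by blast
  obtain r' j' where rj': "\<And>k. (0::real) \<le> r' k" "\<And>z. z \<in> T \<Longrightarrow> g z = (SUP n. ennreal (run_max (\<lambda>k z. r' k * tent (j' k) z) n z))"
    using lsc_eq_SUP_run_max[OF g] by blast
  let ?F = "run_max (\<lambda>k z. r k * tent (j k) z)" and ?G = "run_max (\<lambda>k z. r' k * tent (j' k) z)"
  have "f z + g z = (SUP n. ennreal (?F n z + ?G n z))" if "z \<in> T" for z
  proof -
    have "f z + g z = (SUP n. ennreal (?F n z) + ennreal (?G n z))"
      using that rj rj' by (simp add: ennreal_SUP_add incseq_def run_max_mono ennreal_leI)
    also have "\<dots> = (SUP n. ennreal (?F n z + ?G n z))"
      by (intro SUP_cong refl ennreal_plus[symmetric] run_max_tent_bounds(1) rj(1) rj'(1))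
    finally show ?thesis .
  qed
  moreover have "lsc T (\<lambda>z. SUP n. ennreal (?F n z + ?G n z))"
    by (intro lsc_SUP continuous_imp_lsc continuous_intros continuous_on_run_max)
  ultimately show ?thesis by (simp cong: lsc_cong)
qed

section \<open>Coding separable metric spaces by real numbers\<close>

definition bin_digit :: "nat \<Rightarrow> real \<Rightarrow> bool" where
  "bin_digit i y \<longleftrightarrow> odd \<lfloor>2 ^ Suc i * y\<rfloor>"

lemma floor_double: "\<lfloor>2 * x\<rfloor> = 2 * \<lfloor>x\<rfloor> + of_bool (odd \<lfloor>2 * x :: real\<rfloor>)"
proof -
  have "2 * \<lfloor>x\<rfloor> \<le> \<lfloor>2 * x\<rfloor>" "\<lfloor>2 * x\<rfloor> < 2 * \<lfloor>x\<rfloor> + 2" by linarith+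
  then consider "\<lfloor>2 * x\<rfloor> = 2 * \<lfloor>x\<rfloor>" | "\<lfloor>2 * x\<rfloor> = 2 * \<lfloor>x\<rfloor> + 1" by linarith
  then show ?thesis by cases auto
qed

lemma bin_digit_sums:
  assumes y: "0 \<le> y" "y < 1"
  shows "(\<lambda>i. of_bool (bin_digit i y) / 2 ^ Suc i) sums y"
proof -
  have part: "(\<Sum>i<n. of_bool (bin_digit i y) / 2 ^ Suc i) = real_of_int \<lfloor>2 ^ n * y\<rfloor> / 2 ^ n" for n
  proof (induction n)
    case 0
    have "\<lfloor>y\<rfloor> = 0" using y by linarith
    then show ?case by simp
  next
    case (Suc n)
    have "\<lfloor>2 ^ Suc n * y\<rfloor> = 2 * \<lfloor>2 ^ n * y\<rfloor> + of_bool (bin_digit n y)"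
      using floor_double[of "2 ^ n * y"] by (simp add: bin_digit_def mult.assoc)
    then show ?case using Suc by (simp add: field_simps)
  qed
  have "(\<lambda>n. real_of_int \<lfloor>2 ^ n * y\<rfloor> / 2 ^ n) \<longlonglongrightarrow> y"
  proof (rule LIMSEQ_I)
    fix e :: real assume "0 < e"
    then obtain N where N: "(1/2) ^ N < e" using real_arch_pow_inv[of e "1/2"] by auto
    have "norm (real_of_int \<lfloor>2 ^ n * y\<rfloor> / 2 ^ n - y) < e" if "n \<ge> N" for n
    proof -
      have "\<bar>real_of_int \<lfloor>2 ^ n * y\<rfloor> - 2 ^ n * y\<bar> \<le> 1" by linarith
      then have "\<bar>real_of_int \<lfloor>2 ^ n * y\<rfloor> - 2 ^ n * y\<bar> / 2 ^ n \<le> 1 / 2 ^ n" by (intro divide_right_mono) auto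
      moreover have "real_of_int \<lfloor>2 ^ n * y\<rfloor> / 2 ^ n - y = (real_of_int \<lfloor>2 ^ n * y\<rfloor> - 2 ^ n * y) / 2 ^ n"
        by (simp add: diff_divide_distrib)
      ultimately have "\<bar>real_of_int \<lfloor>2 ^ n * y\<rfloor> / 2 ^ n - y\<bar> \<le> 1 / 2 ^ n" by (simp only: abs_divide) simp
      also have "\<dots> = (1/2) ^ n" by (simp add: power_divide)
      also have "\<dots> \<le> (1/2) ^ N" using that by (intro power_decreasing) auto
      finally show ?thesis using N by simp
    qed
    then show "\<exists>N. \<forall>n\<ge>N. norm (real_of_int \<lfloor>2 ^ n * y\<rfloor> / 2 ^ n - y) < e" by blast
  qed
  then show ?thesis unfolding sums_def part .
qed

text \<open>Base 4 with digits 0 and 1 leaves gaps: the tail behind the first differing digit is at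
  most a third of that digit's weight, so the sum determines the sequence. In base 2, dyadic numbers
  would have two expansions.\<close>

definition cantor_sum :: "(nat \<Rightarrow> bool) \<Rightarrow> real" where
  "cantor_sum b = (\<Sum>m. of_bool (b m) * (1/4) ^ m)"

lemma summable_cantor: "summable (\<lambda>m. of_bool (b m) * (1/4::real) ^ m)"
  by (rule summable_comparison_test'[where g="\<lambda>m. (1/4) ^ m" and N=0]) (auto intro: summable_geometric)

lemma continuous_on_bool_series:
  fixes c :: "nat \<Rightarrow> real" and \<sigma> :: "nat \<Rightarrow> nat"
  assumes "summable c" "\<And>m. 0 \<le> c m"
  shows "continuous_on UNIV (\<lambda>b. \<Sum>m. of_bool (b (\<sigma> m)) * c m)"
proof (rule uniform_limit_theorem[OF always_eventually Weierstrass_m_test[where M=c]])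
  show "\<forall>n. continuous_on UNIV (\<lambda>b. \<Sum>i<n. of_bool (b (\<sigma> i)) * c i)"
  proof (intro allI continuous_on_sum continuous_on_mult_right)
    fix i
    have "continuous_on UNIV (\<lambda>b::nat\<Rightarrow>bool. b (\<sigma> i))" by simp
    then show "continuous_on UNIV (\<lambda>b. of_bool (b (\<sigma> i)) :: real)"
      using continuous_on_compose2[of UNIV "of_bool :: bool \<Rightarrow> real" UNIV "\<lambda>b. b (\<sigma> i)"] by simp
  qed
qed (use assms in auto)

lemma inj_cantor_sum: "inj cantor_sum"
proof (rule injI, rule ccontr)
  fix b b' assume eq: "cantor_sum b = cantor_sum b'" and ne: "b \<noteq> b'"
  then obtain m0 where "b m0 \<noteq> b' m0" by auto
  define m where "m = (LEAST m. b m \<noteq> b' m)"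
  have m: "b m \<noteq> b' m" unfolding m_def by (rule LeastI) fact
  have less: "b i = b' i" if "i < m" for i using not_less_Least that unfolding m_def by blast
  define d where "d i = (of_bool (b i) - of_bool (b' i)) * (1/4::real) ^ i" for i
  have dd: "d = (\<lambda>i. of_bool (b i) * (1/4) ^ i - of_bool (b' i) * (1/4) ^ i)"
    by (auto simp: d_def left_diff_distrib)
  have sd: "summable d" unfolding dd by (intro summable_diff summable_cantor)
  have "suminf d = 0" unfolding dd using eq
    by (subst suminf_diff[symmetric]) (auto simp: summable_cantor cantor_sum_def)
  moreover have "suminf d = (\<Sum>i. d (i + Suc m)) + (\<Sum>i<Suc m. d i)"
    by (rule suminf_split_initial_segment[OF sd])
  moreover have "(\<Sum>i<Suc m. d i) = d m" using less by (simp add: d_def)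
  ultimately have "\<bar>d m\<bar> = \<bar>\<Sum>i. d (i + Suc m)\<bar>" by simp
  also have "\<dots> \<le> (\<Sum>i. (1/4) ^ Suc m * (1/4::real) ^ i)"
  proof -
    have b: "norm (d (i + Suc m)) \<le> (1/4) ^ Suc m * (1/4::real) ^ i" for i
      by (auto simp: d_def power_add abs_mult)
    have s: "summable (\<lambda>i. (1/4) ^ Suc m * (1/4::real) ^ i)" by (intro summable_mult summable_geometric) auto
    show ?thesis using summable_norm[of "\<lambda>i. d (i + Suc m)"] suminf_le[of "\<lambda>i. norm (d (i + Suc m))", OF b _ s]
      summable_comparison_test'[OF s, of 0 "\<lambda>i. norm (d (i + Suc m))"] b by (auto simp: real_norm_def)
  qed
  also have "\<dots> = (1/4) ^ Suc m * (4/3)" by (subst suminf_mult) (auto simp: suminf_geometric intro!: summable_geometric)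
  also have "\<dots> < (1/4) ^ m" by simp
  also have "\<dots> = \<bar>d m\<bar>" using m by (auto simp: d_def)
  finally show False by simp
qed

lemma compact_bool_seq: "compact (UNIV :: (nat \<Rightarrow> bool) set)"
proof -
  have "compact_space (euclidean :: bool topology)" by (simp add: compact_space_def finite_imp_compact)
  then have "compact_space (product_topology (\<lambda>_::nat. euclidean :: bool topology) UNIV)"
    by (simp add: compact_space_product_topology)
  then show ?thesis by (simp add: euclidean_product_topology compact_space_def)
qed

text \<open>The code packs all binary digits of all tent values into one Cantor sum. Digits jump, so
  \<open>e\<close> is only Borel; but each tent is a continuous function of the digit sequence and
  therefore of the code, first on the compact range of \<open>cantor_sum\<close> and then on the
  line by Tietze. This is the direction of continuity that weak limits on the line can
  exploit.\<close>

lemma ex_real_code: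
  "\<exists>(e :: 'a::{metric_space,second_countable_topology} \<Rightarrow> real) G. e \<in> borel_measurable borel \<and> range e \<subseteq> {0..2} \<and>
    (\<forall>l. continuous_on UNIV (G l)) \<and> (\<forall>l z. G l (e z) = tent l z)"
proof -
  \<comment> \<open>Halving moves tent values into the half-open unit interval, where
    \<open>bin_digit_sums\<close> applies.\<close>
  define b :: "'a \<Rightarrow> nat \<Rightarrow> bool" where
    "b z m = bin_digit (snd (prod_decode m)) (tent (fst (prod_decode m)) z / 2)" for z m
  define e where "e z = cantor_sum (b z)" for z
  define g :: "nat \<Rightarrow> (nat \<Rightarrow> bool) \<Rightarrow> real" where
    "g l c = (\<Sum>i. of_bool (c (prod_encode (l, i))) * (1/2) ^ i)" for l c
  have "continuous_on UNIV cantor_sum"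
    unfolding cantor_sum_def[abs_def] by (rule continuous_on_bool_series) (auto intro: summable_geometric)
  then have cC: "compact (range cantor_sum)" and inv: "continuous_on (range cantor_sum) (inv cantor_sum)"
    using compact_bool_seq inj_cantor_sum by (auto intro!: compact_continuous_image continuous_on_inv)
  have gc: "continuous_on UNIV (g l)" for l
    unfolding g_def[abs_def] by (rule continuous_on_bool_series) (auto intro: summable_geometric)
  have gb: "norm (g l c) \<le> 2" for l c
  proof -
    have s: "summable (\<lambda>i. (1/2::real) ^ i)" by (auto intro: summable_geometric)
    have s2: "summable (\<lambda>i. of_bool (c (prod_encode (l, i))) * (1/2::real) ^ i)"
      by (rule summable_comparison_test'[OF s, of 0]) auto
    have "g l c \<le> (\<Sum>i. (1/2::real) ^ i)" unfolding g_def by (rule suminf_le[OF _ s2 s]) auto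
    moreover have "0 \<le> g l c" unfolding g_def by (rule suminf_nonneg[OF s2]) auto
    ultimately show ?thesis by (simp add: suminf_geometric)
  qed
  have "\<exists>G. continuous_on UNIV G \<and> (\<forall>x\<in>range cantor_sum. G x = g l (inv cantor_sum x))" for l
  proof -
    have "continuous_on (range cantor_sum) (\<lambda>x. g l (inv cantor_sum x))"
      by (rule continuous_on_compose2[OF gc inv]) auto
    moreover have "closedin (top_of_set UNIV) (range cantor_sum)" using compact_imp_closed[OF cC] by simp
    ultimately show ?thesis by (rule Tietze[where B=2]) (use gb in auto)
  qed
  then obtain G where G: "\<And>l. continuous_on UNIV (G l)" "\<And>l x. x \<in> range cantor_sum \<Longrightarrow> G l x = g l (inv cantor_sum x)"
    by metis
  have "G l (e z) = tent l z" for l z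
  proof -
    have "(\<lambda>i. of_bool (bin_digit i (tent l z / 2)) / 2 ^ Suc i) sums (tent l z / 2)"
      using tent_nonneg[of l z] tent_le_1[of l z] by (intro bin_digit_sums) auto
    from sums_mult[OF this, of 2] have "(\<lambda>i. of_bool (bin_digit i (tent l z / 2)) * (1/2) ^ i) sums tent l z"
      by (simp add: power_divide)
    then have "g l (b z) = tent l z" by (simp add: g_def b_def sums_iff)
    then show ?thesis by (simp add: G(2) e_def inv_f_f[OF inj_cantor_sum])
  qed
  moreover have "e \<in> borel_measurable borel" unfolding e_def cantor_sum_def b_def bin_digit_def by measurable
  moreover have "e z \<in> {0..2}" for z
  proof -
    have s: "summable (\<lambda>m. (1/4::real) ^ m)" by (auto intro: summable_geometric)
    have "cantor_sum (b z) \<le> (\<Sum>m. (1/4::real) ^ m)" unfolding cantor_sum_def by (rule suminf_le[OF _ summable_cantor s]) auto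
    moreover have "0 \<le> cantor_sum (b z)" unfolding cantor_sum_def by (rule suminf_nonneg[OF summable_cantor]) auto
    ultimately show ?thesis by (simp add: e_def suminf_geometric)
  qed
  ultimately show ?thesis using G(1) by blast
qed

text \<open>Possibly larger than the image of \<open>K\<close> under the code, but compact for
  compact \<open>K\<close>, which the image under a Borel map need not be. Each of its points still
  determines one point of \<open>K\<close>, because tents separate.\<close>

definition coded_points :: "(nat \<Rightarrow> real \<Rightarrow> real) \<Rightarrow> 'a::{metric_space,second_countable_topology} set \<Rightarrow> real set" where
  "coded_points G K = {t\<in>{0..2}. \<exists>z\<in>K. \<forall>l. G l t = tent l z}"

definition decode :: "(nat \<Rightarrow> real \<Rightarrow> real) \<Rightarrow> real \<Rightarrow> 'a::{metric_space,second_countable_topology}" where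
  "decode G t = (THE z. \<forall>l. G l t = tent l z)"

lemma decode_eq: "(\<And>l. G l t = tent l z) \<Longrightarrow> decode G t = z"
  unfolding decode_def by (rule the_equality) (auto intro: tent_separates)

lemma decode_coded:
  fixes K :: "'a::{metric_space,second_countable_topology} set"
  assumes "t \<in> coded_points G K" shows "decode G t \<in> K" "\<And>l. G l t = tent l (decode G t :: 'a)"
proof -
  obtain z where z: "z \<in> K" "\<And>l. G l t = tent l z" using assms by (auto simp: coded_points_def)
  then have "decode G t = z" by (intro decode_eq)
  then show "decode G t \<in> K" "\<And>l. G l t = tent l (decode G t :: 'a)" using z by auto
qed

lemma compact_coded_points:
  assumes G: "\<And>l. continuous_on UNIV (G l)" and K: "compact K"
  shows "compact (coded_points G K)"
proof -
  have "closed {p :: real \<times> 'a. \<forall>l. G l (fst p) = tent l (snd p)}"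
  proof (intro closed_Collect_all closed_Collect_eq)
    fix l
    show "continuous_on UNIV (\<lambda>p::real \<times> 'a. G l (fst p))"
      by (rule continuous_on_compose2[OF G]) (auto intro: continuous_intros)
    show "continuous_on UNIV (\<lambda>p::real \<times> 'a. tent l (snd p))" by (intro continuous_intros)
  qed
  then have "compact (({0..2} \<times> K) \<inter> {p. \<forall>l. G l (fst p) = tent l (snd p)})"
    using K by (intro compact_Int_closed compact_Times) auto
  then have "compact (fst ` (({0..2} \<times> K) \<inter> {p. \<forall>l. G l (fst p) = tent l (snd p)}))"
    by (rule compact_continuous_image[rotated]) (intro continuous_intros)
  moreover have "fst ` (({0..2} \<times> K) \<inter> {p. \<forall>l. G l (fst p) = tent l (snd p)}) = coded_points G K"
    by (force simp: coded_points_def image_iff)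
  ultimately show ?thesis by simp
qed

lemma decode_vimage:
  assumes "t \<in> coded_points G K"
  shows "decode G t \<in> F \<longleftrightarrow> t \<in> coded_points G (K \<inter> F)"
proof
  assume "decode G t \<in> F"
  with decode_coded[OF assms] assms show "t \<in> coded_points G (K \<inter> F)" by (auto simp: coded_points_def)
next
  assume "t \<in> coded_points G (K \<inter> F)"
  from decode_coded(1)[OF this] show "decode G t \<in> F" by simp
qed

text \<open>The preimage of a closed \<open>F\<close> is
  \<open>coded_points G (K \<inter> F)\<close>, which is again compact.\<close>

lemma continuous_on_decode:
  fixes K :: "'a::{metric_space,second_countable_topology} set"
  assumes G: "\<And>l. continuous_on UNIV (G l)" and K: "compact K"
  shows "continuous_on (coded_points G K) (decode G :: real \<Rightarrow> 'a)"
  unfolding continuous_on_closed_invariant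
proof (intro allI impI)
  fix F :: "'a set" assume F: "closed F"
  have "closed (coded_points G (K \<inter> F))"
    using compact_coded_points[where G=G, OF G compact_Int_closed[OF K F]] by (rule compact_imp_closed)
  then show "\<exists>A. closed A \<and> A \<inter> coded_points G K = decode G -` F \<inter> coded_points G K"
    by (intro exI[of _ "coded_points G (K \<inter> F)"]) (auto simp: decode_vimage[of _ G K])
qed

text \<open>On a countable union of such code sets the preimage of a closed set is a countable union
  of compact sets, hence Borel.\<close>

lemma measurable_decode:
  fixes K :: "nat \<Rightarrow> 'a::{metric_space,second_countable_topology} set"
  assumes G: "\<And>l. continuous_on UNIV (G l)" and K: "\<And>i. compact (K i)"
  shows "(decode G :: real \<Rightarrow> 'a) \<in> borel_measurable (restrict_space borel (\<Union>i. coded_points G (K i)))"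
proof (rule borel_measurableI)
  let ?L = "\<Union>i. coded_points G (K i)"
  fix U :: "'a set" assume U: "open U"
  have cl: "closed (coded_points G (K i))" "closed (coded_points G (K i \<inter> (- U)))" for i
    by (rule compact_imp_closed[OF compact_coded_points[where G=G, OF G K]],
        rule compact_imp_closed[OF compact_coded_points[where G=G, OF G compact_Int_closed[OF K closed_Compl[OF U]]]])
  have iff: "(decode G t :: 'a) \<in> U \<longleftrightarrow> (\<forall>i'. t \<notin> coded_points G (K i' \<inter> - U))" if "t \<in> coded_points G (K i)" for t i
    using decode_coded(1)[of t G "K _ \<inter> - U"] decode_vimage[OF that, of "- U"] by auto
  have "(decode G :: real \<Rightarrow> 'a) -` U \<inter> ?L = ?L - (\<Union>i. coded_points G (K i \<inter> (- U)))"
    using iff by blast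
  moreover have "?L - (\<Union>i. coded_points G (K i \<inter> (- U))) \<in> sets borel" using cl by (auto intro!: sets.Diff)
  ultimately show "decode G -` U \<inter> space (restrict_space borel ?L) \<in> sets (restrict_space borel ?L)"
    by (auto simp: sets_restrict_space space_restrict_space image_iff Int_commute intro!: bexI[of _ "decode G -` U \<inter> ?L"])
qed

text \<open>Replaces a compact action space by a compact set of reals, where least elements and
  distribution functions are available.\<close>

lemma ex_compact_code:
  fixes A :: "'a::{metric_space,second_countable_topology} set"
  assumes A: "compact A"
  obtains e :: "'a \<Rightarrow> real" and L \<psi> where "e \<in> borel_measurable borel" "compact L" "L \<subseteq> {0..2}" "continuous_on L \<psi>" "\<psi> ` L = A"
    "\<And>a. a \<in> A \<Longrightarrow> e a \<in> L \<and> \<psi> (e a) = a"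
proof -
  obtain e :: "'a \<Rightarrow> real" and G where e: "e \<in> borel_measurable borel" "range e \<subseteq> {0..2}"
    and G: "\<And>l. continuous_on UNIV (G l)" "\<And>l z. G l (e z) = tent l z"
    using ex_real_code by blast
  have ea: "e a \<in> coded_points G A \<and> decode G (e a) = a" if "a \<in> A" for a
    using that e(2) G(2) decode_eq[of G "e a" a] by (auto simp: coded_points_def image_subset_iff)
  have "decode G ` coded_points G A = A" using ea decode_coded(1)[of _ G A] by (auto simp: image_iff) metis
  then show ?thesis
    using e(1) compact_coded_points[where G=G, OF G(1) A] continuous_on_decode[where G=G, OF G(1) A] ea
    by (intro that) (auto simp: coded_points_def)
qed

section \<open>Weak sequential compactness\<close>

text \<open>One half of the portmanteau theorem: \<open>h\<close> is an increasing limit of bounded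
  continuous functions, and each of these passes to the weak limit.\<close>

lemma weak_conv_lsc:
  fixes h :: "real \<Rightarrow> ennreal"
  assumes \<nu>: "\<And>k. real_distribution (\<nu> k)" and M: "real_distribution M" and conv: "weak_conv_m \<nu> M" and h: "lsc UNIV h"
  shows "(\<integral>\<^sup>+t. h t \<partial>M) \<le> liminf (\<lambda>k. \<integral>\<^sup>+t. h t \<partial>\<nu> k)"
proof -
  interpret M: real_distribution M by fact
  interpret \<nu>: real_distribution "\<nu> k" for k by fact
  obtain r j where rj: "\<And>k. (0::real) \<le> r k" "\<And>z. h z = (SUP n. ennreal (run_max (\<lambda>k z. r k * tent (j k) z) n z))"
    using lsc_eq_SUP_run_max[OF h] by (metis UNIV_I)
  define \<phi> :: "nat \<Rightarrow> real \<Rightarrow> real" where "\<phi> = run_max (\<lambda>k z. r k * tent (j k) z)"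
  have cont: "continuous_on UNIV (\<phi> n)" for n unfolding \<phi>_def by (intro continuous_on_run_max continuous_intros)
  have [measurable]: "\<phi> n \<in> borel_measurable borel" for n using cont by (rule borel_measurable_continuous_onI)
  have pos: "0 \<le> \<phi> n t" for n t unfolding \<phi>_def using rj(1) by (rule run_max_tent_bounds)
  have inc: "\<phi> n t \<le> \<phi> n' t" if "n \<le> n'" for n n' t unfolding \<phi>_def using that by (rule run_max_mono)
  have hS: "h t = (SUP n. ennreal (\<phi> n t))" for t by (simp add: rj(2) \<phi>_def)
  have "(\<integral>\<^sup>+t. h t \<partial>M) = (SUP n. \<integral>\<^sup>+t. ennreal (\<phi> n t) \<partial>M)"
    unfolding hS using inc by (intro nn_integral_monotone_convergence_SUP) (auto simp: incseq_def le_fun_def intro!: ennreal_leI)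
  also have "\<dots> \<le> liminf (\<lambda>k. \<integral>\<^sup>+t. h t \<partial>\<nu> k)"
  proof (rule SUP_least)
    fix n
    obtain B where B: "\<And>t. \<phi> n t \<le> B" using run_max_tent_bounds(2)[of r j n, OF rj(1)] by (auto simp: \<phi>_def)
    have nB: "norm (\<phi> n t) \<le> B" for t using pos[of n t] B[of t] by simp
    have "(\<lambda>k. integral\<^sup>L (\<nu> k) (\<phi> n)) \<longlonglongrightarrow> integral\<^sup>L M (\<phi> n)"
      by (rule weak_conv_imp_integral_bdd_continuous_conv[OF \<nu> M conv, of _ B])
        (use nB cont in \<open>auto simp: continuous_on_eq_continuous_at\<close>)
    then have "(\<lambda>k. ennreal (integral\<^sup>L (\<nu> k) (\<phi> n))) \<longlonglongrightarrow> ennreal (integral\<^sup>L M (\<phi> n))" by (rule tendsto_ennrealI)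
    moreover have "(\<integral>\<^sup>+t. ennreal (\<phi> n t) \<partial>M) = ennreal (integral\<^sup>L M (\<phi> n))"
      by (intro nn_integral_eq_integral M.integrable_const_bound[where B=B]) (use nB pos in auto)
    moreover have "(\<integral>\<^sup>+t. ennreal (\<phi> n t) \<partial>\<nu> k) = ennreal (integral\<^sup>L (\<nu> k) (\<phi> n))" for k
      by (intro nn_integral_eq_integral \<nu>.integrable_const_bound[where B=B]) (use nB pos in auto)
    ultimately have "(\<integral>\<^sup>+t. ennreal (\<phi> n t) \<partial>M) = liminf (\<lambda>k. \<integral>\<^sup>+t. ennreal (\<phi> n t) \<partial>\<nu> k)"
      by (simp add: lim_imp_Liminf)
    also have "\<dots> \<le> liminf (\<lambda>k. \<integral>\<^sup>+t. h t \<partial>\<nu> k)"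
      unfolding hS by (intro Liminf_mono always_eventually allI nn_integral_mono SUP_upper) auto
    finally show "(\<integral>\<^sup>+t. ennreal (\<phi> n t) \<partial>M) \<le> liminf (\<lambda>k. \<integral>\<^sup>+t. h t \<partial>\<nu> k)" .
  qed
  finally show ?thesis .
qed

lemma space_SM[simp]: "space (SM S) = S"
  by (simp add: SM_def space_restrict_space)

lemma measurable_SM_borel[measurable]: "(\<lambda>x. x) \<in> measurable (SM S) borel"
  unfolding SM_def by (rule measurable_restrict_space1) simp

lemma measurable_pair_SM_borel:
  fixes S :: "'s::second_countable_topology set" and A :: "'b::second_countable_topology set"
  shows "(\<lambda>z. z) \<in> measurable (SM S \<Otimes>\<^sub>M SM A) borel"
proof -
  have "(\<lambda>z. (fst z, snd z)) \<in> measurable (SM S \<Otimes>\<^sub>M SM A) (borel \<Otimes>\<^sub>M borel)" by measurable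
  then show ?thesis by (simp add: borel_prod)
qed

lemma space_pair_SM[simp]: "space (SM S \<Otimes>\<^sub>M SM A) = S \<times> A"
  by (simp add: space_pair_measure)

lemma measurable_into_SM: "f \<in> measurable M borel \<Longrightarrow> (\<And>x. x \<in> space M \<Longrightarrow> f x \<in> S) \<Longrightarrow> f \<in> measurable M (SM S)"
  unfolding SM_def by (rule measurable_restrict_space2) auto

lemma continuous_on_measurable_SM:
  fixes f :: "'s::topological_space \<Rightarrow> real"
  shows "continuous_on S f \<Longrightarrow> f \<in> borel_measurable (SM S)"
  unfolding SM_def by (rule borel_measurable_continuous_on_restrict)

text \<open>The complement is the projection of a closed set along \<open>K\<close>. With
  \<open>J\<close> growing and \<open>\<epsilon>\<close> shrinking, these open sets exhaust the
  reals whose tent values agree with those of no point of \<open>K\<close>.\<close>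

lemma open_far_codes:
  fixes K :: "'a::{metric_space,second_countable_topology} set"
  assumes G: "\<And>l. continuous_on UNIV (G l)" and K: "compact K"
  shows "open {t::real. \<forall>z\<in>K. \<exists>j\<le>J::nat. \<epsilon> < \<bar>G j t - tent j z\<bar>}"
proof -
  let ?F = "{p \<in> UNIV \<times> K. \<forall>j\<le>J. \<bar>G j (fst p) - tent j (snd p)\<bar> \<le> \<epsilon>}"
  have "closed {p :: real \<times> 'a. \<forall>j\<le>J. \<bar>G j (fst p) - tent j (snd p)\<bar> \<le> \<epsilon>}"
  proof (intro closed_Collect_all closed_Collect_imp closed_Collect_le)
    fix l
    have "continuous_on UNIV (\<lambda>p::real \<times> 'a. G l (fst p))"
      by (rule continuous_on_compose2[OF G]) (auto intro: continuous_intros)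
    then show "continuous_on UNIV (\<lambda>p::real \<times> 'a. \<bar>G l (fst p) - tent l (snd p)\<bar>)" by (intro continuous_intros)
  qed auto
  then have "closedin (top_of_set (UNIV \<times> K)) ?F"
    by (auto simp: closedin_closed intro!: exI[of _ "{p. \<forall>j\<le>J. \<bar>G j (fst p) - tent j (snd p)\<bar> \<le> \<epsilon>}"])
  then have "closed (fst ` ?F)" using closedin_fst_image[OF K, of UNIV ?F] by simp
  moreover have "{t. \<forall>z\<in>K. \<exists>j\<le>J. \<epsilon> < \<bar>G j t - tent j z\<bar>} = - fst ` ?F" by (force simp: not_less image_iff)
  ultimately show ?thesis by auto
qed

text \<open>Approximate agreement at every level produces a sequence in \<open>K\<close>; the tents
  are continuous, so a limit point agrees exactly.\<close>

lemma codes_near_compact: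
  fixes K :: "'a::{metric_space,second_countable_topology} set"
  assumes K: "compact K" and near: "\<And>J::nat. \<exists>z\<in>K. \<forall>j\<le>J. \<bar>G j t - tent j z\<bar> \<le> 1 / real (Suc J)"
  shows "\<exists>z\<in>K. \<forall>l. G l t = tent l z"
proof -
  obtain z where z: "\<And>J. z J \<in> K" "\<And>J j. j \<le> J \<Longrightarrow> \<bar>G j t - tent j (z J)\<bar> \<le> 1 / real (Suc J)"
    using near by metis
  obtain z0 \<sigma> where z0: "z0 \<in> K" "strict_mono (\<sigma>::nat\<Rightarrow>nat)" "(z \<circ> \<sigma>) \<longlonglongrightarrow> z0"
    using K z(1) unfolding compact_eq_seq_compact_metric seq_compact_def by metis
  have "G l t = tent l z0" for l
  proof -
    have "(\<lambda>i. tent l (z (\<sigma> i))) \<longlonglongrightarrow> tent l z0"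
      using continuous_on_tent[OF continuous_on_id, of UNIV l] z0(3)
      by (intro isCont_tendsto_compose[of z0 "tent l"]) (auto simp: continuous_on_eq_continuous_at o_def)
    moreover have "(\<lambda>i. tent l (z (\<sigma> i))) \<longlonglongrightarrow> G l t"
    proof (rule LIMSEQ_norm_0[THEN Lim_transform2, rotated, of "\<lambda>_. G l t"] | rule metric_LIMSEQ_I)+
      fix e :: real assume "0 < e"
      then obtain N where N: "1 / real (Suc N) < e" using nat_approx_posE by blast
      have "dist (tent l (z (\<sigma> i))) (G l t) < e" if "max N l \<le> i" for i
      proof -
        have i: "i \<le> \<sigma> i" using z0(2) by (rule seq_suble)
        then have "\<bar>G l t - tent l (z (\<sigma> i))\<bar> \<le> 1 / real (Suc (\<sigma> i))" using that by (intro z(2)) auto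
        also have "\<dots> \<le> 1 / real (Suc N)" using i that by (intro divide_left_mono) auto
        finally show ?thesis using N by (simp add: dist_real_def abs_minus_commute)
      qed
      then show "\<exists>no. \<forall>n\<ge>no. dist (tent l (z (\<sigma> n))) (G l t) < e" by blast
    qed
    ultimately show ?thesis by (rule LIMSEQ_unique[symmetric])
  qed
  then show ?thesis using z0(1) by blast
qed

text \<open>Everything is moved to the line by the code, a weak limit is extracted there, and the
  limit is moved back. The danger is that the limit charges reals which code no point of
  \<open>S \<times> A\<close>. This is excluded by the convergence of the state marginals to a
  finite measure \<open>m\<close>, which is inner regular, and by the compactness of
  \<open>A\<close>.\<close>

theorem subprob_weakly_compact:
  fixes S :: "'s::polish_space set" and A :: "'b::polish_space set"
  assumes S: "S \<in> sets borel" and A: "compact A"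
    and \<mu>: "\<And>k. sets (\<mu> k) = sets (SM S \<Otimes>\<^sub>M SM A)" "\<And>k. emeasure (\<mu> k) (S \<times> A) \<le> 1"
    and m: "sets m = sets (SM S)" "finite_measure m"
    and conv: "\<And>(f::'s \<Rightarrow> real) B. continuous_on S f \<Longrightarrow> (\<And>x. 0 \<le> f x) \<Longrightarrow> (\<And>x. f x \<le> B) \<Longrightarrow>
      (\<lambda>k. \<integral>\<^sup>+z. ennreal (f (fst z)) \<partial>\<mu> k) \<longlonglongrightarrow> (\<integral>\<^sup>+x. ennreal (f x) \<partial>m)"
  obtains r \<mu>' where "strict_mono (r :: nat \<Rightarrow> nat)" "sets \<mu>' = sets (SM S \<Otimes>\<^sub>M SM A)"
    "emeasure \<mu>' (S \<times> A) = emeasure m S"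
    "\<And>h. lsc (S \<times> A) h \<Longrightarrow> (\<integral>\<^sup>+z. h z \<partial>\<mu>') \<le> liminf (\<lambda>k. \<integral>\<^sup>+z. h z \<partial>\<mu> (r k))"
proof -
  obtain e :: "'s \<times> 'b \<Rightarrow> real" and G where e[measurable]: "e \<in> borel_measurable borel" and e02: "range e \<subseteq> {0..2}"
    and G: "\<And>l. continuous_on UNIV (G l)" "\<And>l z. G l (e z) = tent l z"
    using ex_real_code by blast
  have e02': "0 \<le> e z" "e z \<le> 2" for z using subsetD[OF e02, of "e z"] by auto
  interpret m: finite_measure m by fact
  have spm[simp]: "space m = S" using sets_eq_imp_space_eq[OF m(1)] by simp
  have sp[simp]: "space (\<mu> k) = S \<times> A" for k using sets_eq_imp_space_eq[OF \<mu>(1)] by simp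
  note \<mu>(1)[measurable_cong] m(1)[measurable_cong]
  note [measurable] = measurable_pair_SM_borel
  have eM[measurable]: "e \<in> borel_measurable (\<mu> k)" for k
    using measurable_compose[OF measurable_pair_SM_borel e] by (simp cong: measurable_cong_sets[OF \<mu>(1)])
  have fin: "finite_measure (\<mu> k)" for k using \<mu>(2)[of k] by (intro finite_measureI) (auto simp: top_unique)
  \<comment> \<open>The missing mass is parked at -1, away from all codes. The images become
    probability measures on one bounded interval and are therefore tight.\<close>
  define \<Phi> where "\<Phi> k f = (\<integral>\<^sup>+z. f (e z) \<partial>\<mu> k) + (1 - emeasure (\<mu> k) (S \<times> A)) * f (-1)" for k f
  have pos: "pos_functional borel (\<Phi> k)" for k
    unfolding \<Phi>_def
    by (intro pos_functional_add pos_functional_cmult pos_functional_eval pos_functional_map[OF pos_functional_nn_integral[OF refl] eM]) simp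
  define \<nu> where "\<nu> k = functional_measure borel (\<Phi> k)" for k
  have int\<nu>: "(\<integral>\<^sup>+t. f t \<partial>\<nu> k) = (\<integral>\<^sup>+z. f (e z) \<partial>\<mu> k) + (1 - emeasure (\<mu> k) (S \<times> A)) * f (-1)"
    if "f \<in> borel_measurable borel" for f k
    unfolding \<nu>_def using nn_integral_functional_measure[OF pos that] by (simp add: \<Phi>_def)
  have [simp]: "sets (\<nu> k) = sets borel" "space (\<nu> k) = UNIV" for k by (simp_all add: \<nu>_def)
  have one: "emeasure (\<nu> k) X = 1" if "{-1} \<union> {0..2} \<subseteq> X" "X \<in> sets borel" for k X
  proof -
    have "emeasure (\<nu> k) X = (\<integral>\<^sup>+t. indicator X t \<partial>\<nu> k)" using that by simp
    also have "\<dots> = (\<integral>\<^sup>+z. 1 \<partial>\<mu> k) + (1 - emeasure (\<mu> k) (S \<times> A))"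
      using that e02' by (subst int\<nu>) (auto simp: subset_iff)
    finally show ?thesis using \<mu>(2)[of k] by (simp add: add_diff_inverse_ennreal)
  qed
  have rd: "real_distribution (\<nu> k)" for k
    by (intro real_distribution.intro prob_spaceI real_distribution_axioms.intro) (auto intro: one)
  have "tight \<nu>"
    unfolding tight_def
  proof (intro conjI allI impI rd)
    fix \<epsilon> :: real assume "0 < \<epsilon>"
    have "measure (\<nu> k) {-2<..2} = 1" for k using one[of "{-2<..2}" k] by (simp add: measure_def subset_iff)
    then show "\<exists>a b. a < b \<and> (\<forall>n. 1 - \<epsilon> < measure (\<nu> n) {a<..b})"
      using \<open>0 < \<epsilon>\<close> by (intro exI[of _ "-2"] exI[of _ 2]) auto
  qed
  from tight_imp_convergent_subsubsequence[OF this strict_mono_id]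
  obtain r M where r: "strict_mono r" and M: "real_distribution M" and wc: "weak_conv_m (\<nu> \<circ> id \<circ> r) M" by blast
  interpret M: real_distribution M by fact
  have sM[measurable_cong]: "sets M = sets borel" and spM[simp]: "space M = UNIV" by simp_all
  have lscM: "(\<integral>\<^sup>+t. h t \<partial>M) \<le> liminf (\<lambda>k. \<integral>\<^sup>+t. h t \<partial>\<nu> (r k))" if "lsc UNIV h" for h
    using weak_conv_lsc[OF _ M wc that] rd by simp
  have convnn: "(\<lambda>k. \<integral>\<^sup>+z. ennreal (f (fst z)) \<partial>\<mu> (r k)) \<longlonglongrightarrow> (\<integral>\<^sup>+x. ennreal (f x) \<partial>m)"
    if f: "continuous_on S f" "\<And>x. 0 \<le> f x" "\<And>x. f x \<le> B" for f :: "'s \<Rightarrow> real" and B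
    using LIMSEQ_subseq_LIMSEQ[OF conv[OF f] r] by (simp add: o_def)
  \<comment> \<open>A continuous function equal to 1 on the codes and to 0 at the parking point: its
    integrals recover the masses of the \<open>\<mu> k\<close> and hence the mass of the useful part
    of the limit.\<close>
  define \<kappa> where "\<kappa> t = max 0 (min 1 (t + 1))" for t :: real
  have [measurable]: "\<kappa> \<in> borel_measurable borel" unfolding \<kappa>_def by measurable
  have \<kappa>c: "continuous_on UNIV \<kappa>" unfolding \<kappa>_def by (intro continuous_intros)
  have \<kappa>: "0 \<le> \<kappa> t" "\<kappa> t \<le> 1" "\<kappa> (e z) = 1" "\<kappa> (-1) = 0" for t z using e02'[of z] by (auto simp: \<kappa>_def)
  have mass: "(\<integral>\<^sup>+t. ennreal (\<kappa> t) \<partial>M) = emeasure m S"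
  proof -
    have "(\<lambda>k. integral\<^sup>L (\<nu> (r k)) \<kappa>) \<longlonglongrightarrow> integral\<^sup>L M \<kappa>"
      using weak_conv_imp_integral_bdd_continuous_conv[OF _ M wc, of \<kappa> 1] rd \<kappa> \<kappa>c
      by (auto simp: continuous_on_eq_continuous_at o_def)
    then have "(\<lambda>k. ennreal (integral\<^sup>L (\<nu> (r k)) \<kappa>)) \<longlonglongrightarrow> ennreal (integral\<^sup>L M \<kappa>)" by (rule tendsto_ennrealI)
    moreover have "ennreal (integral\<^sup>L M \<kappa>) = (\<integral>\<^sup>+t. ennreal (\<kappa> t) \<partial>M)"
      by (intro nn_integral_eq_integral[symmetric] M.integrable_const_bound[where B=1]) (use \<kappa> in auto)
    moreover have "ennreal (integral\<^sup>L (\<nu> k) \<kappa>) = emeasure (\<mu> k) (S \<times> A)" for k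
    proof -
      interpret real_distribution "\<nu> k" by (rule rd)
      have "ennreal (integral\<^sup>L (\<nu> k) \<kappa>) = (\<integral>\<^sup>+t. ennreal (\<kappa> t) \<partial>\<nu> k)"
        by (intro nn_integral_eq_integral[symmetric] integrable_const_bound[where B=1]) (use \<kappa> in auto)
      then show ?thesis using \<kappa> by (subst (asm) int\<nu>) auto
    qed
    moreover have "(\<lambda>k. emeasure (\<mu> (r k)) (S \<times> A)) \<longlonglongrightarrow> emeasure m S"
      using convnn[of "\<lambda>_. 1" 1] by simp
    ultimately show ?thesis using LIMSEQ_unique by (metis (no_types, lifting) ext)
  qed
  \<comment> \<open>Mass that \<open>m\<close> gives to a compact \<open>K\<close> must arrive at
    codes of \<open>K \<times> A\<close>: open sets of reals away from these codes receive in the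
    limit at most the \<open>m\<close>-mass of \<open>S - K\<close>.\<close>
  have LK: "emeasure m K \<le> emeasure M (coded_points G (K \<times> A))" if K: "compact K" "K \<subseteq> S" for K
  proof (cases "K = {}")
    case False
    let ?L = "coded_points G (K \<times> A)"
    have cKA: "compact (K \<times> A)" using K A by (intro compact_Times)
    have [measurable]: "?L \<in> sets borel" using compact_coded_points[where G=G, OF G(1) cKA] by (simp add: borel_closed compact_imp_closed)
    have Km[measurable]: "K \<in> sets m" using K unfolding m(1) SM_def by (auto simp: sets_restrict_space image_iff intro!: bexI[of _ K] borel_closed compact_imp_closed)
    \<comment> \<open>The parking point is left out. As \<open>J\<close> grows, these open sets
      cover every number above -1 that lies outside \<open>?L\<close>.\<close>
    define U where "U J = {-1<..} \<inter> ({..<0} \<union> {2<..} \<union> {t. \<forall>z\<in>K \<times> A. \<exists>j\<le>J. 1 / real (Suc J) < \<bar>G j t - tent j z\<bar>})" for J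
    have oU: "open (U J)" for J unfolding U_def using open_far_codes[where G=G, OF G(1) cKA] by (intro open_Int open_Un) auto
    have incU: "incseq U"
    proof (rule incseq_SucI)
      fix J
      have "1 / real (Suc (Suc J)) \<le> 1 / real (Suc J)" by (intro divide_left_mono) auto
      then have *: "\<exists>j\<le>Suc J. 1 / real (Suc (Suc J)) < f j" if "\<exists>j\<le>J. 1 / real (Suc J) < f j" for f :: "nat \<Rightarrow> real"
        using that by (meson le_SucI le_less_trans)
      have "{t. \<forall>z\<in>K \<times> A. \<exists>j\<le>J. 1 / real (Suc J) < \<bar>G j t - tent j z\<bar>}
        \<subseteq> {t. \<forall>z\<in>K \<times> A. \<exists>j\<le>Suc J. 1 / real (Suc (Suc J)) < \<bar>G j t - tent j z\<bar>}"
        using *[of "\<lambda>j. \<bar>G j _ - tent j _\<bar>"] by (intro Collect_mono impI ballI) (drule bspec, assumption)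
      then show "U J \<subseteq> U (Suc J)" unfolding U_def by (intro Int_mono Un_mono order_refl)
    qed
    have cover: "{-1<..} - ?L \<subseteq> (\<Union>J. U J)"
    proof
      fix t :: real assume t: "t \<in> {-1<..} - ?L"
      show "t \<in> (\<Union>J. U J)"
      proof (rule ccontr)
        assume no: "t \<notin> (\<Union>J. U J)"
        then have "t \<notin> U J" for J by auto
        then have "t \<in> {0..2}" "\<And>J. \<exists>z\<in>K \<times> A. \<forall>j\<le>J. \<bar>G j t - tent j z\<bar> \<le> 1 / real (Suc J)"
          using t unfolding U_def by (auto simp: not_less)
        then have "t \<in> ?L" using codes_near_compact[OF cKA, of G t] by (auto simp: coded_points_def)
        then show False using t by simp
      qed
    qed
    have UM: "emeasure M (U J) \<le> emeasure m (S - K)" for J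
    proof -
      \<comment> \<open>Tents of index at most \<open>J\<close> have Lipschitz constant at most
        \<open>Suc J\<close>. A state within this \<open>\<delta>\<close> of \<open>K\<close> thus
        has, with its action kept, tent values within \<open>1 / Suc J\<close> of those of a point
        of \<open>K \<times> A\<close>, so its code is not in \<open>U J\<close>.\<close>
      define \<delta> where "\<delta> = 1 / (real (Suc J))\<^sup>2"
      have \<delta>: "0 < \<delta>" by (simp add: \<delta>_def)
      define g where "g x = min 1 (infdist x K / \<delta>)" for x
      have gc: "continuous_on S g" unfolding g_def by (intro continuous_intros) (use \<delta> in auto)
      have g01: "0 \<le> g x" "g x \<le> 1" for x using \<delta> by (auto simp: g_def infdist_nonneg)
      have key: "indicator (U J) (e z) \<le> ennreal (g (fst z))" if z: "z \<in> S \<times> A" for z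
      proof (cases "infdist (fst z) K < \<delta>")
        case True
        obtain x' where x': "x' \<in> K" "dist (fst z) x' < \<delta>"
          using True \<open>K \<noteq> {}\<close> by (auto simp: infdist_def cINF_less_iff)
        have "\<bar>G j (e z) - tent j (x', snd z)\<bar> \<le> 1 / real (Suc J)" if "j \<le> J" for j
        proof -
          have "\<bar>G j (e z) - tent j (x', snd z)\<bar> \<le> real j * dist z (x', snd z)" unfolding G(2) by (rule tent_lipschitz)
          also have "dist z (x', snd z) = dist (fst z) x'" by (cases z) (simp add: dist_prod_def)
          also have "real j * \<dots> \<le> real (Suc J) * \<delta>" using x'(2) that by (intro mult_mono) auto
          finally show ?thesis by (simp add: \<delta>_def power2_eq_square)
        qed
        then have "e z \<notin> U J" using x' z e02'[of z] unfolding U_def by (force simp: not_less)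
        then show ?thesis by simp
      next
        case False
        then have "g (fst z) = 1" using \<delta> by (simp add: g_def)
        then show ?thesis by (simp split: split_indicator)
      qed
      have "lsc UNIV (indicator (U J) :: real \<Rightarrow> ennreal)" unfolding lsc_def
      proof
        fix r :: ennreal
        have "{z \<in> UNIV. r < indicator (U J) z} = (if r < 1 then U J else {})"
          by (auto split: split_indicator)
        then show "openin (top_of_set UNIV) {z \<in> UNIV. r < indicator (U J) z}" using oU[of J] by auto
      qed
      from lscM[OF this] have "emeasure M (U J) \<le> liminf (\<lambda>k. \<integral>\<^sup>+t. indicator (U J) t \<partial>\<nu> (r k))"
        using oU[of J] by simp
      also have "\<dots> \<le> liminf (\<lambda>k. \<integral>\<^sup>+z. ennreal (g (fst z)) \<partial>\<mu> (r k))"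
      proof (intro Liminf_mono always_eventually allI)
        fix k
        have "-1 \<notin> U J" by (simp add: U_def)
        then show "(\<integral>\<^sup>+t. indicator (U J) t \<partial>\<nu> (r k)) \<le> (\<integral>\<^sup>+z. ennreal (g (fst z)) \<partial>\<mu> (r k))"
          using oU[of J] key by (subst int\<nu>) (auto intro!: nn_integral_mono)
      qed
      also have "\<dots> = (\<integral>\<^sup>+x. ennreal (g x) \<partial>m)"
        using convnn[OF gc g01] by (simp add: lim_imp_Liminf)
      also have "\<dots> \<le> (\<integral>\<^sup>+x. indicator (S - K) x \<partial>m)"
        using g01 by (intro nn_integral_mono) (auto simp: g_def split: split_indicator)
      also have "\<dots> = emeasure m (S - K)" using sets.top[of m] by simp
      finally show ?thesis .
    qed
    have "emeasure M ({-1<..} - ?L) \<le> emeasure M (\<Union>J. U J)" using cover oU by (intro emeasure_mono) (auto intro!: sets.countable_UN)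
    also have "\<dots> = (SUP J. emeasure M (U J))" using oU incU by (intro SUP_emeasure_incseq[symmetric]) auto
    also have "\<dots> \<le> emeasure m (S - K)" by (intro SUP_least UM)
    finally have 1: "emeasure M ({-1<..} - ?L) \<le> emeasure m (S - K)" .
    have "emeasure m K + emeasure m (S - K) = emeasure m S"
      using K(2) sets.top[of m] by (subst plus_emeasure) (auto simp: Un_absorb1)
    also have "\<dots> \<le> (\<integral>\<^sup>+t. indicator {-1<..} t \<partial>M)" unfolding mass[symmetric]
      by (intro nn_integral_mono) (auto simp: \<kappa>_def ennreal_neg split: split_indicator)
    also have "\<dots> = emeasure M {-1<..}" by simp
    also have "\<dots> \<le> emeasure M (?L \<union> ({-1<..} - ?L))" by (intro emeasure_mono) auto
    also have "\<dots> \<le> emeasure M ?L + emeasure M ({-1<..} - ?L)" by (intro emeasure_subadditive) auto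
    also have "\<dots> \<le> emeasure M ?L + emeasure m (S - K)" using 1 by (intro add_left_mono)
    finally show ?thesis using m.emeasure_finite[of "S - K"] by (simp add: ennreal_add_left_cancel_le add.commute)
  qed simp
  define mb where "mb = distr m borel (\<lambda>x. x)"
  have mid[measurable]: "(\<lambda>x. x) \<in> measurable m borel" using measurable_SM_borel[of S] by (simp cong: measurable_cong_sets[OF m(1)])
  have mbX: "emeasure mb X = emeasure m (X \<inter> S)" if "X \<in> sets borel" for X
    using that unfolding mb_def by (subst emeasure_distr) auto
  \<comment> \<open>Inner regularity of finite Borel measures on a Polish space. Countably many
    compact sets realize the supremum, so the set \<open>L\<close> below is Borel and carries the
    full mass.\<close>
  have "emeasure mb S = (SUP K\<in>{K. K \<subseteq> S \<and> compact K}. emeasure mb K)"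
    by (rule inner_regular) (use S mbX[of UNIV] in \<open>auto simp: mb_def intro!: m.emeasure_finite\<close>)
  moreover have "{K. K \<subseteq> S \<and> compact K} \<noteq> {}" by (auto intro!: exI[of _ "{}"])
  ultimately have "\<exists>f::nat \<Rightarrow> ennreal. range f \<subseteq> emeasure mb ` {K. K \<subseteq> S \<and> compact K} \<and> emeasure mb S = (SUP i. f i)"
    using ennreal_SUP_countable_SUP[of "{K. K \<subseteq> S \<and> compact K}" "emeasure mb"] by simp
  then obtain f :: "nat \<Rightarrow> ennreal" where f: "range f \<subseteq> emeasure mb ` {K. K \<subseteq> S \<and> compact K}" "emeasure mb S = (SUP i. f i)"
    by blast
  then have "\<forall>i. \<exists>K. K \<subseteq> S \<and> compact K \<and> f i = emeasure mb K" using f(1) by blast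
  then obtain K where K: "\<And>i. K i \<subseteq> S" "\<And>i. compact (K i)" "\<And>i. f i = emeasure mb (K i)" by metis
  define L where "L = (\<Union>i. coded_points G (K i \<times> A))"
  have cK: "compact (K i \<times> A)" for i using K(2) A by (intro compact_Times)
  have Lm[measurable]: "L \<in> sets borel" unfolding L_def by (intro sets.countable_UN image_subsetI borel_closed compact_imp_closed compact_coded_points G(1) cK)
  have "emeasure m S \<le> emeasure M L"
  proof -
    have "emeasure m S = emeasure mb S" using S by (simp add: mbX)
    also have "\<dots> = (SUP i. emeasure m (K i))" using f(2) K S by (auto simp: mbX borel_closed compact_imp_closed Int_absorb2)
    also have "\<dots> \<le> emeasure M L"
    proof (rule SUP_least)
      fix i show "emeasure m (K i) \<le> emeasure M L"
        by (rule order_trans[OF LK[OF K(2,1)]]) (auto simp: L_def[symmetric] intro!: emeasure_mono, auto simp: L_def)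
    qed
    finally show ?thesis .
  qed
  moreover have "emeasure M L \<le> emeasure m S"
  proof -
    have "(\<integral>\<^sup>+t. indicator L t \<partial>M) \<le> (\<integral>\<^sup>+t. ennreal (\<kappa> t) \<partial>M)"
      by (intro nn_integral_mono) (auto simp: L_def coded_points_def \<kappa>_def split: split_indicator)
    then show ?thesis by (simp add: mass)
  qed
  ultimately have massL: "emeasure M L = emeasure m S" by (rule antisym[rotated])
  define D where "D = (decode G :: real \<Rightarrow> 's \<times> 'b)"
  have Din: "D t \<in> S \<times> A" "G l t = tent l (D t)" if "t \<in> L" for t l
    using that K(1) decode_coded[of t G] unfolding L_def D_def by (fastforce, blast)
  have "D \<in> borel_measurable (restrict_space borel L)"
    unfolding L_def D_def by (rule measurable_decode[where G=G, OF G(1) cK])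
  then have Db: "D \<in> borel_measurable (restrict_space M L)" by (simp cong: measurable_cong_sets add: sets_restrict_space_cong[OF sM])
  then have "(\<lambda>t. (fst (D t), snd (D t))) \<in> measurable (restrict_space M L) (SM S \<Otimes>\<^sub>M SM A)"
    using Din(1) by (intro measurable_Pair measurable_into_SM)
      (auto simp: space_restrict_space mem_Times_iff borel_prod[symmetric] intro!: measurable_compose[OF Db] borel_measurable_continuous_onI continuous_intros)
  then have D[measurable]: "D \<in> measurable (restrict_space M L) (SM S \<Otimes>\<^sub>M SM A)" by simp
  define \<mu>' where "\<mu>' = distr (restrict_space M L) (SM S \<Otimes>\<^sub>M SM A) D"
  have "emeasure \<mu>' (S \<times> A) = emeasure m S"
    unfolding \<mu>'_def using Din(1) Lm sM sets.top[of "SM S \<Otimes>\<^sub>M SM A"]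
    by (subst emeasure_distr) (auto simp: space_restrict_space emeasure_restrict_space massL[symmetric] intro!: arg_cong[where f="emeasure M"] simp del: sets.top)
  moreover have "(\<integral>\<^sup>+z. h z \<partial>\<mu>') \<le> liminf (\<lambda>k. \<integral>\<^sup>+z. h z \<partial>\<mu> (r k))" if h: "lsc (S \<times> A) h" for h
  proof -
    obtain \<rho> j where rj: "\<And>k. (0::real) \<le> \<rho> k" "\<And>z. z \<in> S \<times> A \<Longrightarrow> h z = (SUP n. ennreal (run_max (\<lambda>k z. \<rho> k * tent (j k) z) n z))"
      using lsc_eq_SUP_run_max[OF h] by blast
    have hm: "h \<in> borel_measurable (SM S \<Otimes>\<^sub>M SM A)"
      by (rule lsc_borel_measurable[OF h _ measurable_pair_SM_borel]) simp
    \<comment> \<open>Lower semicontinuous on the whole line, equal to \<open>h\<close> after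
      decoding on \<open>L\<close>, equal to \<open>h z\<close> at each code \<open>e z\<close>, and
      0 at the parking point. Its values elsewhere are harmless because only an upper bound for the
      integral of \<open>h\<close> is wanted.\<close>
    define h' where "h' t = (SUP n. ennreal (\<kappa> t * run_max (\<lambda>k t. \<rho> k * G (j k) t) n t))" for t
    have rmG: "run_max (\<lambda>k t. \<rho> k * G (j k) t) n t = run_max (\<lambda>k z. \<rho> k * tent (j k) z) n z"
      if "\<And>l. G l t = tent l z" for n t and z :: "'s \<times> 'b" using that by (induction n) auto
    have h'lsc: "lsc UNIV h'" unfolding h'_def
      by (intro lsc_SUP continuous_imp_lsc continuous_on_mult \<kappa>c continuous_on_run_max continuous_on_mult_left G(1))
    have [measurable]: "h' \<in> borel_measurable borel" by (rule lsc_borel_measurable[OF h'lsc]) auto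
    have "(\<integral>\<^sup>+z. h z \<partial>\<mu>') = (\<integral>\<^sup>+t. h (D t) * indicator L t \<partial>M)"
      unfolding \<mu>'_def using hm Lm by (subst nn_integral_distr) (auto simp: nn_integral_restrict_space)
    also have "\<dots> \<le> (\<integral>\<^sup>+t. h' t \<partial>M)"
    proof (intro nn_integral_mono)
      fix t
      show "h (D t) * indicator L t \<le> h' t"
      proof (cases "t \<in> L")
        case True
        then have "\<kappa> t = 1" by (auto simp: L_def coded_points_def \<kappa>_def)
        then show ?thesis using True Din[OF True] by (simp add: h'_def rj(2) rmG[of t "D t"])
      qed simp
    qed
    also have "\<dots> \<le> liminf (\<lambda>k. \<integral>\<^sup>+t. h' t \<partial>\<nu> (r k))" by (rule lscM[OF h'lsc])
    also have "\<dots> = liminf (\<lambda>k. \<integral>\<^sup>+z. h z \<partial>\<mu> (r k))"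
    proof -
      have "(\<integral>\<^sup>+t. h' t \<partial>\<nu> k) = (\<integral>\<^sup>+z. h z \<partial>\<mu> k)" for k
      proof -
        have "h' (-1) = 0" by (simp add: h'_def \<kappa>)
        moreover have "h' (e z) = h z" if "z \<in> S \<times> A" for z
          using that by (simp add: h'_def \<kappa> rj(2) rmG[of "e z" z, OF G(2)])
        ultimately show ?thesis by (subst int\<nu>) (auto intro!: nn_integral_cong)
      qed
      then show ?thesis by simp
    qed
    finally show ?thesis .
  qed
  moreover have "sets \<mu>' = sets (SM S \<Otimes>\<^sub>M SM A)" by (simp add: \<mu>'_def)
  ultimately show ?thesis using r that by blast
qed

text \<open>The liminf inequality is applied to \<open>f\<close> and to \<open>B - f\<close>. Their
  integrals add up to \<open>B\<close> times a convergent mass, so the second inequality is a limsup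
  bound for the first integral.\<close>

lemma tendsto_of_lsc_bounds:
  fixes \<mu> :: "nat \<Rightarrow> 'a::{metric_space,second_countable_topology} measure"
  assumes sp: "\<And>k. space (\<mu> k) = T" "space \<mu>' = T" and id: "\<And>k. (\<lambda>z. z) \<in> measurable (\<mu> k) borel" "(\<lambda>z. z) \<in> measurable \<mu>' borel"
    and fin: "\<And>k. emeasure (\<mu> k) T < \<infinity>" "emeasure \<mu>' T < \<infinity>"
    and mass: "(\<lambda>k. emeasure (\<mu> k) T) \<longlonglongrightarrow> emeasure \<mu>' T"
    and lsc: "\<And>h. lsc T h \<Longrightarrow> (\<integral>\<^sup>+z. h z \<partial>\<mu>') \<le> liminf (\<lambda>k. \<integral>\<^sup>+z. h z \<partial>\<mu> k)"
    and f: "continuous_on T f" "\<And>z. z \<in> T \<Longrightarrow> 0 \<le> f z" "\<And>z. z \<in> T \<Longrightarrow> f z \<le> B" and B: "0 \<le> B"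
  shows "(\<lambda>k. \<integral>\<^sup>+z. ennreal (f z) \<partial>\<mu> k) \<longlonglongrightarrow> (\<integral>\<^sup>+z. ennreal (f z) \<partial>\<mu>')"
proof -
  define \<alpha> where "\<alpha> N = enn2real (\<integral>\<^sup>+z. ennreal (f z) \<partial>N)" for N
  define \<beta> where "\<beta> N = enn2real (\<integral>\<^sup>+z. ennreal (B - f z) \<partial>N)" for N
  have l1: "lsc T (\<lambda>z. ennreal (f z))" by (rule continuous_imp_lsc[OF f(1)])
  have l2: "lsc T (\<lambda>z. ennreal (B - f z))" by (intro continuous_imp_lsc continuous_intros f(1))
  have main: "(\<integral>\<^sup>+z. ennreal (f z) \<partial>N) = ennreal (\<alpha> N) \<and> (\<integral>\<^sup>+z. ennreal (B - f z) \<partial>N) = ennreal (\<beta> N)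
     \<and> \<alpha> N + \<beta> N = B * measure N T"
    if N: "space N = T" "(\<lambda>z. z) \<in> measurable N borel" "emeasure N T < \<infinity>" for N
  proof -
    have [measurable]: "(\<lambda>z. ennreal (f z)) \<in> borel_measurable N" "(\<lambda>z. ennreal (B - f z)) \<in> borel_measurable N"
      using lsc_borel_measurable[OF l1, of N] lsc_borel_measurable[OF l2, of N] N by auto
    have "(\<integral>\<^sup>+z. ennreal (f z) \<partial>N) + (\<integral>\<^sup>+z. ennreal (B - f z) \<partial>N) = (\<integral>\<^sup>+z. ennreal (f z) + ennreal (B - f z) \<partial>N)"
      by (rule nn_integral_add[symmetric]) auto
    also have "\<dots> = (\<integral>\<^sup>+z. ennreal B \<partial>N)"
      using f N(1) by (intro nn_integral_cong) (simp flip: ennreal_plus)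
    also have "\<dots> = ennreal (B * measure N T)"
      using N B by (simp add: emeasure_eq_ennreal_measure ennreal_mult less_top)
    finally have eq: "(\<integral>\<^sup>+z. ennreal (f z) \<partial>N) + (\<integral>\<^sup>+z. ennreal (B - f z) \<partial>N) = ennreal (B * measure N T)" .
    have fin: "(\<integral>\<^sup>+z. ennreal (f z) \<partial>N) < \<infinity>" "(\<integral>\<^sup>+z. ennreal (B - f z) \<partial>N) < \<infinity>"
    proof -
      have "(\<integral>\<^sup>+z. ennreal (f z) \<partial>N) + (\<integral>\<^sup>+z. ennreal (B - f z) \<partial>N) \<noteq> \<top>" unfolding eq by simp
      then show "(\<integral>\<^sup>+z. ennreal (f z) \<partial>N) < \<infinity>" "(\<integral>\<^sup>+z. ennreal (B - f z) \<partial>N) < \<infinity>"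
        by (simp_all add: less_top[symmetric])
    qed
    then have e: "(\<integral>\<^sup>+z. ennreal (f z) \<partial>N) = ennreal (\<alpha> N)" "(\<integral>\<^sup>+z. ennreal (B - f z) \<partial>N) = ennreal (\<beta> N)"
      by (simp_all add: \<alpha>_def \<beta>_def less_top)
    moreover have "ennreal (\<alpha> N + \<beta> N) = ennreal (B * measure N T)"
      using eq unfolding e by (subst ennreal_plus) (auto simp: \<alpha>_def \<beta>_def)
    then have "\<alpha> N + \<beta> N = B * measure N T" using B by (subst (asm) ennreal_inj) (auto simp: \<alpha>_def \<beta>_def)
    ultimately show ?thesis by simp
  qed
  note mk = main[OF sp(1) id(1) fin(1)] and m' = main[OF sp(2) id(2) fin(2)]
  have nn: "0 \<le> \<alpha> N" "0 \<le> \<beta> N" for N by (simp_all add: \<alpha>_def \<beta>_def)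
  have "(\<lambda>k. enn2real (emeasure (\<mu> k) T)) \<longlonglongrightarrow> enn2real (emeasure \<mu>' T)"
    using fin(2) mass by (intro tendsto_enn2real) auto
  then have "(\<lambda>k. B * measure (\<mu> k) T) \<longlonglongrightarrow> B * measure \<mu>' T" unfolding measure_def by (intro tendsto_mult tendsto_const)
  then have sum: "(\<lambda>k. \<alpha> (\<mu> k) + \<beta> (\<mu> k)) \<longlonglongrightarrow> \<alpha> \<mu>' + \<beta> \<mu>'" using mk m' by simp
  have ev: "\<forall>\<^sub>F k in sequentially. y < g (\<mu> k)"
    if le: "ennreal (g \<mu>') \<le> liminf (\<lambda>k. ennreal (g (\<mu> k)))" and g: "\<And>N. 0 \<le> g N" and y: "y < g \<mu>'" for g :: "'a measure \<Rightarrow> real" and y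
  proof (cases "0 \<le> y")
    case True
    then have "ennreal y < ennreal (g \<mu>')" using y by (simp add: ennreal_less_iff)
    from less_LiminfD[OF less_le_trans[OF this le]] show ?thesis by eventually_elim (use True in \<open>simp add: ennreal_less_iff\<close>)
  next
    case False
    then have "y < g (\<mu> k)" for k using g[of "\<mu> k"] by linarith
    then show ?thesis by simp
  qed
  have ea: "\<forall>\<^sub>F k in sequentially. y < \<alpha> (\<mu> k)" if "y < \<alpha> \<mu>'" for y
    using lsc[OF l1] mk m' nn that by (intro ev) auto
  have eb: "\<forall>\<^sub>F k in sequentially. y < \<beta> (\<mu> k)" if "y < \<beta> \<mu>'" for y
    using lsc[OF l2] mk m' nn that by (intro ev) auto
  have "(\<lambda>k. \<alpha> (\<mu> k)) \<longlonglongrightarrow> \<alpha> \<mu>'"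
  proof (rule order_tendstoI)
    fix y assume y: "\<alpha> \<mu>' < y"
    define d where "d = (y - \<alpha> \<mu>') / 2"
    have "0 < d" using y by (simp add: d_def)
    then have "\<forall>\<^sub>F k in sequentially. \<alpha> (\<mu> k) + \<beta> (\<mu> k) < \<alpha> \<mu>' + \<beta> \<mu>' + d" using sum by (intro order_tendstoD(2)) auto
    moreover have "\<forall>\<^sub>F k in sequentially. \<beta> \<mu>' - d < \<beta> (\<mu> k)" using \<open>0 < d\<close> by (intro eb) auto
    ultimately show "\<forall>\<^sub>F k in sequentially. \<alpha> (\<mu> k) < y" by eventually_elim (simp add: d_def field_simps)
  qed (rule ea)
  then show ?thesis using mk m' by (simp add: tendsto_ennrealI)
qed

section \<open>Measurable selection and disintegration\<close>

text \<open>The zero with the least real code is selected. The zero sets \<open>Z x\<close> are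
  compact by semicontinuity, and whether \<open>Z x\<close> meets \<open>{..y}\<close> is decided by
  an infimum over the codes up to \<open>y\<close>, a measurable function of \<open>x\<close> by
  \<open>lsc_INF\<close>.\<close>

lemma measurable_zero_selector:
  fixes S :: "'s::polish_space set" and A :: "'b::polish_space set"
  assumes A: "compact A" "A \<noteq> {}" and h: "lsc (S \<times> A) h"
  shows "\<exists>f\<in>measurable (SM S) (SM A). \<forall>x\<in>S. (\<exists>a\<in>A. h (x, a) = 0) \<longrightarrow> h (x, f x) = 0"
proof -
  obtain e :: "'b \<Rightarrow> real" and L \<psi> where "e \<in> borel_measurable borel" and L: "compact L" "L \<subseteq> {0..2}" "continuous_on L \<psi>" "\<psi> ` L = A"
    and "\<And>a. a \<in> A \<Longrightarrow> e a \<in> L \<and> \<psi> (e a) = a"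
    by (rule ex_compact_code[OF A(1)]; rule that; assumption)
  have Lne: "L \<noteq> {}" using L(4) A(2) by auto
  define g where "g p = h (fst p, \<psi> (snd p))" for p
  have g: "lsc (S \<times> L) g" unfolding g_def
  proof (rule lsc_compose[OF h])
    have "continuous_on (S \<times> L) (\<lambda>p. \<psi> (snd p))"
      by (rule continuous_on_compose2[OF L(3)]) (auto intro: continuous_intros)
    then show "continuous_on (S \<times> L) (\<lambda>p. (fst p, \<psi> (snd p)))" by (intro continuous_intros)
  qed (use L(4) in auto)
  define Z where "Z x = {t\<in>L. g (x, t) = 0}" for x
  have Zc: "compact (Z x)" if "x \<in> S" for x
  proof -
    have "lsc L (\<lambda>t. g (x, t))" using that by (intro lsc_compose[OF g] continuous_intros) auto
    from lscD[OF this, of 0] have "closedin (top_of_set L) (L - {t\<in>L. 0 < g (x, t)})"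
      using closedin_diff[OF closedin_topspace] by fastforce
    moreover have "L - {t\<in>L. 0 < g (x, t)} = Z x" by (auto simp: Z_def)
    ultimately show ?thesis using closedin_compact[OF L(1)] by simp
  qed
  have meas: "{x\<in>S. Z x \<inter> {..y} \<noteq> {}} \<in> sets (SM S)" for y
  proof (cases "L \<inter> {..y} = {}")
    case True
    then have "{x\<in>S. Z x \<inter> {..y} \<noteq> {}} = {}" by (auto simp: Z_def)
    then show ?thesis by (simp only: sets.empty_sets)
  next
    case False
    have cy: "compact (L \<inter> {..y})" using L(1) by (intro compact_Int_closed) auto
    have gy: "lsc (S \<times> (L \<inter> {..y})) g" by (rule lsc_subset[OF g]) auto
    have l: "lsc S (\<lambda>x. INF t\<in>L \<inter> {..y}. g (x, t))" by (rule lsc_INF[OF gy cy False])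
    have [measurable]: "(\<lambda>x. INF t\<in>L \<inter> {..y}. g (x, t)) \<in> borel_measurable (SM S)"
      by (rule lsc_borel_measurable[OF l]) auto
    have eq: "{x\<in>S. Z x \<inter> {..y} \<noteq> {}} = {x\<in>space (SM S). (INF t\<in>L \<inter> {..y}. g (x, t)) = 0}"
    proof -
      have "(INF t\<in>L \<inter> {..y}. g (x, t)) = 0 \<longleftrightarrow> Z x \<inter> {..y} \<noteq> {}" if "x \<in> S" for x
      proof -
        have "lsc (L \<inter> {..y}) (\<lambda>t. g (x, t))" using that by (intro lsc_compose[OF gy] continuous_intros) auto
        from lsc_attains_INF[OF this cy False] obtain t where t: "t \<in> L \<inter> {..y}" "g (x, t) = (INF t\<in>L \<inter> {..y}. g (x, t))" by blast
        have "(INF t\<in>L \<inter> {..y}. g (x, t)) \<le> g (x, s)" if "s \<in> L \<inter> {..y}" for s using that by (rule INF_lower)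
        then show ?thesis using t by (fastforce simp: Z_def)
      qed
      then show ?thesis by auto
    qed
    show ?thesis unfolding eq by measurable
  qed
  obtain t0 where t0: "t0 \<in> L" using Lne by auto
  define \<tau> where "\<tau> x = (if Z x = {} then t0 else Inf (Z x))" for x
  have Inf_in: "Inf (Z x) \<in> Z x" and Inf_le: "t \<in> Z x \<Longrightarrow> Inf (Z x) \<le> t" if "x \<in> S" "Z x \<noteq> {}" for x t
  proof -
    have b: "bdd_below (Z x)" using Zc[OF that(1)] by (intro bounded_imp_bdd_below compact_imp_bounded)
    show "Inf (Z x) \<in> Z x" using that Zc b by (intro closed_contains_Inf compact_imp_closed) auto
    show "t \<in> Z x \<Longrightarrow> Inf (Z x) \<le> t" using b by (rule cInf_lower[rotated])
  qed
  have tL: "\<tau> x \<in> L" if "x \<in> S" for x using Inf_in[OF that] t0 by (auto simp: \<tau>_def Z_def)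
  have good[measurable]: "{x\<in>S. Z x \<noteq> {}} \<in> sets (SM S)"
  proof -
    obtain B where "\<And>t. t \<in> L \<Longrightarrow> t \<le> B" using compact_imp_bounded[OF L(1)] bounded_imp_bdd_above by (metis bdd_above.E)
    then have "{x\<in>S. Z x \<noteq> {}} = {x\<in>S. Z x \<inter> {..B} \<noteq> {}}" by (auto simp: Z_def) 
    then show ?thesis using meas by simp
  qed
  have "\<tau> \<in> borel_measurable (SM S)"
  proof (rule borel_measurable_iff_le[THEN iffD2], intro allI)
    fix y
    have "{w \<in> space (SM S). \<tau> w \<le> y} = {x\<in>S. Z x \<inter> {..y} \<noteq> {}} \<union> (if t0 \<le> y then S - {x\<in>S. Z x \<noteq> {}} else {})"
    proof -
      have "Z x \<inter> {..y} \<noteq> {} \<longleftrightarrow> Inf (Z x) \<le> y" if "x \<in> S" "Z x \<noteq> {}" for x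
      proof
        assume "Z x \<inter> {..y} \<noteq> {}"
        then obtain t where "t \<in> Z x" "t \<le> y" by auto
        then show "Inf (Z x) \<le> y" using Inf_le[OF that, of t] by simp
      qed (use Inf_in[OF that] in auto)
      then show ?thesis by (auto simp: \<tau>_def)
    qed
    moreover have "S - {x\<in>S. Z x \<noteq> {}} \<in> sets (SM S)" using sets.compl_sets[OF good] by simp
    ultimately show "{w \<in> space (SM S). \<tau> w \<le> y} \<in> sets (SM S)" using meas[of y] by auto
  qed
  then have "\<tau> \<in> measurable (SM S) (restrict_space borel L)" using tL by (intro measurable_restrict_space2) auto
  moreover have "\<psi> \<in> borel_measurable (restrict_space borel L)" using L(3) by (rule borel_measurable_continuous_on_restrict)
  ultimately have "(\<lambda>x. \<psi> (\<tau> x)) \<in> borel_measurable (SM S)" by (rule measurable_compose)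
  then have sel: "(\<lambda>x. \<psi> (\<tau> x)) \<in> measurable (SM S) (SM A)" using tL L(4) by (intro measurable_into_SM) auto
  have "h (x, \<psi> (\<tau> x)) = 0" if x: "x \<in> S" and a: "a \<in> A" "h (x, a) = 0" for x a
  proof -
    obtain t where "t \<in> L" "a = \<psi> t" using L(4) a(1) by auto
    then have "t \<in> Z x" using a(2) by (simp add: Z_def g_def)
    then have "Z x \<noteq> {}" by auto
    then show ?thesis using Inf_in[OF x] by (auto simp: \<tau>_def Z_def g_def)
  qed
  then have "\<forall>x\<in>S. (\<exists>a\<in>A. h (x, a) = 0) \<longrightarrow> h (x, \<psi> (\<tau> x)) = 0" by blast
  then show ?thesis by (rule bexI[of _ "\<lambda>x. \<psi> (\<tau> x)"]) (rule sel)
qed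

text \<open>Test with the set where the inequality fails; finiteness of the integral of
  \<open>g\<close> permits the subtraction.\<close>

lemma AE_le_of_nn_integral_le:
  fixes f g :: "'a \<Rightarrow> ennreal"
  assumes [measurable]: "f \<in> borel_measurable M" "g \<in> borel_measurable M" and fin: "(\<integral>\<^sup>+x. g x \<partial>M) < \<infinity>"
    and le: "\<And>X. X \<in> sets M \<Longrightarrow> (\<integral>\<^sup>+x\<in>X. f x \<partial>M) \<le> (\<integral>\<^sup>+x\<in>X. g x \<partial>M)"
  shows "AE x in M. f x \<le> g x"
proof -
  define E where "E = {x\<in>space M. g x < f x}"
  have [measurable]: "E \<in> sets M" unfolding E_def by measurable
  have "(\<integral>\<^sup>+x. g x * indicator E x \<partial>M) \<le> (\<integral>\<^sup>+x. g x \<partial>M)" by (intro nn_integral_mono) (auto split: split_indicator)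
  then have fE: "(\<integral>\<^sup>+x. g x * indicator E x \<partial>M) < \<infinity>" using fin by (rule le_less_trans)
  have "(\<integral>\<^sup>+x. f x * indicator E x - g x * indicator E x \<partial>M) = (\<integral>\<^sup>+x. f x * indicator E x \<partial>M) - (\<integral>\<^sup>+x. g x * indicator E x \<partial>M)"
    using fE by (intro nn_integral_diff) (auto simp: E_def split: split_indicator)
  also have "\<dots> = 0" using le[of E] le_less_trans[OF le[of E] fE] by (simp add: diff_eq_0_iff_ennreal)
  finally have "AE x in M. f x * indicator E x - g x * indicator E x = 0" by (subst (asm) nn_integral_0_iff_AE) auto
  then show ?thesis
  proof (rule AE_mp, intro AE_I2 impI)
    fix x assume x: "x \<in> space M" "f x * indicator E x - g x * indicator E x = 0"
    show "f x \<le> g x"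
    proof (rule ccontr)
      assume "\<not> f x \<le> g x"
      then have "x \<in> E" "g x < f x" using x by (auto simp: E_def)
      then show False using x(2) by (auto simp: diff_eq_0_iff_ennreal)
    qed
  qed
qed

lemma measurable_kernel_integral:
  "L \<in> measurable M (subprob_algebra N) \<Longrightarrow> g \<in> borel_measurable (M \<Otimes>\<^sub>M N) \<Longrightarrow> (\<lambda>x. \<integral>\<^sup>+t. g (x, t) \<partial>L x) \<in> borel_measurable M"
  by (rule nn_integral_measurable_subprob_algebra2[where N=N]) simp_all

text \<open>In terms of the action's code, a conditional law is a family of distribution functions
  on the line. For each \<open>y\<close> the conditional probability of a code at most
  \<open>y\<close> is a Radon-Nikodym derivative \<open>w y\<close>; the derivatives at rational
  \<open>y\<close> are consistent almost everywhere, and right limits turn them into distribution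
  functions.\<close>

theorem disintegration:
  fixes A :: "'b::polish_space set"
  assumes A: "compact A" "A \<noteq> {}" and N: "finite_measure N" "sets N = sets (M \<Otimes>\<^sub>M SM A)"
  shows "\<exists>\<phi>\<in>measurable M (prob_algebra (SM A)). \<forall>g\<in>borel_measurable (M \<Otimes>\<^sub>M SM A).
    (\<integral>\<^sup>+z. g z \<partial>N) = (\<integral>\<^sup>+x. (\<integral>\<^sup>+a. g (x, a) \<partial>\<phi> x) \<partial>distr N M fst)"
proof -
  interpret N: finite_measure N by fact
  note N(2)[measurable_cong]
  obtain e :: "'b \<Rightarrow> real" and L \<psi> where e[measurable]: "e \<in> borel_measurable borel" and L: "compact L" "L \<subseteq> {0..2}" "continuous_on L \<psi>" "\<psi> ` L = A"
    and e\<psi>: "\<And>a. a \<in> A \<Longrightarrow> e a \<in> L \<and> \<psi> (e a) = a"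
    by (rule ex_compact_code[OF A(1)]; rule that; assumption)
  have eA[measurable]: "e \<in> borel_measurable (SM A)" by (rule measurable_compose[OF measurable_SM_borel e])
  have spN: "space N = space M \<times> A" using sets_eq_imp_space_eq[OF N(2)] by (simp add: space_pair_measure)
  define NM where "NM = distr N M fst"
  have sNM[simp, measurable_cong]: "sets NM = sets M" and spNM[simp]: "space NM = space M" by (simp_all add: NM_def)
  interpret NM: finite_measure NM unfolding NM_def by (rule N.finite_measure_distr) simp
  define F where "F y = distr (density N (\<lambda>z. indicator {..y} (e (snd z)))) M fst" for y
  have sF[simp, measurable_cong]: "sets (F y) = sets M" for y by (simp add: F_def)
  have FX: "emeasure (F y) X = (\<integral>\<^sup>+z. indicator {..y} (e (snd z)) * indicator X (fst z) \<partial>N)" if [measurable]: "X \<in> sets M" for X y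
  proof -
    have "emeasure (F y) X = (\<integral>\<^sup>+x. indicator X x \<partial>F y)" using that by simp
    also have "\<dots> = (\<integral>\<^sup>+z. indicator X (fst z) \<partial>density N (\<lambda>z. indicator {..y} (e (snd z))))"
      unfolding F_def by (rule nn_integral_distr) auto
    also have "\<dots> = (\<integral>\<^sup>+z. indicator {..y} (e (snd z)) * indicator X (fst z) \<partial>N)"
      by (rule nn_integral_density) auto
    finally show ?thesis .
  qed
  have NMX: "emeasure NM X = (\<integral>\<^sup>+z. indicator X (fst z) \<partial>N)" if [measurable]: "X \<in> sets M" for X
  proof -
    have "emeasure NM X = (\<integral>\<^sup>+x. indicator X x \<partial>NM)" using that by simp
    also have "\<dots> = (\<integral>\<^sup>+z. indicator X (fst z) \<partial>N)"
      unfolding NM_def by (rule nn_integral_distr) auto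
    finally show ?thesis .
  qed
  have FNM: "emeasure (F y) X \<le> emeasure NM X" if "X \<in> sets M" for X y
    using that by (subst FX) (auto simp: NMX intro!: nn_integral_mono split: split_indicator)
  have Fmono: "emeasure (F y) X \<le> emeasure (F y') X" if "X \<in> sets M" "y \<le> y'" for X y y'
    using that by (simp add: FX) (auto intro!: nn_integral_mono split: split_indicator)
  define w where "w y = RN_deriv NM (F y)" for y
  have [measurable]: "w y \<in> borel_measurable M" for y
    using borel_measurable_RN_deriv[of NM "F y"] unfolding w_def by simp
  have wint: "(\<integral>\<^sup>+x\<in>X. w y x \<partial>NM) = emeasure (F y) X" if X: "X \<in> sets M" for X y
  proof -
    have "absolutely_continuous NM (F y)" unfolding absolutely_continuous_def null_sets_def
      using FNM[of _ y] by (auto, metis le_zero_eq)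
    then have "density NM (w y) = F y" unfolding w_def by (rule NM.density_RN_deriv) simp
    then show ?thesis using X emeasure_density[of "w y" NM X] by simp
  qed
  have w1int: "(\<integral>\<^sup>+x\<in>X. 1 \<partial>NM) = emeasure NM X" if "X \<in> sets M" for X using that by simp
  have wfin: "(\<integral>\<^sup>+x. w y x \<partial>NM) < \<infinity>" for y
  proof -
    have "(\<integral>\<^sup>+x. w y x \<partial>NM) = (\<integral>\<^sup>+x\<in>space M. w y x \<partial>NM)" by (intro nn_integral_cong) simp
    also have "\<dots> \<le> emeasure NM (space M)" using FNM[of "space M" y] by (simp add: wint)
    also have "\<dots> < \<infinity>" by (simp add: less_top[symmetric])
    finally show ?thesis .
  qed
  have wmono: "AE x in NM. w y x \<le> w y' x" if "y \<le> y'" for y y'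
    by (rule AE_le_of_nn_integral_le) (use that wfin in \<open>auto simp: wint Fmono\<close>)
  have wle1: "AE x in NM. w y x \<le> 1" for y
    by (rule AE_le_of_nn_integral_le) (auto simp: wint FNM less_top[symmetric])
  have w0: "AE x in NM. w y x \<le> 0" if "y < 0" for y
  proof (rule AE_le_of_nn_integral_le)
    fix X assume "X \<in> sets NM"
    then have X[measurable]: "X \<in> sets M" by simp
    have "emeasure (F y) X = (\<integral>\<^sup>+z. 0 \<partial>N)" unfolding FX[OF X]
      using that e\<psi> L(2) by (intro nn_integral_cong) (fastforce simp: spN split: split_indicator)
    then show "(\<integral>\<^sup>+x\<in>X. w y x \<partial>NM) \<le> (\<integral>\<^sup>+x\<in>X. 0 \<partial>NM)" by (simp add: wint)
  qed auto
  have w2: "AE x in NM. 1 \<le> w y x" if "2 \<le> y" for y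
  proof (rule AE_le_of_nn_integral_le)
    fix X assume "X \<in> sets NM"
    then have X[measurable]: "X \<in> sets M" by simp
    have "emeasure (F y) X = (\<integral>\<^sup>+z. indicator X (fst z) \<partial>N)" unfolding FX[OF X]
      using that e\<psi> L(2) by (intro nn_integral_cong) (fastforce simp: spN split: split_indicator)
    then show "(\<integral>\<^sup>+x\<in>X. 1 \<partial>NM) \<le> (\<integral>\<^sup>+x\<in>X. w y x \<partial>NM)" using X by (simp add: wint NMX)
  qed (use wfin in auto)
  \<comment> \<open>Quantification over the countable type of rationals makes \<open>good\<close>
    measurable and valid almost everywhere; \<open>good_iff\<close> returns to rational real
    numbers.\<close>
  define good where "good x \<longleftrightarrow> (\<forall>q::rat. w (of_rat q) x \<le> 1 \<and> (\<forall>p::rat. (of_rat q :: real) \<le> of_rat p \<longrightarrow> w (of_rat q) x \<le> w (of_rat p) x)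
    \<and> ((of_rat q :: real) < 0 \<longrightarrow> w (of_rat q) x \<le> 0) \<and> (2 \<le> (of_rat q :: real) \<longrightarrow> 1 \<le> w (of_rat q) x))" for x
  have good_iff: "good x \<longleftrightarrow> (\<forall>q\<in>\<rat>. w q x \<le> 1 \<and> (\<forall>p\<in>\<rat>. q \<le> p \<longrightarrow> w q x \<le> w p x) \<and> (q < 0 \<longrightarrow> w q x \<le> 0) \<and> (2 \<le> q \<longrightarrow> 1 \<le> w q x))" for x
    unfolding good_def Rats_def ball_simps by simp
  have [measurable]: "Measurable.pred M good" unfolding good_def by measurable
  have AEgood: "AE x in NM. good x"
    unfolding good_def AE_all_countable AE_conj_iff
    using wle1 wmono w0 w2 by auto
  \<comment> \<open>The infimum over larger rationals enforces right-continuity. At exceptional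
    states the distribution function of the point mass at 0 is taken, so that every
    \<open>H x\<close> defines a probability.\<close>
  define H where "H x y = (if good x then (INF q\<in>{q\<in>\<rat>. y < q}. w q x) else indicator {0..} y)" for x y
  have cnt: "countable {q\<in>\<rat>. (y::real) < q}" for y by (rule countable_subset[OF _ countable_rat]) auto
  have ne: "\<exists>q\<in>\<rat>. y < q \<and> q < y + d" if "0 < d" for y d :: real using Rats_dense_in_real[of y "y + d"] that by auto
  have Hm[measurable]: "(\<lambda>x. H x y) \<in> borel_measurable M" for y
    unfolding H_def using cnt by measurable
  have Hle1: "H x y \<le> 1" for x y
    using ne[of 1 y] by (auto simp: H_def good_iff intro!: INF_lower2 split: split_indicator)
  have Hmono: "H x y \<le> H x y'" if "y \<le> y'" for x y y'
    using that by (auto simp: H_def intro!: INF_superset_mono split: split_indicator)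
  have H0: "H x y = 0" if y0: "y < 0" for x y
  proof (cases "good x")
    case True
    obtain q where "q \<in> \<rat>" "y < q" "q < 0" using Rats_dense_in_real[OF y0] by auto
    moreover from this have "w q x \<le> 0" using True by (simp add: good_iff)
    ultimately have "(INF q\<in>{q\<in>\<rat>. y < q}. w q x) \<le> 0" by (intro INF_lower2[of q]) auto
    then show ?thesis using True by (simp add: H_def)
  qed (use that in \<open>simp add: H_def\<close>)
  have H1: "H x y = 1" if "2 \<le> y" for x y
  proof (rule antisym[OF Hle1])
    show "1 \<le> H x y" using that by (auto simp: H_def good_iff intro!: INF_greatest split: split_indicator)
  qed
  define h where "h x y = enn2real (H x y)" for x y
  have hH: "ennreal (h x y) = H x y" for x y unfolding h_def using Hle1[of x y] by (intro ennreal_enn2real) (auto simp: less_top[symmetric] top_unique)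
  have hmono: "h x y \<le> h x y'" if "y \<le> y'" for x y y'
    unfolding h_def using Hmono[OF that, of x] Hle1[of x y'] by (intro enn2real_mono) (auto simp: less_top[symmetric] top_unique)
  have hrc: "continuous (at_right y) (h x)" for x y
  proof -
    have H_right: "\<exists>q>y. H x q < H x y + ennreal \<epsilon>" if \<epsilon>: "0 < \<epsilon>" for \<epsilon>
    proof (cases "good x")
      case True
      have "H x y < H x y + ennreal \<epsilon>" using \<epsilon> Hle1[of x y] by (cases "H x y") (auto simp: top_unique ennreal_less_iff simp flip: ennreal_plus)
      then obtain q where q: "q \<in> \<rat>" "y < q" "w q x < H x y + ennreal \<epsilon>" using True by (auto simp: H_def INF_less_iff)
      define p where "p = (y + q) / 2"
      have "H x p \<le> w q x" using q True by (auto simp: H_def p_def intro!: INF_lower)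
      then show ?thesis using q by (intro exI[of _ p]) (auto simp: p_def)
    next
      case False
      then show ?thesis using \<epsilon> by (intro exI[of _ "if y < 0 then y / 2 else y + 1"]) (auto simp: H_def split: split_indicator)
    qed
    show ?thesis unfolding continuous_within
    proof (rule tendstoI)
      fix \<epsilon> :: real assume \<epsilon>: "0 < \<epsilon>"
      obtain q where q: "y < q" "H x q < H x y + ennreal \<epsilon>" using H_right[OF \<epsilon>] by blast
      have "0 \<le> h x y" by (simp add: h_def)
      then have "ennreal (h x q) < ennreal (h x y + \<epsilon>)" using q \<epsilon> by (simp add: hH)
      then have hq: "h x q < h x y + \<epsilon>" by (simp add: ennreal_less_iff h_def)
      show "\<forall>\<^sub>F z in at_right y. dist (h x z) (h x y) < \<epsilon>"
        unfolding eventually_at_right_field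
      proof (intro exI[of _ q] conjI allI impI q)
        fix z assume "y < z" "z < q"
        then show "dist (h x z) (h x y) < \<epsilon>" using hmono[of y z x] hmono[of z q x] hq by (simp add: dist_real_def)
      qed
    qed
  qed
  define \<kappa> where "\<kappa> x = interval_measure (h x)" for x
  have lim: "(h x \<longlongrightarrow> 0) at_bot" "(h x \<longlongrightarrow> 1) at_top" for x
  proof -
    have "\<forall>\<^sub>F y in at_bot. h x y = 0" using eventually_le_at_bot[of "-1"] by eventually_elim (simp add: h_def H0)
    then show "(h x \<longlongrightarrow> 0) at_bot" by (rule tendsto_eventually)
    have "\<forall>\<^sub>F y in at_top. h x y = 1" using eventually_ge_at_top[of 2] by eventually_elim (simp add: h_def H1)
    then show "(h x \<longlongrightarrow> 1) at_top" by (rule tendsto_eventually)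
  qed
  have rd: "real_distribution (\<kappa> x)" for x unfolding \<kappa>_def
    by (rule real_distribution_interval_measure[OF hmono hrc lim])
  have \<kappa>y: "emeasure (\<kappa> x) {..y} = H x y" for x y
  proof -
    interpret real_distribution "\<kappa> x" by (rule rd)
    have "cdf (\<kappa> x) = h x" unfolding \<kappa>_def by (rule cdf_interval_measure[OF hmono hrc lim(1)])
    then have "measure (\<kappa> x) {..y} = h x y" by (metis cdf_def)
    then show ?thesis by (simp add: emeasure_eq_measure hH)
  qed
  have \<kappa>m[measurable]: "\<kappa> \<in> measurable M (prob_algebra borel)"
  proof (rule measurable_prob_algebra_generated[where \<Omega>=UNIV and G="range atMost"])
    show "sets borel = sigma_sets UNIV (range atMost :: real set set)" by (simp add: borel_eq_atMost)
    show "Int_stable (range atMost :: real set set)" by (auto simp: Int_stable_def)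
    fix x show "prob_space (\<kappa> x)" "sets (\<kappa> x) = sets borel" using rd[of x] by (auto simp: real_distribution_def real_distribution_axioms_def)
  next
    fix y assume "y \<in> range (atMost :: real \<Rightarrow> _)"
    then show "(\<lambda>x. emeasure (\<kappa> x) y) \<in> borel_measurable M" by (auto simp: \<kappa>y)
  qed auto
  \<comment> \<open>Right limits change no integral: the mass with code at most
    \<open>y + 1 / Suc n\<close> decreases to the mass with code at most \<open>y\<close>.\<close>
  have HF: "(\<integral>\<^sup>+x\<in>X. H x y \<partial>NM) = emeasure (F y) X" if X[measurable]: "X \<in> sets M" for X y
  proof (rule antisym)
    have "(\<integral>\<^sup>+x\<in>X. H x y \<partial>NM) \<le> emeasure (F (y + 1 / real (Suc n))) X" for n
    proof -
      obtain q where q: "q \<in> \<rat>" "y < q" "q < y + 1 / real (Suc n)" using ne[of "1 / real (Suc n)" y] by auto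
      have "AE x in NM. H x y * indicator X x \<le> w q x * indicator X x"
        using AEgood by eventually_elim (use q in \<open>auto simp: H_def intro!: INF_lower mult_right_mono\<close>)
      then have "(\<integral>\<^sup>+x\<in>X. H x y \<partial>NM) \<le> emeasure (F q) X" unfolding wint[OF X, symmetric] by (rule nn_integral_mono_AE)
      also have "\<dots> \<le> emeasure (F (y + 1 / real (Suc n))) X" using q X by (intro Fmono) auto
      finally show ?thesis .
    qed
    then have "(\<integral>\<^sup>+x\<in>X. H x y \<partial>NM) \<le> (INF n. emeasure (F (y + 1 / real (Suc n))) X)" by (rule INF_greatest)
    also have "\<dots> = emeasure (F y) X"
    proof -
      define E where "E t = {z\<in>space N. e (snd z) \<le> t \<and> fst z \<in> X}" for t
      have [measurable]: "E t \<in> sets N" for t unfolding E_def by measurable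
      have FE: "emeasure (F t) X = emeasure N (E t)" for t
      proof -
        have "emeasure (F t) X = (\<integral>\<^sup>+z. indicator (E t) z \<partial>N)"
          unfolding FX[OF X] by (intro nn_integral_cong) (auto simp: E_def split: split_indicator)
        then show ?thesis by simp
      qed
      have "(INF n. emeasure N (E (y + 1 / real (Suc n)))) = emeasure N (\<Inter>n. E (y + 1 / real (Suc n)))"
      proof (rule INF_emeasure_decseq)
        show "decseq (\<lambda>n. E (y + 1 / real (Suc n)))"
        proof (rule decseq_SucI)
          fix n
          have "1 / real (Suc (Suc n)) \<le> 1 / real (Suc n)" by (intro divide_left_mono) auto
          then show "E (y + 1 / real (Suc (Suc n))) \<subseteq> E (y + 1 / real (Suc n))" unfolding E_def by auto
        qed
      qed auto
      also have "(\<Inter>n. E (y + 1 / real (Suc n))) = E y"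
      proof -
        have "t \<le> y" if "\<And>n. t \<le> y + 1 / real (Suc n)" for t
        proof (rule field_le_epsilon)
          fix d :: real assume "0 < d"
          then obtain n where "1 / real (Suc n) < d" using nat_approx_posE by blast
          then show "t \<le> y + d" using that[of n] by simp
        qed
        then show ?thesis by (auto simp: E_def intro: order_trans)
      qed
      finally show ?thesis by (simp add: FE)
    qed
    finally show "(\<integral>\<^sup>+x\<in>X. H x y \<partial>NM) \<le> emeasure (F y) X" .
    have "AE x in NM. \<forall>q\<in>{q\<in>\<rat>. y < q}. w y x \<le> w q x"
      by (intro AE_ball_countable[THEN iffD2, OF cnt] ballI wmono) auto
    then have "AE x in NM. w y x * indicator X x \<le> H x y * indicator X x"
      using AEgood by eventually_elim (auto simp: H_def intro!: INF_greatest mult_right_mono)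
    then show "emeasure (F y) X \<le> (\<integral>\<^sup>+x\<in>X. H x y \<partial>NM)" unfolding wint[OF X, symmetric] by (rule nn_integral_mono_AE)
  qed
  define \<Phi> where "\<Phi> g = (\<integral>\<^sup>+x. (\<integral>\<^sup>+t. g (x, t) \<partial>\<kappa> x) \<partial>NM)" for g
  have [measurable]: "\<kappa> \<in> measurable M (subprob_algebra borel)" using \<kappa>m by (rule measurable_prob_algebraD)
  have s\<kappa>: "sets (\<kappa> x) = sets borel" for x using rd[of x] by (auto simp: real_distribution_def real_distribution_axioms_def)
  have pos\<Phi>: "pos_functional (M \<Otimes>\<^sub>M borel) \<Phi>" unfolding \<Phi>_def
  proof (rule pos_functional_integral)
    fix x assume "x \<in> space NM"
    then have "(\<lambda>t. (x, t)) \<in> measurable (\<kappa> x) (M \<Otimes>\<^sub>M borel)"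
      using measurable_Pair1'[of x M borel] by (simp add: measurable_cong_sets[OF s\<kappa> refl])
    from pos_functional_map[OF pos_functional_nn_integral[OF refl] this]
    show "pos_functional (M \<Otimes>\<^sub>M borel) (\<lambda>f. \<integral>\<^sup>+t. f (x, t) \<partial>\<kappa> x)" .
  next
    fix g :: "_ \<times> real \<Rightarrow> ennreal" assume "g \<in> borel_measurable (M \<Otimes>\<^sub>M borel)"
    then show "(\<lambda>x. \<integral>\<^sup>+t. g (x, t) \<partial>\<kappa> x) \<in> borel_measurable NM"
      using measurable_kernel_integral[of \<kappa> M borel g] by (simp cong: measurable_cong_sets)
  qed
  define N1 where "N1 = distr N (M \<Otimes>\<^sub>M borel) (\<lambda>z. (fst z, e (snd z)))"
  define N2 where "N2 = functional_measure (M \<Otimes>\<^sub>M borel) \<Phi>"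
  have N12: "N1 = N2"
  proof (rule measure_eqI_pair_finite)
    show "sets N1 = sets (M \<Otimes>\<^sub>M borel)" "sets N2 = sets (M \<Otimes>\<^sub>M borel)" by (simp_all add: N1_def N2_def)
    have "finite_measure N1" unfolding N1_def by (rule N.finite_measure_distr) simp
    then show "emeasure N1 (space N1) \<noteq> \<infinity>" by (simp add: finite_measure.emeasure_finite)
    fix X and b :: "real set" assume X[measurable]: "X \<in> sets M" and b: "b \<in> sets borel"
    \<comment> \<open>With \<open>X\<close> fixed, both sides are finite measures in
      \<open>b\<close>, and \<open>HF\<close> states their agreement on half-lines.\<close>
    define K1 where "K1 = functional_measure borel (\<lambda>f. \<integral>\<^sup>+z. indicator X (fst z) * f (e (snd z)) \<partial>N)"
    define K2 where "K2 = functional_measure borel (\<lambda>f. \<integral>\<^sup>+x. indicator X x * (\<integral>\<^sup>+t. f t \<partial>\<kappa> x) \<partial>NM)"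
    have p1: "pos_functional borel (\<lambda>f. \<integral>\<^sup>+z. indicator X (fst z) * f (e (snd z)) \<partial>N)"
      by (intro pos_functional_integral pos_functional_cmult pos_functional_eval) auto
    have p2: "pos_functional borel (\<lambda>f. \<integral>\<^sup>+x. indicator X x * (\<integral>\<^sup>+t. f t \<partial>\<kappa> x) \<partial>NM)"
      by (intro pos_functional_integral pos_functional_cmult pos_functional_nn_integral s\<kappa>) auto
    have K1b: "emeasure K1 B = (\<integral>\<^sup>+z. indicator X (fst z) * indicator B (e (snd z)) \<partial>N)" if "B \<in> sets borel" for B
      unfolding K1_def by (rule emeasure_functional_measure[OF p1 that])
    have K2b: "emeasure K2 B = (\<integral>\<^sup>+x. indicator X x * emeasure (\<kappa> x) B \<partial>NM)" if "B \<in> sets borel" for B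
      unfolding K2_def using that by (subst emeasure_functional_measure[OF p2 that]) (simp add: s\<kappa>)
    have "K1 = K2"
    proof (rule measure_eqI_generator_eq[where E="range atMost" and \<Omega>=UNIV and A="\<lambda>n. {..real n}"])
      show "Int_stable (range atMost :: real set set)" by (auto simp: Int_stable_def)
      show "sets K1 = sigma_sets UNIV (range atMost)" "sets K2 = sigma_sets UNIV (range atMost)"
        by (simp_all add: K1_def K2_def borel_eq_atMost)
      show "(\<Union>n. {..real n}) = UNIV" by (auto intro: real_arch_simple)
      fix n
      have "emeasure K1 {..real n} \<le> (\<integral>\<^sup>+z. 1 \<partial>N)" by (subst K1b, simp, intro nn_integral_mono) (auto split: split_indicator)
      then show "emeasure K1 {..real n} \<noteq> \<infinity>" using N.emeasure_finite[of "space N"] by (auto simp: top_unique)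
    next
      fix B assume "B \<in> range (atMost :: real \<Rightarrow> _)"
      then obtain y where y: "B = {..y}" by auto
      show "emeasure K1 B = emeasure K2 B"
        unfolding y using HF[OF X, of y] FX[OF X, of y] by (subst K1b, simp, subst K2b, simp) (simp add: \<kappa>y mult.commute)
    qed auto
    then have "emeasure K1 b = emeasure K2 b" by simp
    moreover have "emeasure N1 (X \<times> b) = emeasure K1 b"
    proof -
      have "emeasure N1 (X \<times> b) = (\<integral>\<^sup>+z. indicator (X \<times> b) z \<partial>N1)" using b by (simp add: N1_def)
      also have "\<dots> = (\<integral>\<^sup>+z. indicator (X \<times> b) (fst z, e (snd z)) \<partial>N)" unfolding N1_def using b by (intro nn_integral_distr) auto
      finally show ?thesis using b by (simp add: K1b indicator_times)
    qed
    moreover have "emeasure N2 (X \<times> b) = emeasure K2 b"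
    proof -
      have "emeasure N2 (X \<times> b) = \<Phi> (indicator (X \<times> b))" unfolding N2_def using b by (intro emeasure_functional_measure[OF pos\<Phi>]) auto
      also have "\<dots> = (\<integral>\<^sup>+x. indicator X x * emeasure (\<kappa> x) b \<partial>NM)"
        unfolding \<Phi>_def using b by (intro nn_integral_cong) (simp add: indicator_times nn_integral_cmult_indicator s\<kappa>)
      finally show ?thesis using b by (simp add: K2b)
    qed
    ultimately show "emeasure N1 (X \<times> b) = emeasure N2 (X \<times> b)" by simp
  qed
  \<comment> \<open>Some \<open>\<kappa> x\<close> may charge reals outside \<open>L\<close>; these
    are decoded to an arbitrary action.\<close>
  obtain a0 where a0: "a0 \<in> A" using A(2) by auto
  define \<psi>' where "\<psi>' t = (if t \<in> L then \<psi> t else a0)" for t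
  have Lb[measurable]: "L \<in> sets borel" using L(1) by (simp add: borel_closed compact_imp_closed)
  have "\<psi>' \<in> borel_measurable borel" unfolding \<psi>'_def
    by (rule measurable_If_restrict_space_iff[THEN iffD2]) (use Lb borel_measurable_continuous_on_restrict[OF L(3)] in auto)
  then have \<psi>'m[measurable]: "\<psi>' \<in> measurable borel (SM A)" using L(4) a0 by (intro measurable_into_SM) (auto simp: \<psi>'_def)
  define \<phi> where "\<phi> x = distr (\<kappa> x) (SM A) \<psi>'" for x
  have \<phi>m: "\<phi> \<in> measurable M (prob_algebra (SM A))" unfolding \<phi>_def by measurable
  have "(\<integral>\<^sup>+z. g z \<partial>N) = (\<integral>\<^sup>+x. (\<integral>\<^sup>+a. g (x, a) \<partial>\<phi> x) \<partial>distr N M fst)"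
    if g[measurable]: "g \<in> borel_measurable (M \<Otimes>\<^sub>M SM A)" for g
  proof -
    have "(\<integral>\<^sup>+z. g z \<partial>N) = (\<integral>\<^sup>+z. g (fst z, \<psi>' (e (snd z))) \<partial>N)"
      using e\<psi> by (intro nn_integral_cong) (auto simp: spN \<psi>'_def)
    also have "\<dots> = (\<integral>\<^sup>+p. g (fst p, \<psi>' (snd p)) \<partial>N1)" unfolding N1_def by (subst nn_integral_distr) auto
    also have "\<dots> = (\<integral>\<^sup>+x. (\<integral>\<^sup>+t. g (x, \<psi>' t) \<partial>\<kappa> x) \<partial>NM)"
      unfolding N12 N2_def by (subst nn_integral_functional_measure[OF pos\<Phi>]) (auto simp: \<Phi>_def)
    also have "\<dots> = (\<integral>\<^sup>+x. (\<integral>\<^sup>+a. g (x, a) \<partial>\<phi> x) \<partial>NM)"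
      unfolding \<phi>_def by (intro nn_integral_cong nn_integral_distr[symmetric]) (auto simp: measurable_cong_sets[OF s\<kappa> refl])
    finally show ?thesis by (simp add: NM_def)
  qed
  then show ?thesis using \<phi>m by (intro bexI[of _ \<phi>] ballI)
qed

section \<open>The jump kernel of the decision process\<close>

lemma lsc_mult_continuous:
  fixes f :: "'a::{metric_space,second_countable_topology} \<Rightarrow> ennreal" and w :: "'a \<Rightarrow> real"
  assumes f: "lsc T f" and w: "continuous_on T w" "\<And>z. z \<in> T \<Longrightarrow> 0 \<le> w z"
  shows "lsc T (\<lambda>z. f z * ennreal (w z))"
proof -
  obtain r j where rj: "\<And>k. (0::real) \<le> r k" "\<And>z. z \<in> T \<Longrightarrow> f z = (SUP n. ennreal (run_max (\<lambda>k z. r k * tent (j k) z) n z))"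
    using lsc_eq_SUP_run_max[OF f] by blast
  have "f z * ennreal (w z) = (SUP n. ennreal (run_max (\<lambda>k z. r k * tent (j k) z) n z * w z))" if "z \<in> T" for z
    using that w(2)[OF that] run_max_tent_bounds(1)[of r j _ z, OF rj(1)]
    by (simp add: rj(2) SUP_mult_right_ennreal ennreal_mult)
  moreover have "lsc T (\<lambda>z. SUP n. ennreal (run_max (\<lambda>k z. r k * tent (j k) z) n z * w z))"
    by (intro lsc_SUP continuous_imp_lsc continuous_on_mult continuous_on_run_max w(1) continuous_intros)
  ultimately show ?thesis by (simp cong: lsc_cong)
qed

locale ctmdp =
  fixes S :: "'s::polish_space set" and A :: "'b::polish_space set"
    and \<gamma> :: "'s measure" and q :: "'s \<Rightarrow> 'b \<Rightarrow> 's set \<Rightarrow> real"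
  assumes S_ne: "S \<noteq> {}" and S_borel: "S \<in> sets borel" and A_ne: "A \<noteq> {}"
    and gamma: "prob_space \<gamma>" "sets \<gamma> = sets (SM S)"
    and q_kernel: "signed_kernel S A q"
    and q_nonneg: "\<forall>x\<in>S. \<forall>a\<in>A. \<forall>\<Gamma>\<in>sets (SM S). 0 \<le> qt q x a \<Gamma>"
    and q_conservative: "\<forall>x\<in>S. \<forall>a\<in>A. q x a S = 0"
    and qx_nonneg: "\<forall>x\<in>S. \<forall>a\<in>A. 0 \<le> qx q x a"
    and q_bounded: "\<forall>x\<in>S. bdd_above (qx q x ` A)"
    and A_compact: "compact A"
    and C1b: "\<forall>f :: 's \<Rightarrow> real. continuous_on S f \<and> bounded (f ` S) \<longrightarrow>
               continuous_on (S \<times> A) (\<lambda>(x,a). (\<integral>y. f y \<partial>(qtM q S x a)) / qx q x a)"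
    and C1c: "continuous_on (S \<times> A) (\<lambda>(x,a). qx q x a)"
begin

abbreviation "SA \<equiv> SM S \<Otimes>\<^sub>M SM A"

lemma singleton_sets[measurable]: "x \<in> S \<Longrightarrow> {x} \<in> sets (SM S)"
  unfolding SM_def by (auto simp: sets_restrict_space image_iff intro!: bexI[of _ "{x}"])

lemma diff_singleton_sets: "\<Gamma> \<in> sets (SM S) \<Longrightarrow> x \<in> S \<Longrightarrow> \<Gamma> - {x} \<in> sets (SM S)"
  by auto

lemma q_sums:
  "x \<in> S \<Longrightarrow> a \<in> A \<Longrightarrow> range F \<subseteq> sets (SM S) \<Longrightarrow> disjoint_family F \<Longrightarrow> (\<lambda>i. q x a (F i)) sums q x a (\<Union>i. F i)"
  using q_kernel unfolding signed_kernel_def by blast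

lemma q_empty: assumes "x \<in> S" "a \<in> A" shows "q x a {} = 0"
proof -
  have "(\<lambda>i::nat. q x a {}) sums q x a (\<Union>i::nat. {})" by (rule q_sums) (use assms in \<open>auto simp: disjoint_family_on_def\<close>)
  then show ?thesis by (auto dest: sums_summable simp: summable_const_iff)
qed

lemma q_Un: assumes "x \<in> S" "a \<in> A" "X \<in> sets (SM S)" "Y \<in> sets (SM S)" "X \<inter> Y = {}"
  shows "q x a (X \<union> Y) = q x a X + q x a Y"
proof -
  have "(\<lambda>i. q x a (binaryset X Y i)) sums q x a (\<Union>i. binaryset X Y i)"
    by (rule q_sums) (use assms in \<open>auto simp: disjoint_family_on_def binaryset_def\<close>)
  moreover have "(\<lambda>i. q x a (binaryset X Y i)) sums (q x a X + q x a Y)"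
    by (rule binaryset_sums) (rule q_empty[OF assms(1,2)])
  ultimately show ?thesis by (simp add: UN_binaryset_eq sums_unique2)
qed

text \<open>Removes the moving set \<open>\<Gamma> - {x}\<close>, in which the state occurs as an
  argument of the kernel and of the set; measurability of \<open>qt\<close> in the pair then
  follows.\<close>

lemma qt_eq: assumes "x \<in> S" "a \<in> A" "\<Gamma> \<in> sets (SM S)"
  shows "qt q x a \<Gamma> = q x a \<Gamma> + indicator \<Gamma> x * qx q x a"
proof (cases "x \<in> \<Gamma>")
  case True
  then have "\<Gamma> = (\<Gamma> - {x}) \<union> {x}" by auto
  with q_Un[OF assms(1,2) diff_singleton_sets[OF assms(3,1)] singleton_sets[OF assms(1)]]
  have "q x a \<Gamma> = q x a (\<Gamma> - {x}) + q x a {x}" by auto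
  then show ?thesis using True by (simp add: qt_def qx_def)
qed (simp add: qt_def)

lemma qt_S: "x \<in> S \<Longrightarrow> a \<in> A \<Longrightarrow> qt q x a S = qx q x a"
  using qt_eq[of x a S] q_conservative sets.top[of "SM S"] by simp

lemma emeasure_qtM:
  assumes x: "x \<in> S" and a: "a \<in> A" and \<Gamma>: "\<Gamma> \<in> sets (SM S)"
  shows "emeasure (qtM q S x a) \<Gamma> = ennreal (qt q x a \<Gamma>)"
  unfolding qtM_def
proof (rule emeasure_measure_of_sigma[OF _ _ _ \<Gamma>])
  show "sigma_algebra S (sets (SM S))" using sets.sigma_algebra_axioms[of "SM S"] by simp
  show "positive (sets (SM S)) (\<lambda>\<Gamma>. ennreal (qt q x a \<Gamma>))" by (simp add: positive_def qt_def q_empty[OF x a])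
  show "countably_additive (sets (SM S)) (\<lambda>\<Gamma>. ennreal (qt q x a \<Gamma>))"
    unfolding countably_additive_def
  proof (intro allI impI)
    fix F :: "nat \<Rightarrow> 's set" assume F: "range F \<subseteq> sets (SM S)" "disjoint_family F"
    have "(\<lambda>i. q x a (F i - {x})) sums q x a (\<Union>i. F i - {x})"
      by (rule q_sums[OF x a]) (use F x in \<open>auto simp: disjoint_family_on_def\<close>)
    then have "(\<lambda>i. qt q x a (F i)) sums qt q x a (\<Union>i. F i)" by (simp add: qt_def)
    then show "(\<Sum>i. ennreal (qt q x a (F i))) = ennreal (qt q x a (\<Union>i. F i))"
      using F q_nonneg x a by (subst suminf_ennreal2) (auto simp: sums_iff)
  qed
qed

lemma sets_qtM[simp]: "sets (qtM q S x a) = sets (SM S)" and space_qtM[simp]: "space (qtM q S x a) = S"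
  unfolding qtM_def using sets.space_closed[of "SM S"] sets.sigma_sets_eq[of "SM S"] by simp_all

lemma measurable_qx[measurable]: "(\<lambda>z. qx q (fst z) (snd z)) \<in> borel_measurable SA"
proof -
  have "lsc (S \<times> A) (\<lambda>z. ennreal (qx q (fst z) (snd z)))"
    using C1c by (intro continuous_imp_lsc) (simp add: case_prod_beta)
  then have "(\<lambda>z. ennreal (qx q (fst z) (snd z))) \<in> borel_measurable SA"
    by (rule lsc_borel_measurable) (auto intro: measurable_pair_SM_borel)
  then have "(\<lambda>z. enn2real (ennreal (qx q (fst z) (snd z)))) \<in> borel_measurable SA" by measurable
  then show ?thesis using qx_nonneg by (subst measurable_cong[of _ _ "\<lambda>z. enn2real (ennreal (qx q (fst z) (snd z)))"]) auto
qed

lemma measurable_qt[measurable]: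
  assumes "\<Gamma> \<in> sets (SM S)" shows "(\<lambda>z. qt q (fst z) (snd z) \<Gamma>) \<in> borel_measurable SA"
proof -
  have [measurable]: "(\<lambda>z. q (fst z) (snd z) \<Gamma>) \<in> borel_measurable SA"
    using bspec[OF conjunct2[OF q_kernel[unfolded signed_kernel_def]] assms] by (simp add: case_prod_beta')
  note [measurable] = assms
  have "(\<lambda>z. q (fst z) (snd z) \<Gamma> + indicator \<Gamma> (fst z) * qx q (fst z) (snd z)) \<in> borel_measurable SA" by measurable
  then show ?thesis using assms
    by (subst measurable_cong[of _ _ "\<lambda>z. q (fst z) (snd z) \<Gamma> + indicator \<Gamma> (fst z) * qx q (fst z) (snd z)"])
      (auto simp: qt_eq)
qed

text \<open>The law of the next state. As \<open>1 / 0 = 0\<close> in the reals, a pair of rate zero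
  receives the null measure, so that the mass is always 0 or 1.\<close>

definition Q :: "'s \<times> 'b \<Rightarrow> 's measure" where
  "Q z = scale_measure (ennreal (1 / qx q (fst z) (snd z))) (qtM q S (fst z) (snd z))"

definition rate :: "'s \<times> 'b \<Rightarrow> ennreal" where
  "rate z = ennreal (qx q (fst z) (snd z))"

lemma measurable_rate[measurable]: "rate \<in> borel_measurable SA"
  unfolding rate_def[abs_def] by measurable

lemma rate_finite: "rate z < \<top>" by (simp add: rate_def)

lemma sets_Q[simp]: "sets (Q z) = sets (SM S)"
  by (simp add: Q_def)

lemma space_Q[simp]: "space (Q z) = S"
  using sets_eq_imp_space_eq[OF sets_Q] by simp

lemma emeasure_Q: "z \<in> S \<times> A \<Longrightarrow> \<Gamma> \<in> sets (SM S) \<Longrightarrow> emeasure (Q z) \<Gamma> = ennreal (qt q (fst z) (snd z) \<Gamma> / qx q (fst z) (snd z))"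
  using q_nonneg qx_nonneg by (auto simp: Q_def emeasure_qtM mem_Times_iff simp flip: ennreal_mult)

lemma emeasure_Q_S: "z \<in> S \<times> A \<Longrightarrow> emeasure (Q z) S = (if rate z = 0 then 0 else 1)"
  using sets.top[of "SM S"] qx_nonneg by (auto simp: emeasure_Q qt_S rate_def)

lemma subprob_space_Q: "z \<in> S \<times> A \<Longrightarrow> subprob_space (Q z)"
  using S_ne by (intro subprob_spaceI) (auto simp: emeasure_Q_S)

lemma measurable_Q[measurable]: "Q \<in> measurable SA (subprob_algebra (SM S))"
proof (rule measurable_subprob_algebra)
  fix \<Gamma> assume [measurable]: "\<Gamma> \<in> sets (SM S)"
  have "(\<lambda>z. ennreal (qt q (fst z) (snd z) \<Gamma> / qx q (fst z) (snd z))) \<in> borel_measurable SA" by measurable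
  then show "(\<lambda>z. emeasure (Q z) \<Gamma>) \<in> borel_measurable SA"
    by (subst measurable_cong[of _ _ "\<lambda>z. ennreal (qt q (fst z) (snd z) \<Gamma> / qx q (fst z) (snd z))"]) (auto simp: emeasure_Q)
qed (auto intro: subprob_space_Q)

text \<open>At rate zero both sides vanish, because \<open>qtM\<close> has total mass
  \<open>qx\<close>.\<close>

lemma rate_Q: assumes "z \<in> S \<times> A" "\<Gamma> \<in> sets (SM S)"
  shows "rate z * emeasure (Q z) \<Gamma> = ennreal (qt q (fst z) (snd z) \<Gamma>)"
proof (cases "qx q (fst z) (snd z) = 0")
  case True
  then have "emeasure (qtM q S (fst z) (snd z)) S = 0" using assms sets.top[of "SM S"] by (auto simp: emeasure_qtM qt_S)
  then have "emeasure (qtM q S (fst z) (snd z)) \<Gamma> = 0"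
    using emeasure_mono[of \<Gamma> S "qtM q S (fst z) (snd z)"] sets.sets_into_space[OF assms(2)] sets.top[of "SM S"] by simp
  then show ?thesis using True assms by (auto simp: rate_def emeasure_qtM)
next
  case False
  then show ?thesis using assms qx_nonneg q_nonneg
    by (auto simp: rate_def emeasure_Q simp flip: ennreal_mult)
qed

lemma measurable_nn_integral_Q:
  "f \<in> borel_measurable (SM S) \<Longrightarrow> (\<lambda>z. \<integral>\<^sup>+y. f y \<partial>Q z) \<in> borel_measurable SA"
  by (rule measurable_compose[OF measurable_Q nn_integral_measurable_subprob_algebra])

subsection \<open>Semicontinuity\<close>

definition Qf :: "('s \<Rightarrow> real) \<Rightarrow> 's \<times> 'b \<Rightarrow> real" where
  "Qf f z = (\<integral>y. f y \<partial>(qtM q S (fst z) (snd z))) / qx q (fst z) (snd z)"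

lemma finite_measure_qtM: "z \<in> S \<times> A \<Longrightarrow> finite_measure (qtM q S (fst z) (snd z))"
  using sets.top[of "SM S"] by (intro finite_measureI) (auto simp: emeasure_qtM)

lemma nn_integral_Q_eq:
  assumes z: "z \<in> S \<times> A" and f: "f \<in> borel_measurable (SM S)" "\<And>x. x \<in> S \<Longrightarrow> 0 \<le> f x" "\<And>x. x \<in> S \<Longrightarrow> f x \<le> B"
  shows "(\<integral>\<^sup>+y. ennreal (f y) \<partial>Q z) = ennreal (Qf f z)" "0 \<le> Qf f z" "0 \<le> B \<Longrightarrow> Qf f z \<le> B"
proof -
  interpret finite_measure "qtM q S (fst z) (snd z)" by (rule finite_measure_qtM[OF z])
  have fm: "f \<in> borel_measurable (qtM q S (fst z) (snd z))" using f(1) by (simp cong: measurable_cong_sets)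
  have q0: "0 \<le> qx q (fst z) (snd z)" using z qx_nonneg by auto
  have i: "(\<integral>\<^sup>+y. ennreal (f y) \<partial>qtM q S (fst z) (snd z)) = ennreal (\<integral>y. f y \<partial>qtM q S (fst z) (snd z))"
    using f fm by (intro nn_integral_eq_integral integrable_const_bound[where B=B]) (auto intro!: AE_I2)
  have n: "0 \<le> (\<integral>y. f y \<partial>qtM q S (fst z) (snd z))" using f by (intro integral_nonneg_AE AE_I2) auto
  show eq: "(\<integral>\<^sup>+y. ennreal (f y) \<partial>Q z) = ennreal (Qf f z)"
    unfolding Q_def Qf_def using fm q0 n by (subst nn_integral_scale_measure) (auto simp: i simp flip: ennreal_mult)
  show nn: "0 \<le> Qf f z" unfolding Qf_def using n q0 by simp
  assume B: "0 \<le> B"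
  have "(\<integral>\<^sup>+y. ennreal (f y) \<partial>Q z) \<le> (\<integral>\<^sup>+y. ennreal B \<partial>Q z)" using f by (intro nn_integral_mono) (auto intro!: ennreal_leI)
  also have "\<dots> \<le> ennreal B" using emeasure_Q_S[OF z] by simp
  finally show "Qf f z \<le> B" using B eq by (simp add: ennreal_le_iff)
qed

lemma continuous_on_Qf:
  assumes "continuous_on S f" "\<And>x. x \<in> S \<Longrightarrow> 0 \<le> f x" "\<And>x. x \<in> S \<Longrightarrow> f x \<le> B"
  shows "continuous_on (S \<times> A) (Qf f)"
proof -
  have "bounded (f ` S)" using assms by (intro boundedI[of _ B]) auto
  then show ?thesis using C1b assms(1) unfolding Qf_def[abs_def] by (simp add: case_prod_beta)
qed

definition alive_ind :: "'s \<times> 'b \<Rightarrow> real" where "alive_ind z = (if rate z = 0 then 0 else 1)"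

text \<open>This is Condition 1(b) for the constant function 1, since \<open>Q z\<close> has mass 1
  or 0. Consequently the pairs of rate zero form an open and closed part of
  \<open>S \<times> A\<close>; both the semicontinuity of \<open>jcost\<close> and the positivity of
  \<open>kap\<close> rest on this.\<close>

lemma continuous_on_alive_ind: "continuous_on (S \<times> A) alive_ind"
proof -
  have "alive_ind z = Qf (\<lambda>_. 1) z" if "z \<in> S \<times> A" for z
  proof -
    have "ennreal (Qf (\<lambda>_. 1) z) = emeasure (Q z) S"
      using nn_integral_Q_eq(1)[OF that, of "\<lambda>_. 1" 1] by simp
    also have "\<dots> = ennreal (alive_ind z)" by (simp add: alive_ind_def emeasure_Q_S[OF that])
    finally show ?thesis using nn_integral_Q_eq(2)[OF that, of "\<lambda>_. 1" 1]
      by (subst (asm) ennreal_inj) (auto simp: alive_ind_def)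
  qed
  then show ?thesis using continuous_on_Qf[of "\<lambda>_. 1" 1] by (simp cong: continuous_on_cong)
qed

lemma continuous_on_qx: "continuous_on (S \<times> A) (\<lambda>z. qx q (fst z) (snd z))"
  using C1c by (simp add: case_prod_beta)

text \<open>Condition 1(b) settles bounded continuous integrands; increasing approximation by
  \<open>run_max\<close> does the rest.\<close>

lemma lsc_nn_integral_Q:
  assumes v: "lsc S v" shows "lsc (S \<times> A) (\<lambda>z. \<integral>\<^sup>+y. v y \<partial>Q z)"
proof -
  obtain r j where rj: "\<And>k. (0::real) \<le> r k" "\<And>z. z \<in> S \<Longrightarrow> v z = (SUP n. ennreal (run_max (\<lambda>k z. r k * tent (j k) z) n z))"
    using lsc_eq_SUP_run_max[OF v] by blast
  define \<phi> :: "nat \<Rightarrow> 's \<Rightarrow> real" where "\<phi> = run_max (\<lambda>k z. r k * tent (j k) z)"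
  have c: "continuous_on S (\<phi> n)" for n unfolding \<phi>_def by (intro continuous_on_run_max continuous_intros)
  have m: "\<phi> n \<in> borel_measurable (SM S)" for n by (rule continuous_on_measurable_SM[OF c])
  have nn: "0 \<le> \<phi> n x" for n x unfolding \<phi>_def by (rule run_max_tent_bounds(1)[OF rj(1)])
  have "\<exists>B. \<forall>x. \<phi> n x \<le> B" for n unfolding \<phi>_def by (rule run_max_tent_bounds(2)[OF rj(1)])
  then obtain B where B: "\<And>n x. \<phi> n x \<le> B n" by metis
  have inc: "\<phi> n x \<le> \<phi> n' x" if "n \<le> n'" for n n' x unfolding \<phi>_def using that by (rule run_max_mono)
  have "(\<integral>\<^sup>+y. v y \<partial>Q z) = (SUP n. ennreal (Qf (\<phi> n) z))" if z: "z \<in> S \<times> A" for z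
  proof -
    have "(\<integral>\<^sup>+y. v y \<partial>Q z) = (\<integral>\<^sup>+y. (SUP n. ennreal (\<phi> n y)) \<partial>Q z)"
      by (intro nn_integral_cong) (auto simp: rj(2) \<phi>_def)
    also have "\<dots> = (SUP n. \<integral>\<^sup>+y. ennreal (\<phi> n y) \<partial>Q z)"
      using m inc by (intro nn_integral_monotone_convergence_SUP) (auto simp: incseq_def le_fun_def measurable_cong_sets[OF sets_Q refl] intro!: ennreal_leI)
    also have "\<dots> = (SUP n. ennreal (Qf (\<phi> n) z))"
      using nn_integral_Q_eq(1)[OF z m nn B] by simp
    finally show ?thesis .
  qed
  moreover have "lsc (S \<times> A) (\<lambda>z. SUP n. ennreal (Qf (\<phi> n) z))"
    by (intro lsc_SUP continuous_imp_lsc continuous_on_Qf[OF c nn B])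
  ultimately show ?thesis by (simp cong: lsc_cong)
qed

text \<open>The cost of one jump: with the conventions of \<^typ>\<open>ennreal\<close> this is \<open>0\<close> for \<open>0 / 0\<close> and \<open>\<infinity>\<close> for \<open>c / 0\<close>.\<close>
definition jcost :: "('s \<times> 'b \<Rightarrow> real) \<Rightarrow> 's \<times> 'b \<Rightarrow> ennreal" where
  "jcost c z = ennreal (c z) / rate z"

lemma lsc_of_lsc_on: "lsc_on T c \<Longrightarrow> (\<And>z. z \<in> T \<Longrightarrow> 0 \<le> c z) \<Longrightarrow> lsc T (\<lambda>z. ennreal (c z))"
  unfolding lsc_def
proof
  fix r assume c: "lsc_on T c" "\<And>z. z \<in> T \<Longrightarrow> 0 \<le> c z"
  show "openin (top_of_set T) {z \<in> T. r < ennreal (c z)}"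
  proof (cases r)
    case (real x)
    then have "{z \<in> T. r < ennreal (c z)} = {z \<in> T. x < c z}" using c(2) by (auto simp: ennreal_less_iff)
    then show ?thesis using c(1) by (simp add: lsc_on_def)
  qed auto
qed

lemma lsc_jcost:
  assumes c: "lsc_on (S \<times> A) c" "\<And>z. z \<in> S \<times> A \<Longrightarrow> 0 \<le> c z"
  shows "lsc (S \<times> A) (jcost c)"
proof -
  \<comment> \<open>Continuous weights with supremum \<open>1 / rate\<close>: the true reciprocal
    where the rate is positive, the constant \<open>n\<close> where it is zero. The term
    \<open>1 - alive_ind z\<close> keeps the denominator away from 0 without altering it at positive
    rates.\<close>
  define w where "w n z = alive_ind z / (qx q (fst z) (snd z) + (1 - alive_ind z)) + (1 - alive_ind z) * real n" for n z
  have q0: "z \<in> S \<times> A \<Longrightarrow> 0 \<le> qx q (fst z) (snd z)" for z using qx_nonneg by auto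
  have den: "qx q (fst z) (snd z) + (1 - alive_ind z) \<noteq> 0" if "z \<in> S \<times> A" for z
    using q0[OF that] by (auto simp: alive_ind_def rate_def)
  have wc: "continuous_on (S \<times> A) (w n)" for n unfolding w_def
    using den by (intro continuous_intros continuous_on_alive_ind continuous_on_qx) auto
  have w0: "0 \<le> w n z" if "z \<in> S \<times> A" for n z using q0[OF that] by (auto simp: w_def alive_ind_def)
  have "jcost c z = (SUP n. ennreal (c z) * ennreal (w n z))" if z: "z \<in> S \<times> A" for z
  proof (cases "rate z = 0")
    case True
    then have w: "w n z = real n" for n by (simp add: w_def alive_ind_def)
    have "(SUP n. ennreal (real n)) = \<top>" by (simp add: ennreal_SUP_of_nat_eq_top ennreal_of_nat_eq_real_of_nat[symmetric])
    moreover have "(SUP n. ennreal (c z) * ennreal (w n z)) = ennreal (c z) * (SUP n. ennreal (real n))"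
      unfolding w by (rule SUP_mult_left_ennreal[symmetric])
    ultimately have "(SUP n. ennreal (c z) * ennreal (w n z)) = ennreal (c z) * \<top>" by (simp only:)
    then show ?thesis using True by (simp add: jcost_def divide_ennreal_def)
  next
    case False
    then have "w n z = 1 / qx q (fst z) (snd z)" for n by (simp add: w_def alive_ind_def)
    moreover have "0 < qx q (fst z) (snd z)" using False q0[OF z] by (auto simp: rate_def less_le)
    ultimately show ?thesis using c(2)[OF z] by (simp add: jcost_def rate_def divide_ennreal flip: ennreal_mult)
  qed
  moreover have "lsc (S \<times> A) (\<lambda>z. SUP n. ennreal (c z) * ennreal (w n z))"
    by (intro lsc_SUP lsc_mult_continuous lsc_of_lsc_on c wc w0)
  ultimately show ?thesis by (simp cong: lsc_cong)
qed

end

section \<open>The path measure of a policy\<close>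

definition posL :: "real measure" where "posL = restrict_space lborel {0<..}"

lemma space_posR[simp]: "space posR = {0<..}" and space_posL[simp]: "space posL = {0<..}"
  by (simp_all add: posR_def posL_def space_restrict_space)

lemma sets_posL[simp, measurable_cong]: "sets posL = sets posR"
  by (simp add: posL_def posR_def sets_restrict_space)

lemma measurable_posR_borel[measurable]: "(\<lambda>x. x) \<in> measurable posR borel"
  unfolding posR_def by (rule measurable_restrict_space1) simp

lemma measurable_into_posR: "f \<in> borel_measurable M \<Longrightarrow> (\<And>x. x \<in> space M \<Longrightarrow> 0 < f x) \<Longrightarrow> f \<in> measurable M posR"
  unfolding posR_def by (rule measurable_restrict_space2) auto

lemma measurable_indicator_posR: "B \<in> sets borel \<Longrightarrow> (indicator B :: real \<Rightarrow> ennreal) \<in> borel_measurable posR"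
  using measurable_compose[OF measurable_posR_borel borel_measurable_indicator] by simp

lemma sets_posR_iff: "B \<in> sets posR \<longleftrightarrow> B \<in> sets borel \<and> B \<subseteq> {0<..}"
  unfolding posR_def by (auto simp: sets_restrict_space_iff)

lemma sigma_finite_posL: "sigma_finite_measure posL"
  unfolding posL_def by (rule sigma_finite_measure_restrict_space[OF sigma_finite_lborel]) simp

lemma nn_integral_posL: "(\<integral>\<^sup>+s. f s \<partial>posL) = (\<integral>\<^sup>+s. f s * indicator {0<..} s \<partial>lborel)"
  unfolding posL_def by (rule nn_integral_restrict_space) simp

lemma measurable_posL_integral:
  assumes "f \<in> borel_measurable (M \<Otimes>\<^sub>M posR)"
  shows "(\<lambda>h. \<integral>\<^sup>+s. f (h, s) \<partial>posL) \<in> borel_measurable M"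
proof -
  interpret sigma_finite_measure posL by (rule sigma_finite_posL)
  have "sets (M \<Otimes>\<^sub>M posL) = sets (M \<Otimes>\<^sub>M posR)" by (rule sets_pair_measure_cong) simp_all
  then have "(\<lambda>(h, s). f (h, s)) \<in> borel_measurable (M \<Otimes>\<^sub>M posL)" using assms by (simp cong: measurable_cong_sets)
  then show ?thesis by (rule borel_measurable_nn_integral)
qed

locale ctmdp_policy = ctmdp S A \<gamma> q for S :: "'s::polish_space set" and A :: "'b::polish_space set" and \<gamma> q +
  fixes pol :: "('s, 'b) policy"
  assumes is_pol: "is_policy S A pol"
begin

abbreviation "HM \<equiv> histM S"
abbreviation "HP n \<equiv> histM S n \<Otimes>\<^sub>M posR"

lemma pol_measurable[measurable]: "pol n \<in> measurable (HP n) (prob_algebra (SM A))"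
  using is_pol by (simp add: is_policy_def)

lemma pol_subprob[measurable]: "pol n \<in> measurable (HP n) (subprob_algebra (SM A))"
  by (rule measurable_prob_algebraD) (rule pol_measurable)

lemma pol_prob: assumes "h \<in> space (HM n)" "0 < s"
  shows "prob_space (pol n (h, s))" "sets (pol n (h, s)) = sets (SM A)" "space (pol n (h, s)) = A"
proof -
  have "(h, s) \<in> space (HP n)" using assms by (simp add: space_pair_measure)
  from measurable_space[OF pol_measurable this] show "prob_space (pol n (h, s))" and *: "sets (pol n (h, s)) = sets (SM A)"
    by (auto simp: space_prob_algebra)
  from sets_eq_imp_space_eq[OF *] show "space (pol n (h, s)) = A" by simp
qed

lemma measurable_snd_HM[measurable]: "snd \<in> measurable (HM n) (SM S)" and measurable_fst_HM[measurable]: "fst \<in> measurable (HM n) (PiM {..<n} (\<lambda>_. SM S \<Otimes>\<^sub>M posR))"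
  by (simp_all add: histM_def)

lemma snd_HM: "h \<in> space (HM n) \<Longrightarrow> snd h \<in> S"
  using measurable_space[OF measurable_snd_HM, of h n] by simp

definition lamE :: "nat \<Rightarrow> ((nat \<Rightarrow> 's \<times> real) \<times> 's) \<times> real \<Rightarrow> ennreal" where
  "lamE n p = (\<integral>\<^sup>+a. rate (snd (fst p), a) \<partial>pol n p)"

lemma measurable_pol_integral:
  assumes g: "g \<in> borel_measurable SA"
  shows "(\<lambda>p. \<integral>\<^sup>+a. g (snd (fst p), a) \<partial>pol n p) \<in> borel_measurable (HP n)"
proof -
  note [measurable] = g
  have "(\<lambda>z. g (snd (fst (fst z)), snd z)) \<in> borel_measurable (HP n \<Otimes>\<^sub>M SM A)" by measurable
  from measurable_kernel_integral[OF pol_subprob this] show ?thesis by simp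
qed

lemma measurable_lamE[measurable]: "lamE n \<in> borel_measurable (HP n)"
  unfolding lamE_def[abs_def] by (rule measurable_pol_integral) simp

text \<open>Real-valued form of \<open>lamE\<close>, extended by 0 because a policy is constrained
  at positive times only.\<close>

definition lam :: "nat \<Rightarrow> ((nat \<Rightarrow> 's \<times> real) \<times> 's) \<Rightarrow> real \<Rightarrow> real" where
  "lam n h s = (if 0 < s then \<integral>a. qx q (snd h) a \<partial>pol n (h, s) else 0)"

lemma qx_bound: assumes x: "x \<in> S" shows "\<exists>L\<ge>0. \<forall>a\<in>A. qx q x a \<le> L"
proof -
  obtain L where L: "\<forall>a\<in>A. qx q x a \<le> L" using bspec[OF q_bounded x] by (auto simp: bdd_above_def)
  moreover obtain a where "a \<in> A" using A_ne by auto
  ultimately have "0 \<le> L" using qx_nonneg x by (meson order_trans)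
  then show ?thesis using L by blast
qed

lemma lam_props: assumes h: "h \<in> space (HM n)" and s: "0 < s"
  shows "ennreal (lam n h s) = lamE n (h, s)" "0 \<le> lam n h s" "(\<And>a. a \<in> A \<Longrightarrow> qx q (snd h) a \<le> L) \<Longrightarrow> lam n h s \<le> L"
proof -
  interpret prob_space "pol n (h, s)" by (rule pol_prob[OF h s])
  obtain B where B: "0 \<le> B" "\<And>a. a \<in> A \<Longrightarrow> qx q (snd h) a \<le> B" using qx_bound[OF snd_HM[OF h]] by blast
  have m: "(\<lambda>a. qx q (snd h) a) \<in> borel_measurable (pol n (h, s))"
    using measurable_compose[OF measurable_Pair1'[of "snd h" "SM S" "SM A"] measurable_qx] snd_HM[OF h]
    by (simp add: measurable_cong_sets[OF pol_prob(2)[OF h s] refl])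
  have nn: "a \<in> A \<Longrightarrow> 0 \<le> qx q (snd h) a" for a using qx_nonneg snd_HM[OF h] by auto
  have i: "integrable (pol n (h, s)) (\<lambda>a. qx q (snd h) a)"
    using m B nn by (intro integrable_const_bound[where B=B]) (auto simp: pol_prob(3)[OF h s] intro!: AE_I2)
  show "ennreal (lam n h s) = lamE n (h, s)"
  proof -
    have "(\<integral>\<^sup>+a. ennreal (qx q (snd h) a) \<partial>pol n (h, s)) = ennreal (\<integral>a. qx q (snd h) a \<partial>pol n (h, s))"
      using i nn by (intro nn_integral_eq_integral) (auto simp: pol_prob(3)[OF h s] intro!: AE_I2)
    then show ?thesis using s by (simp add: lam_def lamE_def rate_def)
  qed
  show "0 \<le> lam n h s" unfolding lam_def using nn s by (auto intro!: integral_nonneg_AE AE_I2 simp: pol_prob(3)[OF h s])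
  assume L: "\<And>a. a \<in> A \<Longrightarrow> qx q (snd h) a \<le> L"
  have "(\<integral>a. qx q (snd h) a \<partial>pol n (h, s)) \<le> (\<integral>a. L \<partial>pol n (h, s))"
    using i L by (intro integral_mono) (auto simp: pol_prob(3)[OF h s])
  then show "lam n h s \<le> L" using s by (simp add: lam_def prob_space)
qed

lemma measurable_lam[measurable]: "(\<lambda>p. lam n (fst p) (snd p)) \<in> borel_measurable (HM n \<Otimes>\<^sub>M borel)"
proof -
  \<comment> \<open>Time 1 is a dummy that keeps the policy inside its domain.\<close>
  have "(\<lambda>p. (fst p, if 0 < snd p then snd p else 1)) \<in> measurable (HM n \<Otimes>\<^sub>M borel) (HP n)"
    by (intro measurable_Pair measurable_into_posR) auto
  from measurable_compose[OF this measurable_lamE]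
  have [measurable]: "(\<lambda>p. lamE n (fst p, if 0 < snd p then snd p else 1)) \<in> borel_measurable (HM n \<Otimes>\<^sub>M borel)" .
  have "(\<lambda>p. if 0 < snd p then enn2real (lamE n (fst p, if 0 < snd p then snd p else 1)) else 0) \<in> borel_measurable (HM n \<Otimes>\<^sub>M borel)"
    by measurable
  then show ?thesis
  proof (rule measurable_cong[THEN iffD1, rotated])
    fix p :: "((nat \<Rightarrow> 's \<times> real) \<times> 's) \<times> real" assume "p \<in> space (HM n \<Otimes>\<^sub>M borel)"
    then have h: "fst p \<in> space (HM n)" by (auto simp: space_pair_measure)
    show "(if 0 < snd p then enn2real (lamE n (fst p, if 0 < snd p then snd p else 1)) else 0) = lam n (fst p) (snd p)"
    proof (cases "0 < snd p")
      case True
      have "enn2real (ennreal (lam n (fst p) (snd p))) = lam n (fst p) (snd p)"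
        using lam_props(2)[OF h True] by (rule enn2real_ennreal)
      then show ?thesis using True by (simp only: lam_props(1)[OF h True]) simp
    qed (simp add: lam_def)
  qed
qed

definition surv :: "nat \<Rightarrow> ((nat \<Rightarrow> 's \<times> real) \<times> 's) \<Rightarrow> real \<Rightarrow> real" where
  "surv n h t = exp (- (LINT s:{0<..t}|lborel. lam n h s))"

lemma lam_borel[measurable]: "h \<in> space (HM n) \<Longrightarrow> lam n h \<in> borel_measurable borel"
  using measurable_compose[OF measurable_Pair1' measurable_lam, of h n] by simp

lemma lam_nonneg: "h \<in> space (HM n) \<Longrightarrow> 0 \<le> lam n h s"
  using lam_props(2)[of h n s] by (cases "0 < s") (auto simp: lam_def)

lemma lam_bound: assumes "h \<in> space (HM n)" obtains L where "\<And>s. lam n h s \<le> L"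
proof -
  obtain L where L: "0 \<le> L" "\<And>a. a \<in> A \<Longrightarrow> qx q (snd h) a \<le> L" using qx_bound[OF snd_HM[OF assms]] by blast
  have "lam n h s \<le> L" for s using lam_props(3)[OF assms _ L(2), of s] L(1) by (cases "0 < s") (auto simp: lam_def)
  then show ?thesis by (rule that)
qed

lemma surv_props: assumes h: "h \<in> space (HM n)"
  shows "0 < surv n h t" "surv n h t \<le> 1" "t \<le> t' \<Longrightarrow> surv n h t' \<le> surv n h t" "surv n h \<in> borel_measurable borel"
    "0 \<le> t \<Longrightarrow> (\<integral>\<^sup>+s\<in>{0<..t}. ennreal (lam n h s * surv n h s) \<partial>lborel) = ennreal (1 - surv n h t)"
proof -
  obtain L where L: "\<And>s. lam n h s \<le> L" using lam_bound[OF h] by blast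
  note H = hazard_integral[OF lam_borel[OF h] lam_nonneg[OF h] L]
  have m: "mono (\<lambda>t. LINT s:{0<..t}|lborel. lam n h s)" using H(4)[of 0] by simp
  show "0 < surv n h t" by (simp add: surv_def)
  show "0 \<le> t \<Longrightarrow> (\<integral>\<^sup>+s\<in>{0<..t}. ennreal (lam n h s * surv n h s) \<partial>lborel) = ennreal (1 - surv n h t)"
    using H(1)[of t] by (simp add: surv_def)
  have "0 \<le> (LINT s:{0<..t}|lborel. lam n h s)"
    unfolding set_lebesgue_integral_def using lam_nonneg[OF h] by (intro integral_nonneg_AE) auto
  then show "surv n h t \<le> 1" by (simp add: surv_def)
  show "t \<le> t' \<Longrightarrow> surv n h t' \<le> surv n h t" using monoD[OF m, of t t'] by (simp add: surv_def)
  show "surv n h \<in> borel_measurable borel" unfolding surv_def[abs_def] using H(3)[of 0] by simp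
qed

definition ew :: "nat \<Rightarrow> ((nat \<Rightarrow> 's \<times> real) \<times> 's) \<times> real \<Rightarrow> ennreal" where
  "ew n p = ennreal (surv n (fst p) (snd p))"

lemma measurable_surv: "(\<lambda>p. surv n (fst p) (snd p)) \<in> borel_measurable (HM n \<Otimes>\<^sub>M borel)"
proof -
  have "(\<lambda>z. (fst (fst z), snd z)) \<in> measurable ((HM n \<Otimes>\<^sub>M borel) \<Otimes>\<^sub>M lborel) (HM n \<Otimes>\<^sub>M borel)" by measurable
  from measurable_compose[OF this measurable_lam]
  have [measurable]: "(\<lambda>z. lam n (fst (fst z)) (snd z)) \<in> borel_measurable ((HM n \<Otimes>\<^sub>M borel) \<Otimes>\<^sub>M lborel)" by simp
  have "(\<lambda>z. ennreal (if 0 < snd z \<and> snd z \<le> snd (fst z) then lam n (fst (fst z)) (snd z) else 0)) \<in> borel_measurable ((HM n \<Otimes>\<^sub>M borel) \<Otimes>\<^sub>M lborel)"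
    by measurable
  moreover have "(\<lambda>z. ennreal (if 0 < snd z \<and> snd z \<le> snd (fst z) then lam n (fst (fst z)) (snd z) else 0))
    = (\<lambda>z. ennreal (indicator {0<..snd (fst z)} (snd z) * lam n (fst (fst z)) (snd z)))" by (auto simp: fun_eq_iff)
  ultimately have "(\<lambda>z. ennreal (indicator {0<..snd (fst z)} (snd z) * lam n (fst (fst z)) (snd z))) \<in> borel_measurable ((HM n \<Otimes>\<^sub>M borel) \<Otimes>\<^sub>M lborel)"
    by simp
  then have [measurable]: "(\<lambda>p. \<integral>\<^sup>+s. ennreal (indicator {0<..snd p} s * lam n (fst p) s) \<partial>lborel) \<in> borel_measurable (HM n \<Otimes>\<^sub>M borel)"
    by (intro lborel.borel_measurable_nn_integral) (simp add: case_prod_beta')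
  have "(\<lambda>p. exp (- enn2real (\<integral>\<^sup>+s. ennreal (indicator {0<..snd p} s * lam n (fst p) s) \<partial>lborel))) \<in> borel_measurable (HM n \<Otimes>\<^sub>M borel)"
    by measurable
  then show ?thesis
  proof (rule measurable_cong[THEN iffD1, rotated])
    fix p :: "((nat \<Rightarrow> 's \<times> real) \<times> 's) \<times> real" assume "p \<in> space (HM n \<Otimes>\<^sub>M borel)"
    then have h: "fst p \<in> space (HM n)" by (auto simp: space_pair_measure)
    have "(LINT s:{0<..snd p}|lborel. lam n (fst p) s) = enn2real (\<integral>\<^sup>+s. ennreal (indicator {0<..snd p} s * lam n (fst p) s) \<partial>lborel)"
      unfolding set_lebesgue_integral_def using lam_borel[OF h] lam_nonneg[OF h]
      by (subst integral_eq_nn_integral) auto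
    then show "exp (- enn2real (\<integral>\<^sup>+s. ennreal (indicator {0<..snd p} s * lam n (fst p) s) \<partial>lborel)) = surv n (fst p) (snd p)"
      by (simp add: surv_def)
  qed
qed

lemma measurable_ew[measurable]: "ew n \<in> borel_measurable (HP n)"
proof -
  have "(\<lambda>p. (fst p, snd p)) \<in> measurable (HP n) (HM n \<Otimes>\<^sub>M borel)" by measurable
  from measurable_compose[OF this measurable_surv] show ?thesis unfolding ew_def[abs_def] by simp
qed

lemma ew_le_1: "h \<in> space (HM n) \<Longrightarrow> ew n (h, s) \<le> 1"
  using surv_props(2)[of h n s] by (simp add: ew_def)

text \<open>The half-line \<open>{..<t}\<close> is the complement of the event in the survival
  clause of \<open>strategic\<close>; compared with the closed interval of
  \<open>hazard_integral\<close>, only a null set is lost.\<close>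

lemma hazard_posL: assumes h: "h \<in> space (HM n)" and t: "0 < t"
  shows "(\<integral>\<^sup>+s. ew n (h, s) * lamE n (h, s) * indicator {..<t} s \<partial>posL) = 1 - ew n (h, t)"
proof -
  have "(\<integral>\<^sup>+s. ew n (h, s) * lamE n (h, s) * indicator {..<t} s \<partial>posL) = (\<integral>\<^sup>+s\<in>{0<..t}. ennreal (lam n h s * surv n h s) \<partial>lborel)"
    unfolding nn_integral_posL
  proof (intro nn_integral_cong_AE)
    have "AE s in lborel. s \<noteq> t" by (rule AE_lborel_singleton)
    then show "AE s in lborel. ew n (h, s) * lamE n (h, s) * indicator {..<t} s * indicator {0<..} s
        = ennreal (lam n h s * surv n h s) * indicator {0<..t} s"
    proof eventually_elim
      fix s assume "s \<noteq> t"
      then show "ew n (h, s) * lamE n (h, s) * indicator {..<t} s * indicator {0<..} s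
        = ennreal (lam n h s * surv n h s) * indicator {0<..t} s"
        using lam_props[OF h, of s] surv_props(1)[OF h, of s]
        by (auto simp: ew_def ennreal_mult mult.commute split: split_indicator)
    qed
  qed
  also have "\<dots> = ennreal (1 - surv n h t)" using surv_props(5)[OF h, of t] t by simp
  also have "\<dots> = 1 - ew n (h, t)" using surv_props(1)[OF h, of t] by (simp add: ew_def ennreal_minus flip: ennreal_1)
  finally show ?thesis .
qed

text \<open>Probability that the sojourn after \<open>h\<close> is finite; the remaining
  \<open>1 - jmass n h\<close> is the limit of the survival function.\<close>

definition jmass :: "nat \<Rightarrow> ((nat \<Rightarrow> 's \<times> real) \<times> 's) \<Rightarrow> ennreal" where
  "jmass n h = (\<integral>\<^sup>+s. ew n (h, s) * lamE n (h, s) \<partial>posL)"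

lemma measurable_jmass[measurable]: "jmass n \<in> borel_measurable (HM n)"
  unfolding jmass_def[abs_def] by (rule measurable_posL_integral) simp

lemma measurable_HP_section: "h \<in> space (HM n) \<Longrightarrow> f \<in> borel_measurable (HP n) \<Longrightarrow> (\<lambda>s. f (h, s)) \<in> borel_measurable posR"
  by (rule measurable_compose[OF measurable_Pair1'])

lemma jmass_le_1: assumes h: "h \<in> space (HM n)" shows "jmass n h \<le> 1"
proof -
  have [measurable]: "(\<lambda>s. ew n (h, s) * lamE n (h, s)) \<in> borel_measurable posL"
    using measurable_HP_section[OF h, of "\<lambda>p. ew n p * lamE n p"] by simp
  have m: "(\<lambda>s. indicator {..<real (Suc k)} s :: ennreal) \<in> borel_measurable posL" for k
    by (simp add: measurable_indicator_posR)
  have "jmass n h = (\<integral>\<^sup>+s. (SUP k. ew n (h, s) * lamE n (h, s) * indicator {..<real (Suc k)} s) \<partial>posL)"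
    unfolding jmass_def
  proof (intro nn_integral_cong)
    fix s :: real
    obtain k where "s < real (Suc k)" by (meson less_trans lessI of_nat_less_iff reals_Archimedean2)
    then show "ew n (h, s) * lamE n (h, s) = (SUP k. ew n (h, s) * lamE n (h, s) * indicator {..<real (Suc k)} s)"
      by (intro antisym SUP_least SUP_upper2[of k]) (auto split: split_indicator)
  qed
  also have "\<dots> = (SUP k. \<integral>\<^sup>+s. ew n (h, s) * lamE n (h, s) * indicator {..<real (Suc k)} s \<partial>posL)"
    using m by (intro nn_integral_monotone_convergence_SUP) (auto simp: incseq_def le_fun_def intro!: mult_left_mono split: split_indicator)
  also have "\<dots> \<le> 1"
    by (intro SUP_least) (simp add: hazard_posL[OF h] diff_le_self_ennreal)
  finally show ?thesis .
qed

text \<open>Surviving until \<open>t\<close> splits into a later jump at a finite time and no jump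
  at all.\<close>

lemma hazard_tail: assumes h: "h \<in> space (HM n)" and t: "0 < t"
  shows "(\<integral>\<^sup>+s. ew n (h, s) * lamE n (h, s) * indicator {t..} s \<partial>posL) + (1 - jmass n h) = ew n (h, t)"
proof -
  have [measurable]: "(\<lambda>s. ew n (h, s) * lamE n (h, s)) \<in> borel_measurable posL"
    using measurable_HP_section[OF h, of "\<lambda>p. ew n p * lamE n p"] by simp
  have [measurable]: "(\<lambda>s. indicator {..<t} s :: ennreal) \<in> borel_measurable posL" "(\<lambda>s. indicator {t..} s :: ennreal) \<in> borel_measurable posL"
    by (simp_all add: measurable_indicator_posR)
  let ?T = "\<integral>\<^sup>+s. ew n (h, s) * lamE n (h, s) * indicator {t..} s \<partial>posL"
  have "jmass n h = (\<integral>\<^sup>+s. ew n (h, s) * lamE n (h, s) * indicator {..<t} s + ew n (h, s) * lamE n (h, s) * indicator {t..} s \<partial>posL)"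
    unfolding jmass_def by (intro nn_integral_cong) (auto split: split_indicator)
  also have "\<dots> = (1 - ew n (h, t)) + ?T" by (subst nn_integral_add) (auto simp: hazard_posL[OF h t])
  finally have eq: "jmass n h = (1 - ew n (h, t)) + ?T" .
  have "?T + (1 - jmass n h) + (1 - ew n (h, t)) = jmass n h + (1 - jmass n h)" unfolding eq by (simp add: ac_simps)
  also have "\<dots> = 1" using jmass_le_1[OF h] by (simp add: add_diff_inverse_ennreal)
  also have "\<dots> = ew n (h, t) + (1 - ew n (h, t))" using ew_le_1[OF h] by (simp add: add_diff_inverse_ennreal)
  finally show ?thesis
    using ennreal_add_left_cancel[of "1 - ew n (h, t)"] by (auto simp: add.commute) 
qed

text \<open>Integral of \<open>f\<close> against the joint law of sojourn length and next state on
  the event of a finite sojourn. The form \<open>rate * Q\<close> under the action integral avoids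
  the quotient of averages in \<open>jump_ratio\<close>, so a vanishing averaged rate needs no
  separate treatment.\<close>

definition jump :: "nat \<Rightarrow> ((nat \<Rightarrow> 's \<times> real) \<times> 's) \<Rightarrow> (real \<times> 's \<Rightarrow> ennreal) \<Rightarrow> ennreal" where
  "jump n h f = (\<integral>\<^sup>+s. ew n (h, s) * (\<integral>\<^sup>+a. rate (snd h, a) * (\<integral>\<^sup>+y. f (s, y) \<partial>Q (snd h, a)) \<partial>pol n (h, s)) \<partial>posL)"

lemma measurable_jump_inner:
  assumes g: "g \<in> borel_measurable (HP n \<Otimes>\<^sub>M SM S)"
  shows "(\<lambda>p. \<integral>\<^sup>+a. rate (snd (fst p), a) * (\<integral>\<^sup>+y. g (p, y) \<partial>Q (snd (fst p), a)) \<partial>pol n p) \<in> borel_measurable (HP n)"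
proof -
  note [measurable] = g
  have "(\<lambda>z. (snd (fst (fst z)), snd z)) \<in> measurable (HP n \<Otimes>\<^sub>M SM A) SA" by measurable
  from measurable_compose[OF this measurable_Q] measurable_compose[OF this measurable_rate]
  have k: "(\<lambda>z. Q (snd (fst (fst z)), snd z)) \<in> measurable (HP n \<Otimes>\<^sub>M SM A) (subprob_algebra (SM S))"
    and r[measurable]: "(\<lambda>z. rate (snd (fst (fst z)), snd z)) \<in> borel_measurable (HP n \<Otimes>\<^sub>M SM A)" by auto
  have "(\<lambda>z. g (fst (fst z), snd z)) \<in> borel_measurable ((HP n \<Otimes>\<^sub>M SM A) \<Otimes>\<^sub>M SM S)" by measurable
  from measurable_kernel_integral[OF k this]
  have [measurable]: "(\<lambda>z. \<integral>\<^sup>+y. g (fst z, y) \<partial>Q (snd (fst (fst z)), snd z)) \<in> borel_measurable (HP n \<Otimes>\<^sub>M SM A)" by simp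
  have "(\<lambda>z. rate (snd (fst (fst z)), snd z) * (\<integral>\<^sup>+y. g (fst z, y) \<partial>Q (snd (fst (fst z)), snd z))) \<in> borel_measurable (HP n \<Otimes>\<^sub>M SM A)" by measurable
  from measurable_kernel_integral[OF pol_subprob this] show ?thesis by simp
qed

lemma measurable_jump:
  assumes g: "g \<in> borel_measurable (HM n \<Otimes>\<^sub>M (posR \<Otimes>\<^sub>M SM S))"
  shows "(\<lambda>h. jump n h (\<lambda>w. g (h, w))) \<in> borel_measurable (HM n)"
proof -
  note [measurable] = g
  have "(\<lambda>z. g (fst (fst z), (snd (fst z), snd z))) \<in> borel_measurable (HP n \<Otimes>\<^sub>M SM S)" by measurable
  from measurable_jump_inner[OF this]
  have [measurable]: "(\<lambda>p. \<integral>\<^sup>+a. rate (snd (fst p), a) * (\<integral>\<^sup>+y. g (fst p, (snd p, y)) \<partial>Q (snd (fst p), a)) \<partial>pol n p) \<in> borel_measurable (HP n)" by simp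
  have "(\<lambda>p. ew n p * (\<integral>\<^sup>+a. rate (snd (fst p), a) * (\<integral>\<^sup>+y. g (fst p, (snd p, y)) \<partial>Q (snd (fst p), a)) \<partial>pol n p)) \<in> borel_measurable (HP n)" by measurable
  from measurable_posL_integral[OF this] show ?thesis by (simp add: jump_def)
qed

lemma pos_functional_jump: assumes h: "h \<in> space (HM n)"
  shows "pos_functional (posR \<Otimes>\<^sub>M SM S) (jump n h)"
  unfolding jump_def
proof (intro pos_functional_integral pos_functional_cmult)
  fix s a y assume "s \<in> space posL" "y \<in> space (Q (snd h, a))"
  then show "pos_functional (posR \<Otimes>\<^sub>M SM S) (\<lambda>f. f (s, y))"
    by (intro pos_functional_eval) (simp add: space_pair_measure)
next
  fix s a and f :: "real \<times> 's \<Rightarrow> ennreal" assume s: "s \<in> space posL" and f: "f \<in> borel_measurable (posR \<Otimes>\<^sub>M SM S)"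
  have "(\<lambda>y. f (s, y)) \<in> borel_measurable (SM S)" using measurable_compose[OF measurable_Pair1' f] s by simp
  then show "(\<lambda>y. f (s, y)) \<in> borel_measurable (Q (snd h, a))" by (simp add: measurable_cong_sets[OF sets_Q refl])
next
  fix s and f :: "real \<times> 's \<Rightarrow> ennreal" assume s: "s \<in> space posL" and f: "f \<in> borel_measurable (posR \<Otimes>\<^sub>M SM S)"
  have "(\<lambda>y. f (s, y)) \<in> borel_measurable (SM S)" using measurable_compose[OF measurable_Pair1' f] s by simp
  from measurable_nn_integral_Q[OF this]
  have "(\<lambda>z. rate z * (\<integral>\<^sup>+y. f (s, y) \<partial>Q z)) \<in> borel_measurable SA" by measurable
  then have "(\<lambda>a. rate (snd h, a) * (\<integral>\<^sup>+y. f (s, y) \<partial>Q (snd h, a))) \<in> borel_measurable (SM A)"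
    by (rule measurable_compose[OF measurable_Pair1'[of "snd h" "SM S" "SM A"], rotated]) (simp add: snd_HM[OF h])
  then show "(\<lambda>a. rate (snd h, a) * (\<integral>\<^sup>+y. f (s, y) \<partial>Q (snd h, a))) \<in> borel_measurable (pol n (h, s))"
    using s by (simp add: measurable_cong_sets[OF pol_prob(2)[OF h] refl])
next
  fix f :: "real \<times> 's \<Rightarrow> ennreal" assume f[measurable]: "f \<in> borel_measurable (posR \<Otimes>\<^sub>M SM S)"
  have "(\<lambda>z. f (snd (fst z), snd z)) \<in> borel_measurable (HP n \<Otimes>\<^sub>M SM S)" by measurable
  from measurable_jump_inner[OF this]
  have [measurable]: "(\<lambda>p. \<integral>\<^sup>+a. rate (snd (fst p), a) * (\<integral>\<^sup>+y. f (snd p, y) \<partial>Q (snd (fst p), a)) \<partial>pol n p) \<in> borel_measurable (HP n)" by simp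
  have "(\<lambda>p. ew n p * (\<integral>\<^sup>+a. rate (snd (fst p), a) * (\<integral>\<^sup>+y. f (snd p, y) \<partial>Q (snd (fst p), a)) \<partial>pol n p)) \<in> borel_measurable (HP n)" by measurable
  from measurable_HP_section[OF h this]
  show "(\<lambda>s. ew n (h, s) * (\<integral>\<^sup>+a. rate (snd h, a) * (\<integral>\<^sup>+y. f (s, y) \<partial>Q (snd h, a)) \<partial>pol n (h, s))) \<in> borel_measurable posL" by simp
qed

lemma jump_state_free:
  assumes h: "h \<in> space (HM n)" and f: "f \<in> borel_measurable posR"
  shows "jump n h (\<lambda>w. f (fst w)) = (\<integral>\<^sup>+s. ew n (h, s) * lamE n (h, s) * f s \<partial>posL)"
  unfolding jump_def
proof (intro nn_integral_cong)
  fix s assume "s \<in> space posL"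
  then have s: "0 < s" by simp
  have m: "(\<lambda>a. rate (snd h, a)) \<in> borel_measurable (pol n (h, s))"
    using measurable_compose[OF measurable_Pair1'[of "snd h" "SM S" "SM A"] measurable_rate] snd_HM[OF h]
    by (simp add: measurable_cong_sets[OF pol_prob(2)[OF h s] refl])
  have "(\<integral>\<^sup>+a. rate (snd h, a) * (\<integral>\<^sup>+y. f (fst (s, y)) \<partial>Q (snd h, a)) \<partial>pol n (h, s)) = (\<integral>\<^sup>+a. rate (snd h, a) * f s \<partial>pol n (h, s))"
    using emeasure_Q_S snd_HM[OF h] by (intro nn_integral_cong) (auto simp: pol_prob(3)[OF h s])
  also have "\<dots> = lamE n (h, s) * f s" using m by (simp add: nn_integral_multc lamE_def)
  finally show "ew n (h, s) * (\<integral>\<^sup>+a. rate (snd h, a) * (\<integral>\<^sup>+y. f (fst (s, y)) \<partial>Q (snd h, a)) \<partial>pol n (h, s)) = ew n (h, s) * lamE n (h, s) * f s"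
    by (simp add: mult.assoc)
qed

text \<open>The numerator of the ratio is dominated by its denominator, so both sides are 0 when the
  averaged rate is.\<close>

lemma lamE_jump_ratio:
  assumes h: "h \<in> space (HM n)" and s: "0 < s" and \<Gamma>: "\<Gamma> \<in> sets (SM S)"
  shows "lamE n (h, s) * ennreal (jump_ratio q (snd h) (pol n (h, s)) \<Gamma>) = (\<integral>\<^sup>+a. rate (snd h, a) * emeasure (Q (snd h, a)) \<Gamma> \<partial>pol n (h, s))"
proof -
  interpret prob_space "pol n (h, s)" by (rule pol_prob[OF h s])
  obtain B where B: "0 \<le> B" "\<And>a. a \<in> A \<Longrightarrow> qx q (snd h) a \<le> B" using qx_bound[OF snd_HM[OF h]] by blast
  have m: "(\<lambda>a. qx q (snd h) a) \<in> borel_measurable (pol n (h, s))" "(\<lambda>a. qt q (snd h) a \<Gamma>) \<in> borel_measurable (pol n (h, s))"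
    using measurable_compose[OF measurable_Pair1'[of "snd h" "SM S" "SM A"] measurable_qx] 
      measurable_compose[OF measurable_Pair1'[of "snd h" "SM S" "SM A"] measurable_qt[OF \<Gamma>]] snd_HM[OF h]
    by (simp_all add: measurable_cong_sets[OF pol_prob(2)[OF h s] refl])
  have nn: "a \<in> A \<Longrightarrow> 0 \<le> qx q (snd h) a" "a \<in> A \<Longrightarrow> 0 \<le> qt q (snd h) a \<Gamma>" for a using qx_nonneg q_nonneg \<Gamma> snd_HM[OF h] by auto
  have le: "qt q (snd h) a \<Gamma> \<le> qx q (snd h) a" if "a \<in> A" for a
  proof -
    have "emeasure (qtM q S (snd h) a) \<Gamma> \<le> emeasure (qtM q S (snd h) a) S"
      using sets.sets_into_space[OF \<Gamma>] sets.top[of "SM S"] by (intro emeasure_mono) auto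
    then show ?thesis using that snd_HM[OF h] \<Gamma> sets.top[of "SM S"] nn[OF that] by (simp add: emeasure_qtM qt_S)
  qed
  have i: "integrable (pol n (h, s)) (\<lambda>a. qx q (snd h) a)" "integrable (pol n (h, s)) (\<lambda>a. qt q (snd h) a \<Gamma>)"
    using m B nn order_trans[OF le B(2)] by (auto intro!: integrable_const_bound[where B=B] AE_I2 simp: pol_prob(3)[OF h s])
  define X Y where "X = (\<integral>a. qx q (snd h) a \<partial>pol n (h, s))" and "Y = (\<integral>a. qt q (snd h) a \<Gamma> \<partial>pol n (h, s))"
  have YX: "0 \<le> Y" "Y \<le> X" unfolding X_def Y_def using i le nn
    by (auto intro!: integral_mono integral_nonneg_AE AE_I2 simp: pol_prob(3)[OF h s])
  have "lamE n (h, s) = ennreal X" using lam_props(1)[OF h s] s by (simp add: lam_def X_def)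
  moreover have "(\<integral>\<^sup>+a. rate (snd h, a) * emeasure (Q (snd h, a)) \<Gamma> \<partial>pol n (h, s)) = (\<integral>\<^sup>+a. ennreal (qt q (snd h) a \<Gamma>) \<partial>pol n (h, s))"
    using rate_Q[OF _ \<Gamma>] snd_HM[OF h] by (intro nn_integral_cong) (auto simp: pol_prob(3)[OF h s])
  moreover have "\<dots> = ennreal Y" unfolding Y_def using i nn by (intro nn_integral_eq_integral) (auto simp: pol_prob(3)[OF h s] AE_I2)
  moreover have "ennreal X * ennreal (Y / X) = ennreal Y" using YX by (cases "X = 0") (auto simp flip: ennreal_mult)
  ultimately show ?thesis by (simp add: jump_ratio_def X_def[symmetric] Y_def[symmetric])
qed

end

section \<open>Measurable structure of the path space, and histories read off a path\<close>

lemma space_optM[simp]: "space (optM M) = UNIV"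
  by (simp add: optM_def space_measure_of_conv)

lemma None_sets_optM[measurable]: "{None} \<in> sets (optM M)"
  and Some_image_sets_optM: "B \<in> sets M \<Longrightarrow> Some ` B \<in> sets (optM M)"
  by (auto simp: optM_def)

lemma Some_measurable_optM[measurable]: "Some \<in> measurable M (optM M)"
  unfolding optM_def
proof (rule measurable_measure_of)
  fix Y assume "Y \<in> insert {None} ((\<lambda>B. Some ` B) ` sets M)"
  then consider "Y = {None}" | B where "B \<in> sets M" "Y = Some ` B" by auto
  then show "Some -` Y \<inter> space M \<in> sets M"
  proof cases
    case 2
    then have "Some -` Y \<inter> space M = B" using sets.sets_into_space by auto
    then show ?thesis using 2 by simp
  qed (simp add: vimage_def)
qed auto

context ctmdp
begin

abbreviation "PM \<equiv> optM (SM S) \<Otimes>\<^sub>M (borel :: ennreal measure)"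

definition x0 :: 's where "x0 = (SOME x. x \<in> S)"

lemma x0: "x0 \<in> S" unfolding x0_def using S_ne by (simp add: some_in_eq)

text \<open>\<open>unS\<close> and \<open>unP\<close> are total substitutes for \<open>the\<close>
  and \<open>enn2real\<close> with values in \<open>S\<close> and in the positive reals. They make
  \<open>hst\<close> measurable into \<open>histM\<close> on the entire path space, which
  \<open>hist\<close> is not.\<close>

definition unS :: "'s option \<Rightarrow> 's" where "unS w = (if w \<in> Some ` S then the w else x0)"
definition unP :: "ennreal \<Rightarrow> real" where "unP t = (if 0 < t \<and> t < \<top> then enn2real t else 1)"

lemma unS_Some[simp]: "x \<in> S \<Longrightarrow> unS (Some x) = x" by (simp add: unS_def)

lemma unP_ennreal[simp]: "0 < s \<Longrightarrow> unP (ennreal s) = s" by (simp add: unP_def)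

lemma unP_pos: "0 < unP t" by (auto simp: unP_def enn2real_positive_iff)

lemma Some_S_sets[measurable]: "Some ` S \<in> sets (optM (SM S))"
  using Some_image_sets_optM[OF sets.top[of "SM S"]] by simp

lemma unS_measurable[measurable]: "unS \<in> measurable (optM (SM S)) (SM S)"
proof (rule measurableI)
  fix B assume B: "B \<in> sets (SM S)"
  then have BS: "B \<subseteq> S" using sets.sets_into_space by fastforce
  have "unS -` B \<inter> space (optM (SM S)) = Some ` B \<union> (if x0 \<in> B then space (optM (SM S)) - Some ` S else {})"
    using BS by (auto simp: unS_def split: if_splits)
  then show "unS -` B \<inter> space (optM (SM S)) \<in> sets (optM (SM S))"
    using Some_image_sets_optM[OF B] Some_S_sets by (auto simp del: space_optM)
qed (auto simp: unS_def x0)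

lemma unP_measurable[measurable]: "unP \<in> measurable borel posR"
  unfolding unP_def by (rule measurable_into_posR) (auto simp: enn2real_positive_iff)

definition good :: "nat \<Rightarrow> 's path \<Rightarrow> bool" where
  "good n \<omega> \<longleftrightarrow> (\<forall>k\<in>{..n}. fst (\<omega> k) \<in> Some ` S) \<and> (\<forall>k\<in>{..<n}. 0 < snd (\<omega> (Suc k)) \<and> snd (\<omega> (Suc k)) < \<top>)"

definition hst :: "nat \<Rightarrow> 's path \<Rightarrow> (nat \<Rightarrow> 's \<times> real) \<times> 's" where
  "hst n \<omega> = (restrict (\<lambda>k. (unS (fst (\<omega> k)), unP (snd (\<omega> (Suc k))))) {..<n}, unS (fst (\<omega> n)))"

lemma coord_measurable: "k \<in> I \<Longrightarrow> (\<lambda>\<omega>. fst (\<omega> k)) \<in> measurable (PiM I (\<lambda>_. PM)) (optM (SM S))"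
  "k \<in> I \<Longrightarrow> (\<lambda>\<omega>. snd (\<omega> k)) \<in> measurable (PiM I (\<lambda>_. PM)) borel"
  by (auto intro: measurable_compose[OF measurable_component_singleton])

lemma good_measurable: assumes "{..n} \<subseteq> I" shows "Measurable.pred (PiM I (\<lambda>_. PM)) (good n)"
  unfolding good_def
proof (intro pred_intros_logic pred_intros_finite)
  fix k assume "k \<in> {..n}"
  then have [measurable]: "(\<lambda>\<omega>. fst (\<omega> k)) \<in> measurable (PiM I (\<lambda>_. PM)) (optM (SM S))" using assms by (intro coord_measurable) auto
  show "Measurable.pred (PiM I (\<lambda>_. PM)) (\<lambda>\<omega>. fst (\<omega> k) \<in> Some ` S)" by measurable
next
  fix k assume "k \<in> {..<n}"
  then have [measurable]: "(\<lambda>\<omega>. snd (\<omega> (Suc k))) \<in> measurable (PiM I (\<lambda>_. PM)) borel" using assms by (intro coord_measurable) auto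
  show "Measurable.pred (PiM I (\<lambda>_. PM)) (\<lambda>\<omega>. 0 < snd (\<omega> (Suc k)))" "Measurable.pred (PiM I (\<lambda>_. PM)) (\<lambda>\<omega>. snd (\<omega> (Suc k)) < \<top>)" by measurable
qed auto

lemma hst_measurable: assumes "{..n} \<subseteq> I" shows "hst n \<in> measurable (PiM I (\<lambda>_. PM)) (histM S n)"
  unfolding hst_def histM_def
proof (intro measurable_Pair measurable_restrict)
  have n: "n \<in> I" using assms by auto
  show "(\<lambda>\<omega>. unS (fst (\<omega> n))) \<in> measurable (PiM I (\<lambda>_. PM)) (SM S)"
    by (rule measurable_compose[OF coord_measurable(1)[OF n] unS_measurable])
  fix k assume "k \<in> {..<n}"
  then have k: "k \<in> I" "Suc k \<in> I" using assms by auto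
  show "(\<lambda>\<omega>. unS (fst (\<omega> k))) \<in> measurable (PiM I (\<lambda>_. PM)) (SM S)"
    by (rule measurable_compose[OF coord_measurable(1)[OF k(1)] unS_measurable])
  show "(\<lambda>\<omega>. unP (snd (\<omega> (Suc k)))) \<in> measurable (PiM I (\<lambda>_. PM)) posR"
    by (rule measurable_compose[OF coord_measurable(2)[OF k(2)] unP_measurable])
qed

lemma good_Suc: "good (Suc n) \<omega> \<longleftrightarrow> good n \<omega> \<and> fst (\<omega> (Suc n)) \<in> Some ` S \<and> 0 < snd (\<omega> (Suc n)) \<and> snd (\<omega> (Suc n)) < \<top>"
  by (auto simp: good_def atMost_Suc lessThan_Suc)

lemma good_hist: "good n \<omega> \<Longrightarrow> hist n \<omega> = hst n \<omega>"
  unfolding good_def hist_def hst_def xs_def th_def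
  by (auto simp: fun_eq_iff unS_def unP_def restrict_def)

text \<open>Membership of \<open>hist n \<omega>\<close> in a measurable set already forces all
  coordinates into their proper ranges. The clauses of \<open>strategic\<close> may therefore be
  read with \<open>good\<close> and \<open>hst\<close> instead of \<open>alive\<close> and
  \<open>hist\<close>.\<close>

lemma alive_hist_iff: assumes "H \<in> sets (histM S n)"
  shows "alive n \<omega> \<and> hist n \<omega> \<in> H \<longleftrightarrow> good n \<omega> \<and> hst n \<omega> \<in> H"
proof
  assume a: "alive n \<omega> \<and> hist n \<omega> \<in> H"
  then have "hist n \<omega> \<in> space (histM S n)" using sets.sets_into_space[OF assms] by auto
  then have "the (xs \<omega> n) \<in> S" and k: "\<And>k. k < n \<Longrightarrow> the (xs \<omega> k) \<in> S \<and> 0 < enn2real (th \<omega> (Suc k))"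
    by (auto simp: hist_def histM_def space_pair_measure space_PiM PiE_iff)
  then have "xs \<omega> k \<in> Some ` S" if "k \<le> n" for k
    using a that by (cases "k = n") (auto simp: alive_def image_iff intro!: bexI[of _ "the (xs \<omega> k)"])
  moreover have "0 < th \<omega> (Suc k) \<and> th \<omega> (Suc k) < \<top>" if "k < n" for k
    using k[OF that] by (auto simp: enn2real_positive_iff)
  ultimately have "good n \<omega>" by (auto simp: good_def xs_def th_def)
  then show "good n \<omega> \<and> hst n \<omega> \<in> H" using a good_hist by auto
next
  assume g: "good n \<omega> \<and> hst n \<omega> \<in> H"
  then have "alive n \<omega>" by (auto simp: good_def alive_def xs_def)
  then show "alive n \<omega> \<and> hist n \<omega> \<in> H" using g good_hist by auto
qed

lemma Omega_alive: assumes "\<omega> \<in> Omega S" shows "alive n \<omega> \<longleftrightarrow> good n \<omega>"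
proof -
  have p: "0 < snd (\<omega> (Suc k))" for k using assms by (auto simp: Omega_def th_def)
  show ?thesis
  proof
    assume a: "alive n \<omega>"
    then have "fst (\<omega> k) \<in> Some ` S" if "k \<le> n" for k
    proof -
      have "xs \<omega> k \<in> Some ` S \<or> xs \<omega> k = None" using assms by (auto simp: Omega_def)
      then show ?thesis using a that by (auto simp: alive_def xs_def)
    qed
    moreover have "snd (\<omega> (Suc k)) < \<top>" if "k < n" for k
      using assms a that by (auto simp: Omega_def alive_def xs_def th_def less_top[symmetric])
    ultimately show "good n \<omega>" using p by (auto simp: good_def)
  qed (auto simp: good_def alive_def xs_def)
qed

text \<open>The first missing state has an infinite sojourn time, and infinite sojourn times
  persist.\<close>

lemma Omega_dead: assumes \<omega>: "\<omega> \<in> Omega S" and n: "\<not> good (Suc n) \<omega>" shows "\<omega> (Suc n) = (None, \<top>)"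
proof -
  have step: "th \<omega> (Suc k) = \<top> \<Longrightarrow> th \<omega> (Suc (Suc k)) = \<top>" "th \<omega> (Suc k) = \<top> \<longleftrightarrow> xs \<omega> (Suc k) = None" for k
    using \<omega> by (auto simp: Omega_def)
  have stay: "th \<omega> (Suc k) = \<top> \<Longrightarrow> th \<omega> (Suc (k + d)) = \<top>" for k d by (induction d) (auto simp: step(1))
  obtain k where k: "k \<le> Suc n" "xs \<omega> k = None" using n Omega_alive[OF \<omega>, of "Suc n"] by (auto simp: alive_def)
  have "k \<noteq> 0" using k(2) \<omega> by (cases k) (auto simp: Omega_def)
  then obtain k' where k': "k = Suc k'" by (cases k) auto
  then have "th \<omega> (Suc k') = \<top>" using k step(2) by auto
  from stay[OF this, of "n - k'"] have "th \<omega> (Suc n) = \<top>" using k k' by simp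
  then show ?thesis using step(2)[of n] by (auto simp: th_def xs_def prod_eq_iff)
qed

definition hext :: "nat \<Rightarrow> ((nat \<Rightarrow> 's \<times> real) \<times> 's) \<times> real \<times> 's \<Rightarrow> (nat \<Rightarrow> 's \<times> real) \<times> 's" where
  "hext n z = ((fst (fst z))(n := (snd (fst z), fst (snd z))), snd (snd z))"

lemma hext_measurable[measurable]: "hext n \<in> measurable (histM S n \<Otimes>\<^sub>M (posR \<Otimes>\<^sub>M SM S)) (histM S (Suc n))"
proof -
  have [measurable]: "fst \<in> measurable (histM S n) (PiM {..<n} (\<lambda>_. SM S \<Otimes>\<^sub>M posR))" "snd \<in> measurable (histM S n) (SM S)"
    by (simp_all add: histM_def)
  have "(\<lambda>z. (fst (fst z))(n := (snd (fst z), fst (snd z)))) \<in> measurable (histM S n \<Otimes>\<^sub>M (posR \<Otimes>\<^sub>M SM S)) (PiM {..<Suc n} (\<lambda>_. SM S \<Otimes>\<^sub>M posR))"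
    by (rule measurable_fun_upd[where J="{..<n}"]) (auto simp: lessThan_Suc)
  then show ?thesis unfolding hext_def[abs_def] histM_def[of S "Suc n"] by (intro measurable_Pair) auto
qed

lemma hst_Suc: "hst (Suc n) \<omega> = hext n (hst n \<omega>, (unP (snd (\<omega> (Suc n))), unS (fst (\<omega> (Suc n)))))"
  by (auto simp: hst_def hext_def fun_eq_iff restrict_def)

definition hpath :: "nat \<Rightarrow> (nat \<Rightarrow> 's \<times> real) \<times> 's \<Rightarrow> 's path" where
  "hpath n h k = (if k \<le> n then (Some (if k < n then fst (fst h k) else snd h), if k = 0 then 0 else ennreal (snd (fst h (k - 1)))) else (None, \<top>))"

lemma hpath_measurable[measurable]: "hpath n \<in> measurable (histM S n) (OmegaM S)"
  unfolding OmegaM_def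
proof (rule measurable_PiM_single')
  fix k
  have [measurable]: "snd \<in> measurable (histM S n) (SM S)" by (simp add: histM_def)
  have c: "(\<lambda>h. fst h i) \<in> measurable (histM S n) (SM S \<Otimes>\<^sub>M posR)" if "i < n" for i
    unfolding histM_def by (rule measurable_compose[OF measurable_fst measurable_component_singleton]) (use that in auto)
  have a: "(\<lambda>h. Some (if k < n then fst (fst h k) else snd h)) \<in> measurable (histM S n) (optM (SM S))"
    using c[of k] by (cases "k < n") (auto intro!: measurable_compose[OF _ Some_measurable_optM])
  have b: "(\<lambda>h. if k = 0 then 0 else ennreal (snd (fst h (k - 1)))) \<in> borel_measurable (histM S n)" if "k \<le> n"
  proof (cases "k = 0")
    case False
    then have [measurable]: "(\<lambda>h. fst h (k - 1)) \<in> measurable (histM S n) (SM S \<Otimes>\<^sub>M posR)" using c[of "k - 1"] that by auto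
    have "(\<lambda>h. snd (fst h (k - 1))) \<in> borel_measurable (histM S n)" by (rule measurable_compose[OF measurable_compose[OF _ measurable_snd] measurable_posR_borel]) measurable
    then show ?thesis using False by simp
  qed simp
  show "(\<lambda>h. hpath n h k) \<in> measurable (histM S n) PM"
    using a b by (cases "k \<le> n") (auto simp: hpath_def intro!: measurable_Pair)
qed (auto simp: space_pair_measure)

text \<open>On a good path of \<open>Omega\<close> the truncation depends on the history alone
  (\<open>cut_good\<close>); this is how path laws are reduced to laws of histories.\<close>

definition cut :: "nat \<Rightarrow> 's path \<Rightarrow> 's path" where
  "cut n \<omega> k = (if k \<le> n then \<omega> k else (None, \<top>))"

lemma cut_measurable[measurable]: "cut n \<in> measurable (OmegaM S) (OmegaM S)"
  unfolding OmegaM_def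
proof (rule measurable_PiM_single')
  fix k show "(\<lambda>\<omega>. cut n \<omega> k) \<in> measurable (PiM UNIV (\<lambda>_. PM)) PM"
    by (cases "k \<le> n") (auto simp: cut_def space_pair_measure)
qed (auto simp: space_pair_measure)

lemma cut_good: assumes "\<omega> \<in> Omega S" "good n \<omega>" shows "cut n \<omega> = hpath n (hst n \<omega>)"
proof
  fix k
  have z: "snd (\<omega> 0) = 0" using assms by (auto simp: Omega_def th_def)
  show "cut n \<omega> k = hpath n (hst n \<omega>) k"
  proof (cases "k \<le> n")
    case True
    have f: "fst (\<omega> k) = Some (unS (fst (\<omega> k)))" 
    proof -
      have "fst (\<omega> k) \<in> Some ` S" using assms(2) True by (simp add: good_def)
      then obtain x where "x \<in> S" "fst (\<omega> k) = Some x" by auto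
      then show ?thesis by simp
    qed
    have s: "snd (\<omega> k) = ennreal (unP (snd (\<omega> k)))" if "k \<noteq> 0"
    proof -
      have "0 < snd (\<omega> (Suc (k - 1))) \<and> snd (\<omega> (Suc (k - 1))) < \<top>" using assms(2) True that unfolding good_def by (metis One_nat_def Suc_pred lessThan_iff not_gr_zero less_eq_Suc_le)
      then show ?thesis using that by (simp add: unP_def)
    qed
    show ?thesis using True f s z by (auto simp: cut_def hpath_def hst_def prod_eq_iff)
  qed (simp add: cut_def hpath_def)
qed

end

section \<open>Laws of histories, computed from the policy\<close>

context ctmdp_policy
begin

text \<open>Law of the history up to the \<open>n\<close>-th jump on the event that this jump
  occurs; the lost mass belongs to paths that have stopped jumping. The constant
  \<open>undefined\<close> function is the only point of the empty product.\<close>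

primrec mh :: "nat \<Rightarrow> ((nat \<Rightarrow> 's \<times> real) \<times> 's) measure" where
  "mh 0 = distr \<gamma> (HM 0) (\<lambda>x. (\<lambda>_. undefined, x))"
| "mh (Suc n) = functional_measure (HM (Suc n)) (\<lambda>f. \<integral>\<^sup>+h. jump n h (\<lambda>w. f (hext n (h, w))) \<partial>mh n)"

lemma sets_mh[simp, measurable_cong]: "sets (mh n) = sets (HM n)"
  by (cases n) simp_all

lemma space_mh[simp]: "space (mh n) = space (HM n)"
  by (rule sets_eq_imp_space_eq) simp

lemma pos_functional_mh_Suc: "pos_functional (HM (Suc n)) (\<lambda>f. \<integral>\<^sup>+h. jump n h (\<lambda>w. f (hext n (h, w))) \<partial>mh n)"
proof (rule pos_functional_integral)
  fix h assume "h \<in> space (mh n)"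
  then have h: "h \<in> space (HM n)" by simp
  have "(\<lambda>w. hext n (h, w)) \<in> measurable (posR \<Otimes>\<^sub>M SM S) (HM (Suc n))"
    by (rule measurable_compose[OF measurable_Pair1'[OF h] hext_measurable])
  then show "pos_functional (HM (Suc n)) (\<lambda>f. jump n h (\<lambda>w. f (hext n (h, w))))"
    by (rule pos_functional_map[OF pos_functional_jump[OF h]])
next
  fix f :: "_ \<Rightarrow> ennreal" assume f: "f \<in> borel_measurable (HM (Suc n))"
  from measurable_jump[OF measurable_compose[OF hext_measurable f]]
  show "(\<lambda>h. jump n h (\<lambda>w. f (hext n (h, w)))) \<in> borel_measurable (mh n)" by simp
qed

lemma nn_integral_mh_Suc:
  "f \<in> borel_measurable (HM (Suc n)) \<Longrightarrow> (\<integral>\<^sup>+h. f h \<partial>mh (Suc n)) = (\<integral>\<^sup>+h. jump n h (\<lambda>w. f (hext n (h, w))) \<partial>mh n)"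
  unfolding mh.simps by (rule nn_integral_functional_measure[OF pos_functional_mh_Suc])

end

section \<open>Histories under an arbitrary strategic measure\<close>

locale strategic_measure = ctmdp_policy S A \<gamma> q pol for S :: "'s::polish_space set" and A :: "'b::polish_space set" and \<gamma> q pol +
  fixes P :: "'s path measure"
  assumes strat: "strategic S \<gamma> q pol P"
begin

lemma sets_P[measurable_cong]: "sets P = sets (OmegaM S)" and prob_P: "prob_space P" and AE_Omega: "AE \<omega> in P. \<omega> \<in> Omega S"
  using strat by (auto simp: strategic_def)

sublocale P: prob_space P by (rule prob_P)

lemma good_P[measurable]: "Measurable.pred P (good n)"
  using good_measurable[of n UNIV] unfolding measurable_cong_sets[OF sets_P refl] OmegaM_def by simp

lemma hst_P[measurable]: "hst n \<in> measurable P (HM n)"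
  using hst_measurable[of n UNIV] unfolding measurable_cong_sets[OF sets_P refl] OmegaM_def by simp

lemma fst_P[measurable]: "(\<lambda>\<omega>. fst (\<omega> k)) \<in> measurable P (optM (SM S))" and snd_P[measurable]: "(\<lambda>\<omega>. snd (\<omega> k)) \<in> borel_measurable P"
  using coord_measurable[of k UNIV] unfolding measurable_cong_sets[OF sets_P refl] OmegaM_def by simp_all

definition ig :: "nat \<Rightarrow> 's path \<Rightarrow> ennreal" where "ig n = indicator (Collect (good n))"
definition it :: "nat \<Rightarrow> 's path \<Rightarrow> ennreal" where "it n = indicator {\<omega>. 0 < snd (\<omega> (Suc n)) \<and> snd (\<omega> (Suc n)) < \<top>}"

lemma ig_measurable[measurable]: "ig n \<in> borel_measurable P" unfolding ig_def by (intro borel_measurable_indicator') measurable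
lemma it_measurable[measurable]: "it n \<in> borel_measurable P" unfolding it_def by (intro borel_measurable_indicator') measurable

text \<open>The law of the history as seen from \<open>P\<close>; the goal is to identify it with
  \<open>mh n\<close>.\<close>

definition mP :: "nat \<Rightarrow> ((nat \<Rightarrow> 's \<times> real) \<times> 's) measure" where
  "mP n = functional_measure (HM n) (\<lambda>f. \<integral>\<^sup>+\<omega>. ig n \<omega> * f (hst n \<omega>) \<partial>P)"

lemma sets_mP[simp, measurable_cong]: "sets (mP n) = sets (HM n)" and space_mP[simp]: "space (mP n) = space (HM n)"
  by (simp_all add: mP_def)

lemma nn_integral_mP: assumes [measurable]: "f \<in> borel_measurable (HM n)"
  shows "(\<integral>\<^sup>+h. f h \<partial>mP n) = (\<integral>\<^sup>+\<omega>. ig n \<omega> * f (hst n \<omega>) \<partial>P)"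
  unfolding mP_def
proof (rule nn_integral_functional_measure[OF _ assms], intro pos_functional_integral pos_functional_cmult pos_functional_eval)
  fix \<omega> assume "\<omega> \<in> space P" then show "hst n \<omega> \<in> space (HM n)" using measurable_space[OF hst_P] by blast
next
  fix f :: "_ \<Rightarrow> ennreal" assume [measurable]: "f \<in> borel_measurable (HM n)"
  show "(\<lambda>\<omega>. ig n \<omega> * f (hst n \<omega>)) \<in> borel_measurable P" by measurable
qed

lemma set_eq: assumes "H \<in> sets (HM n)"
  shows "{\<omega>\<in>space P. alive n \<omega> \<and> hist n \<omega> \<in> H \<and> R \<omega>} = {\<omega>\<in>space P. good n \<omega> \<and> hst n \<omega> \<in> H \<and> R \<omega>}"
  using alive_hist_iff[OF assms] by auto

lemma cond1: assumes H[measurable]: "H \<in> sets (HM n)" and t: "0 < t"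
  shows "(\<integral>\<^sup>+\<omega>. ig n \<omega> * indicator H (hst n \<omega>) * indicator {ennreal t..} (snd (\<omega> (Suc n))) \<partial>P) = (\<integral>\<^sup>+h. indicator H h * ew n (h, t) \<partial>mP n)"
proof -
  have ewm[measurable]: "(\<lambda>h. ew n (h, t)) \<in> borel_measurable (HM n)"
    using t by (intro measurable_compose[OF measurable_Pair2' measurable_ew]) simp
  have "(\<integral>\<^sup>+\<omega>. ig n \<omega> * indicator H (hst n \<omega>) * indicator {ennreal t..} (snd (\<omega> (Suc n))) \<partial>P)
      = (\<integral>\<^sup>+\<omega>. indicator {\<omega>\<in>space P. good n \<omega> \<and> hst n \<omega> \<in> H \<and> ennreal t \<le> th \<omega> (Suc n)} \<omega> \<partial>P)"
    by (intro nn_integral_cong) (auto simp: ig_def th_def split: split_indicator)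
  also have "\<dots> = emeasure P {\<omega>\<in>space P. good n \<omega> \<and> hst n \<omega> \<in> H \<and> ennreal t \<le> th \<omega> (Suc n)}"
    unfolding th_def by (intro nn_integral_indicator) measurable
  also have "\<dots> = emeasure P {\<omega>\<in>space P. alive n \<omega> \<and> hist n \<omega> \<in> H \<and> ennreal t \<le> th \<omega> (Suc n)}"
    by (simp only: set_eq[OF H])
  also have "\<dots> = (\<integral>\<^sup>+ \<omega>\<in>{\<omega>\<in>space P. alive n \<omega> \<and> hist n \<omega> \<in> H}.
           ennreal (exp (- (LINT s:{0<..t}|lborel. (\<integral>a. qx q (snd (hist n \<omega>)) a \<partial>(pol n (hist n \<omega>, s)))))) \<partial>P)"
    using strat H t unfolding strategic_def by blast
  also have "\<dots> = (\<integral>\<^sup>+\<omega>. ig n \<omega> * (indicator H (hst n \<omega>) * ew n (hst n \<omega>, t)) \<partial>P)"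
  proof (intro nn_integral_cong)
    fix \<omega> assume "\<omega> \<in> space P"
    have e: "(LINT s:{0<..t}|lborel. (\<integral>a. qx q (snd h) a \<partial>(pol n (h, s)))) = (LINT s:{0<..t}|lborel. lam n h s)" for h
      unfolding set_lebesgue_integral_def by (intro Bochner_Integration.integral_cong) (auto simp: lam_def split: split_indicator)
    show "ennreal (exp (- (LINT s:{0<..t}|lborel. (\<integral>a. qx q (snd (hist n \<omega>)) a \<partial>(pol n (hist n \<omega>, s)))))) *
       indicator {\<omega>\<in>space P. alive n \<omega> \<and> hist n \<omega> \<in> H} \<omega> = ig n \<omega> * (indicator H (hst n \<omega>) * ew n (hst n \<omega>, t))"
      using alive_hist_iff[OF H, of \<omega>] good_hist[of n \<omega>] \<open>\<omega> \<in> space P\<close> unfolding e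
      by (auto simp: ig_def ew_def surv_def split: split_indicator)
  qed
  also have "\<dots> = (\<integral>\<^sup>+h. indicator H h * ew n (h, t) \<partial>mP n)" by (subst nn_integral_mP) auto
  finally show ?thesis .
qed

lemma AE_theta_pos: "AE \<omega> in P. 0 < snd (\<omega> (Suc n))"
  using AE_Omega by eventually_elim (auto simp: Omega_def th_def)

lemma mP_mass: "(\<integral>\<^sup>+h. indicator H h * 1 \<partial>mP n) \<le> 1" if [measurable]: "H \<in> sets (HM n)"
proof -
  have "(\<integral>\<^sup>+h. indicator H h * 1 \<partial>mP n) \<le> (\<integral>\<^sup>+\<omega>. 1 \<partial>P)"
    by (subst nn_integral_mP) (auto intro!: nn_integral_mono simp del: nn_integral_const simp: ig_def split: split_indicator)
  then show ?thesis by (simp add: P.emeasure_space_1)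
qed

text \<open>The survival clause determines the law of a finite sojourn: on half-lines
  \<open>{..<t}\<close> both sides complement the survival probability, and half-lines generate the
  Borel sets. Infinite sojourns count on the survival side only.\<close>

lemma law_theta_H: assumes H[measurable]: "H \<in> sets (HM n)" and B: "B \<in> sets borel"
  shows "(\<integral>\<^sup>+\<omega>. ig n \<omega> * it n \<omega> * indicator H (hst n \<omega>) * indicator B (unP (snd (\<omega> (Suc n)))) \<partial>P)
    = (\<integral>\<^sup>+h. indicator H h * (\<integral>\<^sup>+s. ew n (h, s) * lamE n (h, s) * indicator B s \<partial>posL) \<partial>mP n)"
proof -
  have uP[measurable]: "(\<lambda>\<omega>. unP (snd (\<omega> (Suc n)))) \<in> borel_measurable P"
    by (rule measurable_compose[OF measurable_compose[OF snd_P unP_measurable] measurable_posR_borel])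
  define \<Phi>1 where "\<Phi>1 f = (\<integral>\<^sup>+\<omega>. ig n \<omega> * it n \<omega> * indicator H (hst n \<omega>) * f (unP (snd (\<omega> (Suc n)))) \<partial>P)" for f :: "real \<Rightarrow> ennreal"
  define \<Phi>2 where "\<Phi>2 f = (\<integral>\<^sup>+h. indicator H h * (\<integral>\<^sup>+s. ew n (h, s) * lamE n (h, s) * f s \<partial>posL) \<partial>mP n)" for f :: "real \<Rightarrow> ennreal"
  have p1: "pos_functional borel \<Phi>1" unfolding \<Phi>1_def
    by (intro pos_functional_integral pos_functional_cmult pos_functional_eval) auto
  have meas2: "(\<lambda>p. ew n p * lamE n p * f (snd p)) \<in> borel_measurable (HP n)" if f: "f \<in> borel_measurable borel" for f :: "real \<Rightarrow> ennreal"
  proof -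
    have [measurable]: "(\<lambda>p. f (snd p)) \<in> borel_measurable (HP n)" by (rule measurable_compose[OF measurable_compose[OF measurable_snd measurable_posR_borel] f])
    show ?thesis by measurable
  qed
  have p2: "pos_functional borel \<Phi>2" unfolding \<Phi>2_def
  proof (intro pos_functional_integral pos_functional_cmult pos_functional_eval)
    fix h and f :: "real \<Rightarrow> ennreal" assume "h \<in> space (mP n)" "f \<in> borel_measurable borel"
    then show "(\<lambda>s. ew n (h, s) * lamE n (h, s) * f s) \<in> borel_measurable posL"
      using measurable_HP_section[OF _ meas2] by simp
  next
    fix f :: "real \<Rightarrow> ennreal" assume f: "f \<in> borel_measurable borel"
    have [measurable]: "(\<lambda>h. \<integral>\<^sup>+s. ew n (h, s) * lamE n (h, s) * f s \<partial>posL) \<in> borel_measurable (HM n)"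
      using measurable_posL_integral[OF meas2[OF f]] by simp
    show "(\<lambda>h. indicator H h * (\<integral>\<^sup>+s. ew n (h, s) * lamE n (h, s) * f s \<partial>posL)) \<in> borel_measurable (mP n)" by measurable
  qed auto
  define K1 K2 where "K1 = functional_measure borel \<Phi>1" and "K2 = functional_measure borel \<Phi>2"
  have KB: "emeasure K1 X = \<Phi>1 (indicator X)" "emeasure K2 X = \<Phi>2 (indicator X)" if "X \<in> sets borel" for X
    unfolding K1_def K2_def using that by (auto intro: emeasure_functional_measure p1 p2)
  have fin: "\<Phi>1 (indicator X) \<le> 1" for X
  proof -
    have "\<Phi>1 (indicator X) \<le> (\<integral>\<^sup>+\<omega>. 1 \<partial>P)" unfolding \<Phi>1_def
      by (intro nn_integral_mono) (auto simp: ig_def it_def split: split_indicator)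
    then show ?thesis by (simp add: P.emeasure_space_1)
  qed
  have eq: "\<Phi>1 (indicator {..<t}) = \<Phi>2 (indicator {..<t})" for t
  proof (cases "0 < t")
    case False
    have "\<Phi>1 (indicator {..<t}) = (\<integral>\<^sup>+\<omega>. 0 \<partial>P)" unfolding \<Phi>1_def
    proof (intro nn_integral_cong)
      fix \<omega> :: "'s path"
      have "t \<le> unP (snd (\<omega> (Suc n)))" using False unP_pos[of "snd (\<omega> (Suc n))"] by linarith
      then show "ig n \<omega> * it n \<omega> * indicator H (hst n \<omega>) * indicator {..<t} (unP (snd (\<omega> (Suc n)))) = 0" by simp
    qed
    moreover have "\<Phi>2 (indicator {..<t}) = (\<integral>\<^sup>+h. 0 \<partial>mP n)" unfolding \<Phi>2_def
    proof (intro nn_integral_cong)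
      fix h
      have "(\<integral>\<^sup>+s. ew n (h, s) * lamE n (h, s) * indicator {..<t} s \<partial>posL) = (\<integral>\<^sup>+s. 0 \<partial>posL)"
        using False by (intro nn_integral_cong) (auto split: split_indicator)
      then show "indicator H h * (\<integral>\<^sup>+s. ew n (h, s) * lamE n (h, s) * indicator {..<t} s \<partial>posL) = 0" by simp
    qed
    ultimately show ?thesis by simp
  next
    case True
    have ewm[measurable]: "(\<lambda>h. ew n (h, t)) \<in> borel_measurable (HM n)"
      using True by (intro measurable_compose[OF measurable_Pair2' measurable_ew]) simp
    let ?E = "\<integral>\<^sup>+h. indicator H h * ew n (h, t) \<partial>mP n"
    \<comment> \<open>The survival part \<open>?E\<close> is added on both sides and cancelled at
      the end, where it is seen to be finite; this avoids subtraction in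
      \<open>ennreal\<close>.\<close>
    have "\<Phi>1 (indicator {..<t}) + ?E = (\<integral>\<^sup>+\<omega>. ig n \<omega> * it n \<omega> * indicator H (hst n \<omega>) * indicator {..<t} (unP (snd (\<omega> (Suc n))))
        + ig n \<omega> * indicator H (hst n \<omega>) * indicator {ennreal t..} (snd (\<omega> (Suc n))) \<partial>P)"
      unfolding \<Phi>1_def cond1[OF H True, symmetric] by (intro nn_integral_add[symmetric]) measurable
    also have "\<dots> = (\<integral>\<^sup>+\<omega>. ig n \<omega> * (indicator H (hst n \<omega>) * 1) \<partial>P)"
    proof (intro nn_integral_cong_AE)
      show "AE \<omega> in P. ig n \<omega> * it n \<omega> * indicator H (hst n \<omega>) * indicator {..<t} (unP (snd (\<omega> (Suc n))))
        + ig n \<omega> * indicator H (hst n \<omega>) * indicator {ennreal t..} (snd (\<omega> (Suc n))) = ig n \<omega> * (indicator H (hst n \<omega>) * 1)"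
        using AE_theta_pos[of n]
      proof eventually_elim
        case (elim \<omega>)
        have "it n \<omega> * indicator {..<t} (unP (snd (\<omega> (Suc n)))) + indicator {ennreal t..} (snd (\<omega> (Suc n))) = (1 :: ennreal)"
        proof (cases "snd (\<omega> (Suc n))")
          case (real r)
          then show ?thesis using elim True by (auto simp: it_def ennreal_le_iff split: split_indicator)
        qed (auto simp: it_def split: split_indicator)
        then have "ig n \<omega> * indicator H (hst n \<omega>) * (it n \<omega> * indicator {..<t} (unP (snd (\<omega> (Suc n)))) + indicator {ennreal t..} (snd (\<omega> (Suc n)))) = ig n \<omega> * indicator H (hst n \<omega>) * 1"
          by simp
        then show ?case by (simp add: distrib_left ac_simps)
      qed
    qed
    also have "\<dots> = (\<integral>\<^sup>+h. indicator H h * 1 \<partial>mP n)" by (subst nn_integral_mP) auto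
    also have "\<dots> = (\<integral>\<^sup>+h. indicator H h * (1 - ew n (h, t)) + indicator H h * ew n (h, t) \<partial>mP n)"
      using ew_le_1 by (intro nn_integral_cong) (auto simp: add_diff_inverse_ennreal add.commute split: split_indicator)
    also have "\<dots> = (\<integral>\<^sup>+h. indicator H h * (1 - ew n (h, t)) \<partial>mP n) + ?E" by (intro nn_integral_add) measurable
    also have "(\<integral>\<^sup>+h. indicator H h * (1 - ew n (h, t)) \<partial>mP n) = \<Phi>2 (indicator {..<t})" unfolding \<Phi>2_def
      using hazard_posL[OF _ True] by (intro nn_integral_cong) auto
    finally have "\<Phi>1 (indicator {..<t}) + ?E = \<Phi>2 (indicator {..<t}) + ?E" .
    moreover have "?E \<le> (\<integral>\<^sup>+h. indicator H h * 1 \<partial>mP n)" using ew_le_1 by (intro nn_integral_mono mult_left_mono) auto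
    then have "?E \<noteq> \<top>" using mP_mass[OF H] by (auto simp: top_unique)
    ultimately show ?thesis using ennreal_add_left_cancel[of ?E] by (auto simp: add.commute)
  qed
  have "K1 = K2"
  proof (rule measure_eqI_generator_eq[where E="range lessThan" and \<Omega>=UNIV and A="\<lambda>n. {..<real n}"])
    have "{..<a} \<inter> {..<b} = {..<min a b}" for a b :: real by auto
    then show "Int_stable (range lessThan :: real set set)" by (auto simp: Int_stable_def)
    show "sets K1 = sigma_sets UNIV (range lessThan)" "sets K2 = sigma_sets UNIV (range lessThan)"
      by (simp_all add: K1_def K2_def borel_Iio)
    show "(\<Union>n. {..<real n}) = UNIV" by (auto intro: reals_Archimedean2)
    show "emeasure K1 {..<real k} \<noteq> \<infinity>" for k using fin[of "{..<real k}"] by (auto simp: KB top_unique)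
    fix X :: "real set" assume "X \<in> range lessThan"
    then show "emeasure K1 X = emeasure K2 X" using eq by (auto simp: KB)
  qed auto
  then show ?thesis using KB[OF B] by (simp add: \<Phi>1_def \<Phi>2_def)
qed

lemma law_theta: assumes f: "f \<in> borel_measurable (HP n)"
  shows "(\<integral>\<^sup>+\<omega>. ig n \<omega> * it n \<omega> * f (hst n \<omega>, unP (snd (\<omega> (Suc n)))) \<partial>P)
    = (\<integral>\<^sup>+h. (\<integral>\<^sup>+s. ew n (h, s) * lamE n (h, s) * f (h, s) \<partial>posL) \<partial>mP n)"
proof -
  have uP[measurable]: "(\<lambda>\<omega>. unP (snd (\<omega> (Suc n)))) \<in> measurable P posR"
    by (rule measurable_compose[OF snd_P unP_measurable])
  define \<Phi>1 where "\<Phi>1 f = (\<integral>\<^sup>+\<omega>. ig n \<omega> * it n \<omega> * f (hst n \<omega>, unP (snd (\<omega> (Suc n)))) \<partial>P)" for f :: "_ \<Rightarrow> ennreal"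
  define \<Phi>2 where "\<Phi>2 f = (\<integral>\<^sup>+h. (\<integral>\<^sup>+s. ew n (h, s) * lamE n (h, s) * f (h, s) \<partial>posL) \<partial>mP n)" for f :: "_ \<Rightarrow> ennreal"
  have p1: "pos_functional (HP n) \<Phi>1" unfolding \<Phi>1_def
  proof (intro pos_functional_integral pos_functional_cmult pos_functional_eval)
    fix \<omega> assume "\<omega> \<in> space P"
    then show "(hst n \<omega>, unP (snd (\<omega> (Suc n)))) \<in> space (HP n)" using measurable_space[OF hst_P] measurable_space[OF uP]
      by (simp add: space_pair_measure)
  next
    fix f :: "_ \<Rightarrow> ennreal" assume [measurable]: "f \<in> borel_measurable (HP n)"
    show "(\<lambda>\<omega>. ig n \<omega> * it n \<omega> * f (hst n \<omega>, unP (snd (\<omega> (Suc n))))) \<in> borel_measurable P" by measurable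
  qed
  have p2: "pos_functional (HP n) \<Phi>2" unfolding \<Phi>2_def
  proof (intro pos_functional_integral pos_functional_cmult pos_functional_eval)
    fix h s assume "h \<in> space (mP n)" "s \<in> space posL"
    then show "(h, s) \<in> space (HP n)" by (simp add: space_pair_measure)
  next
    fix h and f :: "_ \<Rightarrow> ennreal" assume h: "h \<in> space (mP n)" and [measurable]: "f \<in> borel_measurable (HP n)"
    show "(\<lambda>s. ew n (h, s) * lamE n (h, s) * f (h, s)) \<in> borel_measurable posL"
      using measurable_HP_section[of h n "\<lambda>p. ew n p * lamE n p * f p"] h by simp
  next
    fix f :: "_ \<Rightarrow> ennreal" assume [measurable]: "f \<in> borel_measurable (HP n)"
    show "(\<lambda>h. \<integral>\<^sup>+s. ew n (h, s) * lamE n (h, s) * f (h, s) \<partial>posL) \<in> borel_measurable (mP n)"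
      using measurable_posL_integral[of "\<lambda>p. ew n p * lamE n p * f p" "HM n"] by simp
  qed
  have "functional_measure (HP n) \<Phi>1 = functional_measure (HP n) \<Phi>2"
  proof (rule measure_eqI_pair_finite)
    have "\<Phi>1 (indicator (space (HP n))) \<le> (\<integral>\<^sup>+\<omega>. 1 \<partial>P)" unfolding \<Phi>1_def
      by (intro nn_integral_mono) (auto simp: ig_def it_def split: split_indicator)
    then show "emeasure (functional_measure (HP n) \<Phi>1) (space (functional_measure (HP n) \<Phi>1)) \<noteq> \<infinity>"
      by (auto simp: emeasure_functional_measure[OF p1] P.emeasure_space_1 top_unique)
    fix H B assume H: "H \<in> sets (HM n)" and B: "B \<in> sets posR"
    then have Bb: "B \<in> sets borel" by (simp add: sets_posR_iff)
    have HB: "H \<times> B \<in> sets (HP n)" using H B by auto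
    have "\<Phi>1 (indicator (H \<times> B)) = (\<integral>\<^sup>+\<omega>. ig n \<omega> * it n \<omega> * indicator H (hst n \<omega>) * indicator B (unP (snd (\<omega> (Suc n)))) \<partial>P)"
      unfolding \<Phi>1_def by (intro nn_integral_cong) (simp add: indicator_times mult.assoc)
    also have "\<dots> = (\<integral>\<^sup>+h. indicator H h * (\<integral>\<^sup>+s. ew n (h, s) * lamE n (h, s) * indicator B s \<partial>posL) \<partial>mP n)"
      by (rule law_theta_H[OF H Bb])
    also have "\<dots> = \<Phi>2 (indicator (H \<times> B))" unfolding \<Phi>2_def
      by (intro nn_integral_cong) (auto simp: indicator_times split: split_indicator)
    finally show "emeasure (functional_measure (HP n) \<Phi>1) (H \<times> B) = emeasure (functional_measure (HP n) \<Phi>2) (H \<times> B)"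
      using HB by (simp add: emeasure_functional_measure[OF p1] emeasure_functional_measure[OF p2])
  qed simp_all
  then show ?thesis using nn_integral_functional_measure[OF p1 f] nn_integral_functional_measure[OF p2 f] by (simp add: \<Phi>1_def \<Phi>2_def)
qed
end

context ctmdp_policy
begin

lemma jump_ratio_eq:
  assumes h: "h \<in> space (HM n)" and s: "0 < s" and \<Gamma>: "\<Gamma> \<in> sets (SM S)"
  shows "ennreal (jump_ratio q (snd h) (pol n (h, s)) \<Gamma>) = (\<integral>\<^sup>+a. rate (snd h, a) * emeasure (Q (snd h, a)) \<Gamma> \<partial>pol n (h, s)) / lamE n (h, s)"
proof (cases "lamE n (h, s) = 0")
  case True
  then have "lam n h s = 0" using lam_props(1,2)[OF h s] by (metis ennreal_eq_0_iff order_antisym)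
  then have "jump_ratio q (snd h) (pol n (h, s)) \<Gamma> = 0" using s by (simp add: jump_ratio_def lam_def)
  moreover have "(\<integral>\<^sup>+a. rate (snd h, a) * emeasure (Q (snd h, a)) \<Gamma> \<partial>pol n (h, s)) = 0"
    using lamE_jump_ratio[OF h s \<Gamma>] True by simp
  ultimately show ?thesis by simp
next
  case False
  have "lamE n (h, s) \<noteq> \<top>" using lam_props(1)[OF h s] by (metis ennreal_neq_top)
  moreover have "(\<integral>\<^sup>+a. rate (snd h, a) * emeasure (Q (snd h, a)) \<Gamma> \<partial>pol n (h, s)) = ennreal (jump_ratio q (snd h) (pol n (h, s)) \<Gamma>) * lamE n (h, s)"
    unfolding lamE_jump_ratio[OF h s \<Gamma>, symmetric] by (rule mult.commute)
  ultimately show ?thesis using False by (simp add: ennreal_mult_divide_eq)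
qed

lemma jump_ratio_measurable:
  assumes \<Gamma>: "\<Gamma> \<in> sets (SM S)"
  shows "(\<lambda>p. ennreal (jump_ratio q (snd (fst p)) (pol n p) \<Gamma>)) \<in> borel_measurable (HP n)"
proof -
  have "(\<lambda>z. emeasure (Q z) \<Gamma>) \<in> borel_measurable SA"
    using measurable_compose[OF measurable_Q measurable_emeasure_subprob_algebra[OF \<Gamma>]] by simp
  then have [measurable]: "(\<lambda>p. \<integral>\<^sup>+a. rate (snd (fst p), a) * emeasure (Q (snd (fst p), a)) \<Gamma> \<partial>pol n p) \<in> borel_measurable (HP n)"
    using measurable_pol_integral[of "\<lambda>z. rate z * emeasure (Q z) \<Gamma>"] by simp
  have "(\<lambda>p. (\<integral>\<^sup>+a. rate (snd (fst p), a) * emeasure (Q (snd (fst p), a)) \<Gamma> \<partial>pol n p) / lamE n p) \<in> borel_measurable (HP n)" by measurable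
  then show ?thesis
  proof (rule measurable_cong[THEN iffD1, rotated])
    fix p :: "((nat \<Rightarrow> 's \<times> real) \<times> 's) \<times> real" assume "p \<in> space (HP n)"
    then have p: "fst p \<in> space (HM n)" "0 < snd p" by (auto simp: space_pair_measure)
    show "(\<integral>\<^sup>+a. rate (snd (fst p), a) * emeasure (Q (snd (fst p), a)) \<Gamma> \<partial>pol n p) / lamE n p = ennreal (jump_ratio q (snd (fst p)) (pol n p) \<Gamma>)"
      using jump_ratio_eq[OF p \<Gamma>] by simp
  qed
qed

lemma jump_rectangle:
  assumes h: "h \<in> space (HM n)" and B: "B \<in> sets posR" and \<Gamma>: "\<Gamma> \<in> sets (SM S)"
  shows "jump n h (indicator (B \<times> \<Gamma>)) = (\<integral>\<^sup>+s. ew n (h, s) * lamE n (h, s) * (indicator B s * ennreal (jump_ratio q (snd h) (pol n (h, s)) \<Gamma>)) \<partial>posL)"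
  unfolding jump_def
proof (intro nn_integral_cong)
  fix s assume "s \<in> space posL"
  then have s: "0 < s" by simp
  have "(\<integral>\<^sup>+y. indicator (B \<times> \<Gamma>) (s, y) \<partial>Q (snd h, a)) = indicator B s * emeasure (Q (snd h, a)) \<Gamma>" for a
    using \<Gamma> by (simp add: indicator_times nn_integral_cmult_indicator)
  then have "(\<integral>\<^sup>+a. rate (snd h, a) * (\<integral>\<^sup>+y. indicator (B \<times> \<Gamma>) (s, y) \<partial>Q (snd h, a)) \<partial>pol n (h, s))
    = indicator B s * (\<integral>\<^sup>+a. rate (snd h, a) * emeasure (Q (snd h, a)) \<Gamma> \<partial>pol n (h, s))"
    by (cases "s \<in> B") auto
  then show "ew n (h, s) * (\<integral>\<^sup>+a. rate (snd h, a) * (\<integral>\<^sup>+y. indicator (B \<times> \<Gamma>) (s, y) \<partial>Q (snd h, a)) \<partial>pol n (h, s))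
    = ew n (h, s) * lamE n (h, s) * (indicator B s * ennreal (jump_ratio q (snd h) (pol n (h, s)) \<Gamma>))"
    using lamE_jump_ratio[OF h s \<Gamma>, symmetric] by (simp add: ac_simps)
qed

end

context strategic_measure
begin

text \<open>The jump clause evaluates \<open>jump_ratio\<close> at the realized sojourn. Inserting
  the sojourn density from \<open>law_theta\<close> turns \<open>lamE * jump_ratio\<close> into the
  \<open>rate * Q\<close> of \<open>jump\<close>.\<close>

lemma cond2: assumes H[measurable]: "H \<in> sets (HM n)" and B: "B \<in> sets posR" and \<Gamma>[measurable]: "\<Gamma> \<in> sets (SM S)"
  shows "(\<integral>\<^sup>+\<omega>. ig (Suc n) \<omega> * indicator H (hst n \<omega>) * indicator (B \<times> \<Gamma>) (unP (snd (\<omega> (Suc n))), unS (fst (\<omega> (Suc n)))) \<partial>P)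
    = (\<integral>\<^sup>+h. indicator H h * jump n h (indicator (B \<times> \<Gamma>)) \<partial>mP n)"
proof -
  have Bb: "B \<in> sets borel" "B \<subseteq> {0<..}" using B by (auto simp: sets_posR_iff)
  have \<Gamma>S: "\<Gamma> \<subseteq> S" using sets.sets_into_space[OF \<Gamma>] by simp
  have im: "(\<theta> \<in> ennreal ` B) \<longleftrightarrow> (0 < \<theta> \<and> \<theta> < \<top> \<and> unP \<theta> \<in> B)" for \<theta>
  proof
    assume "\<theta> \<in> ennreal ` B" then show "0 < \<theta> \<and> \<theta> < \<top> \<and> unP \<theta> \<in> B" using Bb(2) by (auto simp: subset_iff)
  next
    assume "0 < \<theta> \<and> \<theta> < \<top> \<and> unP \<theta> \<in> B" then show "\<theta> \<in> ennreal ` B" by (auto simp: unP_def image_iff intro!: bexI[of _ "enn2real \<theta>"])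
  qed
  have imS: "(w \<in> Some ` \<Gamma>) \<longleftrightarrow> w \<in> Some ` S \<and> unS w \<in> \<Gamma>" for w using \<Gamma>S by (auto simp: unS_def)
  have [measurable]: "Some ` \<Gamma> \<in> sets (optM (SM S))" by (rule Some_image_sets_optM[OF \<Gamma>])
  have [measurable]: "ennreal ` B \<in> sets borel"
  proof -
    have "ennreal ` B = {\<theta>. 0 < \<theta> \<and> \<theta> < \<top> \<and> unP \<theta> \<in> B}" using im by auto
    also have "\<dots> \<in> sets borel" using B by measurable
    finally show ?thesis .
  qed
  have "(\<integral>\<^sup>+\<omega>. ig (Suc n) \<omega> * indicator H (hst n \<omega>) * indicator (B \<times> \<Gamma>) (unP (snd (\<omega> (Suc n))), unS (fst (\<omega> (Suc n)))) \<partial>P)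
     = (\<integral>\<^sup>+\<omega>. indicator {\<omega>\<in>space P. good n \<omega> \<and> hst n \<omega> \<in> H \<and> th \<omega> (Suc n) \<in> ennreal ` B \<and> xs \<omega> (Suc n) \<in> Some ` \<Gamma>} \<omega> \<partial>P)"
    by (intro nn_integral_cong) (auto simp: ig_def good_Suc th_def xs_def im imS split: split_indicator)
  also have "\<dots> = emeasure P {\<omega>\<in>space P. good n \<omega> \<and> hst n \<omega> \<in> H \<and> th \<omega> (Suc n) \<in> ennreal ` B \<and> xs \<omega> (Suc n) \<in> Some ` \<Gamma>}"
    unfolding th_def xs_def by (intro nn_integral_indicator) measurable
  also have "\<dots> = emeasure P {\<omega>\<in>space P. alive n \<omega> \<and> hist n \<omega> \<in> H \<and> th \<omega> (Suc n) \<in> ennreal ` B \<and> xs \<omega> (Suc n) \<in> Some ` \<Gamma>}"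
    by (simp only: set_eq[OF H])
  also have "\<dots> = (\<integral>\<^sup>+ \<omega>\<in>{\<omega>\<in>space P. alive n \<omega> \<and> hist n \<omega> \<in> H \<and> th \<omega> (Suc n) \<in> ennreal ` B}.
           ennreal (jump_ratio q (snd (hist n \<omega>)) (pol n (hist n \<omega>, enn2real (th \<omega> (Suc n)))) \<Gamma>) \<partial>P)"
    using strat H Bb \<Gamma> unfolding strategic_def by blast
  also have "\<dots> = (\<integral>\<^sup>+\<omega>. ig n \<omega> * it n \<omega> * (indicator H (hst n \<omega>) * indicator B (unP (snd (\<omega> (Suc n)))) *
      ennreal (jump_ratio q (snd (hst n \<omega>)) (pol n (hst n \<omega>, unP (snd (\<omega> (Suc n))))) \<Gamma>)) \<partial>P)"
  proof (intro nn_integral_cong)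
    fix \<omega> assume "\<omega> \<in> space P"
    then show "ennreal (jump_ratio q (snd (hist n \<omega>)) (pol n (hist n \<omega>, enn2real (th \<omega> (Suc n)))) \<Gamma>) *
        indicator {\<omega>\<in>space P. alive n \<omega> \<and> hist n \<omega> \<in> H \<and> th \<omega> (Suc n) \<in> ennreal ` B} \<omega>
      = ig n \<omega> * it n \<omega> * (indicator H (hst n \<omega>) * indicator B (unP (snd (\<omega> (Suc n)))) *
      ennreal (jump_ratio q (snd (hst n \<omega>)) (pol n (hst n \<omega>, unP (snd (\<omega> (Suc n))))) \<Gamma>))"
      using alive_hist_iff[OF H, of \<omega>] good_hist[of n \<omega>] im[of "snd (\<omega> (Suc n))"]
      by (cases "good n \<omega> \<and> hst n \<omega> \<in> H \<and> snd (\<omega> (Suc n)) \<in> ennreal ` B") (auto simp: ig_def it_def th_def unP_def split: split_indicator)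
  qed
  also have "\<dots> = (\<integral>\<^sup>+h. (\<integral>\<^sup>+s. ew n (h, s) * lamE n (h, s) * (indicator H h * indicator B s * ennreal (jump_ratio q (snd h) (pol n (h, s)) \<Gamma>)) \<partial>posL) \<partial>mP n)"
  proof -
    have [measurable]: "(\<lambda>p. ennreal (jump_ratio q (snd (fst p)) (pol n p) \<Gamma>)) \<in> borel_measurable (HP n)" by (rule jump_ratio_measurable[OF \<Gamma>])
    have "(\<lambda>p. indicator H (fst p) * indicator B (snd p) * ennreal (jump_ratio q (snd (fst p)) (pol n p) \<Gamma>)) \<in> borel_measurable (HP n)" using B by measurable
    from law_theta[OF this] show ?thesis by simp
  qed
  also have "\<dots> = (\<integral>\<^sup>+h. indicator H h * jump n h (indicator (B \<times> \<Gamma>)) \<partial>mP n)"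
    by (intro nn_integral_cong) (auto simp: jump_rectangle[OF _ B \<Gamma>] split: split_indicator)
  finally show ?thesis .
qed

lemma uP_P[measurable]: "(\<lambda>\<omega>. unP (snd (\<omega> (Suc n)))) \<in> measurable P posR" and uS_P[measurable]: "(\<lambda>\<omega>. unS (fst (\<omega> (Suc n)))) \<in> measurable P (SM S)"
  by (rule measurable_compose[OF snd_P unP_measurable], rule measurable_compose[OF fst_P unS_measurable])

text \<open>For a fixed \<open>H\<close> both sides are finite measures in \<open>b\<close>, so the
  rectangles treated in \<open>cond2\<close> suffice.\<close>

lemma law_jump_H: assumes H[measurable]: "H \<in> sets (HM n)" and b: "b \<in> sets (posR \<Otimes>\<^sub>M SM S)"
  shows "(\<integral>\<^sup>+\<omega>. ig (Suc n) \<omega> * indicator H (hst n \<omega>) * indicator b (unP (snd (\<omega> (Suc n))), unS (fst (\<omega> (Suc n)))) \<partial>P)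
    = (\<integral>\<^sup>+h. indicator H h * jump n h (indicator b) \<partial>mP n)"
proof -
  define \<Phi>1 where "\<Phi>1 f = (\<integral>\<^sup>+\<omega>. ig (Suc n) \<omega> * indicator H (hst n \<omega>) * f (unP (snd (\<omega> (Suc n))), unS (fst (\<omega> (Suc n)))) \<partial>P)" for f :: "_ \<Rightarrow> ennreal"
  define \<Phi>2 where "\<Phi>2 f = (\<integral>\<^sup>+h. indicator H h * jump n h f \<partial>mP n)" for f :: "_ \<Rightarrow> ennreal"
  have p1: "pos_functional (posR \<Otimes>\<^sub>M SM S) \<Phi>1" unfolding \<Phi>1_def
  proof (intro pos_functional_integral pos_functional_cmult pos_functional_eval)
    fix \<omega> assume "\<omega> \<in> space P"
    then show "(unP (snd (\<omega> (Suc n))), unS (fst (\<omega> (Suc n)))) \<in> space (posR \<Otimes>\<^sub>M SM S)"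
      using measurable_space[OF uP_P] measurable_space[OF uS_P] by (simp add: space_pair_measure)
  next
    fix f :: "_ \<Rightarrow> ennreal" assume [measurable]: "f \<in> borel_measurable (posR \<Otimes>\<^sub>M SM S)"
    show "(\<lambda>\<omega>. ig (Suc n) \<omega> * indicator H (hst n \<omega>) * f (unP (snd (\<omega> (Suc n))), unS (fst (\<omega> (Suc n))))) \<in> borel_measurable P" by measurable
  qed
  have p2: "pos_functional (posR \<Otimes>\<^sub>M SM S) \<Phi>2" unfolding \<Phi>2_def
  proof (rule pos_functional_integral[OF pos_functional_cmult[OF pos_functional_jump]])
    fix f :: "_ \<Rightarrow> ennreal" assume [measurable]: "f \<in> borel_measurable (posR \<Otimes>\<^sub>M SM S)"
    have [measurable]: "(\<lambda>h. jump n h f) \<in> borel_measurable (HM n)" using measurable_jump[of "\<lambda>z. f (snd z)" n] by simp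
    show "(\<lambda>h. indicator H h * jump n h f) \<in> borel_measurable (mP n)" by measurable
  qed simp
  have "functional_measure (posR \<Otimes>\<^sub>M SM S) \<Phi>1 = functional_measure (posR \<Otimes>\<^sub>M SM S) \<Phi>2"
  proof (rule measure_eqI_pair_finite)
    have "\<Phi>1 (indicator (space (posR \<Otimes>\<^sub>M SM S))) \<le> (\<integral>\<^sup>+\<omega>. 1 \<partial>P)" unfolding \<Phi>1_def
      by (intro nn_integral_mono) (auto simp: ig_def split: split_indicator)
    then show "emeasure (functional_measure (posR \<Otimes>\<^sub>M SM S) \<Phi>1) (space (functional_measure (posR \<Otimes>\<^sub>M SM S) \<Phi>1)) \<noteq> \<infinity>"
      by (auto simp: emeasure_functional_measure[OF p1] P.emeasure_space_1 top_unique)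
    fix B \<Gamma> assume "B \<in> sets posR" "\<Gamma> \<in> sets (SM S)"
    then show "emeasure (functional_measure (posR \<Otimes>\<^sub>M SM S) \<Phi>1) (B \<times> \<Gamma>) = emeasure (functional_measure (posR \<Otimes>\<^sub>M SM S) \<Phi>2) (B \<times> \<Gamma>)"
      using cond2[OF H] by (simp add: emeasure_functional_measure[OF p1] emeasure_functional_measure[OF p2] \<Phi>1_def \<Phi>2_def)
  qed simp_all
  then show ?thesis using emeasure_functional_measure[OF p1 b] emeasure_functional_measure[OF p2 b] by (simp add: \<Phi>1_def \<Phi>2_def)
qed

lemma law_jump: assumes f: "f \<in> borel_measurable (HM n \<Otimes>\<^sub>M (posR \<Otimes>\<^sub>M SM S))"
  shows "(\<integral>\<^sup>+\<omega>. ig (Suc n) \<omega> * f (hst n \<omega>, (unP (snd (\<omega> (Suc n))), unS (fst (\<omega> (Suc n))))) \<partial>P) = (\<integral>\<^sup>+h. jump n h (\<lambda>w. f (h, w)) \<partial>mP n)"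
proof -
  let ?N = "HM n \<Otimes>\<^sub>M (posR \<Otimes>\<^sub>M SM S)"
  define \<Phi>1 where "\<Phi>1 f = (\<integral>\<^sup>+\<omega>. ig (Suc n) \<omega> * f (hst n \<omega>, (unP (snd (\<omega> (Suc n))), unS (fst (\<omega> (Suc n))))) \<partial>P)" for f :: "_ \<Rightarrow> ennreal"
  define \<Phi>2 where "\<Phi>2 f = (\<integral>\<^sup>+h. jump n h (\<lambda>w. f (h, w)) \<partial>mP n)" for f :: "_ \<Rightarrow> ennreal"
  have p1: "pos_functional ?N \<Phi>1" unfolding \<Phi>1_def
  proof (intro pos_functional_integral pos_functional_cmult pos_functional_eval)
    fix \<omega> assume "\<omega> \<in> space P"
    then show "(hst n \<omega>, (unP (snd (\<omega> (Suc n))), unS (fst (\<omega> (Suc n))))) \<in> space ?N"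
      using measurable_space[OF uP_P] measurable_space[OF uS_P] measurable_space[OF hst_P] by (simp add: space_pair_measure)
  next
    fix f :: "_ \<Rightarrow> ennreal" assume [measurable]: "f \<in> borel_measurable ?N"
    show "(\<lambda>\<omega>. ig (Suc n) \<omega> * f (hst n \<omega>, (unP (snd (\<omega> (Suc n))), unS (fst (\<omega> (Suc n)))))) \<in> borel_measurable P" by measurable
  qed
  have p2: "pos_functional ?N \<Phi>2" unfolding \<Phi>2_def
  proof (rule pos_functional_integral)
    fix h assume "h \<in> space (mP n)"
    then have h: "h \<in> space (HM n)" by simp
    show "pos_functional ?N (\<lambda>f. jump n h (\<lambda>w. f (h, w)))"
      by (rule pos_functional_map[OF pos_functional_jump[OF h] measurable_Pair1'[OF h]])
  next
    fix f :: "_ \<Rightarrow> ennreal" assume "f \<in> borel_measurable ?N"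
    from measurable_jump[OF this] show "(\<lambda>h. jump n h (\<lambda>w. f (h, w))) \<in> borel_measurable (mP n)" by simp
  qed
  have "functional_measure ?N \<Phi>1 = functional_measure ?N \<Phi>2"
  proof (rule measure_eqI_pair_finite)
    have "\<Phi>1 (indicator (space ?N)) \<le> (\<integral>\<^sup>+\<omega>. 1 \<partial>P)" unfolding \<Phi>1_def
      by (intro nn_integral_mono) (auto simp: ig_def split: split_indicator)
    then show "emeasure (functional_measure ?N \<Phi>1) (space (functional_measure ?N \<Phi>1)) \<noteq> \<infinity>"
      by (auto simp: emeasure_functional_measure[OF p1] P.emeasure_space_1 top_unique)
    fix H b assume H: "H \<in> sets (HM n)" and b: "b \<in> sets (posR \<Otimes>\<^sub>M SM S)"
    then have Hb: "H \<times> b \<in> sets ?N" by auto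
    have "\<Phi>1 (indicator (H \<times> b)) = (\<integral>\<^sup>+\<omega>. ig (Suc n) \<omega> * indicator H (hst n \<omega>) * indicator b (unP (snd (\<omega> (Suc n))), unS (fst (\<omega> (Suc n)))) \<partial>P)"
      unfolding \<Phi>1_def by (intro nn_integral_cong) (simp add: indicator_times mult.assoc)
    also have "\<dots> = (\<integral>\<^sup>+h. indicator H h * jump n h (indicator b) \<partial>mP n)" by (rule law_jump_H[OF H b])
    also have "\<dots> = \<Phi>2 (indicator (H \<times> b))" unfolding \<Phi>2_def
    proof (intro nn_integral_cong)
      fix h assume "h \<in> space (mP n)"
      then have p: "pos_functional (posR \<Otimes>\<^sub>M SM S) (jump n h)" by (intro pos_functional_jump) simp
      have "jump n h (\<lambda>w. indicator (H \<times> b) (h, w)) = jump n h (\<lambda>w. indicator H h * indicator b w)" by (simp add: indicator_times)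
      also have "\<dots> = indicator H h * jump n h (indicator b)" using b by (intro pos_functionalD(3)[OF p]) simp
      finally show "indicator H h * jump n h (indicator b) = jump n h (\<lambda>w. indicator (H \<times> b) (h, w))" by simp
    qed
    finally show "emeasure (functional_measure ?N \<Phi>1) (H \<times> b) = emeasure (functional_measure ?N \<Phi>2) (H \<times> b)"
      using Hb by (simp add: emeasure_functional_measure[OF p1] emeasure_functional_measure[OF p2])
  qed simp_all
  then show ?thesis using nn_integral_functional_measure[OF p1 f] nn_integral_functional_measure[OF p2 f] by (simp add: \<Phi>1_def \<Phi>2_def)
qed

text \<open>By \<open>law_jump\<close>, the next jump given the history has the same law under every
  strategic measure, so \<open>mP\<close> satisfies the recursion that defines
  \<open>mh\<close>.\<close>

lemma mP_eq_mh: "mP n = mh n"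
proof (induction n)
  case 0
  show ?case
  proof (rule measure_eqI)
    fix X assume "X \<in> sets (mP 0)"
    then have X[measurable]: "X \<in> sets (HM 0)" by simp
    have T: "(\<lambda>x. (\<lambda>_. undefined, x)) \<in> measurable (SM S) (HM 0)"
      unfolding histM_def by (intro measurable_Pair) (auto intro!: measurable_const simp: space_PiM)
    define \<Gamma> where "\<Gamma> = (\<lambda>x. (\<lambda>_. undefined, x)) -` X \<inter> S"
    have \<Gamma>: "\<Gamma> \<in> sets (SM S)" using measurable_sets[OF T X] by (simp add: \<Gamma>_def)
    have [measurable]: "Some ` \<Gamma> \<in> sets (optM (SM S))" by (rule Some_image_sets_optM[OF \<Gamma>])
    have "emeasure (mP 0) X = (\<integral>\<^sup>+h. indicator X h \<partial>mP 0)" by simp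
    also have "\<dots> = (\<integral>\<^sup>+\<omega>. ig 0 \<omega> * indicator X (hst 0 \<omega>) \<partial>P)" by (rule nn_integral_mP) measurable
    also have "\<dots> = (\<integral>\<^sup>+\<omega>. indicator {\<omega>\<in>space P. xs \<omega> 0 \<in> Some ` \<Gamma>} \<omega> \<partial>P)"
      by (intro nn_integral_cong) (auto simp: ig_def good_def hst_def restrict_def xs_def \<Gamma>_def split: split_indicator)
    also have "\<dots> = emeasure P {\<omega>\<in>space P. xs \<omega> 0 \<in> Some ` \<Gamma>}" unfolding xs_def by (intro nn_integral_indicator) measurable
    also have "\<dots> = emeasure \<gamma> \<Gamma>" using strat \<Gamma> unfolding strategic_def by blast
    also have "\<dots> = emeasure (mh 0) X"
      using T X sets_eq_imp_space_eq[OF gamma(2)] by (simp add: emeasure_distr measurable_cong_sets[OF gamma(2) refl] \<Gamma>_def)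
    finally show "emeasure (mP 0) X = emeasure (mh 0) X" .
  qed simp
next
  case (Suc n)
  show ?case
  proof (rule measure_eqI)
    fix X assume "X \<in> sets (mP (Suc n))"
    then have X[measurable]: "X \<in> sets (HM (Suc n))" by simp
    have "emeasure (mP (Suc n)) X = (\<integral>\<^sup>+h. indicator X h \<partial>mP (Suc n))" by simp
    also have "\<dots> = (\<integral>\<^sup>+\<omega>. ig (Suc n) \<omega> * indicator X (hst (Suc n) \<omega>) \<partial>P)" by (rule nn_integral_mP) measurable
    also have "\<dots> = (\<integral>\<^sup>+h. jump n h (\<lambda>w. indicator X (hext n (h, w))) \<partial>mP n)"
      unfolding hst_Suc by (rule law_jump[of "\<lambda>z. indicator X (hext n z)"]) measurable
    also have "\<dots> = (\<integral>\<^sup>+h. indicator X h \<partial>mh (Suc n))" unfolding Suc by (rule nn_integral_mh_Suc[symmetric]) simp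
    also have "\<dots> = emeasure (mh (Suc n)) X" by (rule nn_integral_indicator) simp
    finally show "emeasure (mP (Suc n)) X = emeasure (mh (Suc n)) X" .
  qed (simp del: mh.simps)
qed

lemma nn_integral_hist: "f \<in> borel_measurable (HM n) \<Longrightarrow> (\<integral>\<^sup>+\<omega>. ig n \<omega> * f (hst n \<omega>) \<partial>P) = (\<integral>\<^sup>+h. f h \<partial>mh n)"
  using nn_integral_mP[of f n] by (simp add: mP_eq_mh)

end

section \<open>Uniqueness of the strategic measure\<close>

context ctmdp_policy
begin

text \<open>The law of a truncated path in terms of \<open>mh\<close> alone. Truncations at
  \<open>n\<close> and at \<open>Suc n\<close> differ only on paths that make the jump number
  \<open>Suc n\<close>: there the new contribution is added and the old one removed. The addition
  comes first, so that the subtraction in \<open>ennreal\<close> is exact for bounded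
  \<open>F\<close>.\<close>

primrec cut_law :: "nat \<Rightarrow> ('s path \<Rightarrow> ennreal) \<Rightarrow> ennreal" where
  "cut_law 0 F = (\<integral>\<^sup>+h. F (hpath 0 h) \<partial>mh 0)"
| "cut_law (Suc n) F = ((\<integral>\<^sup>+h. F (hpath (Suc n) h) \<partial>mh (Suc n)) + cut_law n F) - (\<integral>\<^sup>+h. F (cut n (hpath (Suc n) h)) \<partial>mh (Suc n))"

end

lemma (in strategic_measure) cut_law:
  assumes F[measurable]: "F \<in> borel_measurable (OmegaM S)" and F1: "\<And>\<omega>. F \<omega> \<le> 1"
  shows "(\<integral>\<^sup>+\<omega>. F (cut n \<omega>) \<partial>P) = cut_law n F"
proof (induction n)
  case 0
  have "(\<integral>\<^sup>+\<omega>. F (cut 0 \<omega>) \<partial>P) = (\<integral>\<^sup>+\<omega>. ig 0 \<omega> * F (hpath 0 (hst 0 \<omega>)) \<partial>P)"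
  proof (intro nn_integral_cong_AE)
    show "AE \<omega> in P. F (cut 0 \<omega>) = ig 0 \<omega> * F (hpath 0 (hst 0 \<omega>))"
      using AE_Omega
    proof eventually_elim
      case (elim \<omega>)
      then have "good 0 \<omega>" by (auto simp: Omega_def good_def xs_def)
      then show ?case using cut_good[OF elim, of 0] by (simp add: ig_def)
    qed
  qed
  also have "\<dots> = (\<integral>\<^sup>+h. F (hpath 0 h) \<partial>mh 0)" by (rule nn_integral_hist) measurable
  finally show ?case by simp
next
  case (Suc n)
  let ?a = "\<integral>\<^sup>+h. F (cut n (hpath (Suc n) h)) \<partial>mh (Suc n)"
  have a: "?a = (\<integral>\<^sup>+\<omega>. ig (Suc n) \<omega> * F (cut n (hpath (Suc n) (hst (Suc n) \<omega>))) \<partial>P)" by (rule nn_integral_hist[symmetric]) measurable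
  have b: "(\<integral>\<^sup>+h. F (hpath (Suc n) h) \<partial>mh (Suc n)) = (\<integral>\<^sup>+\<omega>. ig (Suc n) \<omega> * F (hpath (Suc n) (hst (Suc n) \<omega>)) \<partial>P)" by (rule nn_integral_hist[symmetric]) measurable
  have "(\<integral>\<^sup>+\<omega>. F (cut (Suc n) \<omega>) \<partial>P) + ?a = (\<integral>\<^sup>+\<omega>. F (cut (Suc n) \<omega>) + ig (Suc n) \<omega> * F (cut n (hpath (Suc n) (hst (Suc n) \<omega>))) \<partial>P)"
    unfolding a by (rule nn_integral_add[symmetric]) measurable
  also have "\<dots> = (\<integral>\<^sup>+\<omega>. ig (Suc n) \<omega> * F (hpath (Suc n) (hst (Suc n) \<omega>)) + F (cut n \<omega>) \<partial>P)"
  proof (intro nn_integral_cong_AE)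
    show "AE \<omega> in P. F (cut (Suc n) \<omega>) + ig (Suc n) \<omega> * F (cut n (hpath (Suc n) (hst (Suc n) \<omega>))) = ig (Suc n) \<omega> * F (hpath (Suc n) (hst (Suc n) \<omega>)) + F (cut n \<omega>)"
      using AE_Omega
    proof eventually_elim
      case (elim \<omega>)
      show ?case
      proof (cases "good (Suc n) \<omega>")
        case True
        have "cut n (cut (Suc n) \<omega>) = cut n \<omega>" by (auto simp: cut_def fun_eq_iff)
        then have "cut n (hpath (Suc n) (hst (Suc n) \<omega>)) = cut n \<omega>" by (simp add: cut_good[OF elim True, symmetric])
        then show ?thesis using True by (simp add: ig_def cut_good[OF elim True])
      next
        case False
        then have "cut (Suc n) \<omega> = cut n \<omega>" using Omega_dead[OF elim False] by (auto simp: cut_def fun_eq_iff le_Suc_eq)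
        then show ?thesis using False by (simp add: ig_def)
      qed
    qed
  qed
  also have "\<dots> = (\<integral>\<^sup>+h. F (hpath (Suc n) h) \<partial>mh (Suc n)) + cut_law n F"
    unfolding b Suc[symmetric] by (rule nn_integral_add) measurable
  finally have eq: "(\<integral>\<^sup>+\<omega>. F (cut (Suc n) \<omega>) \<partial>P) + ?a = (\<integral>\<^sup>+h. F (hpath (Suc n) h) \<partial>mh (Suc n)) + cut_law n F" .
  have "?a \<le> (\<integral>\<^sup>+\<omega>. 1 \<partial>P)" unfolding a
    by (intro nn_integral_mono) (use F1 in \<open>auto simp: ig_def split: split_indicator\<close>)
  then have "?a \<noteq> \<top>" by (auto simp: P.emeasure_space_1 top_unique)
  then have "(\<integral>\<^sup>+\<omega>. F (cut (Suc n) \<omega>) \<partial>P) = ((\<integral>\<^sup>+\<omega>. F (cut (Suc n) \<omega>) \<partial>P) + ?a) - ?a" by (simp add: ennreal_add_diff_cancel_right)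
  then show ?case unfolding eq by (simp del: mh.simps)
qed

text \<open>A cylinder over finitely many coordinates is unaffected by a late truncation, and
  \<open>cut_law\<close> depends on the policy but not on the strategic measure.\<close>

lemma (in ctmdp_policy) strategic_unique:
  assumes "strategic S \<gamma> q pol P" "strategic S \<gamma> q pol P'"
  shows "P = P'"
proof -
  interpret P: strategic_measure S A \<gamma> q pol P by unfold_locales fact
  interpret P': strategic_measure S A \<gamma> q pol P' by unfold_locales fact
  show ?thesis
  proof (rule measure_eqI_PiM_infinite[where I=UNIV and M="\<lambda>_. PM"])
    show "sets P = sets (PiM UNIV (\<lambda>_. PM))" "sets P' = sets (PiM UNIV (\<lambda>_. PM))"
      using P.sets_P P'.sets_P by (simp_all add: OmegaM_def)
    show "finite_measure P" by unfold_locales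
    fix X and J :: "nat set" assume J: "finite J" and X: "\<And>i. i \<in> J \<Longrightarrow> X i \<in> sets PM"
    define E where "E = prod_emb UNIV (\<lambda>_. PM) J (Pi\<^sub>E J X)"
    have Em: "E \<in> sets (OmegaM S)" unfolding E_def OmegaM_def using J X by (intro sets_PiM_I_finite[of J, THEN measurable_prod_emb[of J UNIV, rotated]] | auto)+
    obtain n where n: "\<And>i. i \<in> J \<Longrightarrow> i \<le> n" using J by (metis finite_nat_set_iff_bounded_le)
    have ind: "indicator E (cut n \<omega>) = (indicator E \<omega> :: ennreal)" for \<omega>
    proof -
      have "restrict (cut n \<omega>) J = restrict \<omega> J" using n by (auto simp: cut_def restrict_def fun_eq_iff)
      then have "cut n \<omega> \<in> E \<longleftrightarrow> \<omega> \<in> E" by (auto simp: E_def prod_emb_def space_pair_measure)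
      then show ?thesis by (simp split: split_indicator)
    qed
    have "emeasure P E = (\<integral>\<^sup>+\<omega>. indicator E (cut n \<omega>) \<partial>P)" unfolding ind using Em P.sets_P by simp
    also have "\<dots> = (\<integral>\<^sup>+\<omega>. indicator E (cut n \<omega>) \<partial>P')"
      using Em P.cut_law[of "indicator E" n] P'.cut_law[of "indicator E" n] by (simp split: split_indicator)
    also have "\<dots> = emeasure P' E" unfolding ind using Em P'.sets_P by simp
    finally show "emeasure P (prod_emb UNIV (\<lambda>_. PM) J (Pi\<^sub>E J X)) = emeasure P' (prod_emb UNIV (\<lambda>_. PM) J (Pi\<^sub>E J X))" by (simp add: E_def)
  qed
qed

section \<open>Existence of the strategic measure by the Ionescu-Tulcea theorem\<close>

context ctmdp
begin

lemma good_hst_cong: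
  assumes "\<And>k. k \<le> n \<Longrightarrow> \<omega> k = \<omega>' k" shows "good n \<omega> = good n \<omega>'" "hst n \<omega> = hst n \<omega>'"
proof -
  have "good n \<omega> = good n \<omega>'" unfolding good_def using assms by (auto simp: Suc_le_eq)
  moreover have "hst n \<omega> = hst n \<omega>'" unfolding hst_def using assms by (auto simp: restrict_def fun_eq_iff)
  ultimately show "good n \<omega> = good n \<omega>'" "hst n \<omega> = hst n \<omega>'" .
qed

lemma dead_sets[measurable]: "{(None, \<top>)} \<in> sets PM"
proof -
  have "{None} \<times> {\<top> :: ennreal} \<in> sets PM" by (intro pair_measureI) auto
  then show ?thesis by simp
qed

lemma space_PM[simp]: "space PM = UNIV" by (simp add: space_pair_measure)

end

context ctmdp_policy
begin

text \<open>One step of the path: the jump law, completed to a probability by sending the mass of an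
  infinite sojourn to the dead state.\<close>

definition KK :: "nat \<Rightarrow> (nat \<Rightarrow> 's \<times> real) \<times> 's \<Rightarrow> ('s option \<times> ennreal) measure" where
  "KK n h = functional_measure PM (\<lambda>f. jump n h (\<lambda>w. f (Some (snd w), ennreal (fst w))) + (1 - jmass n h) * f (None, \<top>))"

lemma jump_point_measurable: "(\<lambda>w. (Some (snd w), ennreal (fst w))) \<in> measurable (posR \<Otimes>\<^sub>M SM S) PM"
  by (intro measurable_Pair measurable_compose[OF measurable_snd Some_measurable_optM]
      measurable_compose[OF measurable_compose[OF measurable_fst measurable_posR_borel] measurable_ennreal])

lemma pos_functional_KK: assumes h: "h \<in> space (HM n)"
  shows "pos_functional PM (\<lambda>f. jump n h (\<lambda>w. f (Some (snd w), ennreal (fst w))) + (1 - jmass n h) * f (None, \<top>))"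
  by (intro pos_functional_add pos_functional_cmult pos_functional_eval pos_functional_map[OF pos_functional_jump[OF h] jump_point_measurable]) simp

lemma nn_integral_KK: assumes h: "h \<in> space (HM n)" and f: "f \<in> borel_measurable PM"
  shows "(\<integral>\<^sup>+y. f y \<partial>KK n h) = jump n h (\<lambda>w. f (Some (snd w), ennreal (fst w))) + (1 - jmass n h) * f (None, \<top>)"
  unfolding KK_def by (rule nn_integral_functional_measure[OF pos_functional_KK[OF h] f])

lemma sets_KK[simp, measurable_cong]: "sets (KK n h) = sets PM" and space_KK[simp]: "space (KK n h) = UNIV"
  by (simp_all add: KK_def)

lemma prob_space_KK: assumes h: "h \<in> space (HM n)" shows "prob_space (KK n h)"
proof (rule prob_spaceI)
  have "emeasure (KK n h) (space (KK n h)) = (\<integral>\<^sup>+y. 1 \<partial>KK n h)" by simp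
  also have "\<dots> = jump n h (\<lambda>w. 1) + (1 - jmass n h)" by (subst nn_integral_KK[OF h]) auto
  also have "jump n h (\<lambda>w. 1) = jmass n h" using jump_state_free[OF h, of "\<lambda>_. 1"] by (simp add: jmass_def)
  finally show "emeasure (KK n h) (space (KK n h)) = 1" using jmass_le_1[OF h] by (simp add: add_diff_inverse_ennreal)
qed

lemma KK_measurable[measurable]: "KK n \<in> measurable (HM n) (subprob_algebra PM)"
proof (rule measurable_subprob_algebra)
  fix E assume E[measurable]: "E \<in> sets PM"
  have "(\<lambda>z. indicator E (Some (snd (snd z)), ennreal (fst (snd z))) :: ennreal) \<in> borel_measurable (HM n \<Otimes>\<^sub>M (posR \<Otimes>\<^sub>M SM S))"
    by (rule measurable_compose[OF measurable_compose[OF measurable_snd jump_point_measurable] borel_measurable_indicator[OF E]])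
  from measurable_jump[OF this]
  have [measurable]: "(\<lambda>h. jump n h (\<lambda>w. indicator E (Some (snd w), ennreal (fst w)))) \<in> borel_measurable (HM n)" by simp
  have "(\<lambda>h. jump n h (\<lambda>w. indicator E (Some (snd w), ennreal (fst w))) + (1 - jmass n h) * indicator E (None, \<top>)) \<in> borel_measurable (HM n)" by measurable
  then show "(\<lambda>h. emeasure (KK n h) E) \<in> borel_measurable (HM n)"
    by (rule measurable_cong[THEN iffD1, rotated])
      (simp add: KK_def emeasure_functional_measure[OF pos_functional_KK])
qed (auto intro: prob_space_KK prob_space_imp_subprob_space)

text \<open>Index 0 carries the initial state with the dummy time 0. After a prefix that is not
  good, the next coordinate is dead.\<close>

definition IP :: "nat \<Rightarrow> 's path \<Rightarrow> ('s option \<times> ennreal) measure" where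
  "IP i \<omega> = (case i of 0 \<Rightarrow> distr \<gamma> PM (\<lambda>x. (Some x, 0)) | Suc n \<Rightarrow> if good n \<omega> then KK n (hst n \<omega>) else return PM (None, \<top>))"

lemma init_measurable: "(\<lambda>x. (Some x, 0)) \<in> measurable \<gamma> PM"
  unfolding measurable_cong_sets[OF gamma(2) refl] by measurable

lemma prob_space_init: "prob_space (distr \<gamma> PM (\<lambda>x. (Some x, 0)))"
  by (rule prob_space.prob_space_distr[OF gamma(1) init_measurable])

lemma IP_measurable: "IP i \<in> measurable (PiM {0..<i} (\<lambda>_. PM)) (subprob_algebra PM)"
proof (cases i)
  case 0
  then show ?thesis unfolding IP_def using prob_space_init
    by (auto simp: space_subprob_algebra prob_space_imp_subprob_space intro!: measurable_const)
next
  case (Suc n)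
  have sub: "{..n} \<subseteq> {0..<Suc n}" by auto
  have "(\<lambda>\<omega>. if good n \<omega> then KK n (hst n \<omega>) else return PM (None, \<top>)) \<in> measurable (PiM {0..<Suc n} (\<lambda>_. PM)) (subprob_algebra PM)"
    using good_measurable[OF sub] measurable_compose[OF hst_measurable[OF sub] KK_measurable]
    by (intro measurable_If) (auto simp: space_subprob_algebra pred_def intro!: measurable_const prob_space_imp_subprob_space prob_space_return)
  then show ?thesis unfolding IP_def Suc by simp
qed

lemma prob_space_IP: assumes "\<omega> \<in> space (PiM {0..<i} (\<lambda>_. PM))" shows "prob_space (IP i \<omega>)"
proof (cases i)
  case 0 then show ?thesis using prob_space_init by (simp add: IP_def)
next
  case (Suc n)
  have sub: "{..n} \<subseteq> {0..<Suc n}" by auto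
  have "hst n \<omega> \<in> space (HM n)" using measurable_space[OF hst_measurable[OF sub]] assms Suc by blast
  then show ?thesis using Suc by (auto simp: IP_def intro!: prob_space_KK prob_space_return)
qed

sublocale IT: Ionescu_Tulcea IP "\<lambda>_. PM"
  by (rule Ionescu_Tulcea.intro[OF IP_measurable prob_space_IP])

abbreviation "W \<equiv> IT.PF.lim"

lemma sets_W[measurable_cong]: "sets W = sets (OmegaM S)" by (simp add: OmegaM_def)

lemma law_W: "distr W (PiM {0..<n} (\<lambda>_. PM)) (\<lambda>\<omega>. restrict \<omega> {0..<n}) = IT.C 0 n (\<lambda>_. undefined)"
proof -
  have u: "IT.up_to {0..<n} = n"
  proof (rule antisym)
    show "IT.up_to {0..<n} \<le> n" by (simp add: IT.up_to_iff_Ico)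
    have "{0..<n} \<subseteq> {0..<IT.up_to {0..<n}}" by (rule IT.up_to) simp
    then show "n \<le> IT.up_to {0..<n}" by auto
  qed
  have "distr W (PiM {0..<n} (\<lambda>_. PM)) (\<lambda>\<omega>. restrict \<omega> {0..<n}) = IT.CI {0..<n}" by (rule IT.distr_lim) simp
  also have "\<dots> = distr (IT.C 0 n (\<lambda>_. undefined)) (PiM {0..<n} (\<lambda>_. PM)) (\<lambda>f. restrict f {0..<n})"
    unfolding IT.CI_def u ..
  also have "\<dots> = IT.C 0 n (\<lambda>_. undefined)" using IT.distr_C[of n n "\<lambda>_. undefined" 0] by simp
  finally show ?thesis .
qed

lemma restrict_W: "(\<lambda>\<omega>. restrict \<omega> {0..<n}) \<in> measurable W (PiM {0..<n} (\<lambda>_. PM))"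
  unfolding measurable_cong_sets[OF sets_W refl] OmegaM_def by (rule measurable_restrict_subset) simp

lemma nn_integral_W:
  assumes "f \<in> borel_measurable (PiM {0..<n} (\<lambda>_. PM))"
  shows "(\<integral>\<^sup>+\<omega>. f (restrict \<omega> {0..<n}) \<partial>W) = (\<integral>\<^sup>+x. f x \<partial>IT.C 0 n (\<lambda>_. undefined))"
  unfolding law_W[symmetric] using restrict_W assms by (subst nn_integral_distr) auto

text \<open>The last of finitely many coordinates is integrated out by its kernel. The initial law,
  the steps after good prefixes and the dead steps are instances.\<close>

lemma nn_integral_W_step:
  assumes f: "f \<in> borel_measurable (PiM {0..<Suc m} (\<lambda>_. PM))"
  shows "(\<integral>\<^sup>+\<omega>. f (restrict \<omega> {0..<Suc m}) \<partial>W) = (\<integral>\<^sup>+\<omega>. (\<integral>\<^sup>+y. f ((restrict \<omega> {0..<m})(m := y)) \<partial>IP m (restrict \<omega> {0..<m})) \<partial>W)"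
proof -
  let ?u = "\<lambda>_::nat. undefined :: 's option \<times> ennreal"
  have u: "?u \<in> space (PiM {0..<0} (\<lambda>_. PM))" by (simp add: space_PiM)
  note sC = IT.sets_C[OF u, of m, simplified]
  have spC: "space (IT.C 0 m ?u) = space (PiM {0..<m} (\<lambda>_. PM))" using IT.space_C[OF u, of m] by simp
  have eP: "IT.eP m \<in> measurable (IT.C 0 m ?u) (subprob_algebra (PiM {0..<Suc m} (\<lambda>_. PM)))"
    using IT.measurable_eP[of m] by (simp add: measurable_cong_sets[OF sC refl])
  have "(\<lambda>x. \<integral>\<^sup>+z. f z \<partial>IT.eP m x) \<in> borel_measurable (PiM {0..<m} (\<lambda>_. PM))"
    by (rule measurable_compose[OF IT.measurable_eP nn_integral_measurable_subprob_algebra[OF f]])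
  then have "(\<lambda>x. \<integral>\<^sup>+y. f (x(m := y)) \<partial>IP m x) \<in> borel_measurable (PiM {0..<m} (\<lambda>_. PM))"
    by (rule measurable_cong[THEN iffD1, rotated]) (rule IT.nn_integral_eP[OF _ f])
  note m = nn_integral_W[OF this]
  have "(\<integral>\<^sup>+\<omega>. f (restrict \<omega> {0..<Suc m}) \<partial>W) = (\<integral>\<^sup>+x. f x \<partial>IT.C 0 (Suc m) ?u)" by (rule nn_integral_W[OF f])
  also have "\<dots> = (\<integral>\<^sup>+x. f x \<partial>(IT.C 0 m ?u \<bind> IT.eP m))" by simp
  also have "\<dots> = (\<integral>\<^sup>+x. (\<integral>\<^sup>+z. f z \<partial>IT.eP m x) \<partial>IT.C 0 m ?u)" by (rule nn_integral_bind[OF f eP])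
  also have "\<dots> = (\<integral>\<^sup>+x. (\<integral>\<^sup>+y. f (x(m := y)) \<partial>IP m x) \<partial>IT.C 0 m ?u)"
    by (intro nn_integral_cong IT.nn_integral_eP f) (simp add: spC)
  finally show ?thesis unfolding m .
qed

lemma prob_space_W: "prob_space W"
proof (rule prob_spaceI)
  have "emeasure W (space W) = (\<integral>\<^sup>+\<omega>. 1 \<partial>W)" by simp
  also have "\<dots> = emeasure (IT.C 0 0 (\<lambda>_. undefined)) (space (IT.C 0 0 (\<lambda>_. undefined)))" using nn_integral_W[of "\<lambda>_. 1" 0] by simp
  also have "\<dots> = 1" by (intro prob_space.emeasure_space_1 IT.prob_space_C) (simp add: space_PiM)
  finally show "emeasure W (space W) = 1" .
qed

lemma good_W[measurable]: "Measurable.pred W (good n)"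
  using good_measurable[of n UNIV] unfolding measurable_cong_sets[OF sets_W refl] OmegaM_def by simp

lemma hst_W[measurable]: "hst n \<in> measurable W (HM n)"
  using hst_measurable[of n UNIV] unfolding measurable_cong_sets[OF sets_W refl] OmegaM_def by simp

lemma coord_W[measurable]: "(\<lambda>\<omega>. \<omega> k) \<in> measurable W PM"
  unfolding measurable_cong_sets[OF sets_W refl] OmegaM_def by simp

lemma W_init: assumes f[measurable]: "f \<in> borel_measurable PM"
  shows "(\<integral>\<^sup>+\<omega>. f (\<omega> 0) \<partial>W) = (\<integral>\<^sup>+x. f (Some x, 0) \<partial>\<gamma>)"
proof -
  have [measurable]: "(\<lambda>x. x 0) \<in> measurable (PiM {0..<Suc 0} (\<lambda>_. PM)) PM" by (rule measurable_component_singleton) simp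
  have "(\<integral>\<^sup>+\<omega>. f (restrict \<omega> {0..<Suc 0} 0) \<partial>W) = (\<integral>\<^sup>+\<omega>. (\<integral>\<^sup>+y. f (((restrict \<omega> {0..<0})(0 := y)) 0) \<partial>IP 0 (restrict \<omega> {0..<0})) \<partial>W)"
    by (rule nn_integral_W_step[of "\<lambda>x. f (x 0)"]) measurable
  then show ?thesis
    using init_measurable f prob_space.emeasure_space_1[OF prob_space_W] by (simp add: IP_def nn_integral_distr)
qed

lemma W_step: assumes F[measurable]: "F \<in> borel_measurable (HM n \<Otimes>\<^sub>M PM)"
  shows "(\<integral>\<^sup>+\<omega>. indicator (Collect (good n)) \<omega> * F (hst n \<omega>, \<omega> (Suc n)) \<partial>W) = (\<integral>\<^sup>+\<omega>. indicator (Collect (good n)) \<omega> * (\<integral>\<^sup>+y. F (hst n \<omega>, y) \<partial>KK n (hst n \<omega>)) \<partial>W)"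
proof -
  let ?I = "{0..<Suc (Suc n)}"
  have sub: "{..n} \<subseteq> ?I" by auto
  note [measurable] = good_measurable[OF sub] hst_measurable[OF sub]
  have [measurable]: "(\<lambda>x. x (Suc n)) \<in> measurable (PiM ?I (\<lambda>_. PM)) PM" by (rule measurable_component_singleton) simp
  have ind[measurable]: "(indicator (Collect (good n)) :: _ \<Rightarrow> ennreal) \<in> borel_measurable (PiM ?I (\<lambda>_. PM))"
    by (intro borel_measurable_indicator') measurable
  have c: "good n (restrict \<omega> ?I) = good n \<omega>" "hst n (restrict \<omega> ?I) = hst n \<omega>"
     "good n ((restrict \<omega> {0..<Suc n})(Suc n := y)) = good n \<omega>" "hst n ((restrict \<omega> {0..<Suc n})(Suc n := y)) = hst n \<omega>"
     "good n (restrict \<omega> {0..<Suc n}) = good n \<omega>" "hst n (restrict \<omega> {0..<Suc n}) = hst n \<omega>" for \<omega> y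
    by (rule good_hst_cong; auto)+
  have ci: "indicator (Collect (good n)) (restrict \<omega> ?I) = (indicator (Collect (good n)) \<omega> :: ennreal)"
    "indicator (Collect (good n)) ((restrict \<omega> {0..<Suc n})(Suc n := y)) = (indicator (Collect (good n)) \<omega> :: ennreal)" for \<omega> y
    by (simp_all only: indicator_def mem_Collect_eq c)
  have "(\<integral>\<^sup>+\<omega>. indicator (Collect (good n)) (restrict \<omega> ?I) * F (hst n (restrict \<omega> ?I), restrict \<omega> ?I (Suc n)) \<partial>W)
    = (\<integral>\<^sup>+\<omega>. (\<integral>\<^sup>+y. indicator (Collect (good n)) ((restrict \<omega> {0..<Suc n})(Suc n := y)) * F (hst n ((restrict \<omega> {0..<Suc n})(Suc n := y)), ((restrict \<omega> {0..<Suc n})(Suc n := y)) (Suc n)) \<partial>IP (Suc n) (restrict \<omega> {0..<Suc n})) \<partial>W)"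
    by (rule nn_integral_W_step[of "\<lambda>x. indicator (Collect (good n)) x * F (hst n x, x (Suc n))"]) measurable
  also have "\<dots> = (\<integral>\<^sup>+\<omega>. indicator (Collect (good n)) \<omega> * (\<integral>\<^sup>+y. F (hst n \<omega>, y) \<partial>KK n (hst n \<omega>)) \<partial>W)"
    by (intro nn_integral_cong, simp only: ci c fun_upd_same IP_def nat.case) (simp split: split_indicator)
  finally show ?thesis by (simp only: c ci) simp
qed

lemma W_dead: assumes f[measurable]: "f \<in> borel_measurable PM"
  shows "(\<integral>\<^sup>+\<omega>. indicator (- Collect (good n)) \<omega> * f (\<omega> (Suc n)) \<partial>W) = (\<integral>\<^sup>+\<omega>. indicator (- Collect (good n)) \<omega> * f (None, \<top>) \<partial>W)"
proof -
  let ?I = "{0..<Suc (Suc n)}"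
  have sub: "{..n} \<subseteq> ?I" by auto
  note [measurable] = good_measurable[OF sub]
  have [measurable]: "(\<lambda>x. x (Suc n)) \<in> measurable (PiM ?I (\<lambda>_. PM)) PM" by (rule measurable_component_singleton) simp
  have ind[measurable]: "(indicator (- Collect (good n)) :: _ \<Rightarrow> ennreal) \<in> borel_measurable (PiM ?I (\<lambda>_. PM))"
    by (intro borel_measurable_indicator') measurable
  have c: "good n (restrict \<omega> ?I) = good n \<omega>"
     "good n ((restrict \<omega> {0..<Suc n})(Suc n := y)) = good n \<omega>"
     "good n (restrict \<omega> {0..<Suc n}) = good n \<omega>" for \<omega> y
    by (rule good_hst_cong; auto)+
  have ci: "indicator (- Collect (good n)) (restrict \<omega> ?I) = (indicator (- Collect (good n)) \<omega> :: ennreal)"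
    "indicator (- Collect (good n)) ((restrict \<omega> {0..<Suc n})(Suc n := y)) = (indicator (- Collect (good n)) \<omega> :: ennreal)" for \<omega> y
    by (simp_all only: indicator_def mem_Collect_eq Compl_iff c)
  have "(\<integral>\<^sup>+\<omega>. indicator (- Collect (good n)) (restrict \<omega> ?I) * f (restrict \<omega> ?I (Suc n)) \<partial>W)
    = (\<integral>\<^sup>+\<omega>. (\<integral>\<^sup>+y. indicator (- Collect (good n)) ((restrict \<omega> {0..<Suc n})(Suc n := y)) * f (((restrict \<omega> {0..<Suc n})(Suc n := y)) (Suc n)) \<partial>IP (Suc n) (restrict \<omega> {0..<Suc n})) \<partial>W)"
    by (rule nn_integral_W_step[of "\<lambda>x. indicator (- Collect (good n)) x * f (x (Suc n))"]) measurable
  also have "\<dots> = (\<integral>\<^sup>+\<omega>. indicator (- Collect (good n)) \<omega> * f (None, \<top>) \<partial>W)"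
    by (intro nn_integral_cong, simp only: ci c fun_upd_same IP_def nat.case) (simp add: nn_integral_return split: split_indicator)
  finally show ?thesis by (simp only: ci) simp
qed

lemma AE_W_zero: assumes "(\<integral>\<^sup>+\<omega>. indicator {\<omega>. R \<omega>} \<omega> \<partial>W) = 0" "Measurable.pred W R" shows "AE \<omega> in W. \<not> R \<omega>"
proof -
  note [measurable] = assms(2)
  have "(indicator {\<omega>. R \<omega>} :: _ \<Rightarrow> ennreal) \<in> borel_measurable W" by (intro borel_measurable_indicator') measurable
  then have "AE \<omega> in W. indicator {\<omega>. R \<omega>} \<omega> = (0 :: ennreal)" using assms(1) by (simp add: nn_integral_0_iff_AE)
  then show ?thesis by eventually_elim (auto simp: indicator_def split: if_splits)
qed

lemma AE_W_Omega: "AE \<omega> in W. \<omega> \<in> Omega S"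
proof -
  have R0m[measurable]: "Measurable.pred PM (\<lambda>z::'s option \<times> ennreal. \<not> (fst z \<in> Some ` S \<and> snd z = 0))" by measurable
  \<comment> \<open>The coordinates that are neither a genuine jump nor dead; \<open>KK\<close>
    gives them no mass.\<close>
  define E where "E = {z::'s option \<times> ennreal. \<not> (fst z \<in> Some ` S \<and> 0 < snd z \<and> snd z < \<top>) \<and> z \<noteq> (None, \<top>)}"
  have Em[measurable]: "E \<in> sets PM"
  proof -
    have "Measurable.pred PM (\<lambda>z. \<not> (fst z \<in> Some ` S \<and> 0 < snd z \<and> snd z < \<top>) \<and> z \<notin> {(None, \<top>)})" by measurable
    then show ?thesis by (simp add: E_def pred_def)
  qed
  have A0: "AE \<omega> in W. \<not> \<not> (fst (\<omega> 0) \<in> Some ` S \<and> snd (\<omega> 0) = 0)"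
  proof (rule AE_W_zero)
    have "(\<integral>\<^sup>+\<omega>. indicator {z::'s option \<times> ennreal. \<not> (fst z \<in> Some ` S \<and> snd z = 0)} (\<omega> 0) \<partial>W) = (\<integral>\<^sup>+x. indicator {z::'s option \<times> ennreal. \<not> (fst z \<in> Some ` S \<and> snd z = 0)} (Some x, 0) \<partial>\<gamma>)"
      by (rule W_init) (use R0m in \<open>auto simp: pred_def\<close>)
    also have "\<dots> = (\<integral>\<^sup>+x. 0 \<partial>\<gamma>)" using sets_eq_imp_space_eq[OF gamma(2)] by (intro nn_integral_cong) auto
    finally show "(\<integral>\<^sup>+\<omega>. indicator {\<omega>. \<not> (fst (\<omega> 0) \<in> Some ` S \<and> snd (\<omega> 0) = 0)} \<omega> \<partial>W) = 0" by (simp add: indicator_def)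
    show "Measurable.pred W (\<lambda>\<omega>. \<not> (fst (\<omega> 0) \<in> Some ` S \<and> snd (\<omega> 0) = 0))" by measurable
  qed
  have A1: "AE \<omega> in W. \<not> (good n \<omega> \<and> \<omega> (Suc n) \<in> E)" for n
  proof (rule AE_W_zero)
    have "(\<integral>\<^sup>+\<omega>. indicator (Collect (good n)) \<omega> * indicator E (snd (hst n \<omega>, \<omega> (Suc n))) \<partial>W)
      = (\<integral>\<^sup>+\<omega>. indicator (Collect (good n)) \<omega> * (\<integral>\<^sup>+y. indicator E (snd (hst n \<omega>, y)) \<partial>KK n (hst n \<omega>)) \<partial>W)"
      by (rule W_step[of "\<lambda>z. indicator E (snd z)"]) measurable
    also have "\<dots> = (\<integral>\<^sup>+\<omega>. 0 \<partial>W)"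
    proof (intro nn_integral_cong)
      fix \<omega> assume "\<omega> \<in> space W"
      then have h: "hst n \<omega> \<in> space (HM n)" using measurable_space[OF hst_W] by blast
      have "jump n (hst n \<omega>) (\<lambda>w. indicator E (Some (snd w), ennreal (fst w))) = jump n (hst n \<omega>) (\<lambda>w. 0)"
        by (rule pos_functionalD(1)[OF pos_functional_jump[OF h]]) (auto simp: E_def space_pair_measure)
      then have "(\<integral>\<^sup>+y. indicator E y \<partial>KK n (hst n \<omega>)) = 0"
        using pos_functional_zero[OF pos_functional_jump[OF h]] by (subst nn_integral_KK[OF h]) (auto simp: E_def)
      then show "indicator (Collect (good n)) \<omega> * (\<integral>\<^sup>+y. indicator E (snd (hst n \<omega>, y)) \<partial>KK n (hst n \<omega>)) = 0" by simp
    qed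
    finally have "(\<integral>\<^sup>+\<omega>. indicator (Collect (good n)) \<omega> * indicator E (\<omega> (Suc n)) \<partial>W) = 0" by simp
    moreover have "indicator {\<omega>. good n \<omega> \<and> \<omega> (Suc n) \<in> E} = (\<lambda>\<omega>. indicator (Collect (good n)) \<omega> * indicator E (\<omega> (Suc n)) :: ennreal)"
      by (auto simp: fun_eq_iff split: split_indicator)
    ultimately show "(\<integral>\<^sup>+\<omega>. indicator {\<omega>. good n \<omega> \<and> \<omega> (Suc n) \<in> E} \<omega> \<partial>W) = 0" by simp
  qed measurable
  have A2: "AE \<omega> in W. \<not> (\<not> good n \<omega> \<and> \<omega> (Suc n) \<in> - {(None, \<top>)})" for n
  proof (rule AE_W_zero)
    have m: "- {(None, \<top>)} \<in> sets PM" using sets.compl_sets[OF dead_sets] by (simp add: Compl_eq_Diff_UNIV)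
    have "(\<integral>\<^sup>+\<omega>. indicator (- Collect (good n)) \<omega> * indicator (- {(None, \<top>)}) (\<omega> (Suc n)) \<partial>W) = (\<integral>\<^sup>+\<omega>. indicator (- Collect (good n)) \<omega> * indicator (- {(None, \<top>)}) (None :: 's option, \<top> :: ennreal) \<partial>W)"
      using m by (intro W_dead borel_measurable_indicator)
    also have "\<dots> = 0" by simp
    finally have "(\<integral>\<^sup>+\<omega>. indicator (- Collect (good n)) \<omega> * indicator (- {(None, \<top>)}) (\<omega> (Suc n)) \<partial>W) = 0" .
    moreover have "indicator {\<omega>. \<not> good n \<omega> \<and> \<omega> (Suc n) \<in> - {(None, \<top>)}} = (\<lambda>\<omega>. indicator (- Collect (good n)) \<omega> * indicator (- {(None, \<top>)}) (\<omega> (Suc n)) :: ennreal)"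
      by (auto simp: fun_eq_iff split: split_indicator)
    ultimately show "(\<integral>\<^sup>+\<omega>. indicator {\<omega>. \<not> good n \<omega> \<and> \<omega> (Suc n) \<in> - {(None, \<top>)}} \<omega> \<partial>W) = 0" by simp
    have "Measurable.pred W (\<lambda>\<omega>. \<omega> (Suc n) \<in> - {(None, \<top>)})" using m by measurable
    then show "Measurable.pred W (\<lambda>\<omega>. \<not> good n \<omega> \<and> \<omega> (Suc n) \<in> - {(None, \<top>)})" by measurable
  qed
  have "AE \<omega> in W. (\<forall>n. \<not> (good n \<omega> \<and> \<omega> (Suc n) \<in> E)) \<and> (\<forall>n. \<not> (\<not> good n \<omega> \<and> \<omega> (Suc n) \<in> - {(None, \<top>)}))"
    using A1 A2 by (simp add: AE_all_countable)
  with A0 show ?thesis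
  proof eventually_elim
    case (elim \<omega>)
    have dead: "\<omega> (Suc n) = (None, \<top>)" if "\<not> good (Suc n) \<omega>" for n
      using elim(2) that by (cases "good n \<omega>") (auto simp: E_def good_Suc)
    have g: "fst (\<omega> (Suc n)) \<in> Some ` S \<and> 0 < snd (\<omega> (Suc n)) \<and> snd (\<omega> (Suc n)) < \<top>" if "good (Suc n) \<omega>" for n
      using that by (simp add: good_Suc)
    have step: "(xs \<omega> (Suc n) \<in> Some ` S \<or> xs \<omega> (Suc n) = None) \<and> 0 < th \<omega> (Suc n) \<and> (th \<omega> (Suc n) = \<top> \<longleftrightarrow> xs \<omega> (Suc n) = None)
        \<and> (th \<omega> (Suc n) = \<top> \<longrightarrow> th \<omega> (Suc (Suc n)) = \<top>)" for n
    proof (cases "good (Suc n) \<omega>")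
      case True then show ?thesis using g[OF True] by (auto simp: xs_def th_def)
    next
      case False
      then have "\<not> good (Suc (Suc n)) \<omega>" by (simp add: good_Suc[of "Suc n"])
      then show ?thesis using dead[OF False] dead[of "Suc n"] by (simp add: xs_def th_def)
    qed
    have "xs \<omega> n \<in> Some ` S \<or> xs \<omega> n = None" for n using step elim(1) by (cases n) (auto simp: xs_def)
    then show ?case using step elim(1) unfolding Omega_def by (auto simp: xs_def th_def)
  qed
qed

lemma set_eq_W: assumes "H \<in> sets (HM n)"
  shows "{\<omega>\<in>space W. alive n \<omega> \<and> hist n \<omega> \<in> H \<and> R \<omega>} = {\<omega>\<in>space W. good n \<omega> \<and> hst n \<omega> \<in> H \<and> R \<omega>}"
  using alive_hist_iff[OF assms] by auto

lemma W_cond1: assumes H[measurable]: "H \<in> sets (HM n)" and t: "0 < t"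
  shows "emeasure W {\<omega>\<in>space W. alive n \<omega> \<and> hist n \<omega> \<in> H \<and> ennreal t \<le> th \<omega> (Suc n)} =
        (\<integral>\<^sup>+ \<omega>\<in>{\<omega>\<in>space W. alive n \<omega> \<and> hist n \<omega> \<in> H}.
           ennreal (exp (- (LINT s:{0<..t}|lborel. (\<integral>a. qx q (snd (hist n \<omega>)) a \<partial>(pol n (hist n \<omega>, s)))))) \<partial>W)"
proof -
  have "emeasure W {\<omega>\<in>space W. alive n \<omega> \<and> hist n \<omega> \<in> H \<and> ennreal t \<le> th \<omega> (Suc n)}
    = emeasure W {\<omega>\<in>space W. good n \<omega> \<and> hst n \<omega> \<in> H \<and> ennreal t \<le> th \<omega> (Suc n)}" by (simp only: set_eq_W[OF H])
  also have "\<dots> = (\<integral>\<^sup>+\<omega>. indicator {\<omega>\<in>space W. good n \<omega> \<and> hst n \<omega> \<in> H \<and> ennreal t \<le> th \<omega> (Suc n)} \<omega> \<partial>W)"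
    unfolding th_def by (intro nn_integral_indicator[symmetric]) measurable
  also have "\<dots> = (\<integral>\<^sup>+\<omega>. indicator (Collect (good n)) \<omega> * (\<lambda>z. indicator H (fst z) * indicator {ennreal t..} (snd (snd z))) (hst n \<omega>, \<omega> (Suc n)) \<partial>W)"
    by (intro nn_integral_cong) (auto simp: th_def split: split_indicator)
  also have "\<dots> = (\<integral>\<^sup>+\<omega>. indicator (Collect (good n)) \<omega> * (\<integral>\<^sup>+y. (\<lambda>z. indicator H (fst z) * indicator {ennreal t..} (snd (snd z))) (hst n \<omega>, y) \<partial>KK n (hst n \<omega>)) \<partial>W)"
    by (rule W_step) measurable
  also have "\<dots> = (\<integral>\<^sup>+ \<omega>\<in>{\<omega>\<in>space W. alive n \<omega> \<and> hist n \<omega> \<in> H}.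
           ennreal (exp (- (LINT s:{0<..t}|lborel. (\<integral>a. qx q (snd (hist n \<omega>)) a \<partial>(pol n (hist n \<omega>, s)))))) \<partial>W)"
  proof (intro nn_integral_cong)
    fix \<omega> assume \<omega>: "\<omega> \<in> space W"
    then have h: "hst n \<omega> \<in> space (HM n)" using measurable_space[OF hst_W] by blast
    have im: "(\<lambda>y. indicator {ennreal t..} (snd y) :: ennreal) \<in> borel_measurable PM" by measurable
    have ti: "(indicator {t..} :: real \<Rightarrow> ennreal) \<in> borel_measurable posR" by (simp add: measurable_indicator_posR)
    have "(\<integral>\<^sup>+y. indicator {ennreal t..} (snd y) \<partial>KK n (hst n \<omega>)) = jump n (hst n \<omega>) (\<lambda>w. indicator {ennreal t..} (ennreal (fst w))) + (1 - jmass n (hst n \<omega>))"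
      by (subst nn_integral_KK[OF h]) auto
    also have "jump n (hst n \<omega>) (\<lambda>w. indicator {ennreal t..} (ennreal (fst w))) = jump n (hst n \<omega>) (\<lambda>w. indicator {t..} (fst w))"
      by (rule pos_functionalD(1)[OF pos_functional_jump[OF h]]) (auto simp: space_pair_measure ennreal_le_iff split: split_indicator)
    also have "\<dots> + (1 - jmass n (hst n \<omega>)) = ew n (hst n \<omega>, t)"
      unfolding jump_state_free[OF h ti] by (rule hazard_tail[OF h t])
    finally have k: "(\<integral>\<^sup>+y. indicator {ennreal t..} (snd y) \<partial>KK n (hst n \<omega>)) = ew n (hst n \<omega>, t)" .
    have "(\<integral>\<^sup>+y. indicator H (hst n \<omega>) * indicator {ennreal t..} (snd y) \<partial>KK n (hst n \<omega>)) = indicator H (hst n \<omega>) * (\<integral>\<^sup>+y. indicator {ennreal t..} (snd y) \<partial>KK n (hst n \<omega>))"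
      using im by (intro nn_integral_cmult) (simp add: measurable_cong_sets[OF sets_KK refl])
    then have k2: "(\<integral>\<^sup>+y. indicator H (hst n \<omega>) * indicator {ennreal t..} (snd y) \<partial>KK n (hst n \<omega>)) = indicator H (hst n \<omega>) * ew n (hst n \<omega>, t)" by (simp add: k)
    have e: "(LINT s:{0<..t}|lborel. (\<integral>a. qx q (snd h) a \<partial>(pol n (h, s)))) = (LINT s:{0<..t}|lborel. lam n h s)" for h
      unfolding set_lebesgue_integral_def by (intro Bochner_Integration.integral_cong) (auto simp: lam_def split: split_indicator)
    show "indicator (Collect (good n)) \<omega> * (\<integral>\<^sup>+y. (\<lambda>z. indicator H (fst z) * indicator {ennreal t..} (snd (snd z))) (hst n \<omega>, y) \<partial>KK n (hst n \<omega>))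
      = ennreal (exp (- (LINT s:{0<..t}|lborel. (\<integral>a. qx q (snd (hist n \<omega>)) a \<partial>(pol n (hist n \<omega>, s)))))) * indicator {\<omega>\<in>space W. alive n \<omega> \<and> hist n \<omega> \<in> H} \<omega>"
      using alive_hist_iff[OF H, of \<omega>] good_hist[of n \<omega>] \<omega> k2 unfolding e
      by (auto simp: ew_def surv_def split: split_indicator)
  qed
  finally show ?thesis .
qed

lemma W_cond2: assumes H[measurable]: "H \<in> sets (HM n)" and Bb: "B \<in> sets borel" "B \<subseteq> {0<..}" and \<Gamma>[measurable]: "\<Gamma> \<in> sets (SM S)"
  shows "emeasure W {\<omega>\<in>space W. alive n \<omega> \<and> hist n \<omega> \<in> H \<and> th \<omega> (Suc n) \<in> ennreal ` B \<and> xs \<omega> (Suc n) \<in> Some ` \<Gamma>} =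
        (\<integral>\<^sup>+ \<omega>\<in>{\<omega>\<in>space W. alive n \<omega> \<and> hist n \<omega> \<in> H \<and> th \<omega> (Suc n) \<in> ennreal ` B}.
           ennreal (jump_ratio q (snd (hist n \<omega>)) (pol n (hist n \<omega>, enn2real (th \<omega> (Suc n)))) \<Gamma>) \<partial>W)"
proof -
  have B: "B \<in> sets posR" using Bb by (simp add: sets_posR_iff)
  have im: "(\<theta> \<in> ennreal ` B) \<longleftrightarrow> (0 < \<theta> \<and> \<theta> < \<top> \<and> unP \<theta> \<in> B)" for \<theta>
  proof
    assume "\<theta> \<in> ennreal ` B" then show "0 < \<theta> \<and> \<theta> < \<top> \<and> unP \<theta> \<in> B" using Bb(2) by (auto simp: subset_iff)
  next
    assume "0 < \<theta> \<and> \<theta> < \<top> \<and> unP \<theta> \<in> B" then show "\<theta> \<in> ennreal ` B" by (auto simp: unP_def image_iff intro!: bexI[of _ "enn2real \<theta>"])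
  qed
  have eB[measurable]: "ennreal ` B \<in> sets borel"
  proof -
    have "ennreal ` B = {\<theta>. 0 < \<theta> \<and> \<theta> < \<top> \<and> unP \<theta> \<in> B}" using im by auto
    also have "\<dots> \<in> sets borel" using B by measurable
    finally show ?thesis .
  qed
  have [measurable]: "Some ` \<Gamma> \<in> sets (optM (SM S))" by (rule Some_image_sets_optM[OF \<Gamma>])
  \<comment> \<open>\<open>F1\<close> records the jump itself, \<open>F2\<close> its conditional
    probability given the sojourn. For each history both have the same integral under
    \<open>KK n h\<close>, and \<open>W_step\<close> transfers this to paths.\<close>
  define F1 where "F1 z = indicator H (fst z) * (indicator (ennreal ` B) (snd (snd z)) * indicator (Some ` \<Gamma>) (fst (snd z)) :: ennreal)" for z :: "((nat \<Rightarrow> 's \<times> real) \<times> 's) \<times> 's option \<times> ennreal"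
  define F2 where "F2 z = indicator H (fst z) * (indicator (ennreal ` B) (snd (snd z)) * ennreal (jump_ratio q (snd (fst z)) (pol n (fst z, unP (snd (snd z)))) \<Gamma>))" for z :: "((nat \<Rightarrow> 's \<times> real) \<times> 's) \<times> 's option \<times> ennreal"
  have F1m: "F1 \<in> borel_measurable (HM n \<Otimes>\<^sub>M PM)" unfolding F1_def by measurable
  have "(\<lambda>z. (fst z, unP (snd (snd z)))) \<in> measurable (HM n \<Otimes>\<^sub>M PM) (HP n)" by measurable
  from measurable_compose[OF this jump_ratio_measurable[OF \<Gamma>]]
  have [measurable]: "(\<lambda>z. ennreal (jump_ratio q (snd (fst z)) (pol n (fst z, unP (snd (snd z)))) \<Gamma>)) \<in> borel_measurable (HM n \<Otimes>\<^sub>M PM)" by simp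
  have F2m: "F2 \<in> borel_measurable (HM n \<Otimes>\<^sub>M PM)" unfolding F2_def by measurable
  have eq: "(\<integral>\<^sup>+y. F1 (h, y) \<partial>KK n h) = (\<integral>\<^sup>+y. F2 (h, y) \<partial>KK n h)" if h: "h \<in> space (HM n)" for h
  proof -
    have jr[measurable]: "(\<lambda>s. ennreal (jump_ratio q (snd h) (pol n (h, s)) \<Gamma>)) \<in> borel_measurable posR"
      using measurable_HP_section[OF h jump_ratio_measurable[OF \<Gamma>]] by simp
    note pj = pos_functional_jump[OF h]
    have S\<Gamma>: "Some y \<in> Some ` \<Gamma> \<longleftrightarrow> y \<in> \<Gamma>" for y by auto
    have eBi: "ennreal s \<in> ennreal ` B \<longleftrightarrow> s \<in> B" if "0 < s" for s using im[of "ennreal s"] that by simp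
    have "(\<integral>\<^sup>+y. F1 (h, y) \<partial>KK n h) = jump n h (\<lambda>w. F1 (h, (Some (snd w), ennreal (fst w))))"
      using measurable_compose[OF measurable_Pair1'[OF h] F1m] eB by (subst nn_integral_KK[OF h]) (auto simp: F1_def im)
    also have "\<dots> = jump n h (\<lambda>w. indicator H h * indicator (B \<times> \<Gamma>) w)"
      by (rule pos_functionalD(1)[OF pj]) (simp add: F1_def space_pair_measure mem_Times_iff S\<Gamma> eBi indicator_def)
    also have "\<dots> = indicator H h * jump n h (indicator (B \<times> \<Gamma>))" using B \<Gamma> by (intro pos_functionalD(3)[OF pj] borel_measurable_indicator pair_measureI)
    also have "\<dots> = indicator H h * jump n h (\<lambda>w. indicator B (fst w) * ennreal (jump_ratio q (snd h) (pol n (h, fst w)) \<Gamma>))"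
      unfolding jump_rectangle[OF h B \<Gamma>] using B
      by (subst jump_state_free[OF h, of "\<lambda>s. indicator B s * ennreal (jump_ratio q (snd h) (pol n (h, s)) \<Gamma>)"]) auto
    also have "\<dots> = jump n h (\<lambda>w. indicator H h * (indicator B (fst w) * ennreal (jump_ratio q (snd h) (pol n (h, fst w)) \<Gamma>)))"
      by (intro pos_functionalD(3)[OF pj, symmetric] borel_measurable_times_ennreal
          measurable_compose[OF measurable_fst borel_measurable_indicator[OF B]] measurable_compose[OF measurable_fst jr])
    also have "\<dots> = jump n h (\<lambda>w. F2 (h, (Some (snd w), ennreal (fst w))))"
      by (rule pos_functionalD(1)[OF pj]) (simp add: F2_def space_pair_measure mem_Times_iff eBi indicator_def)
    also have "\<dots> = (\<integral>\<^sup>+y. F2 (h, y) \<partial>KK n h)"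
      using measurable_compose[OF measurable_Pair1'[OF h] F2m] by (subst nn_integral_KK[OF h]) (auto simp: F2_def im)
    finally show ?thesis .
  qed
  have "emeasure W {\<omega>\<in>space W. alive n \<omega> \<and> hist n \<omega> \<in> H \<and> th \<omega> (Suc n) \<in> ennreal ` B \<and> xs \<omega> (Suc n) \<in> Some ` \<Gamma>}
    = emeasure W {\<omega>\<in>space W. good n \<omega> \<and> hst n \<omega> \<in> H \<and> th \<omega> (Suc n) \<in> ennreal ` B \<and> xs \<omega> (Suc n) \<in> Some ` \<Gamma>}" by (simp only: set_eq_W[OF H])
  also have "\<dots> = (\<integral>\<^sup>+\<omega>. indicator {\<omega>\<in>space W. good n \<omega> \<and> hst n \<omega> \<in> H \<and> th \<omega> (Suc n) \<in> ennreal ` B \<and> xs \<omega> (Suc n) \<in> Some ` \<Gamma>} \<omega> \<partial>W)"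
    unfolding th_def xs_def by (intro nn_integral_indicator[symmetric]) measurable
  also have "\<dots> = (\<integral>\<^sup>+\<omega>. indicator (Collect (good n)) \<omega> * F1 (hst n \<omega>, \<omega> (Suc n)) \<partial>W)"
    by (intro nn_integral_cong) (auto simp: th_def xs_def F1_def split: split_indicator)
  also have "\<dots> = (\<integral>\<^sup>+\<omega>. indicator (Collect (good n)) \<omega> * (\<integral>\<^sup>+y. F1 (hst n \<omega>, y) \<partial>KK n (hst n \<omega>)) \<partial>W)"
    by (rule W_step[OF F1m])
  also have "\<dots> = (\<integral>\<^sup>+\<omega>. indicator (Collect (good n)) \<omega> * (\<integral>\<^sup>+y. F2 (hst n \<omega>, y) \<partial>KK n (hst n \<omega>)) \<partial>W)"
    using measurable_space[OF hst_W] by (intro nn_integral_cong) (simp add: eq)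
  also have "\<dots> = (\<integral>\<^sup>+\<omega>. indicator (Collect (good n)) \<omega> * F2 (hst n \<omega>, \<omega> (Suc n)) \<partial>W)"
    by (rule W_step[OF F2m, symmetric])
  also have "\<dots> = (\<integral>\<^sup>+ \<omega>\<in>{\<omega>\<in>space W. alive n \<omega> \<and> hist n \<omega> \<in> H \<and> th \<omega> (Suc n) \<in> ennreal ` B}.
           ennreal (jump_ratio q (snd (hist n \<omega>)) (pol n (hist n \<omega>, enn2real (th \<omega> (Suc n)))) \<Gamma>) \<partial>W)"
  proof (intro nn_integral_cong)
    fix \<omega> assume "\<omega> \<in> space W"
    then show "indicator (Collect (good n)) \<omega> * F2 (hst n \<omega>, \<omega> (Suc n))
      = ennreal (jump_ratio q (snd (hist n \<omega>)) (pol n (hist n \<omega>, enn2real (th \<omega> (Suc n)))) \<Gamma>) * indicator {\<omega>\<in>space W. alive n \<omega> \<and> hist n \<omega> \<in> H \<and> th \<omega> (Suc n) \<in> ennreal ` B} \<omega>"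
      using alive_hist_iff[OF H, of \<omega>] good_hist[of n \<omega>] im[of "snd (\<omega> (Suc n))"]
      by (cases "good n \<omega> \<and> hst n \<omega> \<in> H \<and> snd (\<omega> (Suc n)) \<in> ennreal ` B") (auto simp: F2_def th_def unP_def split: split_indicator)
  qed
  finally show ?thesis .
qed

lemma strategic_W: "strategic S \<gamma> q pol W"
  unfolding strategic_def
proof (intro conjI ballI allI impI sets_W prob_space_W AE_W_Omega W_cond1 W_cond2)
  fix \<Gamma> assume \<Gamma>: "\<Gamma> \<in> sets (SM S)"
  have [measurable]: "Some ` \<Gamma> \<in> sets (optM (SM S))" by (rule Some_image_sets_optM[OF \<Gamma>])
  have "emeasure W {\<omega>\<in>space W. xs \<omega> 0 \<in> Some ` \<Gamma>} = (\<integral>\<^sup>+\<omega>. indicator {\<omega>\<in>space W. xs \<omega> 0 \<in> Some ` \<Gamma>} \<omega> \<partial>W)"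
    unfolding xs_def by (intro nn_integral_indicator[symmetric]) measurable
  also have "\<dots> = (\<integral>\<^sup>+\<omega>. (\<lambda>z. indicator (Some ` \<Gamma>) (fst z)) (\<omega> 0) \<partial>W)" by (intro nn_integral_cong) (auto simp: xs_def split: split_indicator)
  also have "\<dots> = (\<integral>\<^sup>+x. (\<lambda>z. indicator (Some ` \<Gamma>) (fst z)) (Some x, 0 :: ennreal) \<partial>\<gamma>)" by (rule W_init) measurable
  also have "\<dots> = (\<integral>\<^sup>+x. indicator \<Gamma> x \<partial>\<gamma>)" by (intro nn_integral_cong) (auto split: split_indicator)
  also have "\<dots> = emeasure \<gamma> \<Gamma>" using \<Gamma> gamma(2) by simp
  finally show "emeasure W {\<omega>\<in>space W. xs \<omega> 0 \<in> Some ` \<Gamma>} = emeasure \<gamma> \<Gamma>" .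
qed

text \<open>Only with existence and uniqueness does the description in \<open>Pstrat\<close> denote
  a measure with the required properties.\<close>

lemma strategic_Pstrat: "strategic S \<gamma> q pol (Pstrat S \<gamma> q pol)"
  unfolding Pstrat_def
  by (rule theI[where P="strategic S \<gamma> q pol", OF strategic_W]) (rule strategic_unique[OF _ strategic_W])

end

sublocale ctmdp_policy \<subseteq> strategic_measure S A \<gamma> q pol "Pstrat S \<gamma> q pol"
  by unfold_locales (rule strategic_Pstrat)

section \<open>The objective as a sum over sojourns\<close>

context ctmdp
begin

lemma jt_0[simp]: "jt \<omega> 0 = 0" by (simp add: jt_def)

lemma jt_Suc: "jt \<omega> (Suc n) = jt \<omega> n + th \<omega> (Suc n)" by (simp add: jt_def)

lemma jt_mono: "m \<le> n \<Longrightarrow> jt \<omega> m \<le> jt \<omega> n"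
  by (induction n) (auto simp: jt_Suc le_Suc_eq intro: order_trans add_increasing2)

lemma jt_interval_unique:
  assumes "jt \<omega> n < t" "t \<le> jt \<omega> (Suc n)" "jt \<omega> m < t" "t \<le> jt \<omega> (Suc m)" shows "m = n"
proof (rule ccontr)
  assume "m \<noteq> n"
  then consider "Suc m \<le> n" | "Suc n \<le> m" by linarith
  then show False
  proof cases
    case 1 then show False using jt_mono[of "Suc m" n \<omega>] assms by simp
  next
    case 2 then show False using jt_mono[of "Suc n" m \<omega>] assms by simp
  qed
qed

lemma jt_finite_iff: assumes "\<omega> \<in> Omega S" shows "jt \<omega> n < \<top> \<longleftrightarrow> good n \<omega>"
proof (induction n)
  case 0
  have "good 0 \<omega>" using assms by (auto simp: Omega_def good_def xs_def)
  then show ?case by simp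
next
  case (Suc n)
  show ?case
  proof (cases "good (Suc n) \<omega>")
    case True then show ?thesis using Suc by (simp add: jt_Suc good_Suc th_def)
  next
    case False
    from Omega_dead[OF assms False] show ?thesis using False by (simp add: jt_Suc th_def)
  qed
qed

end

context ctmdp_policy
begin

definition gc :: "('s \<times> 'b \<Rightarrow> real) \<Rightarrow> nat \<Rightarrow> ((nat \<Rightarrow> 's \<times> real) \<times> 's) \<times> real \<Rightarrow> ennreal" where
  "gc c n p = (\<integral>\<^sup>+a. ennreal (c (snd (fst p), a)) \<partial>pol n p)"

lemma gc_measurable: "c \<in> borel_measurable SA \<Longrightarrow> gc c n \<in> borel_measurable (HP n)"
  unfolding gc_def[abs_def] using measurable_pol_integral[of "\<lambda>z. ennreal (c z)" n] by simp

text \<open>The cost rate within one sojourn as a function of the time \<open>s\<close> since the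
  last jump, which is also the time argument of the policy.\<close>

definition seg :: "('s \<times> 'b \<Rightarrow> real) \<Rightarrow> 's path \<Rightarrow> nat \<Rightarrow> real \<Rightarrow> ennreal" where
  "seg c \<omega> n s = (if good n \<omega> \<and> 0 < s \<and> ennreal s \<le> th \<omega> (Suc n) then gc c n (hst n \<omega>, s) else 0)"

lemma seg_iff: assumes \<omega>: "\<omega> \<in> Omega S" and g: "good n \<omega>" and t: "0 \<le> t"
  shows "0 < t - enn2real (jt \<omega> n) \<and> ennreal (t - enn2real (jt \<omega> n)) \<le> th \<omega> (Suc n) \<longleftrightarrow> jt \<omega> n < ennreal t \<and> ennreal t \<le> jt \<omega> (Suc n)"
proof -
  have "jt \<omega> n < \<top>" using jt_finite_iff[OF \<omega>] g by simp
  then obtain r where r: "jt \<omega> n = ennreal r" "0 \<le> r" by (cases "jt \<omega> n") auto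
  have 1: "0 < t - r \<longleftrightarrow> ennreal r < ennreal t" using r t by (simp add: ennreal_less_iff)
  show ?thesis
  proof (cases "th \<omega> (Suc n)")
    case (real x)
    have "ennreal (t - r) \<le> ennreal x \<longleftrightarrow> ennreal t \<le> ennreal r + ennreal x" if "r < t"
    proof -
      have "ennreal (t - r) \<le> ennreal x \<longleftrightarrow> t - r \<le> x" using real by (simp add: ennreal_le_iff)
      also have "\<dots> \<longleftrightarrow> ennreal t \<le> ennreal (r + x)" using real r by (simp add: ennreal_le_iff algebra_simps del: ennreal_plus)
      finally show ?thesis using real r by simp
    qed
    then show ?thesis using 1 r real by (auto simp: jt_Suc)
  next
    case top then show ?thesis using 1 r by (auto simp: jt_Suc)
  qed
qed

text \<open>States are constant on intervals closed on the left, while policies act on intervals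
  closed on the right; away from the jump times both conventions select the same \<open>n\<close>.
  The jump times are countably many and do not affect the cost integral.\<close>

lemma cost_rate_eq:
  assumes \<omega>: "\<omega> \<in> Omega S" and t: "0 \<le> t" "\<And>n. ennreal t \<noteq> jt \<omega> n"
  shows "cost_rate c pol \<omega> t = (\<Sum>n. seg c \<omega> n (t - enn2real (jt \<omega> n)))"
proof (cases "\<exists>n. jt \<omega> n < ennreal t \<and> ennreal t \<le> jt \<omega> (Suc n)")
  case True
  then obtain n where n: "jt \<omega> n < ennreal t" "ennreal t \<le> jt \<omega> (Suc n)" by auto
  have lt: "ennreal t < jt \<omega> (Suc n)" using n(2) t(2)[of "Suc n"] by (simp add: order_less_le)
  have "jt \<omega> n < \<top>" using n(1) by (rule less_trans) simp
  then have g: "good n \<omega>" using jt_finite_iff[OF \<omega>] by simp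
  have "jt \<omega> (Suc n) \<le> jinf \<omega>" unfolding jinf_def by (rule SUP_upper) simp
  then have ji: "ennreal t < jinf \<omega>" using lt by simp
  have the1: "(THE n. jt \<omega> n < ennreal t \<and> ennreal t \<le> jt \<omega> (Suc n)) = n"
  proof (rule the_equality)
    fix m assume m: "jt \<omega> m < ennreal t \<and> ennreal t \<le> jt \<omega> (Suc m)"
    then show "m = n" by (intro jt_interval_unique[OF n]) auto
  qed (use n in auto)
  have the2: "(THE n. jt \<omega> n \<le> ennreal t \<and> ennreal t < jt \<omega> (Suc n)) = n"
  proof (rule the_equality)
    fix m assume m: "jt \<omega> m \<le> ennreal t \<and> ennreal t < jt \<omega> (Suc m)"
    then have "jt \<omega> m < ennreal t" using t(2)[of m] by (metis order_less_le)
    then show "m = n" using m by (intro jt_interval_unique[OF n]) auto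
  qed (use n lt in auto)
  have "state_at \<omega> t = xs \<omega> n" unfolding state_at_def the2 using n lt by (auto intro: less_imp_le)
  moreover have "polAt pol \<omega> t = pol n (hst n \<omega>, t - enn2real (jt \<omega> n))"
    unfolding polAt_def the1 by (simp add: good_hist[OF g])
  moreover have "the (xs \<omega> n) = snd (hst n \<omega>)" unfolding good_hist[OF g, symmetric] by (simp add: hist_def)
  ultimately have "cost_rate c pol \<omega> t = gc c n (hst n \<omega>, t - enn2real (jt \<omega> n))"
    unfolding cost_rate_def gc_def using True ji by simp
  also have "\<dots> = seg c \<omega> n (t - enn2real (jt \<omega> n))"
    using seg_iff[OF \<omega> g t(1)] g n by (simp add: seg_def)
  also have "\<dots> = (\<Sum>m. seg c \<omega> m (t - enn2real (jt \<omega> m)))"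
  proof -
    have "seg c \<omega> m (t - enn2real (jt \<omega> m)) = 0" if "m \<noteq> n" for m
    proof (rule ccontr)
      assume "seg c \<omega> m (t - enn2real (jt \<omega> m)) \<noteq> 0"
      then have "good m \<omega>" "0 < t - enn2real (jt \<omega> m) \<and> ennreal (t - enn2real (jt \<omega> m)) \<le> th \<omega> (Suc m)" by (auto simp: seg_def split: if_splits)
      then show False using seg_iff[OF \<omega> _ t(1)] jt_interval_unique[OF n] that by blast
    qed
    then show ?thesis by (subst suminf_finite[of "{n}"]) auto
  qed
  finally show ?thesis .
next
  case False
  have "seg c \<omega> m (t - enn2real (jt \<omega> m)) = 0" for m
  proof (rule ccontr)
    assume "seg c \<omega> m (t - enn2real (jt \<omega> m)) \<noteq> 0"
    then have "good m \<omega>" "0 < t - enn2real (jt \<omega> m) \<and> ennreal (t - enn2real (jt \<omega> m)) \<le> th \<omega> (Suc m)" by (auto simp: seg_def split: if_splits)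
    then show False using seg_iff[OF \<omega> _ t(1)] False by blast
  qed
  then have "(\<Sum>n. seg c \<omega> n (t - enn2real (jt \<omega> n))) = 0" by simp
  moreover have "cost_rate c pol \<omega> t = 0" unfolding cost_rate_def using False by auto
  ultimately show ?thesis by simp
qed

lemma seg_measurable:
  assumes c: "c \<in> borel_measurable SA" and \<omega>: "\<omega> \<in> space (OmegaM S)"
  shows "seg c \<omega> n \<in> borel_measurable borel"
proof -
  have h: "hst n \<omega> \<in> space (HM n)" using measurable_space[OF hst_measurable[of n UNIV]] \<omega> by (simp add: OmegaM_def)
  have "(\<lambda>s. (hst n \<omega>, if 0 < s then s else 1)) \<in> measurable borel (HP n)"
    using h by (intro measurable_Pair measurable_into_posR) auto
  from measurable_compose[OF this gc_measurable[OF c]]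
  have [measurable]: "(\<lambda>s. gc c n (hst n \<omega>, if 0 < s then s else 1)) \<in> borel_measurable borel" .
  have "(\<lambda>s. if good n \<omega> \<and> 0 < s \<and> ennreal s \<le> th \<omega> (Suc n) then gc c n (hst n \<omega>, if 0 < s then s else 1) else 0) \<in> borel_measurable borel" by measurable
  moreover have "(\<lambda>s. if good n \<omega> \<and> 0 < s \<and> ennreal s \<le> th \<omega> (Suc n) then gc c n (hst n \<omega>, if 0 < s then s else 1) else 0) = seg c \<omega> n"
    by (auto simp: seg_def fun_eq_iff)
  ultimately show ?thesis by simp
qed

lemma path_cost_eq:
  assumes c: "c \<in> borel_measurable SA" and \<omega>: "\<omega> \<in> Omega S" "\<omega> \<in> space (OmegaM S)"
  shows "path_cost c pol \<omega> = (\<Sum>n. \<integral>\<^sup>+s. seg c \<omega> n s \<partial>lborel)"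
proof -
  note [measurable] = seg_measurable[OF c \<omega>(2)]
  have "path_cost c pol \<omega> = (\<integral>\<^sup>+t. (\<Sum>n. seg c \<omega> n (t - enn2real (jt \<omega> n))) \<partial>lborel)"
    unfolding path_cost_def
  proof (intro nn_integral_cong_AE)
    have "AE t in lborel. \<forall>n. t \<noteq> enn2real (jt \<omega> n)" by (simp add: AE_all_countable AE_lborel_singleton)
    then show "AE t in lborel. cost_rate c pol \<omega> t * indicator {0..} t = (\<Sum>n. seg c \<omega> n (t - enn2real (jt \<omega> n)))"
    proof eventually_elim
      case (elim t)
      show ?case
      proof (cases "0 \<le> t")
        case True
        have "ennreal t \<noteq> jt \<omega> n" for n using elim[rule_format, of n] True by (metis enn2real_ennreal)
        then show ?thesis using cost_rate_eq[OF \<omega>(1) True] True by simp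
      next
        case False
        have "seg c \<omega> n (t - enn2real (jt \<omega> n)) = 0" for n
        proof -
          have "\<not> 0 < t - enn2real (jt \<omega> n)" using enn2real_nonneg[of "jt \<omega> n"] False by linarith
          then show ?thesis unfolding seg_def by auto
        qed
        then show ?thesis using False by simp
      qed
    qed
  qed
  also have "\<dots> = (\<Sum>n. \<integral>\<^sup>+t. seg c \<omega> n (t - enn2real (jt \<omega> n)) \<partial>lborel)"
  proof (rule nn_integral_suminf)
    fix n
    have "(\<lambda>t. t - enn2real (jt \<omega> n)) \<in> measurable lborel lborel" by simp
    then show "(\<lambda>t. seg c \<omega> n (t - enn2real (jt \<omega> n))) \<in> borel_measurable lborel"
      by (rule measurable_compose) (use seg_measurable[OF c \<omega>(2)] in simp)
  qed
  also have "\<dots> = (\<Sum>n. \<integral>\<^sup>+s. seg c \<omega> n s \<partial>lborel)"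
  proof (rule suminf_cong)
    fix n show "(\<integral>\<^sup>+t. seg c \<omega> n (t - enn2real (jt \<omega> n)) \<partial>lborel) = (\<integral>\<^sup>+s. seg c \<omega> n s \<partial>lborel)"
      using nn_integral_real_affine[of "\<lambda>t. seg c \<omega> n t" 1 "- enn2real (jt \<omega> n)"] by simp
  qed
  finally show ?thesis .
qed

text \<open>Extends the survival clause from sets of histories to functions, as needed for cost
  rates.\<close>

lemma cond1_fun: assumes f[measurable]: "f \<in> borel_measurable (HM n)" and t: "0 < t"
  shows "(\<integral>\<^sup>+\<omega>. ig n \<omega> * indicator {ennreal t..} (snd (\<omega> (Suc n))) * f (hst n \<omega>) \<partial>Pstrat S \<gamma> q pol) = (\<integral>\<^sup>+h. ew n (h, t) * f h \<partial>mh n)"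
proof -
  have ewm[measurable]: "(\<lambda>h. ew n (h, t)) \<in> borel_measurable (HM n)"
    using t by (intro measurable_compose[OF measurable_Pair2' measurable_ew]) simp
  define \<Phi>1 where "\<Phi>1 f = (\<integral>\<^sup>+\<omega>. ig n \<omega> * indicator {ennreal t..} (snd (\<omega> (Suc n))) * f (hst n \<omega>) \<partial>Pstrat S \<gamma> q pol)" for f :: "_ \<Rightarrow> ennreal"
  define \<Phi>2 where "\<Phi>2 f = (\<integral>\<^sup>+h. ew n (h, t) * f h \<partial>mh n)" for f :: "_ \<Rightarrow> ennreal"
  have p1: "pos_functional (HM n) \<Phi>1" unfolding \<Phi>1_def
  proof (intro pos_functional_integral pos_functional_cmult pos_functional_eval)
    fix \<omega> assume "\<omega> \<in> space (Pstrat S \<gamma> q pol)"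
    then show "hst n \<omega> \<in> space (HM n)" using measurable_space[OF hst_P] by blast
  next
    fix f :: "_ \<Rightarrow> ennreal" assume [measurable]: "f \<in> borel_measurable (HM n)"
    show "(\<lambda>\<omega>. ig n \<omega> * indicator {ennreal t..} (snd (\<omega> (Suc n))) * f (hst n \<omega>)) \<in> borel_measurable (Pstrat S \<gamma> q pol)" by measurable
  qed
  have p2: "pos_functional (HM n) \<Phi>2" unfolding \<Phi>2_def
    by (rule pos_functional_density[OF pos_functional_nn_integral]) simp_all
  have "functional_measure (HM n) \<Phi>1 = functional_measure (HM n) \<Phi>2"
  proof (rule measure_eqI)
    fix X assume "X \<in> sets (functional_measure (HM n) \<Phi>1)"
    then have X: "X \<in> sets (HM n)" by simp
    have "\<Phi>1 (indicator X) = \<Phi>2 (indicator X)" unfolding \<Phi>1_def \<Phi>2_def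
      using cond1[OF X t] by (simp add: mP_eq_mh ac_simps)
    then show "emeasure (functional_measure (HM n) \<Phi>1) X = emeasure (functional_measure (HM n) \<Phi>2) X"
      using X by (simp add: emeasure_functional_measure[OF p1] emeasure_functional_measure[OF p2])
  qed simp
  then show ?thesis using nn_integral_functional_measure[OF p1 f] nn_integral_functional_measure[OF p2 f] by (simp add: \<Phi>1_def \<Phi>2_def)
qed

lemma mh_mass: "emeasure (mh n) (space (mh n)) \<le> 1"
proof -
  have "emeasure (mP n) (space (HM n)) \<le> 1" using mP_mass[OF sets.top[of "HM n"]] by simp
  then show ?thesis by (simp add: mP_eq_mh)
qed

lemma finite_measure_mh: "finite_measure (mh n)"
  using mh_mass[of n] by (intro finite_measureI) (auto simp: top_unique)

text \<open>By Fubini, the cost rate at time \<open>s\<close> of a sojourn is weighted with the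
  probability \<open>ew n (h, s)\<close> that the sojourn still lasts. The objective now depends
  only on the policy and the laws \<open>mh\<close>.\<close>

theorem objective_eq:
  assumes c: "c \<in> borel_measurable SA"
  shows "objective S \<gamma> q c pol = (\<Sum>n. \<integral>\<^sup>+h. (\<integral>\<^sup>+s. ew n (h, s) * gc c n (h, s) \<partial>posL) \<partial>mh n)"
proof -
  let ?P = "Pstrat S \<gamma> q pol"
  have spP: "space ?P = space (OmegaM S)" by (rule sets_eq_imp_space_eq[OF sets_P])
  define k where "k n z = ig n (fst z) * (indicator {ennreal (snd z)..} (snd (fst z (Suc n))) * gc c n (hst n (fst z), snd z))" for n and z :: "'s path \<times> real"
  have km: "k n \<in> borel_measurable (?P \<Otimes>\<^sub>M posR)" for n
  proof -
    have "(\<lambda>z. (hst n (fst z), snd z)) \<in> measurable (?P \<Otimes>\<^sub>M posR) (HP n)" by measurable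
    from measurable_compose[OF this gc_measurable[OF c]]
    have [measurable]: "(\<lambda>z. gc c n (hst n (fst z), snd z)) \<in> borel_measurable (?P \<Otimes>\<^sub>M posR)" by simp
    have [measurable]: "(\<lambda>z. snd z) \<in> borel_measurable (?P \<Otimes>\<^sub>M posR)" by (rule measurable_compose[OF measurable_snd measurable_posR_borel])
    have [measurable]: "(\<lambda>z. snd (fst z (Suc n))) \<in> borel_measurable (?P \<Otimes>\<^sub>M posR)" by (rule measurable_compose[OF measurable_fst snd_P])
    have [measurable]: "(\<lambda>z. ig n (fst z)) \<in> borel_measurable (?P \<Otimes>\<^sub>M posR)" by measurable
    have "(\<lambda>z. ig n (fst z) * (if ennreal (snd z) \<le> snd (fst z (Suc n)) then gc c n (hst n (fst z), snd z) else 0)) \<in> borel_measurable (?P \<Otimes>\<^sub>M posR)" by measurable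
    moreover have "(\<lambda>z. ig n (fst z) * (if ennreal (snd z) \<le> snd (fst z (Suc n)) then gc c n (hst n (fst z), snd z) else 0)) = k n"
      by (auto simp: k_def fun_eq_iff)
    ultimately show ?thesis by simp
  qed
  interpret pL: sigma_finite_measure posL by (rule sigma_finite_posL)
  interpret PL: pair_sigma_finite ?P posL by unfold_locales
  have kL: "(\<lambda>(\<omega>, s). k n (\<omega>, s)) \<in> borel_measurable (?P \<Otimes>\<^sub>M posL)" for n
  proof -
    have "sets (?P \<Otimes>\<^sub>M posL) = sets (?P \<Otimes>\<^sub>M posR)" by (rule sets_pair_measure_cong) simp_all
    then show ?thesis using km[of n] by (simp cong: measurable_cong_sets)
  qed
  have "objective S \<gamma> q c pol = (\<integral>\<^sup>+\<omega>. (\<Sum>n. \<integral>\<^sup>+s. k n (\<omega>, s) \<partial>posL) \<partial>?P)"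
    unfolding objective_def
  proof (intro nn_integral_cong_AE, rule AE_mp[OF AE_Omega], intro AE_I2 impI)
    fix \<omega> assume \<omega>: "\<omega> \<in> space ?P" "\<omega> \<in> Omega S"
    have "(\<integral>\<^sup>+s. seg c \<omega> n s \<partial>lborel) = (\<integral>\<^sup>+s. k n (\<omega>, s) \<partial>posL)" for n
      unfolding nn_integral_posL by (intro nn_integral_cong) (auto simp: seg_def k_def ig_def th_def split: split_indicator)
    then show "path_cost c pol \<omega> = (\<Sum>n. \<integral>\<^sup>+s. k n (\<omega>, s) \<partial>posL)"
      using path_cost_eq[OF c \<omega>(2)] \<omega>(1) by (simp add: spP)
  qed
  also have "\<dots> = (\<Sum>n. \<integral>\<^sup>+\<omega>. (\<integral>\<^sup>+s. k n (\<omega>, s) \<partial>posL) \<partial>?P)"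
    using measurable_posL_integral[OF km] by (rule nn_integral_suminf)
  also have "\<dots> = (\<Sum>n. \<integral>\<^sup>+h. (\<integral>\<^sup>+s. ew n (h, s) * gc c n (h, s) \<partial>posL) \<partial>mh n)"
  proof (rule suminf_cong)
    fix n
    interpret mh: finite_measure "mh n" by (rule finite_measure_mh)
    interpret mL: pair_sigma_finite "mh n" posL by unfold_locales
    note [measurable] = gc_measurable[OF c]
    have eL: "(\<lambda>(h, s). ew n (h, s) * gc c n (h, s)) \<in> borel_measurable (mh n \<Otimes>\<^sub>M posL)"
    proof -
      have "sets (mh n \<Otimes>\<^sub>M posL) = sets (HP n)" by (rule sets_pair_measure_cong) simp_all
      moreover have "(\<lambda>p. ew n p * gc c n p) \<in> borel_measurable (HP n)" by measurable
      ultimately show ?thesis by (simp add: case_prod_beta' cong: measurable_cong_sets)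
    qed
    have "(\<integral>\<^sup>+\<omega>. (\<integral>\<^sup>+s. k n (\<omega>, s) \<partial>posL) \<partial>?P) = (\<integral>\<^sup>+s. (\<integral>\<^sup>+\<omega>. k n (\<omega>, s) \<partial>?P) \<partial>posL)"
      by (rule PL.Fubini'[OF kL, symmetric])
    also have "\<dots> = (\<integral>\<^sup>+s. (\<integral>\<^sup>+h. ew n (h, s) * gc c n (h, s) \<partial>mh n) \<partial>posL)"
    proof (intro nn_integral_cong)
      fix s assume "s \<in> space posL"
      then have s: "0 < s" by simp
      have "(\<lambda>h. gc c n (h, s)) \<in> borel_measurable (HM n)" using s by (intro measurable_compose[OF measurable_Pair2' gc_measurable[OF c]]) simp
      from cond1_fun[OF this s] show "(\<integral>\<^sup>+\<omega>. k n (\<omega>, s) \<partial>?P) = (\<integral>\<^sup>+h. ew n (h, s) * gc c n (h, s) \<partial>mh n)"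
        by (simp add: k_def mult.assoc)
    qed
    also have "\<dots> = (\<integral>\<^sup>+h. (\<integral>\<^sup>+s. ew n (h, s) * gc c n (h, s) \<partial>posL) \<partial>mh n)" by (rule mL.Fubini'[OF eL])
    finally show "(\<integral>\<^sup>+\<omega>. (\<integral>\<^sup>+s. k n (\<omega>, s) \<partial>posL) \<partial>?P) = (\<integral>\<^sup>+h. (\<integral>\<^sup>+s. ew n (h, s) * gc c n (h, s) \<partial>posL) \<partial>mh n)" .
  qed
  finally show ?thesis .
qed

end

section \<open>Occupation sequences of the embedded chain\<close>

lemma nn_integral_zero_of_null_space: "emeasure M (space M) = 0 \<Longrightarrow> (\<integral>\<^sup>+x. f x \<partial>M) = 0"
proof -
  assume "emeasure M (space M) = 0"
  then have "AE x in M. f x = 0" by (intro AE_I[of _ _ "space M"]) auto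
  then have "(\<integral>\<^sup>+x. f x \<partial>M) = (\<integral>\<^sup>+x. 0 \<partial>M)" by (rule nn_integral_cong_AE)
  then show ?thesis by simp
qed

context ctmdp
begin

text \<open>What is kept of a policy: joint laws of state and action at successive sojourns, linked
  by \<open>Q\<close> alone. Time and history have disappeared, and the conditions are stable under
  weak limits.\<close>

definition occ :: "(nat \<Rightarrow> ('s \<times> 'b) measure) \<Rightarrow> bool" where
  "occ \<mu> \<longleftrightarrow> (\<forall>n. sets (\<mu> n) = sets SA) \<and>
    (\<forall>f\<in>borel_measurable (SM S). (\<integral>\<^sup>+z. f (fst z) \<partial>\<mu> 0) = (\<integral>\<^sup>+x. f x \<partial>\<gamma>)) \<and>
    (\<forall>n. \<forall>f\<in>borel_measurable (SM S). (\<integral>\<^sup>+z. f (fst z) \<partial>\<mu> (Suc n)) = (\<integral>\<^sup>+z. (\<integral>\<^sup>+y. f y \<partial>Q z) \<partial>\<mu> n))"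

lemma occD:
  assumes "occ \<mu>"
  shows "sets (\<mu> n) = sets SA" "space (\<mu> n) = S \<times> A"
    "f \<in> borel_measurable (SM S) \<Longrightarrow> (\<integral>\<^sup>+z. f (fst z) \<partial>\<mu> 0) = (\<integral>\<^sup>+x. f x \<partial>\<gamma>)"
    "f \<in> borel_measurable (SM S) \<Longrightarrow> (\<integral>\<^sup>+z. f (fst z) \<partial>\<mu> (Suc n)) = (\<integral>\<^sup>+z. (\<integral>\<^sup>+y. f y \<partial>Q z) \<partial>\<mu> n)"
proof -
  show *: "sets (\<mu> n) = sets SA" using assms by (simp add: occ_def)
  show "space (\<mu> n) = S \<times> A" using sets_eq_imp_space_eq[OF *] by simp
qed (use assms in \<open>auto simp: occ_def\<close>)

lemma occ_mass: assumes "occ \<mu>" shows "emeasure (\<mu> n) (S \<times> A) \<le> 1"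
proof (induction n)
  case 0
  have "emeasure (\<mu> 0) (S \<times> A) = (\<integral>\<^sup>+x. 1 \<partial>\<gamma>)" using occD(3)[OF assms, of "\<lambda>_. 1"] occD(2)[OF assms, of 0] by simp
  then show ?case using prob_space.emeasure_space_1[OF gamma(1)] by simp
next
  case (Suc n)
  have "emeasure (\<mu> (Suc n)) (S \<times> A) = (\<integral>\<^sup>+z. (\<integral>\<^sup>+y. 1 \<partial>Q z) \<partial>\<mu> n)"
    using occD(4)[OF assms, of "\<lambda>_. 1" n] occD(2)[OF assms, of "Suc n"] by simp
  also have "\<dots> \<le> (\<integral>\<^sup>+z. 1 \<partial>\<mu> n)"
    using emeasure_Q_S by (intro nn_integral_mono) (auto simp: occD(2)[OF assms])
  finally show ?case using Suc occD(2)[OF assms, of n] by simp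
qed

end

section \<open>Costs and free actions\<close>

locale ctmdp_costs = ctmdp S A \<gamma> q for S :: "'s::polish_space set" and A :: "'b::polish_space set" and \<gamma> q +
  fixes c :: "nat \<Rightarrow> 's \<times> 'b \<Rightarrow> real" and N :: nat
  assumes c_meas: "\<forall>i\<le>N. c i \<in> borel_measurable SA"
    and c_nonneg: "\<forall>i\<le>N. \<forall>z\<in>S \<times> A. 0 \<le> c i z"
    and C1d: "\<forall>i\<le>N. lsc_on (S \<times> A) (c i)"
begin

lemma lsc_sum: "(\<And>i. i \<le> N \<Longrightarrow> lsc T (f i)) \<Longrightarrow> lsc T (\<lambda>z::'s \<times> 'b. \<Sum>i\<le>N. f i z)"
proof (induction N)
  case (Suc n)
  then show ?case by (simp add: lsc_add)
qed simp

lemma lsc_c: "i \<le> N \<Longrightarrow> lsc (S \<times> A) (\<lambda>z. ennreal (c i z))"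
  using C1d c_nonneg by (intro lsc_of_lsc_on) auto

lemma lsc_rate: "lsc (S \<times> A) rate"
  unfolding rate_def[abs_def] by (rule continuous_imp_lsc[OF continuous_on_qx])

text \<open>On \<open>S \<times> A\<close> this is zero exactly if the state is never left and
  nothing is paid; with the rate included, one selector takes care of both.\<close>

definition stay_cost :: "'s \<times> 'b \<Rightarrow> ennreal" where
  "stay_cost z = rate z + (\<Sum>i\<le>N. ennreal (c i z))"

lemma lsc_stay_cost: "lsc (S \<times> A) stay_cost"
  unfolding stay_cost_def[abs_def] by (intro lsc_add lsc_rate lsc_sum lsc_c)

definition stay :: "'s \<Rightarrow> 'b" where
  "stay = (SOME f. f \<in> measurable (SM S) (SM A) \<and> (\<forall>x\<in>S. (\<exists>a\<in>A. stay_cost (x, a) = 0) \<longrightarrow> stay_cost (x, f x) = 0))"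

lemma stay: "stay \<in> measurable (SM S) (SM A)" "x \<in> S \<Longrightarrow> a \<in> A \<Longrightarrow> stay_cost (x, a) = 0 \<Longrightarrow> stay_cost (x, stay x) = 0"
proof -
  have "\<exists>f. f \<in> measurable (SM S) (SM A) \<and> (\<forall>x\<in>S. (\<exists>a\<in>A. stay_cost (x, a) = 0) \<longrightarrow> stay_cost (x, f x) = 0)"
    using measurable_zero_selector[OF A_compact A_ne lsc_stay_cost] by blast
  from someI_ex[OF this] have *: "stay \<in> measurable (SM S) (SM A) \<and> (\<forall>x\<in>S. (\<exists>a\<in>A. stay_cost (x, a) = 0) \<longrightarrow> stay_cost (x, stay x) = 0)"
    unfolding stay_def .
  show "stay \<in> measurable (SM S) (SM A)" using * by blast
  show "x \<in> S \<Longrightarrow> a \<in> A \<Longrightarrow> stay_cost (x, a) = 0 \<Longrightarrow> stay_cost (x, stay x) = 0" using * by blast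
qed

lemma jcost_measurable: "i \<le> N \<Longrightarrow> jcost (c i) \<in> borel_measurable SA"
proof -
  assume "i \<le> N"
  then have "(\<lambda>z. ennreal (c i z)) \<in> borel_measurable SA" using c_meas by (intro measurable_compose[OF _ measurable_ennreal]) auto
  then show ?thesis unfolding jcost_def[abs_def] by (intro borel_measurable_divide_ennreal measurable_rate)
qed

lemma lsc_jcost_c: "i \<le> N \<Longrightarrow> lsc (S \<times> A) (jcost (c i))"
  using C1d c_nonneg by (intro lsc_jcost) auto

text \<open>Equality fails at rate zero, where \<open>0 * \<top> = 0\<close> discards the
  cost.\<close>

lemma rate_jcost_le: "rate z * jcost f z \<le> ennreal (f z)"
proof (cases "rate z = 0")
  case False
  then show ?thesis using rate_finite[of z] by (simp add: jcost_def ennreal_times_divide mult.commute[of "rate z"] ennreal_mult_divide_eq)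
qed simp

end

section \<open>The occupation sequence of a policy of finite cost\<close>

locale ctmdp_costs_policy = ctmdp_costs S A \<gamma> q c N + ctmdp_policy S A \<gamma> q pol
  for S :: "'s::polish_space set" and A :: "'b::polish_space set" and \<gamma> q c N pol +
  assumes finite_costs: "\<And>i. i \<le> N \<Longrightarrow> objective S \<gamma> q (c i) pol < \<top>"
begin

lemma gc_meas[measurable]: "i \<le> N \<Longrightarrow> gc (c i) n \<in> borel_measurable (HP n)"
  using c_meas by (intro gc_measurable) auto

lemma AE_finite_segment: "i \<le> N \<Longrightarrow> AE h in mh n. (\<integral>\<^sup>+s. ew n (h, s) * gc (c i) n (h, s) \<partial>posL) < \<top>"
proof -
  assume i: "i \<le> N"
  have [measurable]: "gc (c i) n \<in> borel_measurable (HP n)" using i by (rule gc_meas)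
  have m: "(\<lambda>h. \<integral>\<^sup>+s. ew n (h, s) * gc (c i) n (h, s) \<partial>posL) \<in> borel_measurable (mh n)"
    using measurable_posL_integral[of "\<lambda>p. ew n p * gc (c i) n p" "HM n"] by simp
  have "(\<integral>\<^sup>+h. (\<integral>\<^sup>+s. ew n (h, s) * gc (c i) n (h, s) \<partial>posL) \<partial>mh n) \<le> objective S \<gamma> q (c i) pol"
  proof -
    have "(\<Sum>k\<in>{n}. \<integral>\<^sup>+h. (\<integral>\<^sup>+s. ew k (h, s) * gc (c i) k (h, s) \<partial>posL) \<partial>mh k) \<le> (\<Sum>k. \<integral>\<^sup>+h. (\<integral>\<^sup>+s. ew k (h, s) * gc (c i) k (h, s) \<partial>posL) \<partial>mh k)"
      by (intro sum_le_suminf) auto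
    then show ?thesis using objective_eq[of "c i"] c_meas i by simp
  qed
  then have "(\<integral>\<^sup>+h. (\<integral>\<^sup>+s. ew n (h, s) * gc (c i) n (h, s) \<partial>posL) \<partial>mh n) \<noteq> \<infinity>" using finite_costs[OF i] by (auto simp: top_unique)
  from nn_integral_PInf_AE[OF m this] show ?thesis by (simp add: less_top)
qed

lemma emeasure_posL: "emeasure posL {0<..} = \<top>"
proof -
  have "emeasure posL {0<..} = (\<integral>\<^sup>+s. 1 \<partial>posL)" by simp
  also have "\<dots> = emeasure lborel {0::real<..}" unfolding nn_integral_posL by simp
  also have "\<dots> = \<top>"
  proof (rule ccontr)
    assume "emeasure lborel {0::real<..} \<noteq> \<top>"
    then obtain r where r: "emeasure lborel {0::real<..} = ennreal r" "0 \<le> r" by (cases "emeasure lborel {0::real<..}") auto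
    have "emeasure lborel {0<..r + 1} \<le> emeasure lborel {0::real<..}" by (intro emeasure_mono) auto
    then show False using r by (simp add: ennreal_le_iff)
  qed
  finally show ?thesis .
qed

text \<open>If jumps fail to occur with positive probability, survival stays above a positive
  constant for all time. Without a free action, compactness would bound \<open>stay_cost\<close>
  below by some \<open>\<epsilon> > 0\<close>, and survival times \<open>\<epsilon>\<close> would
  have an infinite time integral; but that integral is at most the jump mass plus finitely many
  finite costs.\<close>

lemma deficit_stay:
  assumes h: "h \<in> space (HM n)" and fin: "\<And>i. i \<le> N \<Longrightarrow> (\<integral>\<^sup>+s. ew n (h, s) * gc (c i) n (h, s) \<partial>posL) < \<top>"
    and lt: "jmass n h < 1"
  shows "stay_cost (snd h, stay (snd h)) = 0"
proof (rule ccontr)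
  assume no: "stay_cost (snd h, stay (snd h)) \<noteq> 0"
  let ?x = "snd h"
  have x: "?x \<in> S" by (rule snd_HM[OF h])
  have pos: "stay_cost (?x, a) \<noteq> 0" if "a \<in> A" for a using stay(2)[OF x that] no by auto
  have "lsc A (\<lambda>a. stay_cost (?x, a))" using x by (intro lsc_compose[OF lsc_stay_cost] continuous_intros) auto
  from lsc_attains_INF[OF this A_compact A_ne] obtain a0 where a0: "a0 \<in> A" "stay_cost (?x, a0) = (INF a\<in>A. stay_cost (?x, a))" by blast
  define \<epsilon> where "\<epsilon> = stay_cost (?x, a0)"
  have \<epsilon>: "0 < \<epsilon>" "\<And>a. a \<in> A \<Longrightarrow> \<epsilon> \<le> stay_cost (?x, a)" using pos[OF a0(1)] a0(2) by (auto simp: \<epsilon>_def zero_less_iff_neq_zero intro: INF_lower)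
  have cm[measurable]: "(\<lambda>z. ennreal (c i z)) \<in> borel_measurable SA" if "i \<le> N" for i
    using c_meas that by (intro measurable_compose[OF _ measurable_ennreal]) auto
  have sec: "(\<lambda>a. g (?x, a)) \<in> borel_measurable (pol n (h, s))" if "0 < s" "g \<in> borel_measurable SA" for g :: "_ \<Rightarrow> ennreal" and s
    using measurable_compose[OF measurable_Pair1'[of ?x "SM S" "SM A"] that(2)] x by (simp add: measurable_cong_sets[OF pol_prob(2)[OF h that(1)] refl])
  have s1: "(\<integral>\<^sup>+a. (\<Sum>i\<le>N. ennreal (c i (?x, a))) \<partial>pol n (h, s)) = (\<Sum>i\<le>N. \<integral>\<^sup>+a. ennreal (c i (?x, a)) \<partial>pol n (h, s))" if "0 < s" for s
    by (rule nn_integral_sum) (use sec[OF that cm] in auto)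
  have inner: "\<epsilon> \<le> lamE n (h, s) + (\<Sum>i\<le>N. gc (c i) n (h, s))" if s: "0 < s" for s
  proof -
    have "\<epsilon> = (\<integral>\<^sup>+a. \<epsilon> \<partial>pol n (h, s))" using prob_space.emeasure_space_1[OF pol_prob(1)[OF h s]] by simp
    also have "\<dots> \<le> (\<integral>\<^sup>+a. stay_cost (?x, a) \<partial>pol n (h, s))" using \<epsilon>(2) by (intro nn_integral_mono) (simp add: pol_prob(3)[OF h s])
    also have "\<dots> = lamE n (h, s) + (\<Sum>i\<le>N. gc (c i) n (h, s))"
      unfolding stay_cost_def lamE_def gc_def
      using sec[OF s measurable_rate] sec[OF s cm] s1[OF s] by (subst nn_integral_add) auto
    finally show ?thesis .
  qed
  have m1: "(\<lambda>s. ew n (h, s) * g (h, s)) \<in> borel_measurable posL" if "g \<in> borel_measurable (HP n)" for g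
    using measurable_HP_section[OF h, of "\<lambda>p. ew n p * g p"] that by simp
  have s2: "(\<integral>\<^sup>+s. (\<Sum>i\<le>N. ew n (h, s) * gc (c i) n (h, s)) \<partial>posL) = (\<Sum>i\<le>N. \<integral>\<^sup>+s. ew n (h, s) * gc (c i) n (h, s) \<partial>posL)"
    by (rule nn_integral_sum) (use m1[OF gc_meas] in auto)
  have ewm: "(\<lambda>s. ew n (h, s)) \<in> borel_measurable posL" using measurable_HP_section[OF h measurable_ew] by simp
  have "(\<integral>\<^sup>+s. ew n (h, s) * \<epsilon> \<partial>posL) \<le> (\<integral>\<^sup>+s. ew n (h, s) * (lamE n (h, s) + (\<Sum>i\<le>N. gc (c i) n (h, s))) \<partial>posL)"
    using inner by (intro nn_integral_mono mult_left_mono) auto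
  also have "\<dots> = jmass n h + (\<Sum>i\<le>N. \<integral>\<^sup>+s. ew n (h, s) * gc (c i) n (h, s) \<partial>posL)"
    unfolding jmass_def distrib_left sum_distrib_left
    using m1[OF measurable_lamE] m1[OF gc_meas] s2 by (subst nn_integral_add) auto
  also have "\<dots> < \<top>" using jmass_le_1[OF h] fin by (auto simp: less_top[symmetric] top_unique)
  finally have A: "(\<integral>\<^sup>+s. ew n (h, s) * \<epsilon> \<partial>posL) < \<top>" .
  have ge: "1 - jmass n h \<le> ew n (h, s)" if "0 < s" for s
    unfolding hazard_tail[OF h that, symmetric] by (rule le_iff_add[THEN iffD2]) (rule exI, rule add.commute)
  have "(\<integral>\<^sup>+s. (1 - jmass n h) * \<epsilon> \<partial>posL) \<le> (\<integral>\<^sup>+s. ew n (h, s) * \<epsilon> \<partial>posL)"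
    using ge by (intro nn_integral_mono mult_right_mono) auto
  moreover have "(\<integral>\<^sup>+s. (1 - jmass n h) * \<epsilon> \<partial>posL) = \<top>"
    using lt \<epsilon>(1) by (simp add: emeasure_posL ennreal_mult_eq_top_iff diff_eq_0_iff_ennreal not_le)
  ultimately show False using A by (simp add: top_unique)
qed

text \<open>The mass that never jumps is put on a free action of rate zero; finiteness of the costs provides one.\<close>
definition occ_of :: "nat \<Rightarrow> ('s \<times> 'b) measure" where
  "occ_of n = functional_measure SA (\<lambda>g. \<integral>\<^sup>+h. (\<integral>\<^sup>+s. ew n (h, s) * (\<integral>\<^sup>+a. rate (snd h, a) * g (snd h, a) \<partial>pol n (h, s)) \<partial>posL)
     + (1 - jmass n h) * g (snd h, stay (snd h)) \<partial>mh n)"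

lemma occ_inner_measurable:
  assumes g: "g \<in> borel_measurable SA"
  shows "(\<lambda>p. ew n p * (\<integral>\<^sup>+a. rate (snd (fst p), a) * g (snd (fst p), a) \<partial>pol n p)) \<in> borel_measurable (HP n)"
proof -
  note [measurable] = g
  have "(\<lambda>z. rate z * g z) \<in> borel_measurable SA" by measurable
  from measurable_pol_integral[OF this] show ?thesis by measurable
qed

lemma stay_point_measurable: "(\<lambda>h. (snd h, stay (snd h))) \<in> measurable (HM n) SA"
  by (intro measurable_Pair measurable_compose[OF measurable_snd_HM stay(1)] measurable_snd_HM)

lemma pos_functional_occ_of: "pos_functional SA (\<lambda>g. \<integral>\<^sup>+h. (\<integral>\<^sup>+s. ew n (h, s) * (\<integral>\<^sup>+a. rate (snd h, a) * g (snd h, a) \<partial>pol n (h, s)) \<partial>posL)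
     + (1 - jmass n h) * g (snd h, stay (snd h)) \<partial>mh n)"
proof (rule pos_functional_integral)
  fix h assume "h \<in> space (mh n)"
  then have h: "h \<in> space (HM n)" by simp
  have "stay (snd h) \<in> A" using measurable_space[OF stay(1)] snd_HM[OF h] by simp
  then have st: "(snd h, stay (snd h)) \<in> space SA" using snd_HM[OF h] by simp
  have "pos_functional SA (\<lambda>g. \<integral>\<^sup>+s. ew n (h, s) * (\<integral>\<^sup>+a. rate (snd h, a) * g (snd h, a) \<partial>pol n (h, s)) \<partial>posL)"
  proof (intro pos_functional_integral pos_functional_cmult pos_functional_eval)
    fix s a assume "s \<in> space posL" "a \<in> space (pol n (h, s))"
    then show "(snd h, a) \<in> space SA" using pol_prob(3)[OF h] snd_HM[OF h] by simp
  next
    fix s and g :: "_ \<Rightarrow> ennreal" assume s: "s \<in> space posL" and [measurable]: "g \<in> borel_measurable SA"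
    have "(\<lambda>z. rate z * g z) \<in> borel_measurable SA" by measurable
    then have "(\<lambda>a. rate (snd h, a) * g (snd h, a)) \<in> borel_measurable (SM A)"
      by (rule measurable_compose[OF measurable_Pair1'[of "snd h" "SM S" "SM A"], rotated]) (simp add: snd_HM[OF h])
    then show "(\<lambda>a. rate (snd h, a) * g (snd h, a)) \<in> borel_measurable (pol n (h, s))"
      using s by (simp add: measurable_cong_sets[OF pol_prob(2)[OF h] refl])
  next
    fix g :: "_ \<Rightarrow> ennreal" assume "g \<in> borel_measurable SA"
    from measurable_HP_section[OF h occ_inner_measurable[OF this]]
    show "(\<lambda>s. ew n (h, s) * (\<integral>\<^sup>+a. rate (snd h, a) * g (snd h, a) \<partial>pol n (h, s))) \<in> borel_measurable posL" by simp
  qed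
  then show "pos_functional SA (\<lambda>g. (\<integral>\<^sup>+s. ew n (h, s) * (\<integral>\<^sup>+a. rate (snd h, a) * g (snd h, a) \<partial>pol n (h, s)) \<partial>posL) + (1 - jmass n h) * g (snd h, stay (snd h)))"
    using pos_functional_cmult[OF pos_functional_eval[OF st]] by (rule pos_functional_add)
next
  fix g :: "_ \<Rightarrow> ennreal" assume g: "g \<in> borel_measurable SA"
  have [measurable]: "(\<lambda>h. \<integral>\<^sup>+s. ew n (h, s) * (\<integral>\<^sup>+a. rate (snd h, a) * g (snd h, a) \<partial>pol n (h, s)) \<partial>posL) \<in> borel_measurable (HM n)"
    using measurable_posL_integral[OF occ_inner_measurable[OF g]] by simp
  have [measurable]: "(\<lambda>h. g (snd h, stay (snd h))) \<in> borel_measurable (HM n)" by (rule measurable_compose[OF stay_point_measurable g])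
  show "(\<lambda>h. (\<integral>\<^sup>+s. ew n (h, s) * (\<integral>\<^sup>+a. rate (snd h, a) * g (snd h, a) \<partial>pol n (h, s)) \<partial>posL) + (1 - jmass n h) * g (snd h, stay (snd h))) \<in> borel_measurable (mh n)"
    by measurable
qed

lemma nn_integral_occ_of: "g \<in> borel_measurable SA \<Longrightarrow> (\<integral>\<^sup>+z. g z \<partial>occ_of n) =
   (\<integral>\<^sup>+h. (\<integral>\<^sup>+s. ew n (h, s) * (\<integral>\<^sup>+a. rate (snd h, a) * g (snd h, a) \<partial>pol n (h, s)) \<partial>posL) + (1 - jmass n h) * g (snd h, stay (snd h)) \<partial>mh n)"
  unfolding occ_of_def by (rule nn_integral_functional_measure[OF pos_functional_occ_of])

lemma AE_deficit: "AE h in mh n. jmass n h = 1 \<or> stay_cost (snd h, stay (snd h)) = 0"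
proof -
  have "AE h in mh n. \<forall>i\<in>{..N}. (\<integral>\<^sup>+s. ew n (h, s) * gc (c i) n (h, s) \<partial>posL) < \<top>"
    by (intro AE_finite_allI) (auto intro: AE_finite_segment)
  then show ?thesis
  proof (rule AE_mp, intro AE_I2 impI)
    fix h assume h: "h \<in> space (mh n)" and fin: "\<forall>i\<in>{..N}. (\<integral>\<^sup>+s. ew n (h, s) * gc (c i) n (h, s) \<partial>posL) < \<top>"
    show "jmass n h = 1 \<or> stay_cost (snd h, stay (snd h)) = 0"
      using deficit_stay[of h n] jmass_le_1[of h n] h fin by (cases "jmass n h = 1") (auto simp: order_less_le)
  qed
qed

text \<open>The jumping part contributes mass \<open>jmass n h\<close> and the idle part the
  complement, so no state loses mass.\<close>

lemma occ_of_marginal: assumes f: "f \<in> borel_measurable (SM S)"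
  shows "(\<integral>\<^sup>+z. f (fst z) \<partial>occ_of n) = (\<integral>\<^sup>+h. f (snd h) \<partial>mh n)"
proof -
  have fm: "(\<lambda>z. f (fst z)) \<in> borel_measurable SA" by (rule measurable_compose[OF measurable_fst f])
  have "(\<integral>\<^sup>+z. f (fst z) \<partial>occ_of n) = (\<integral>\<^sup>+h. (\<integral>\<^sup>+s. ew n (h, s) * (\<integral>\<^sup>+a. rate (snd h, a) * f (snd h) \<partial>pol n (h, s)) \<partial>posL) + (1 - jmass n h) * f (snd h) \<partial>mh n)"
    using nn_integral_occ_of[OF fm, of n] by simp
  also have "\<dots> = (\<integral>\<^sup>+h. f (snd h) \<partial>mh n)"
  proof (intro nn_integral_cong)
    fix h assume "h \<in> space (mh n)"
    then have h: "h \<in> space (HM n)" by simp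
    have m: "(\<lambda>s. ew n (h, s) * lamE n (h, s)) \<in> borel_measurable posL"
      using measurable_HP_section[OF h, of "\<lambda>p. ew n p * lamE n p"] by simp
    have "(\<integral>\<^sup>+s. ew n (h, s) * (\<integral>\<^sup>+a. rate (snd h, a) * f (snd h) \<partial>pol n (h, s)) \<partial>posL) = (\<integral>\<^sup>+s. (ew n (h, s) * lamE n (h, s)) * f (snd h) \<partial>posL)"
    proof (intro nn_integral_cong)
      fix s assume "s \<in> space posL"
      then have s: "0 < s" by simp
      have "(\<lambda>a. rate (snd h, a)) \<in> borel_measurable (pol n (h, s))"
        using measurable_compose[OF measurable_Pair1'[of "snd h" "SM S" "SM A"] measurable_rate] snd_HM[OF h]
        by (simp add: measurable_cong_sets[OF pol_prob(2)[OF h s] refl])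
      then show "ew n (h, s) * (\<integral>\<^sup>+a. rate (snd h, a) * f (snd h) \<partial>pol n (h, s)) = ew n (h, s) * lamE n (h, s) * f (snd h)"
        by (simp add: nn_integral_multc lamE_def mult.assoc)
    qed
    also have "\<dots> = jmass n h * f (snd h)" using m by (simp add: nn_integral_multc jmass_def)
    finally show "(\<integral>\<^sup>+s. ew n (h, s) * (\<integral>\<^sup>+a. rate (snd h, a) * f (snd h) \<partial>pol n (h, s)) \<partial>posL) + (1 - jmass n h) * f (snd h) = f (snd h)"
      using jmass_le_1[OF h] by (simp add: distrib_right[symmetric] add_diff_inverse_ennreal)
  qed
  finally show ?thesis .
qed

lemma occ_occ_of: "occ occ_of"
  unfolding occ_def
proof (intro conjI allI ballI)
  show "sets (occ_of n) = sets SA" for n by (simp add: occ_of_def)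
next
  fix f :: "'s \<Rightarrow> ennreal" assume f: "f \<in> borel_measurable (SM S)"
  have T: "(\<lambda>x. (\<lambda>_. undefined, x)) \<in> measurable \<gamma> (HM 0)"
    unfolding histM_def measurable_cong_sets[OF gamma(2) refl] by (intro measurable_Pair) (auto intro!: measurable_const simp: space_PiM)
  have fs: "(\<lambda>h. f (snd h)) \<in> borel_measurable (HM 0)" by (rule measurable_compose[OF measurable_snd_HM f])
  have "(\<integral>\<^sup>+h. f (snd h) \<partial>mh 0) = (\<integral>\<^sup>+x. f x \<partial>\<gamma>)" using nn_integral_distr[OF T, of "\<lambda>h. f (snd h)"] fs by simp
  then show "(\<integral>\<^sup>+z. f (fst z) \<partial>occ_of 0) = (\<integral>\<^sup>+x. f x \<partial>\<gamma>)" by (simp only: occ_of_marginal[OF f])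
next
  fix n and f :: "'s \<Rightarrow> ennreal" assume f: "f \<in> borel_measurable (SM S)"
  have fs: "(\<lambda>h. f (snd h)) \<in> borel_measurable (HM (Suc n))" by (rule measurable_compose[OF measurable_snd_HM f])
  have "(\<integral>\<^sup>+z. f (fst z) \<partial>occ_of (Suc n)) = (\<integral>\<^sup>+h. f (snd h) \<partial>mh (Suc n))" by (rule occ_of_marginal[OF f])
  also have "\<dots> = (\<integral>\<^sup>+h. jump n h (\<lambda>w. f (snd (hext n (h, w)))) \<partial>mh n)" by (rule nn_integral_mh_Suc[OF fs])
  also have "\<dots> = (\<integral>\<^sup>+h. (\<integral>\<^sup>+s. ew n (h, s) * (\<integral>\<^sup>+a. rate (snd h, a) * (\<integral>\<^sup>+y. f y \<partial>Q (snd h, a)) \<partial>pol n (h, s)) \<partial>posL)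
      + (1 - jmass n h) * (\<integral>\<^sup>+y. f y \<partial>Q (snd h, stay (snd h))) \<partial>mh n)"
  proof (intro nn_integral_cong_AE, rule AE_mp[OF AE_deficit], intro AE_I2 impI)
    fix h assume "h \<in> space (mh n)" and d: "jmass n h = 1 \<or> stay_cost (snd h, stay (snd h)) = 0"
    then have h: "h \<in> space (HM n)" by simp
    \<comment> \<open>Where idle mass is present it sits at rate zero; there \<open>Q\<close> is
      null, so nothing is fed into the next step.\<close>
    have "(1 - jmass n h) * (\<integral>\<^sup>+y. f y \<partial>Q (snd h, stay (snd h))) = 0"
    proof (cases "jmass n h = 1")
      case False
      then have "rate (snd h, stay (snd h)) = 0" using d by (simp add: stay_cost_def)
      moreover have "stay (snd h) \<in> A" using measurable_space[OF stay(1)] snd_HM[OF h] by simp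
      ultimately have "emeasure (Q (snd h, stay (snd h))) (space (Q (snd h, stay (snd h)))) = 0" using emeasure_Q_S snd_HM[OF h] by simp
      then show ?thesis by (simp add: nn_integral_zero_of_null_space)
    qed simp
    then show "jump n h (\<lambda>w. f (snd (hext n (h, w)))) = (\<integral>\<^sup>+s. ew n (h, s) * (\<integral>\<^sup>+a. rate (snd h, a) * (\<integral>\<^sup>+y. f y \<partial>Q (snd h, a)) \<partial>pol n (h, s)) \<partial>posL)
      + (1 - jmass n h) * (\<integral>\<^sup>+y. f y \<partial>Q (snd h, stay (snd h)))" by (simp add: jump_def hext_def)
  qed
  also have "\<dots> = (\<integral>\<^sup>+z. (\<integral>\<^sup>+y. f y \<partial>Q z) \<partial>occ_of n)" by (rule nn_integral_occ_of[OF measurable_nn_integral_Q[OF f], symmetric])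
  finally show "(\<integral>\<^sup>+z. f (fst z) \<partial>occ_of (Suc n)) = (\<integral>\<^sup>+z. (\<integral>\<^sup>+y. f y \<partial>Q z) \<partial>occ_of n)" .
qed

text \<open>Weighting by \<open>rate\<close> converts a cost per unit of time into a cost per jump,
  and the idle part is free. Costs incurred under actions of rate zero are dropped, hence an
  inequality.\<close>

lemma occ_of_cost: assumes i: "i \<le> N"
  shows "(\<Sum>n. \<integral>\<^sup>+z. jcost (c i) z \<partial>occ_of n) \<le> objective S \<gamma> q (c i) pol"
proof -
  have "(\<integral>\<^sup>+z. jcost (c i) z \<partial>occ_of n) \<le> (\<integral>\<^sup>+h. (\<integral>\<^sup>+s. ew n (h, s) * gc (c i) n (h, s) \<partial>posL) \<partial>mh n)" for n
    unfolding nn_integral_occ_of[OF jcost_measurable[OF i]]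
  proof (intro nn_integral_mono_AE, rule AE_mp[OF AE_deficit], intro AE_I2 impI)
    fix h assume "h \<in> space (mh n)" and d: "jmass n h = 1 \<or> stay_cost (snd h, stay (snd h)) = 0"
    have "(1 - jmass n h) * jcost (c i) (snd h, stay (snd h)) = 0"
    proof (cases "jmass n h = 1")
      case False
      then have "ennreal (c i (snd h, stay (snd h))) = 0" using d i by (simp add: stay_cost_def sum_eq_0_iff)
      then show ?thesis by (simp add: jcost_def)
    qed simp
    moreover have "(\<integral>\<^sup>+s. ew n (h, s) * (\<integral>\<^sup>+a. rate (snd h, a) * jcost (c i) (snd h, a) \<partial>pol n (h, s)) \<partial>posL) \<le> (\<integral>\<^sup>+s. ew n (h, s) * gc (c i) n (h, s) \<partial>posL)"
      unfolding gc_def by (intro nn_integral_mono mult_left_mono) (auto simp: rate_jcost_le)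
    ultimately show "(\<integral>\<^sup>+s. ew n (h, s) * (\<integral>\<^sup>+a. rate (snd h, a) * jcost (c i) (snd h, a) \<partial>pol n (h, s)) \<partial>posL) + (1 - jmass n h) * jcost (c i) (snd h, stay (snd h))
       \<le> (\<integral>\<^sup>+s. ew n (h, s) * gc (c i) n (h, s) \<partial>posL)" by (simp only: add_0_right)
  qed
  then show ?thesis using c_meas i by (simp add: objective_eq suminf_le)
qed

end

section \<open>Compactness of occupation sequences\<close>

text \<open>Indicators of open sets are increasing limits of bounded continuous functions, and open
  sets generate.\<close>

lemma finite_measure_eqI_continuous:
  fixes S :: "'s::{metric_space,second_countable_topology} set"
  assumes S: "S \<in> sets borel" and sets: "sets M = sets (SM S)" "sets N = sets (SM S)"
    and fin: "emeasure M S \<noteq> \<infinity>"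
    and eq: "\<And>f B. continuous_on S f \<Longrightarrow> (\<And>x. 0 \<le> f x) \<Longrightarrow> (\<And>x. f x \<le> B) \<Longrightarrow> (\<integral>\<^sup>+x. ennreal (f x) \<partial>M) = (\<integral>\<^sup>+x. ennreal (f x) \<partial>N)"
  shows "M = N"
proof -
  have sp: "space M = S" "space N = S" using sets_eq_imp_space_eq[OF sets(1)] sets_eq_imp_space_eq[OF sets(2)] by auto
  have idm: "(\<lambda>x. x) \<in> measurable M borel" "(\<lambda>x. x) \<in> measurable N borel"
    unfolding measurable_cong_sets[OF sets(1) refl] measurable_cong_sets[OF sets(2) refl] by (rule measurable_SM_borel)+
  have inb: "E \<inter> S \<in> sets M" "E \<inter> S \<in> sets N" if "E \<in> sets borel" for E
    using measurable_sets[OF idm(1) that] measurable_sets[OF idm(2) that] by (simp_all add: sp)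
  have op: "emeasure M (U \<inter> S) = emeasure N (U \<inter> S)" if U: "open U" for U
  proof -
    have "lsc S (indicator U)" unfolding lsc_def
    proof
      fix r :: ennreal
      have "{z \<in> S. r < indicator U z} = (if r < 1 then S \<inter> U else {})" by (auto split: split_indicator)
      then show "openin (top_of_set S) {z \<in> S. r < indicator U z}" using U by auto
    qed
    from lsc_eq_SUP_run_max[OF this] obtain r j where rj: "\<And>k. (0::real) \<le> r k" "\<And>z. z \<in> S \<Longrightarrow> indicator U z = (SUP n. ennreal (run_max (\<lambda>k z. r k * tent (j k) z) n z))"
      by blast
    define \<phi> :: "nat \<Rightarrow> 's \<Rightarrow> real" where "\<phi> = run_max (\<lambda>k z. r k * tent (j k) z)"
    have c: "continuous_on S (\<phi> n)" for n unfolding \<phi>_def by (intro continuous_on_run_max continuous_intros)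
    have m: "\<phi> n \<in> borel_measurable (SM S)" for n by (rule continuous_on_measurable_SM[OF c])
    have nn: "0 \<le> \<phi> n x" for n x unfolding \<phi>_def by (rule run_max_tent_bounds(1)[OF rj(1)])
    have "\<exists>B. \<forall>x. \<phi> n x \<le> B" for n unfolding \<phi>_def by (rule run_max_tent_bounds(2)[OF rj(1)])
    then obtain B where B: "\<And>n x. \<phi> n x \<le> B n" by metis
    have inc: "\<phi> n x \<le> \<phi> n' x" if "n \<le> n'" for n n' x unfolding \<phi>_def using that by (rule run_max_mono)
    have *: "emeasure L (U \<inter> S) = (SUP n. \<integral>\<^sup>+x. ennreal (\<phi> n x) \<partial>L)" if L: "sets L = sets (SM S)" "U \<inter> S \<in> sets L" for L
    proof -
      have "emeasure L (U \<inter> S) = (\<integral>\<^sup>+x. indicator (U \<inter> S) x \<partial>L)" using L(2) by simp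
      also have "\<dots> = (\<integral>\<^sup>+x. (SUP n. ennreal (\<phi> n x)) \<partial>L)"
        using sets_eq_imp_space_eq[OF L(1)] by (intro nn_integral_cong) (auto simp: \<phi>_def rj(2)[symmetric] split: split_indicator)
      also have "\<dots> = (SUP n. \<integral>\<^sup>+x. ennreal (\<phi> n x) \<partial>L)"
        using m inc by (intro nn_integral_monotone_convergence_SUP) (auto simp: incseq_def le_fun_def measurable_cong_sets[OF L(1) refl] intro!: ennreal_leI)
      finally show ?thesis .
    qed
    have b: "U \<in> sets borel" using U by simp
    show ?thesis unfolding *[OF sets(1) inb(1)[OF b]] *[OF sets(2) inb(2)[OF b]] using eq[OF c nn B] by simp
  qed
  have "distr M borel (\<lambda>x. x) = distr N borel (\<lambda>x. x)"
  proof (rule measure_eqI_generator_eq[where E="{U. open U}" and \<Omega>=UNIV and A="\<lambda>_. UNIV"])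
    show "Int_stable {U::'s set. open U}" by (auto simp: Int_stable_def)
    show "sets (distr M borel (\<lambda>x. x)) = sigma_sets UNIV {U. open U}" "sets (distr N borel (\<lambda>x. x)) = sigma_sets UNIV {U. open U}"
      by (simp_all add: borel_def)
    show "emeasure (distr M borel (\<lambda>x. x)) UNIV \<noteq> \<infinity>" using fin by (simp add: emeasure_distr[OF idm(1)] sp)
    fix U :: "'s set" assume "U \<in> {U. open U}"
    then show "emeasure (distr M borel (\<lambda>x. x)) U = emeasure (distr N borel (\<lambda>x. x)) U"
      using op by (simp add: emeasure_distr[OF idm(1)] emeasure_distr[OF idm(2)] sp)
  qed auto
  note deq = this
  show ?thesis
  proof (rule measure_eqI)
    show "sets M = sets N" using sets by simp
    fix E assume E: "E \<in> sets M"
    have "E \<subseteq> S" using sets.sets_into_space[OF E] sp by simp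
    moreover have Eb: "E \<in> sets borel" using E S unfolding sets(1) SM_def by (auto simp: sets_restrict_space)
    moreover have "emeasure M (E \<inter> S) = emeasure N (E \<inter> S)"
      using arg_cong[OF deq, of "\<lambda>L. emeasure L E"] Eb by (simp add: emeasure_distr[OF idm(1)] emeasure_distr[OF idm(2)] sp)
    ultimately show "emeasure M E = emeasure N E" by (simp add: Int_absorb2)
  qed
qed

lemma suminf_liminf_le:
  fixes u :: "nat \<Rightarrow> nat \<Rightarrow> ennreal"
  shows "(\<Sum>n. liminf (\<lambda>k. u k n)) \<le> liminf (\<lambda>k. \<Sum>n. u k n)"
  using nn_integral_liminf[of u "count_space UNIV"] by (simp add: nn_integral_count_space_nat)

context ctmdp
begin

text \<open>Weak convergence in one-sided form: convergence of the mass and a liminf inequality.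
  This is what the compactness theorem delivers and what the costs need; limits of continuous
  integrands follow in \<open>wlim_tendsto\<close>.\<close>

definition wlim :: "(nat \<Rightarrow> ('s \<times> 'b) measure) \<Rightarrow> ('s \<times> 'b) measure \<Rightarrow> bool" where
  "wlim M \<mu> \<longleftrightarrow> sets \<mu> = sets SA \<and> (\<lambda>k. emeasure (M k) (S \<times> A)) \<longlonglongrightarrow> emeasure \<mu> (S \<times> A) \<and>
    (\<forall>h. lsc (S \<times> A) h \<longrightarrow> (\<integral>\<^sup>+z. h z \<partial>\<mu>) \<le> liminf (\<lambda>k. \<integral>\<^sup>+z. h z \<partial>M k))"

lemma wlim_subseq:
  assumes w: "wlim M \<mu>" and r: "strict_mono r" shows "wlim (\<lambda>k. M (r k)) \<mu>"
  unfolding wlim_def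
proof (intro conjI allI impI)
  show "sets \<mu> = sets SA" using w by (simp add: wlim_def)
  show "(\<lambda>k. emeasure (M (r k)) (S \<times> A)) \<longlonglongrightarrow> emeasure \<mu> (S \<times> A)"
    using w LIMSEQ_subseq_LIMSEQ[OF _ r] by (force simp: wlim_def o_def)
  fix h assume "lsc (S \<times> A) h"
  then have "(\<integral>\<^sup>+z. h z \<partial>\<mu>) \<le> liminf (\<lambda>k. \<integral>\<^sup>+z. h z \<partial>M k)" using w by (simp add: wlim_def)
  also have "\<dots> \<le> liminf (\<lambda>k. \<integral>\<^sup>+z. h z \<partial>M (r k))" using liminf_subseq_mono[OF r, of "\<lambda>k. \<integral>\<^sup>+z. h z \<partial>M k"] by (simp add: o_def)
  finally show "(\<integral>\<^sup>+z. h z \<partial>\<mu>) \<le> liminf (\<lambda>k. \<integral>\<^sup>+z. h z \<partial>M (r k))" .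
qed

lemma wlim_tail: assumes w: "wlim (\<lambda>k. M (k + m)) \<mu>" shows "wlim M \<mu>"
  using w LIMSEQ_offset[of "\<lambda>k. emeasure (M k) (S \<times> A)" m] liminf_shift_k[of "\<lambda>k. \<integral>\<^sup>+z. h z \<partial>M k" m for h]
  unfolding wlim_def by auto

lemma wlim_tendsto:
  assumes w: "wlim M \<mu>" and M: "\<And>k. sets (M k) = sets SA" "\<And>k. emeasure (M k) (S \<times> A) \<le> 1"
    and f: "continuous_on (S \<times> A) f" "\<And>z. z \<in> S \<times> A \<Longrightarrow> 0 \<le> f z" "\<And>z. z \<in> S \<times> A \<Longrightarrow> f z \<le> B" "0 \<le> B"
  shows "(\<lambda>k. \<integral>\<^sup>+z. ennreal (f z) \<partial>M k) \<longlonglongrightarrow> (\<integral>\<^sup>+z. ennreal (f z) \<partial>\<mu>)"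
proof (rule tendsto_of_lsc_bounds[where T="S \<times> A"])
  have s: "sets \<mu> = sets SA" and mass: "(\<lambda>k. emeasure (M k) (S \<times> A)) \<longlonglongrightarrow> emeasure \<mu> (S \<times> A)" using w by (auto simp: wlim_def)
  show "space (M k) = S \<times> A" for k using sets_eq_imp_space_eq[OF M(1)] by simp
  show "space \<mu> = S \<times> A" using sets_eq_imp_space_eq[OF s] by simp
  show "(\<lambda>z. z) \<in> measurable (M k) borel" for k unfolding measurable_cong_sets[OF M(1) refl] by (rule measurable_pair_SM_borel)
  show "(\<lambda>z. z) \<in> measurable \<mu> borel" unfolding measurable_cong_sets[OF s refl] by (rule measurable_pair_SM_borel)
  show "emeasure (M k) (S \<times> A) < \<infinity>" for k using M(2)[of k] by (rule order.strict_trans1) simp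
  have "emeasure \<mu> (S \<times> A) \<le> 1" by (rule LIMSEQ_le_const2[OF mass]) (use M(2) in auto)
  then show "emeasure \<mu> (S \<times> A) < \<infinity>" by (rule order.strict_trans1) simp
  show "(\<lambda>k. emeasure (M k) (S \<times> A)) \<longlonglongrightarrow> emeasure \<mu> (S \<times> A)" by (rule mass)
  show "lsc (S \<times> A) h \<Longrightarrow> (\<integral>\<^sup>+z. h z \<partial>\<mu>) \<le> liminf (\<lambda>k. \<integral>\<^sup>+z. h z \<partial>M k)" for h using w by (simp add: wlim_def)
qed (use f in auto)

text \<open>By Condition 1(b) the function \<open>Qf f\<close> is bounded and continuous on pairs,
  so weak convergence at step \<open>n\<close> yields convergence of the state marginals at step
  \<open>Suc n\<close>.\<close>

lemma occ_step_tendsto: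
  assumes o: "\<And>k. occ (\<mu> k)" and w: "wlim (\<lambda>k. \<mu> k n) \<mu>'"
    and f: "continuous_on S f" "\<And>x. 0 \<le> f x" "\<And>x. f x \<le> B"
  shows "(\<lambda>k. \<integral>\<^sup>+z. ennreal (f (fst z)) \<partial>\<mu> k (Suc n)) \<longlonglongrightarrow> (\<integral>\<^sup>+z. (\<integral>\<^sup>+y. ennreal (f y) \<partial>Q z) \<partial>\<mu>')"
proof -
  have B: "0 \<le> B" using f(2,3) order_trans by blast
  have fm: "f \<in> borel_measurable (SM S)" by (rule continuous_on_measurable_SM[OF f(1)])
  have fm': "(\<lambda>x. ennreal (f x)) \<in> borel_measurable (SM S)" by (rule measurable_compose[OF fm measurable_ennreal])
  have s: "space \<mu>' = S \<times> A" using w sets_eq_imp_space_eq[of \<mu>' SA] by (simp add: wlim_def)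
  have "(\<lambda>k. \<integral>\<^sup>+z. ennreal (Qf f z) \<partial>\<mu> k n) \<longlonglongrightarrow> (\<integral>\<^sup>+z. ennreal (Qf f z) \<partial>\<mu>')"
    by (rule wlim_tendsto[OF w occD(1)[OF o] occ_mass[OF o] continuous_on_Qf[OF f] nn_integral_Q_eq(2)[OF _ fm f(2,3)] nn_integral_Q_eq(3)[OF _ fm f(2,3) B] B])
  moreover have "(\<integral>\<^sup>+z. ennreal (Qf f z) \<partial>\<mu>') = (\<integral>\<^sup>+z. (\<integral>\<^sup>+y. ennreal (f y) \<partial>Q z) \<partial>\<mu>')"
    by (intro nn_integral_cong nn_integral_Q_eq(1)[OF _ fm f(2,3), symmetric]) (simp add: s)
  moreover have "(\<integral>\<^sup>+z. ennreal (f (fst z)) \<partial>\<mu> k (Suc n)) = (\<integral>\<^sup>+z. ennreal (Qf f z) \<partial>\<mu> k n)" for k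
    unfolding occD(4)[OF o fm'] by (intro nn_integral_cong nn_integral_Q_eq(1)[OF _ fm f(2,3)]) (simp add: occD(2)[OF o])
  ultimately show ?thesis by simp
qed

definition push :: "('s \<times> 'b) measure \<Rightarrow> 's measure" where
  "push \<mu> = functional_measure (SM S) (\<lambda>f. \<integral>\<^sup>+z. (\<integral>\<^sup>+y. f y \<partial>Q z) \<partial>\<mu>)"

lemma nn_integral_push:
  assumes "sets \<mu> = sets SA" "f \<in> borel_measurable (SM S)"
  shows "(\<integral>\<^sup>+x. f x \<partial>push \<mu>) = (\<integral>\<^sup>+z. (\<integral>\<^sup>+y. f y \<partial>Q z) \<partial>\<mu>)"
  unfolding push_def
proof (rule nn_integral_functional_measure[OF pos_functional_integral assms(2)])
  show "pos_functional (SM S) (integral\<^sup>N (Q z))" for z by (rule pos_functional_nn_integral) simp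
  show "g \<in> borel_measurable (SM S) \<Longrightarrow> (\<lambda>z. integral\<^sup>N (Q z) g) \<in> borel_measurable \<mu>" for g
    using measurable_nn_integral_Q[of g] by (simp add: measurable_cong_sets[OF assms(1) refl])
qed

lemma sets_push[simp]: "sets (push \<mu>) = sets (SM S)" by (simp add: push_def)

lemma push_mass: assumes "sets \<mu> = sets SA" "emeasure \<mu> (S \<times> A) \<le> 1" shows "emeasure (push \<mu>) S \<le> 1"
proof -
  have sp: "space \<mu> = S \<times> A" using sets_eq_imp_space_eq[OF assms(1)] by simp
  have "emeasure (push \<mu>) S = (\<integral>\<^sup>+x. 1 \<partial>push \<mu>)" using sets_eq_imp_space_eq[OF sets_push[of \<mu>]] by simp
  also have "\<dots> = (\<integral>\<^sup>+z. (\<integral>\<^sup>+y. 1 \<partial>Q z) \<partial>\<mu>)" by (rule nn_integral_push[OF assms(1)]) simp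
  also have "\<dots> \<le> (\<integral>\<^sup>+z. 1 \<partial>\<mu>)" using emeasure_Q_S by (intro nn_integral_mono) (auto simp: sp)
  also have "\<dots> \<le> 1" using assms(2) by (simp add: sp)
  finally show ?thesis .
qed

lemma wlim_mass: assumes w: "wlim M \<mu>" and M: "\<And>k. emeasure (M k) (S \<times> A) \<le> 1" shows "emeasure \<mu> (S \<times> A) \<le> 1"
  using w M by (intro LIMSEQ_le_const2[of "\<lambda>k. emeasure (M k) (S \<times> A)"]) (auto simp: wlim_def)

lemma ex_wlim:
  assumes M: "\<And>k. sets (M k) = sets SA" "\<And>k. emeasure (M k) (S \<times> A) \<le> 1"
    and m: "sets m = sets (SM S)" "emeasure m S \<le> 1"
    and conv: "\<And>f B. continuous_on S f \<Longrightarrow> (\<And>x. 0 \<le> f x) \<Longrightarrow> (\<And>x. f x \<le> B) \<Longrightarrow>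
      (\<lambda>k. \<integral>\<^sup>+z. ennreal (f (fst z)) \<partial>M k) \<longlonglongrightarrow> (\<integral>\<^sup>+x. ennreal (f x) \<partial>m)"
  shows "\<exists>r \<mu>. strict_mono r \<and> wlim (\<lambda>k. M (r k)) \<mu>"
proof -
  have spm: "space m = S" using sets_eq_imp_space_eq[OF m(1)] by simp
  have spM: "space (M k) = S \<times> A" for k using sets_eq_imp_space_eq[OF M(1)] by simp
  have "emeasure m S < \<infinity>" using m(2) by (rule order.strict_trans1) simp
  then have fin: "finite_measure m" by (intro finite_measureI) (simp add: spm)
  obtain r \<mu> where r: "strict_mono r" "sets \<mu> = sets SA" "emeasure \<mu> (S \<times> A) = emeasure m S"
    "\<And>h. lsc (S \<times> A) h \<Longrightarrow> (\<integral>\<^sup>+z. h z \<partial>\<mu>) \<le> liminf (\<lambda>k. \<integral>\<^sup>+z. h z \<partial>M (r k))"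
    by (rule subprob_weakly_compact[OF S_borel A_compact M m(1) fin conv]) blast+
  have "(\<lambda>k. emeasure (M k) (S \<times> A)) \<longlonglongrightarrow> emeasure m S"
    using conv[of "\<lambda>_. 1" 1] by (simp add: spm spM)
  from LIMSEQ_subseq_LIMSEQ[OF this r(1)] have "wlim (\<lambda>k. M (r k)) \<mu>"
    using r by (simp add: wlim_def o_def)
  then show ?thesis using r(1) by blast
qed

text \<open>Induction on the step. The marginals are constantly \<open>\<gamma>\<close> at first and
  afterwards converge because the preceding step does; this is the premise of
  \<open>ex_wlim\<close>, so only the action component calls for compactness.\<close>

lemma occ_subseq:
  assumes o: "\<And>k. occ (\<mu> k)" and s: "strict_mono (s :: nat \<Rightarrow> nat)"
  shows "\<exists>r. strict_mono r \<and> (\<forall>m\<le>n. \<exists>\<mu>'. wlim (\<lambda>k. \<mu> ((s \<circ> r) k) m) \<mu>')"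
  using s
proof (induction n arbitrary: s)
  case 0
  have fm: "(\<lambda>x. ennreal (f x)) \<in> borel_measurable (SM S)" if "continuous_on S f" for f
    by (rule measurable_compose[OF continuous_on_measurable_SM[OF that] measurable_ennreal])
  have "\<exists>r \<mu>'. strict_mono r \<and> wlim (\<lambda>k. \<mu> (s (r k)) 0) \<mu>'"
  proof (rule ex_wlim[OF occD(1)[OF o] occ_mass[OF o] gamma(2)])
    show "emeasure \<gamma> S \<le> 1" using prob_space.emeasure_le_1[OF gamma(1)] .
    show "(\<lambda>k. \<integral>\<^sup>+z. ennreal (f (fst z)) \<partial>\<mu> (s k) 0) \<longlonglongrightarrow> (\<integral>\<^sup>+x. ennreal (f x) \<partial>\<gamma>)" if "continuous_on S f" for f
      using occD(3)[OF o fm[OF that]] by simp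
  qed
  then show ?case by auto
next
  case (Suc n)
  from Suc.IH[OF Suc.prems] obtain r where r: "strict_mono r" "\<forall>m\<le>n. \<exists>\<mu>'. wlim (\<lambda>k. \<mu> ((s \<circ> r) k) m) \<mu>'" by blast
  then obtain \<mu>' where \<mu>': "wlim (\<lambda>k. \<mu> ((s \<circ> r) k) n) \<mu>'" by blast
  have st: "sets \<mu>' = sets SA" using \<mu>' by (simp add: wlim_def)
  have "\<exists>r' \<mu>'. strict_mono r' \<and> wlim (\<lambda>k. \<mu> ((s \<circ> r) (r' k)) (Suc n)) \<mu>'"
  proof (rule ex_wlim[OF occD(1)[OF o] occ_mass[OF o] sets_push[of \<mu>']])
    show "emeasure (push \<mu>') S \<le> 1" by (rule push_mass[OF st wlim_mass[OF \<mu>' occ_mass[OF o]]])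
    fix f :: "'s \<Rightarrow> real" and B assume f: "continuous_on S f" "\<And>x. 0 \<le> f x" "\<And>x. f x \<le> B"
    have "(\<lambda>x. ennreal (f x)) \<in> borel_measurable (SM S)"
      by (rule measurable_compose[OF continuous_on_measurable_SM[OF f(1)] measurable_ennreal])
    then show "(\<lambda>k. \<integral>\<^sup>+z. ennreal (f (fst z)) \<partial>\<mu> ((s \<circ> r) k) (Suc n)) \<longlonglongrightarrow> (\<integral>\<^sup>+x. ennreal (f x) \<partial>push \<mu>')"
      using occ_step_tendsto[OF o \<mu>' f] by (simp add: nn_integral_push[OF st])
  qed
  then obtain r' \<mu>2 where r': "strict_mono r'" "wlim (\<lambda>k. \<mu> ((s \<circ> r) (r' k)) (Suc n)) \<mu>2" by blast
  show ?case
  proof (intro exI[of _ "r \<circ> r'"] conjI allI impI)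
    show "strict_mono (r \<circ> r')" using r(1) r'(1) by (rule strict_mono_o)
    fix m assume "m \<le> Suc n"
    then consider "m \<le> n" | "m = Suc n" by linarith
    then show "\<exists>\<mu>'. wlim (\<lambda>k. \<mu> ((s \<circ> (r \<circ> r')) k) m) \<mu>'"
    proof cases
      case 1
      then obtain \<mu>3 where "wlim (\<lambda>k. \<mu> ((s \<circ> r) k) m) \<mu>3" using r(2) by blast
      from wlim_subseq[OF this r'(1)] show ?thesis by (auto simp: o_def)
    next
      case 2
      then show ?thesis using r'(2) by (auto simp: o_def)
    qed
  qed
qed

text \<open>Both sides of each balance equation converge on bounded continuous functions, and these
  determine finite measures.\<close>

lemma occ_wlim:
  assumes o: "\<And>k. occ (\<mu> k)" and w: "\<And>n. wlim (\<lambda>k. \<mu> k n) (\<mu>' n)"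
  shows "occ \<mu>'"
proof -
  have st: "sets (\<mu>' n) = sets SA" for n using w by (simp add: wlim_def)
  have sp: "space (\<mu>' n) = S \<times> A" for n using sets_eq_imp_space_eq[OF st] by simp
  have mass: "emeasure (\<mu>' n) (S \<times> A) \<le> 1" for n by (rule wlim_mass[OF w occ_mass[OF o]])
  have fstm: "fst \<in> measurable (\<mu>' n) (SM S)" for n unfolding measurable_cong_sets[OF st refl] by (rule measurable_fst)
  have fin: "emeasure (distr (\<mu>' n) (SM S) fst) S \<noteq> \<infinity>" for n
  proof -
    have "emeasure (distr (\<mu>' n) (SM S) fst) S \<le> 1"
      using emeasure_distr[OF fstm, of S n] sets.top[of "SM S"] mass[of n] emeasure_mono[of "fst -` S \<inter> space (\<mu>' n)" "S \<times> A" "\<mu>' n"] sets.top[of "\<mu>' n"]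
      by (auto simp: sp intro: order_trans)
    then show ?thesis by (auto simp: top_unique)
  qed
  have fm: "(\<lambda>x. ennreal (f x)) \<in> borel_measurable (SM S)" if "continuous_on S f" for f :: "'s \<Rightarrow> real"
    by (rule measurable_compose[OF continuous_on_measurable_SM[OF that] measurable_ennreal])
  have lim: "(\<lambda>k. \<integral>\<^sup>+z. ennreal (f (fst z)) \<partial>\<mu> k n) \<longlonglongrightarrow> (\<integral>\<^sup>+x. ennreal (f x) \<partial>distr (\<mu>' n) (SM S) fst)"
    if f: "continuous_on S f" "\<And>x. 0 \<le> f x" "\<And>x. f x \<le> B" for f B n
  proof -
    have "0 \<le> B" using f(2,3) order_trans by blast
    moreover have "continuous_on (S \<times> A) (\<lambda>z. f (fst z))" by (rule continuous_on_compose2[OF f(1)]) (auto intro: continuous_intros)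
    ultimately have "(\<lambda>k. \<integral>\<^sup>+z. ennreal (f (fst z)) \<partial>\<mu> k n) \<longlonglongrightarrow> (\<integral>\<^sup>+z. ennreal (f (fst z)) \<partial>\<mu>' n)"
      using f by (intro wlim_tendsto[OF w occD(1)[OF o] occ_mass[OF o]]) auto
    then show ?thesis using fm[OF f(1)] by (simp add: nn_integral_distr[OF fstm])
  qed
  have e0: "distr (\<mu>' 0) (SM S) fst = \<gamma>"
  proof (rule finite_measure_eqI_continuous[OF S_borel _ gamma(2) fin])
    fix f :: "'s \<Rightarrow> real" and B assume f: "continuous_on S f" "\<And>x. 0 \<le> f x" "\<And>x. f x \<le> B"
    show "(\<integral>\<^sup>+x. ennreal (f x) \<partial>distr (\<mu>' 0) (SM S) fst) = (\<integral>\<^sup>+x. ennreal (f x) \<partial>\<gamma>)"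
      using lim[OF f, of 0] by (simp add: occD(3)[OF o fm[OF f(1)]] LIMSEQ_const_iff)
  qed simp
  have eS: "distr (\<mu>' (Suc n)) (SM S) fst = push (\<mu>' n)" for n
  proof (rule finite_measure_eqI_continuous[OF S_borel _ sets_push fin])
    fix f :: "'s \<Rightarrow> real" and B assume f: "continuous_on S f" "\<And>x. 0 \<le> f x" "\<And>x. f x \<le> B"
    show "(\<integral>\<^sup>+x. ennreal (f x) \<partial>distr (\<mu>' (Suc n)) (SM S) fst) = (\<integral>\<^sup>+x. ennreal (f x) \<partial>push (\<mu>' n))"
      unfolding nn_integral_push[OF st fm[OF f(1)]] by (rule LIMSEQ_unique[OF lim[OF f] occ_step_tendsto[OF o w f]])
  qed simp
  show ?thesis unfolding occ_def
  proof (intro conjI allI ballI st)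
    fix f :: "'s \<Rightarrow> ennreal" assume f: "f \<in> borel_measurable (SM S)"
    show "(\<integral>\<^sup>+z. f (fst z) \<partial>\<mu>' 0) = (\<integral>\<^sup>+x. f x \<partial>\<gamma>)" using nn_integral_distr[OF fstm, of f 0] f by (simp add: e0 measurable_cong_sets[OF gamma(2) refl])
    show "(\<integral>\<^sup>+z. f (fst z) \<partial>\<mu>' (Suc n)) = (\<integral>\<^sup>+z. (\<integral>\<^sup>+y. f y \<partial>Q z) \<partial>\<mu>' n)" for n
      using nn_integral_distr[OF fstm, of f "Suc n"] f by (simp add: eS nn_integral_push[OF st f] measurable_cong_sets[OF sets_push refl])
  qed
qed

text \<open>A diagonal sequence serves all steps at once, and Fatou's lemma for series sums the
  liminf inequalities.\<close>

lemma occ_compact: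
  fixes \<mu> :: "nat \<Rightarrow> nat \<Rightarrow> ('s \<times> 'b) measure"
  assumes o: "\<And>k. occ (\<mu> k)"
  obtains s \<mu>' where "strict_mono s" "occ \<mu>'"
    "\<And>h. lsc (S \<times> A) h \<Longrightarrow> (\<Sum>n. \<integral>\<^sup>+z. h z \<partial>\<mu>' n) \<le> liminf (\<lambda>k. \<Sum>n. \<integral>\<^sup>+z. h z \<partial>\<mu> (s k) n)"
proof -
  interpret subseqs "\<lambda>n s. \<forall>m\<le>n. \<exists>\<mu>'. wlim (\<lambda>k. \<mu> (s k) m) \<mu>'"
    by unfold_locales (rule occ_subseq[OF o])
  have "\<exists>\<mu>'. wlim (\<lambda>k. \<mu> (diagseq k) n) \<mu>'" for n
  proof -
    have "\<forall>m\<le>n. \<exists>\<mu>'. wlim (\<lambda>k. \<mu> ((diagseq \<circ> (+) (Suc n)) k) m) \<mu>'"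
    proof (rule diagseq_holds)
      fix r s :: "nat \<Rightarrow> nat" and n assume "strict_mono r" and *: "\<forall>m\<le>n. \<exists>\<mu>'. wlim (\<lambda>k. \<mu> (s k) m) \<mu>'"
      show "\<forall>m\<le>n. \<exists>\<mu>'. wlim (\<lambda>k. \<mu> ((s \<circ> r) k) m) \<mu>'"
      proof (intro allI impI)
        fix m assume "m \<le> n"
        with * obtain \<mu>' where "wlim (\<lambda>k. \<mu> (s k) m) \<mu>'" by blast
        from wlim_subseq[OF this \<open>strict_mono r\<close>] show "\<exists>\<mu>'. wlim (\<lambda>k. \<mu> ((s \<circ> r) k) m) \<mu>'" unfolding o_def by blast
      qed
    qed
    from this[rule_format, OF order_refl] obtain \<mu>' where "wlim (\<lambda>k. \<mu> (diagseq (Suc n + k)) n) \<mu>'" unfolding o_def by blast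
    then have "wlim (\<lambda>k. \<mu> (diagseq (k + Suc n)) n) \<mu>'" by (simp add: add.commute)
    from wlim_tail[OF this] show ?thesis by blast
  qed
  then have "\<exists>\<mu>'. \<forall>n. wlim (\<lambda>k. \<mu> (diagseq k) n) (\<mu>' n)" by (intro choice allI)
  then obtain \<mu>' where "\<forall>n. wlim (\<lambda>k. \<mu> (diagseq k) n) (\<mu>' n)" ..
  then have w: "wlim (\<lambda>k. \<mu> (diagseq k) n) (\<mu>' n)" for n ..
  show thesis
  proof
    show "strict_mono diagseq" by (rule subseq_diagseq)
    show "occ \<mu>'" by (rule occ_wlim[OF o w])
    fix h assume h: "lsc (S \<times> A) h"
    have "(\<integral>\<^sup>+z. h z \<partial>\<mu>' n) \<le> liminf (\<lambda>k. \<integral>\<^sup>+z. h z \<partial>\<mu> (diagseq k) n)" for n using w[of n] h by (simp add: wlim_def)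
    then have "(\<Sum>n. \<integral>\<^sup>+z. h z \<partial>\<mu>' n) \<le> (\<Sum>n. liminf (\<lambda>k. \<integral>\<^sup>+z. h z \<partial>\<mu> (diagseq k) n))" by (intro suminf_le) auto
    also have "\<dots> \<le> liminf (\<lambda>k. \<Sum>n. \<integral>\<^sup>+z. h z \<partial>\<mu> (diagseq k) n)" by (rule suminf_liminf_le)
    finally show "(\<Sum>n. \<integral>\<^sup>+z. h z \<partial>\<mu>' n) \<le> liminf (\<lambda>k. \<Sum>n. \<integral>\<^sup>+z. h z \<partial>\<mu> (diagseq k) n)" .
  qed
qed

end

section \<open>The value function\<close>

lemma ennreal_divide_mult_le: "(a::ennreal) / b * b \<le> a"
proof -
  consider "b = 0" | "b = \<top>" | "b \<noteq> 0" "b \<noteq> \<top>" by blast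
  then show ?thesis
  proof cases
    case 3
    then have "b * (a / b) = a" by (simp add: ennreal_times_divide mult.commute[of b] ennreal_mult_divide_eq)
    then show ?thesis by (simp add: mult.commute)
  qed simp_all
qed

lemma ennreal_le_inverse: "(x::ennreal) * l \<le> 1 \<Longrightarrow> x \<le> 1 / l"
proof -
  assume le: "x * l \<le> 1"
  consider "l = 0" | "l = \<top>" | "l \<noteq> 0" "l \<noteq> \<top>" by blast
  then show ?thesis
  proof cases
    case 2
    then have "x = 0" using le by (cases "x = 0") (auto simp: ennreal_mult_top top_unique)
    then show ?thesis by simp
  next
    case 3
    then have "x = x * l / l" by (simp add: ennreal_mult_divide_eq)
    also have "\<dots> \<le> 1 / l" using le by (rule divide_right_mono_ennreal)
    finally show ?thesis .
  qed simp
qed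

context ctmdp_costs
begin

definition Ct :: "'s \<times> 'b \<Rightarrow> ennreal" where "Ct z = (\<Sum>i\<le>N. jcost (c i) z)"

lemma lsc_Ct: "lsc (S \<times> A) Ct"
  unfolding Ct_def[abs_def] by (intro lsc_sum lsc_jcost_c)

lemma measurable_lsc_SA: "lsc (S \<times> A) h \<Longrightarrow> h \<in> borel_measurable SA"
  by (rule lsc_borel_measurable) (auto intro: measurable_pair_SM_borel)

lemma measurable_lsc_S: "lsc S h \<Longrightarrow> h \<in> borel_measurable (SM S)"
  by (rule lsc_borel_measurable) (auto intro: measurable_SM_borel)

text \<open>Value iteration for all costs together. It separates the states where everything can be
  free from the others, and its iterates will be integrable positive functions on the
  latter.\<close>

primrec vi :: "nat \<Rightarrow> 's \<Rightarrow> ennreal" where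
  "vi 0 x = 0"
| "vi (Suc n) x = (INF a\<in>A. Ct (x, a) + (\<integral>\<^sup>+y. vi n y \<partial>Q (x, a)))"

lemma lsc_vi: "lsc S (vi n)"
proof (induction n)
  case 0
  show ?case using continuous_imp_lsc[of S "\<lambda>_. 0"] by (simp cong: lsc_cong)
next
  case (Suc n)
  have "lsc (S \<times> A) (\<lambda>z. Ct z + (\<integral>\<^sup>+y. vi n y \<partial>Q z))" by (intro lsc_add lsc_Ct lsc_nn_integral_Q Suc)
  from lsc_INF[OF this A_compact A_ne] show ?case by (simp cong: lsc_cong)
qed

lemma measurable_vi: "vi n \<in> borel_measurable (SM S)"
  by (rule measurable_lsc_S[OF lsc_vi])

lemma vi_le: "a \<in> A \<Longrightarrow> vi (Suc n) x \<le> Ct (x, a) + (\<integral>\<^sup>+y. vi n y \<partial>Q (x, a))"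
  unfolding vi.simps by (rule INF_lower)

lemma vi_mono_Suc: "x \<in> S \<Longrightarrow> vi n x \<le> vi (Suc n) x"
proof (induction n arbitrary: x)
  case (Suc n)
  show ?case unfolding vi.simps
  proof (rule INF_mono)
    fix a assume "a \<in> A"
    then show "\<exists>a'\<in>A. Ct (x, a') + (\<integral>\<^sup>+y. vi n y \<partial>Q (x, a')) \<le> Ct (x, a) + (\<integral>\<^sup>+y. (INF a\<in>A. Ct (y, a) + (\<integral>\<^sup>+y. vi n y \<partial>Q (y, a))) \<partial>Q (x, a))"
      using Suc.IH by (intro bexI[of _ a] add_left_mono nn_integral_mono) auto
  qed
qed simp

lemma vi_mono: "m \<le> n \<Longrightarrow> x \<in> S \<Longrightarrow> vi m x \<le> vi n x"
proof (induction n)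
  case (Suc n)
  then show ?case using vi_mono_Suc[of x n] by (cases "m = Suc n") (auto simp del: vi.simps intro: order_trans)
qed simp

definition Vi :: "'s \<Rightarrow> ennreal" where "Vi x = (SUP n. vi n x)"

lemma lsc_Vi: "lsc S Vi"
  unfolding Vi_def[abs_def] by (intro lsc_SUP lsc_vi)

lemma measurable_Vi: "Vi \<in> borel_measurable (SM S)"
  by (rule measurable_lsc_S[OF lsc_Vi])

text \<open>Each stage has an action of value 0 by compactness. A limit point of these actions has
  value 0 at all stages, because the stage functions increase with the stage and each is lower
  semicontinuous; monotone convergence then passes to \<open>Vi\<close>.\<close>

lemma zero_action:
  assumes x: "x \<in> S" and V: "Vi x = 0"
  shows "\<exists>a\<in>A. Ct (x, a) + (\<integral>\<^sup>+y. Vi y \<partial>Q (x, a)) = 0"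
proof -
  define g where "g n a = Ct (x, a) + (\<integral>\<^sup>+y. vi n y \<partial>Q (x, a))" for n a
  have glsc: "lsc A (g n)" for n unfolding g_def[abs_def]
    by (rule lsc_compose[OF lsc_add[OF lsc_Ct lsc_nn_integral_Q[OF lsc_vi]], of A "\<lambda>a. (x, a)"]) (use x in \<open>auto intro!: continuous_intros\<close>)
  have gmono: "g m a \<le> g n a" if "m \<le> n" for m n a
    unfolding g_def using vi_mono[OF that] by (intro add_left_mono nn_integral_mono) auto
  have "\<exists>a\<in>A. g n a = 0" for n
  proof -
    have "vi (Suc n) x \<le> Vi x" unfolding Vi_def by (rule SUP_upper) simp
    then have "vi (Suc n) x = 0" using V by simp
    then have "(INF a\<in>A. g n a) = 0" by (simp add: g_def)
    then show ?thesis using lsc_attains_INF[OF glsc A_compact A_ne, of n] by simp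
  qed
  then obtain b where b: "\<And>n. b n \<in> A" "\<And>n. g n (b n) = 0" by metis
  obtain l r where l: "l \<in> A" "strict_mono r" "(b \<circ> r) \<longlonglongrightarrow> l"
    using A_compact b(1) unfolding compact_eq_seq_compact_metric seq_compact_def by metis
  have gl: "g m l = 0" for m
  proof (rule ccontr)
    assume "g m l \<noteq> 0"
    obtain T where T: "open T" "{a \<in> A. 0 < g m a} = A \<inter> T" using lscD[OF glsc, of 0 m] by (auto simp: openin_open)
    have "l \<in> T" using l(1) \<open>g m l \<noteq> 0\<close> T(2) by (auto simp: zero_less_iff_neq_zero)
    then have "eventually (\<lambda>k. (b \<circ> r) k \<in> T) sequentially" using l(3) T(1) by (rule topological_tendstoD[rotated 2])
    then have "eventually (\<lambda>k. m \<le> k \<and> (b \<circ> r) k \<in> T) sequentially" using eventually_ge_at_top by (rule eventually_conj[rotated])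
    then obtain k where k: "m \<le> k" "b (r k) \<in> T" by (auto dest!: eventually_happens)
    then have "0 < g m (b (r k))" using T(2) b(1)[of "r k"] by blast
    also have "\<dots> \<le> g (r k) (b (r k))" using k(1) seq_suble[OF l(2), of k] by (intro gmono) linarith
    finally show False using b(2) by simp
  qed
  have Q: "(\<lambda>y. vi n y) \<in> borel_measurable (Q (x, l))" for n using measurable_vi by (simp add: measurable_cong_sets[OF sets_Q refl])
  have "(\<integral>\<^sup>+y. Vi y \<partial>Q (x, l)) = (SUP n. \<integral>\<^sup>+y. vi n y \<partial>Q (x, l))"
    unfolding Vi_def by (rule nn_integral_monotone_convergence_SUP_AE) (use Q vi_mono_Suc in \<open>auto simp del: vi.simps\<close>)
  also have "\<dots> = 0" using gl by (simp add: g_def)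
  finally have "(\<integral>\<^sup>+y. Vi y \<partial>Q (x, l)) = 0" .
  moreover have "Ct (x, l) = 0" using gl[of 0] by (simp add: g_def)
  ultimately show ?thesis using l(1) by (intro bexI[of _ l]) simp_all
qed

definition zsel :: "'s \<Rightarrow> 'b" where
  "zsel = (SOME f. f \<in> measurable (SM S) (SM A) \<and> (\<forall>x\<in>S. (\<exists>a\<in>A. Ct (x, a) + (\<integral>\<^sup>+y. Vi y \<partial>Q (x, a)) = 0) \<longrightarrow> Ct (x, f x) + (\<integral>\<^sup>+y. Vi y \<partial>Q (x, f x)) = 0))"

lemma zsel:
  shows "zsel \<in> measurable (SM S) (SM A)" "x \<in> S \<Longrightarrow> zsel x \<in> A"
    and "x \<in> S \<Longrightarrow> Vi x = 0 \<Longrightarrow> Ct (x, zsel x) = 0" "x \<in> S \<Longrightarrow> Vi x = 0 \<Longrightarrow> (\<integral>\<^sup>+y. Vi y \<partial>Q (x, zsel x)) = 0"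
proof -
  have "\<exists>f. f \<in> measurable (SM S) (SM A) \<and> (\<forall>x\<in>S. (\<exists>a\<in>A. Ct (x, a) + (\<integral>\<^sup>+y. Vi y \<partial>Q (x, a)) = 0) \<longrightarrow> Ct (x, f x) + (\<integral>\<^sup>+y. Vi y \<partial>Q (x, f x)) = 0)"
    using measurable_zero_selector[OF A_compact A_ne lsc_add[OF lsc_Ct lsc_nn_integral_Q[OF lsc_Vi]]] by blast
  from someI_ex[OF this] have *: "zsel \<in> measurable (SM S) (SM A) \<and> (\<forall>x\<in>S. (\<exists>a\<in>A. Ct (x, a) + (\<integral>\<^sup>+y. Vi y \<partial>Q (x, a)) = 0) \<longrightarrow> Ct (x, zsel x) + (\<integral>\<^sup>+y. Vi y \<partial>Q (x, zsel x)) = 0)"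
    unfolding zsel_def .
  show "zsel \<in> measurable (SM S) (SM A)" using * by (rule conjunct1)
  then show "x \<in> S \<Longrightarrow> zsel x \<in> A" using measurable_space[of zsel "SM S" "SM A" x] by simp
  have "Ct (x, zsel x) + (\<integral>\<^sup>+y. Vi y \<partial>Q (x, zsel x)) = 0" if "x \<in> S" "Vi x = 0" for x
    using conjunct2[OF *, rule_format, OF that(1) zero_action[OF that]] .
  then show "x \<in> S \<Longrightarrow> Vi x = 0 \<Longrightarrow> Ct (x, zsel x) = 0" "x \<in> S \<Longrightarrow> Vi x = 0 \<Longrightarrow> (\<integral>\<^sup>+y. Vi y \<partial>Q (x, zsel x)) = 0" by simp_all
qed

text \<open>A vanishing quotient by a finite rate has a vanishing numerator; at rate zero a positive
  cost would give \<open>\<top>\<close>.\<close>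

lemma zsel_cost: "x \<in> S \<Longrightarrow> Vi x = 0 \<Longrightarrow> i \<le> N \<Longrightarrow> ennreal (c i (x, zsel x)) = 0"
  using zsel(3)[of x] rate_finite[of "(x, zsel x)"] by (auto simp: Ct_def sum_eq_0_iff jcost_def ennreal_divide_eq_0_iff)

text \<open>At rate zero there is no future, so a positive \<open>Vi\<close> must stem from an
  immediate positive cost, and that cost divided by zero is infinite. A measure with finite total
  cost therefore avoids such pairs.\<close>

lemma zero_rate_cost:
  assumes z: "z \<in> S \<times> A" and V: "0 < Vi (fst z)" and r: "rate z = 0"
  shows "Ct z = \<top>"
proof -
  obtain n where n: "0 < vi n (fst z)" using V by (auto simp: Vi_def less_SUP_iff)
  then obtain m where m: "n = Suc m" by (cases n) auto
  have "emeasure (Q z) (space (Q z)) = 0" using emeasure_Q_S[OF z] r by simp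
  then have "(\<integral>\<^sup>+y. vi m y \<partial>Q z) = 0" by (rule nn_integral_zero_of_null_space)
  then have "0 < Ct z" using n vi_le[of "snd z" m "fst z"] z unfolding m by (auto simp del: vi.simps)
  then obtain i where i: "i \<le> N" "jcost (c i) z \<noteq> 0" by (auto simp: Ct_def zero_less_iff_neq_zero)
  then have "jcost (c i) z = \<top>" using r by (auto simp: jcost_def ennreal_divide_eq_0_iff divide_ennreal_def ennreal_mult_eq_top_iff)
  then show ?thesis using i(1) by (auto simp: Ct_def)
qed

end

section \<open>Stationary policies from occupation measures\<close>

text \<open>Only the sum of the occupation sequence is retained, together with its balance equation
  \<open>flow\<close>. Both sides of \<open>flow\<close> can be infinite, so it is always used as it
  stands and never solved for a term.\<close>

locale occ_total = ctmdp_costs S A \<gamma> q c N for S :: "'s::polish_space set" and A :: "'b::polish_space set" and \<gamma> q c N +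
  fixes Mt :: "('s \<times> 'b) measure"
  assumes sets_Mt[measurable_cong]: "sets Mt = sets SA"
    and flow: "f \<in> borel_measurable (SM S) \<Longrightarrow> (\<integral>\<^sup>+z. f (fst z) \<partial>Mt) = (\<integral>\<^sup>+x. f x \<partial>\<gamma>) + (\<integral>\<^sup>+z. (\<integral>\<^sup>+y. f y \<partial>Q z) \<partial>Mt)"
    and finite_total: "(\<integral>\<^sup>+z. Ct z \<partial>Mt) < \<top>"
begin

lemma space_Mt[simp]: "space Mt = S \<times> A"
  using sets_eq_imp_space_eq[OF sets_Mt] by simp

lemma Mt_measurable: "f \<in> borel_measurable SA \<Longrightarrow> f \<in> borel_measurable Mt"
  by (simp add: measurable_cong_sets[OF sets_Mt refl])

lemma fst_measurable: "G \<in> borel_measurable (SM S) \<Longrightarrow> (\<lambda>z. G (fst z)) \<in> borel_measurable SA"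
  by (rule measurable_compose[OF measurable_fst])

text \<open>The Bellman inequality is integrated. By \<open>flow\<close> the integral of
  \<open>vi j\<close> after one jump is at most its integral before, so each stage adds at most the
  total cost.\<close>

lemma finite_vi: "(\<integral>\<^sup>+z. vi j (fst z) \<partial>Mt) < \<top>"
proof (induction j)
  case (Suc j)
  have "(\<integral>\<^sup>+z. vi (Suc j) (fst z) \<partial>Mt) \<le> (\<integral>\<^sup>+z. Ct z + (\<integral>\<^sup>+y. vi j y \<partial>Q z) \<partial>Mt)"
    using vi_le by (intro nn_integral_mono) (auto simp del: vi.simps)
  also have "\<dots> = (\<integral>\<^sup>+z. Ct z \<partial>Mt) + (\<integral>\<^sup>+z. (\<integral>\<^sup>+y. vi j y \<partial>Q z) \<partial>Mt)"
    by (intro nn_integral_add Mt_measurable measurable_lsc_SA lsc_Ct lsc_nn_integral_Q lsc_vi)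
  also have "\<dots> \<le> (\<integral>\<^sup>+z. Ct z \<partial>Mt) + (\<integral>\<^sup>+z. vi j (fst z) \<partial>Mt)"
    unfolding flow[OF measurable_vi] by (intro add_left_mono) simp
  also have "\<dots> < \<top>" using Suc finite_total by simp
  finally show ?case .
qed simp

text \<open>Each \<open>vi j\<close> has a finite integral, their supremum \<open>Vi\<close> perhaps
  not. These weights make the series integrable and keep it positive wherever \<open>Vi\<close> is.
  The summand 1 guards against division by 0.\<close>

definition wt :: "nat \<Rightarrow> ennreal" where
  "wt j = ennreal ((1/2) ^ j) / (1 + (\<integral>\<^sup>+z. vi j (fst z) \<partial>Mt))"

definition W :: "'s \<Rightarrow> ennreal" where "W x = (\<Sum>j. wt j * vi j x)"

lemma measurable_W: "W \<in> borel_measurable (SM S)"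
  unfolding W_def[abs_def] by (intro borel_measurable_suminf_order borel_measurable_times_ennreal measurable_vi) simp

lemma finite_W: "(\<integral>\<^sup>+z. W (fst z) \<partial>Mt) < \<top>"
proof -
  have m: "(\<lambda>z. vi j (fst z)) \<in> borel_measurable Mt" for j by (intro Mt_measurable fst_measurable measurable_vi)
  have "(\<integral>\<^sup>+z. W (fst z) \<partial>Mt) = (\<Sum>j. \<integral>\<^sup>+z. wt j * vi j (fst z) \<partial>Mt)"
    unfolding W_def using m by (intro nn_integral_suminf borel_measurable_times_ennreal) auto
  also have "\<dots> = (\<Sum>j. wt j * (\<integral>\<^sup>+z. vi j (fst z) \<partial>Mt))" by (simp add: nn_integral_cmult[OF m])
  also have "\<dots> \<le> (\<Sum>j. ennreal ((1/2) ^ j))"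
  proof (intro suminf_le summableI)
    fix j
    have "wt j * (\<integral>\<^sup>+z. vi j (fst z) \<partial>Mt) \<le> wt j * (1 + (\<integral>\<^sup>+z. vi j (fst z) \<partial>Mt))" by (intro mult_left_mono) auto
    also have "\<dots> \<le> ennreal ((1/2) ^ j)" unfolding wt_def by (rule ennreal_divide_mult_le)
    finally show "wt j * (\<integral>\<^sup>+z. vi j (fst z) \<partial>Mt) \<le> ennreal ((1/2) ^ j)" .
  qed
  also have "\<dots> = ennreal 2" using geometric_sums[of "1/2::real"] by (intro suminf_ennreal_eq) auto
  finally show ?thesis by (rule order.strict_trans1) simp
qed

lemma W_pos: "0 < Vi x \<Longrightarrow> 0 < W x"
proof -
  assume "0 < Vi x"
  then obtain j where j: "0 < vi j x" by (auto simp: Vi_def less_SUP_iff)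
  have "0 < wt j" using finite_vi[of j] by (simp add: wt_def ennreal_zero_less_divide)
  then have "0 < wt j * vi j x" using j by (simp add: ennreal_zero_less_mult_iff)
  also have "\<dots> \<le> W x" unfolding W_def using sum_le_suminf[OF summableI, of "{j}" "\<lambda>j. wt j * vi j x"] by simp
  finally show ?thesis .
qed

text \<open>A lower bound for the nonzero rates at \<open>x\<close>, with actions of rate zero
  lifted to 1. Since the pairs of rate zero are open and closed, this is the infimum of a positive
  continuous function over \<open>A\<close>, attained and hence positive.\<close>

definition kap :: "'s \<Rightarrow> ennreal" where
  "kap x = (INF a\<in>A. ennreal (qx q x a + (1 - alive_ind (x, a))))"

lemma lsc_kap_arg: "lsc (S \<times> A) (\<lambda>z. ennreal (qx q (fst z) (snd z) + (1 - alive_ind z)))"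
  by (intro continuous_imp_lsc continuous_intros continuous_on_qx continuous_on_alive_ind)

lemma measurable_kap: "kap \<in> borel_measurable (SM S)"
  using lsc_INF[OF lsc_kap_arg A_compact A_ne] unfolding kap_def[abs_def] by (intro measurable_lsc_S) simp

lemma kap_pos: assumes x: "x \<in> S" shows "0 < kap x"
proof -
  have "lsc A (\<lambda>a. ennreal (qx q x a + (1 - alive_ind (x, a))))"
  proof -
    have "continuous_on A (\<lambda>a. (x, a))" by (intro continuous_intros)
    moreover have "(\<lambda>a. (x, a)) \<in> A \<rightarrow> S \<times> A" using x by auto
    ultimately show ?thesis using lsc_compose[OF lsc_kap_arg] by fastforce
  qed
  from lsc_attains_INF[OF this A_compact A_ne] obtain a where a: "a \<in> A" "ennreal (qx q x a + (1 - alive_ind (x, a))) = kap x"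
    unfolding kap_def by blast
  have "0 \<le> qx q x a" using qx_nonneg x a(1) by blast
  then have "0 < qx q x a + (1 - alive_ind (x, a))" by (auto simp: alive_ind_def rate_def less_le)
  then show ?thesis by (simp add: a(2)[symmetric])
qed

lemma kap_le: "z \<in> S \<times> A \<Longrightarrow> rate z \<noteq> 0 \<Longrightarrow> kap (fst z) \<le> rate z"
  unfolding kap_def by (rule INF_lower2[of "snd z"]) (auto simp: alive_ind_def rate_def)

text \<open>A density making the measure of the sojourn times finite: \<open>W\<close> controls the mass, \<open>kap\<close> the factor \<open>1 / rate\<close>.\<close>
definition wgt :: "'s \<Rightarrow> ennreal" where "wgt x = min 1 (W x) * min 1 (kap x)"

lemma measurable_wgt: "wgt \<in> borel_measurable (SM S)"
  unfolding wgt_def[abs_def] using measurable_W measurable_kap by measurable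

lemma wgt_cancel: assumes "x \<in> S" "0 < Vi x" shows "wgt x * (1 / wgt x) = 1"
proof -
  have "wgt x \<noteq> 0" using W_pos[OF assms(2)] kap_pos[OF assms(1)] by (auto simp: wgt_def min_def)
  moreover have "wgt x \<noteq> \<top>" by (auto simp: wgt_def ennreal_mult_eq_top_iff min_def)
  ultimately show ?thesis by (simp add: ennreal_times_divide ennreal_divide_self less_top)
qed

text \<open>The factor \<open>1 / rate\<close> converts numbers of sojourns into time. It is cut off
  to \<open>Vi > 0\<close>, since on the rest the free selector \<open>zsel\<close> takes
  over.\<close>

definition iv :: "'s \<times> 'b \<Rightarrow> ennreal" where
  "iv z = (if 0 < Vi (fst z) \<and> rate z \<noteq> 0 then 1 / rate z else 0)"

lemma measurable_iv: "iv \<in> borel_measurable SA"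
proof -
  have [measurable]: "(\<lambda>z. Vi (fst z)) \<in> borel_measurable SA" by (rule fst_measurable[OF measurable_Vi])
  show ?thesis unfolding iv_def[abs_def] by measurable
qed

lemma iv_rate_le: "iv z * rate z \<le> 1"
  unfolding iv_def by (auto simp: ennreal_divide_mult_le)

lemma iv_rate: "0 < Vi (fst z) \<Longrightarrow> rate z \<noteq> 0 \<Longrightarrow> iv z * rate z = 1"
  using rate_finite[of z] by (simp add: iv_def mult.commute[of "1 / rate z"] ennreal_times_divide)

lemma iv_wgt_le: assumes z: "z \<in> S \<times> A" shows "iv z * wgt (fst z) \<le> W (fst z)"
proof (cases "0 < Vi (fst z) \<and> rate z \<noteq> 0")
  case True
  then have "min 1 (kap (fst z)) \<le> rate z" using kap_le[OF z] by (simp add: min.coboundedI2)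
  then have "iv z * wgt (fst z) \<le> iv z * (W (fst z) * rate z)"
    unfolding wgt_def by (intro mult_left_mono mult_mono) auto
  also have "\<dots> = (iv z * rate z) * W (fst z)" by (simp add: ac_simps)
  also have "\<dots> \<le> 1 * W (fst z)" by (intro mult_right_mono iv_rate_le) simp
  finally show ?thesis by simp
qed (auto simp: iv_def)

definition Nt :: "('s \<times> 'b) measure" where "Nt = density Mt (\<lambda>z. iv z * wgt (fst z))"

lemma iv_wgt_measurable: "(\<lambda>z. iv z * wgt (fst z)) \<in> borel_measurable Mt"
  by (intro Mt_measurable borel_measurable_times_ennreal measurable_iv fst_measurable measurable_wgt)

lemma finite_measure_Nt: "finite_measure Nt"
proof (rule finite_measureI)
  have "emeasure Nt (space Nt) = (\<integral>\<^sup>+z. 1 \<partial>Nt)" by simp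
  also have "\<dots> = (\<integral>\<^sup>+z. iv z * wgt (fst z) * 1 \<partial>Mt)" unfolding Nt_def by (rule nn_integral_density[OF iv_wgt_measurable]) simp
  also have "\<dots> \<le> (\<integral>\<^sup>+z. W (fst z) \<partial>Mt)" using iv_wgt_le by (intro nn_integral_mono) auto
  also have "\<dots> < \<top>" by (rule finite_W)
  finally show "emeasure Nt (space Nt) \<noteq> \<infinity>" by simp
qed

lemma sets_Nt: "sets Nt = sets SA"
  by (simp add: Nt_def sets_Mt)

definition phi :: "'s \<Rightarrow> 'b measure" where
  "phi = (SOME \<phi>. \<phi> \<in> measurable (SM S) (prob_algebra (SM A)) \<and>
     (\<forall>g\<in>borel_measurable SA. (\<integral>\<^sup>+z. g z \<partial>Nt) = (\<integral>\<^sup>+x. (\<integral>\<^sup>+a. g (x, a) \<partial>\<phi> x) \<partial>distr Nt (SM S) fst)))"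

lemma phi:
  shows measurable_phi: "phi \<in> measurable (SM S) (prob_algebra (SM A))"
    and phi_disintegrates: "g \<in> borel_measurable SA \<Longrightarrow> (\<integral>\<^sup>+z. g z \<partial>Nt) = (\<integral>\<^sup>+x. (\<integral>\<^sup>+a. g (x, a) \<partial>phi x) \<partial>distr Nt (SM S) fst)"
proof -
  have "\<exists>\<phi>. \<phi> \<in> measurable (SM S) (prob_algebra (SM A)) \<and>
     (\<forall>g\<in>borel_measurable SA. (\<integral>\<^sup>+z. g z \<partial>Nt) = (\<integral>\<^sup>+x. (\<integral>\<^sup>+a. g (x, a) \<partial>\<phi> x) \<partial>distr Nt (SM S) fst))"
    using disintegration[OF A_compact A_ne finite_measure_Nt sets_Nt] by blast
  from someI_ex[OF this] have *: "phi \<in> measurable (SM S) (prob_algebra (SM A)) \<and>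
     (\<forall>g\<in>borel_measurable SA. (\<integral>\<^sup>+z. g z \<partial>Nt) = (\<integral>\<^sup>+x. (\<integral>\<^sup>+a. g (x, a) \<partial>phi x) \<partial>distr Nt (SM S) fst))"
    unfolding phi_def .
  show "phi \<in> measurable (SM S) (prob_algebra (SM A))" using * by (rule conjunct1)
  show "g \<in> borel_measurable SA \<Longrightarrow> (\<integral>\<^sup>+z. g z \<partial>Nt) = (\<integral>\<^sup>+x. (\<integral>\<^sup>+a. g (x, a) \<partial>phi x) \<partial>distr Nt (SM S) fst)"
    using conjunct2[OF *] by (rule bspec)
qed

lemma kernel_section:
  assumes "\<phi> \<in> measurable (SM S) (prob_algebra (SM A))" "x \<in> S" "g \<in> borel_measurable SA"
  shows "(\<lambda>a. g (x, a)) \<in> borel_measurable (\<phi> x)"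
proof -
  have s: "sets (\<phi> x) = sets (SM A)" using measurable_space[OF assms(1), of x] assms(2) by (simp add: space_prob_algebra)
  have "(\<lambda>a. g (x, a)) \<in> borel_measurable (SM A)"
    by (rule measurable_compose[OF measurable_Pair1' assms(3)]) (simp add: assms(2))
  then show ?thesis unfolding measurable_cong_sets[OF s refl] .
qed

lemma kernel_integral_measurable:
  "\<phi> \<in> measurable (SM S) (prob_algebra (SM A)) \<Longrightarrow> g \<in> borel_measurable SA \<Longrightarrow> (\<lambda>x. \<integral>\<^sup>+a. g (x, a) \<partial>\<phi> x) \<in> borel_measurable (SM S)"
  by (intro measurable_kernel_integral measurable_prob_algebraD)

text \<open>Integral against the state marginal of \<open>Mt\<close> weighted by \<open>iv\<close>,
  that is, against the time spent in each state. Division by \<open>wgt\<close> undoes the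
  normalization that made \<open>Nt\<close> finite.\<close>

definition Ex :: "('s \<Rightarrow> ennreal) \<Rightarrow> ennreal" where
  "Ex G = (\<integral>\<^sup>+x. 1 / wgt x * G x \<partial>distr Nt (SM S) fst)"

lemma Ex_mono: "(\<And>x. x \<in> S \<Longrightarrow> F x \<le> G x) \<Longrightarrow> Ex F \<le> Ex G"
  unfolding Ex_def by (intro nn_integral_mono mult_left_mono) auto

lemma Ex_phi:
  assumes g: "g \<in> borel_measurable SA"
  shows "(\<integral>\<^sup>+z. iv z * g z \<partial>Mt) = Ex (\<lambda>x. \<integral>\<^sup>+a. g (x, a) \<partial>phi x)"
proof -
  have m: "(\<lambda>z. 1 / wgt (fst z)) \<in> borel_measurable SA"
    by (intro borel_measurable_divide_ennreal fst_measurable[OF measurable_wgt]) simp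
  have m': "(\<lambda>z. 1 / wgt (fst z) * g z) \<in> borel_measurable SA" by (intro borel_measurable_times_ennreal m g)
  have "(\<integral>\<^sup>+z. iv z * g z \<partial>Mt) = (\<integral>\<^sup>+z. iv z * wgt (fst z) * (1 / wgt (fst z) * g z) \<partial>Mt)"
  proof (intro nn_integral_cong)
    fix z assume "z \<in> space Mt"
    then have "fst z \<in> S" by auto
    show "iv z * g z = iv z * wgt (fst z) * (1 / wgt (fst z) * g z)"
    proof (cases "0 < Vi (fst z)")
      case True
      have "iv z * wgt (fst z) * (1 / wgt (fst z) * g z) = iv z * (wgt (fst z) * (1 / wgt (fst z))) * g z" by (simp only: ac_simps)
      then show ?thesis using wgt_cancel[OF \<open>fst z \<in> S\<close> True] by simp
    qed (simp add: iv_def)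
  qed
  also have "\<dots> = (\<integral>\<^sup>+z. 1 / wgt (fst z) * g z \<partial>Nt)"
    unfolding Nt_def by (rule nn_integral_density[OF iv_wgt_measurable Mt_measurable[OF m'], symmetric])
  also have "\<dots> = (\<integral>\<^sup>+x. (\<integral>\<^sup>+a. 1 / wgt x * g (x, a) \<partial>phi x) \<partial>distr Nt (SM S) fst)"
    using phi_disintegrates[OF m'] by simp
  also have "\<dots> = Ex (\<lambda>x. \<integral>\<^sup>+a. g (x, a) \<partial>phi x)"
    unfolding Ex_def by (intro nn_integral_cong nn_integral_cmult kernel_section[OF measurable_phi _ g]) simp
  finally show ?thesis .
qed

lemma AE_rate: "AE z in Mt. 0 < Vi (fst z) \<longrightarrow> rate z \<noteq> 0"
proof -
  have "AE z in Mt. Ct z \<noteq> \<infinity>"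
    using finite_total by (intro nn_integral_PInf_AE Mt_measurable measurable_lsc_SA lsc_Ct) auto
  then show ?thesis by (rule AE_mp) (use zero_rate_cost in \<open>auto intro!: AE_I2\<close>)
qed

text \<open>The number of sojourns at a state is the time spent there times the averaged rate. On
  \<open>Vi > 0\<close> almost no mass of \<open>Mt\<close> sits at rate zero, so \<open>iv\<close>
  really inverts the rate.\<close>

lemma Ex_marginal:
  assumes G: "G \<in> borel_measurable (SM S)" "\<And>x. x \<in> S \<Longrightarrow> Vi x = 0 \<Longrightarrow> G x = 0"
  shows "(\<integral>\<^sup>+z. G (fst z) \<partial>Mt) = Ex (\<lambda>x. (\<integral>\<^sup>+a. rate (x, a) \<partial>phi x) * G x)"
proof -
  have m: "(\<lambda>z. rate z * G (fst z)) \<in> borel_measurable SA" by (intro borel_measurable_times_ennreal measurable_rate fst_measurable G)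
  have "(\<integral>\<^sup>+z. G (fst z) \<partial>Mt) = (\<integral>\<^sup>+z. iv z * (rate z * G (fst z)) \<partial>Mt)"
  proof (intro nn_integral_cong_AE, rule AE_mp[OF AE_rate], intro AE_I2 impI)
    fix z assume z: "z \<in> space Mt" "0 < Vi (fst z) \<longrightarrow> rate z \<noteq> 0"
    show "G (fst z) = iv z * (rate z * G (fst z))"
    proof (cases "0 < Vi (fst z)")
      case True
      then show ?thesis using iv_rate[OF True] z(2) by (simp add: mult.assoc[symmetric])
    next
      case False
      then show ?thesis using G(2)[of "fst z"] z(1) by (auto simp: zero_less_iff_neq_zero)
    qed
  qed
  also have "\<dots> = Ex (\<lambda>x. \<integral>\<^sup>+a. rate (x, a) * G x \<partial>phi x)" using Ex_phi[OF m] by simp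
  also have "\<dots> = Ex (\<lambda>x. (\<integral>\<^sup>+a. rate (x, a) \<partial>phi x) * G x)"
    unfolding Ex_def using kernel_section[OF measurable_phi _ measurable_rate]
    by (intro nn_integral_cong) (simp add: nn_integral_multc)
  finally show ?thesis .
qed

definition sphi :: "'s \<Rightarrow> 'b measure" where
  "sphi x = (if 0 < Vi x then phi x else return (SM A) (zsel x))"

lemma measurable_sphi: "sphi \<in> measurable (SM S) (prob_algebra (SM A))"
  unfolding sphi_def[abs_def]
proof (intro measurable_If measurable_phi)
  show "(\<lambda>x. return (SM A) (zsel x)) \<in> measurable (SM S) (prob_algebra (SM A))"
    by (rule measurable_compose[OF zsel(1) measurable_return_prob_space])
  show "{x \<in> space (SM S). 0 < Vi x} \<in> sets (SM S)" using measurable_Vi by measurable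
qed

lemma sphi_zero:
  assumes x: "x \<in> S" "Vi x = 0" and g: "g \<in> borel_measurable SA"
  shows "(\<integral>\<^sup>+a. g (x, a) \<partial>sphi x) = g (x, zsel x)"
proof -
  have "(\<lambda>a. g (x, a)) \<in> borel_measurable (SM A)"
    using measurable_compose[OF measurable_Pair1'[of x "SM S" "SM A"] g] x(1) by simp
  then show ?thesis using zsel(2)[OF x(1)] x(2) by (simp add: sphi_def nn_integral_return)
qed

definition spol :: "('s, 'b) policy" where "spol n p = sphi (snd (fst p))"

lemma is_policy_spol: "is_policy S A spol"
  unfolding is_policy_def spol_def[abs_def] histM_def
  by (intro allI measurable_compose[OF _ measurable_sphi]) measurable

lemma stationary_spol: "stationary S A spol"
  unfolding stationary_def using measurable_sphi by (auto simp: spol_def)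

interpretation st: ctmdp_policy S A \<gamma> q spol
  by unfold_locales (rule is_policy_spol)

definition lam' :: "'s \<Rightarrow> ennreal" where "lam' x = (\<integral>\<^sup>+a. rate (x, a) \<partial>sphi x)"

definition PP :: "('s \<times> 'b \<Rightarrow> ennreal) \<Rightarrow> 's \<Rightarrow> ennreal" where "PP g x = (\<integral>\<^sup>+a. g (x, a) \<partial>sphi x)"

text \<open>Mean length of the sojourn after \<open>h\<close> under the stationary policy.\<close>

definition X :: "nat \<Rightarrow> ((nat \<Rightarrow> 's \<times> real) \<times> 's) \<Rightarrow> ennreal" where "X n h = (\<integral>\<^sup>+s. st.ew n (h, s) \<partial>posL)"

lemma X_mult: assumes h: "h \<in> space (histM S n)" shows "(\<integral>\<^sup>+s. st.ew n (h, s) * r \<partial>posL) = X n h * r"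
  unfolding X_def using st.measurable_HP_section[OF h st.measurable_ew] by (intro nn_integral_multc) simp

text \<open>Mean sojourn times averaged rate is the probability of a jump, at most 1. If the
  averaged rate is 0, the bound is trivial for \<open>r > 0\<close> since
  \<open>r / 0 = \<top>\<close>, and reads \<open>0 \<le> 0\<close> for
  \<open>r = 0\<close>.\<close>

lemma X_le: assumes h: "h \<in> space (histM S n)" shows "X n h * r \<le> r / lam' (snd h)"
proof -
  have "X n h * lam' (snd h) = st.jmass n h"
    unfolding X_mult[OF h, symmetric] st.jmass_def st.lamE_def lam'_def spol_def by simp
  then have "X n h \<le> 1 / lam' (snd h)" using st.jmass_le_1[OF h] by (intro ennreal_le_inverse) simp
  then have "X n h * r \<le> 1 / lam' (snd h) * r" by (intro mult_right_mono) auto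
  also have "\<dots> = r / lam' (snd h)" by (simp add: mult.commute[of _ r] ennreal_times_divide)
  finally show ?thesis .
qed

lemma mh_zero: assumes f: "f \<in> borel_measurable (SM S)" shows "(\<integral>\<^sup>+h. f (snd h) \<partial>st.mh 0) = (\<integral>\<^sup>+x. f x \<partial>\<gamma>)"
proof -
  have T: "(\<lambda>x. (\<lambda>_. undefined, x)) \<in> measurable \<gamma> (histM S 0)"
    unfolding histM_def measurable_cong_sets[OF gamma(2) refl] by (intro measurable_Pair) (auto intro!: measurable_const simp: space_PiM)
  have fs: "(\<lambda>h. f (snd h)) \<in> borel_measurable (histM S 0)" by (rule measurable_compose[OF st.measurable_snd_HM f])
  show ?thesis using nn_integral_distr[OF T, of "\<lambda>h. f (snd h)"] fs by simp
qed

text \<open>One jump of the stationary chain: the outflow rate times the mean sojourn, the latter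
  bounded by \<open>1 / lam'\<close>.\<close>

lemma mh_Suc_le: assumes f: "f \<in> borel_measurable (SM S)"
  shows "(\<integral>\<^sup>+h. f (snd h) \<partial>st.mh (Suc n)) \<le> (\<integral>\<^sup>+h. PP (\<lambda>z. rate z * (\<integral>\<^sup>+y. f y \<partial>Q z)) (snd h) / lam' (snd h) \<partial>st.mh n)"
proof -
  have fs: "(\<lambda>h. f (snd h)) \<in> borel_measurable (histM S (Suc n))" by (rule measurable_compose[OF st.measurable_snd_HM f])
  have "(\<integral>\<^sup>+h. f (snd h) \<partial>st.mh (Suc n)) = (\<integral>\<^sup>+h. st.jump n h (\<lambda>w. f (snd (hext n (h, w)))) \<partial>st.mh n)"
    by (rule st.nn_integral_mh_Suc[OF fs])
  also have "\<dots> \<le> (\<integral>\<^sup>+h. PP (\<lambda>z. rate z * (\<integral>\<^sup>+y. f y \<partial>Q z)) (snd h) / lam' (snd h) \<partial>st.mh n)"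
  proof (intro nn_integral_mono)
    fix h assume "h \<in> space (st.mh n)"
    then have h: "h \<in> space (histM S n)" by simp
    have "st.jump n h (\<lambda>w. f (snd (hext n (h, w)))) = X n h * PP (\<lambda>z. rate z * (\<integral>\<^sup>+y. f y \<partial>Q z)) (snd h)"
      unfolding X_mult[OF h, symmetric] by (simp add: st.jump_def hext_def PP_def spol_def)
    then show "st.jump n h (\<lambda>w. f (snd (hext n (h, w)))) \<le> PP (\<lambda>z. rate z * (\<integral>\<^sup>+y. f y \<partial>Q z)) (snd h) / lam' (snd h)"
      using X_le[OF h] by simp
  qed
  finally show ?thesis .
qed

text \<open>The key cancellation. \<open>Mt\<close> on states is time multiplied by the averaged
  rate, the quotient divides by the same averaged rate, and \<open>phi\<close> disintegrates time.
  Equality is lost only where the averaged rate is 0.\<close>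

lemma quotient_le:
  assumes g: "g \<in> borel_measurable SA" and z: "\<And>x. x \<in> S \<Longrightarrow> Vi x = 0 \<Longrightarrow> PP g x = 0"
  shows "(\<lambda>x. PP g x / lam' x) \<in> borel_measurable (SM S)"
    and "(\<integral>\<^sup>+z. PP g (fst z) / lam' (fst z) \<partial>Mt) \<le> (\<integral>\<^sup>+z. iv z * g z \<partial>Mt)"
proof -
  show m: "(\<lambda>x. PP g x / lam' x) \<in> borel_measurable (SM S)"
    unfolding PP_def lam'_def by (intro borel_measurable_divide_ennreal kernel_integral_measurable[OF measurable_sphi] g measurable_rate)
  have "(\<integral>\<^sup>+z. PP g (fst z) / lam' (fst z) \<partial>Mt) = Ex (\<lambda>x. (\<integral>\<^sup>+a. rate (x, a) \<partial>phi x) * (PP g x / lam' x))"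
    using z by (intro Ex_marginal[OF m]) simp
  also have "\<dots> \<le> Ex (\<lambda>x. \<integral>\<^sup>+a. g (x, a) \<partial>phi x)"
  proof (rule Ex_mono)
    fix x assume x: "x \<in> S"
    show "(\<integral>\<^sup>+a. rate (x, a) \<partial>phi x) * (PP g x / lam' x) \<le> (\<integral>\<^sup>+a. g (x, a) \<partial>phi x)"
    proof (cases "0 < Vi x")
      case True
      then have "(\<integral>\<^sup>+a. rate (x, a) \<partial>phi x) = lam' x" "(\<integral>\<^sup>+a. g (x, a) \<partial>phi x) = PP g x"
        by (simp_all add: lam'_def PP_def sphi_def)
      then show ?thesis using ennreal_divide_mult_le[of "PP g x" "lam' x"] by (simp add: mult.commute)
    next
      case False
      then show ?thesis using z[OF x] by (simp add: zero_less_iff_neq_zero)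
    qed
  qed
  also have "\<dots> = (\<integral>\<^sup>+z. iv z * g z \<partial>Mt)" by (rule Ex_phi[OF g, symmetric])
  finally show "(\<integral>\<^sup>+z. PP g (fst z) / lam' (fst z) \<partial>Mt) \<le> (\<integral>\<^sup>+z. iv z * g z \<partial>Mt)" .
qed

text \<open>The stationary policy visits states with \<open>Vi > 0\<close> at most as often as
  \<open>Mt\<close> prescribes. The induction keeps the test function free: one jump turns
  \<open>G\<close> into a quotient \<open>PP g / lam'\<close>, and \<open>quotient_le\<close>
  followed by \<open>flow\<close> returns the estimate to \<open>G\<close> under
  \<open>Mt\<close>.\<close>

lemma occupation_le:
  assumes "G \<in> borel_measurable (SM S)" "\<And>x. x \<in> S \<Longrightarrow> Vi x = 0 \<Longrightarrow> G x = 0"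
  shows "(\<Sum>k<n. \<integral>\<^sup>+h. G (snd h) \<partial>st.mh k) \<le> (\<integral>\<^sup>+z. G (fst z) \<partial>Mt)"
  using assms
proof (induction n arbitrary: G)
  case (Suc n)
  define g where "g z = rate z * (\<integral>\<^sup>+y. G y \<partial>Q z)" for z
  have gm: "g \<in> borel_measurable SA" unfolding g_def[abs_def]
    by (intro borel_measurable_times_ennreal measurable_rate measurable_nn_integral_Q Suc.prems)
  \<comment> \<open>From \<open>Vi = 0\<close> the selector \<open>zsel\<close> leads almost surely
    back to \<open>Vi = 0\<close>, so the new test function vanishes there as well and the induction
    hypothesis applies.\<close>
  have gz: "PP g x = 0" if x: "x \<in> S" "Vi x = 0" for x
  proof -
    have "AE y in Q (x, zsel x). Vi y = 0"
      using zsel(4)[OF x] measurable_Vi by (subst (asm) nn_integral_0_iff_AE) (simp_all add: measurable_cong_sets[OF sets_Q refl])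
    then have "AE y in Q (x, zsel x). G y = 0" by (rule AE_mp) (use Suc.prems(2) in \<open>auto intro!: AE_I2\<close>)
    then have "(\<integral>\<^sup>+y. G y \<partial>Q (x, zsel x)) = (\<integral>\<^sup>+y. 0 \<partial>Q (x, zsel x))" by (rule nn_integral_cong_AE)
    then show ?thesis unfolding PP_def sphi_zero[OF x gm] by (simp add: g_def)
  qed
  have "(\<Sum>k<Suc n. \<integral>\<^sup>+h. G (snd h) \<partial>st.mh k) = (\<integral>\<^sup>+x. G x \<partial>\<gamma>) + (\<Sum>k<n. \<integral>\<^sup>+h. G (snd h) \<partial>st.mh (Suc k))"
    unfolding sum.lessThan_Suc_shift mh_zero[OF Suc.prems(1)] ..
  also have "\<dots> \<le> (\<integral>\<^sup>+x. G x \<partial>\<gamma>) + (\<Sum>k<n. \<integral>\<^sup>+h. PP g (snd h) / lam' (snd h) \<partial>st.mh k)"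
    unfolding g_def by (intro add_left_mono sum_mono mh_Suc_le Suc.prems)
  also have "\<dots> \<le> (\<integral>\<^sup>+x. G x \<partial>\<gamma>) + (\<integral>\<^sup>+z. PP g (fst z) / lam' (fst z) \<partial>Mt)"
    using gz by (intro add_left_mono Suc.IH[OF quotient_le(1)[OF gm]]) simp_all
  also have "\<dots> \<le> (\<integral>\<^sup>+x. G x \<partial>\<gamma>) + (\<integral>\<^sup>+z. iv z * g z \<partial>Mt)"
    by (intro add_left_mono quotient_le(2)[OF gm gz])
  also have "\<dots> \<le> (\<integral>\<^sup>+x. G x \<partial>\<gamma>) + (\<integral>\<^sup>+z. (\<integral>\<^sup>+y. G y \<partial>Q z) \<partial>Mt)"
  proof (intro add_left_mono nn_integral_mono)
    fix z
    have "iv z * g z = iv z * rate z * (\<integral>\<^sup>+y. G y \<partial>Q z)" by (simp add: g_def mult.assoc)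
    also have "\<dots> \<le> 1 * (\<integral>\<^sup>+y. G y \<partial>Q z)" by (intro mult_right_mono iv_rate_le) simp
    finally show "iv z * g z \<le> (\<integral>\<^sup>+y. G y \<partial>Q z)" by simp
  qed
  also have "\<dots> = (\<integral>\<^sup>+z. G (fst z) \<partial>Mt)" by (rule flow[OF Suc.prems(1), symmetric])
  finally show ?case .
qed simp

text \<open>Costs vanish on \<open>Vi = 0\<close> under \<open>zsel\<close>. Elsewhere a sojourn
  costs its mean length times the averaged cost rate, and \<open>occupation_le\<close> bounds the
  number of sojourns.\<close>

lemma objective_spol_le:
  assumes i: "i \<le> N" shows "objective S \<gamma> q (c i) spol \<le> (\<integral>\<^sup>+z. jcost (c i) z \<partial>Mt)"
proof -
  define g where "g z = ennreal (c i z)" for z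
  have cm: "c i \<in> borel_measurable SA" using c_meas i by blast
  have gm: "g \<in> borel_measurable SA" unfolding g_def[abs_def] by (rule measurable_compose[OF cm measurable_ennreal])
  have gz: "PP g x = 0" if "x \<in> S" "Vi x = 0" for x
    unfolding PP_def sphi_zero[OF that gm] using zsel_cost[OF that i] by (simp add: g_def)
  have "objective S \<gamma> q (c i) spol = (\<Sum>n. \<integral>\<^sup>+h. (\<integral>\<^sup>+s. st.ew n (h, s) * st.gc (c i) n (h, s) \<partial>posL) \<partial>st.mh n)"
    by (rule st.objective_eq[OF cm])
  also have "\<dots> \<le> (\<Sum>n. \<integral>\<^sup>+h. PP g (snd h) / lam' (snd h) \<partial>st.mh n)"
  proof (intro suminf_le summableI nn_integral_mono)
    fix n h assume "h \<in> space (st.mh n)"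
    then have h: "h \<in> space (histM S n)" by simp
    have "(\<integral>\<^sup>+s. st.ew n (h, s) * st.gc (c i) n (h, s) \<partial>posL) = X n h * PP g (snd h)"
      unfolding X_mult[OF h, symmetric] by (simp add: st.gc_def PP_def g_def spol_def)
    then show "(\<integral>\<^sup>+s. st.ew n (h, s) * st.gc (c i) n (h, s) \<partial>posL) \<le> PP g (snd h) / lam' (snd h)" using X_le[OF h] by simp
  qed
  also have "\<dots> \<le> (\<integral>\<^sup>+z. PP g (fst z) / lam' (fst z) \<partial>Mt)"
    using gz by (intro suminf_le_const summableI occupation_le[OF quotient_le(1)[OF gm gz]]) auto
  also have "\<dots> \<le> (\<integral>\<^sup>+z. iv z * g z \<partial>Mt)" by (rule quotient_le(2)[OF gm gz])
  also have "\<dots> \<le> (\<integral>\<^sup>+z. jcost (c i) z \<partial>Mt)"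
    by (intro nn_integral_mono) (auto simp: iv_def g_def jcost_def mult.commute[of _ "ennreal _"] ennreal_times_divide)
  finally show ?thesis .
qed

end

section \<open>The optimal stationary policy\<close>

context ctmdp_costs
begin

lemma stationary_of_occ:
  assumes o: "occ \<mu>" and fin: "\<And>i. i \<le> N \<Longrightarrow> (\<Sum>n. \<integral>\<^sup>+z. jcost (c i) z \<partial>\<mu> n) < \<top>"
  obtains pol where "stationary S A pol" "is_policy S A pol"
    "\<And>i. i \<le> N \<Longrightarrow> objective S \<gamma> q (c i) pol \<le> (\<Sum>n. \<integral>\<^sup>+z. jcost (c i) z \<partial>\<mu> n)"
proof -
  define Mt where "Mt = functional_measure SA (\<lambda>g. \<Sum>n. \<integral>\<^sup>+z. g z \<partial>\<mu> n)"
  have Mt: "(\<integral>\<^sup>+z. g z \<partial>Mt) = (\<Sum>n. \<integral>\<^sup>+z. g z \<partial>\<mu> n)" if "g \<in> borel_measurable SA" for g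
    unfolding Mt_def by (intro nn_integral_functional_measure[OF pos_functional_suminf[OF pos_functional_nn_integral]] occD(1)[OF o] that)
  have st: "sets Mt = sets SA" by (simp add: Mt_def)
  interpret occ_total S A \<gamma> q c N Mt
  proof
    show "sets Mt = sets SA" by (rule st)
    fix f :: "'s \<Rightarrow> ennreal" assume f: "f \<in> borel_measurable (SM S)"
    have "(\<integral>\<^sup>+z. f (fst z) \<partial>Mt) = (\<Sum>n. \<integral>\<^sup>+z. f (fst z) \<partial>\<mu> n)" by (rule Mt[OF measurable_compose[OF measurable_fst f]])
    also have "\<dots> = (\<integral>\<^sup>+z. f (fst z) \<partial>\<mu> 0) + (\<Sum>n. \<integral>\<^sup>+z. f (fst z) \<partial>\<mu> (Suc n))"
      using suminf_offset[OF summableI, of "\<lambda>n. \<integral>\<^sup>+z. f (fst z) \<partial>\<mu> n" 1] by (simp add: add.commute)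
    also have "\<dots> = (\<integral>\<^sup>+x. f x \<partial>\<gamma>) + (\<Sum>n. \<integral>\<^sup>+z. (\<integral>\<^sup>+y. f y \<partial>Q z) \<partial>\<mu> n)" unfolding occD(3)[OF o f] occD(4)[OF o f] ..
    also have "\<dots> = (\<integral>\<^sup>+x. f x \<partial>\<gamma>) + (\<integral>\<^sup>+z. (\<integral>\<^sup>+y. f y \<partial>Q z) \<partial>Mt)" unfolding Mt[OF measurable_nn_integral_Q[OF f]] ..
    finally show "(\<integral>\<^sup>+z. f (fst z) \<partial>Mt) = (\<integral>\<^sup>+x. f x \<partial>\<gamma>) + (\<integral>\<^sup>+z. (\<integral>\<^sup>+y. f y \<partial>Q z) \<partial>Mt)" .
  next
    have "(\<integral>\<^sup>+z. Ct z \<partial>Mt) = (\<Sum>i\<le>N. \<integral>\<^sup>+z. jcost (c i) z \<partial>Mt)" unfolding Ct_def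
      by (rule nn_integral_sum) (simp add: measurable_cong_sets[OF st refl] jcost_measurable)
    also have "\<dots> < \<top>" using fin by (auto simp: less_top[symmetric] Mt[OF jcost_measurable])
    finally show "(\<integral>\<^sup>+z. Ct z \<partial>Mt) < \<top>" .
  qed
  show thesis using that[OF stationary_spol is_policy_spol] objective_spol_le by (simp add: Mt[OF jcost_measurable])
qed

theorem ex_stationary_optimal:
  assumes C2: "\<exists>pol. feasible S A \<gamma> q c N d pol \<and> objective S \<gamma> q (c 0) pol < \<top>"
  shows "\<exists>pol. stationary S A pol \<and> feasible S A \<gamma> q c N d pol \<and>
     objective S \<gamma> q (c 0) pol = (INF p\<in>{p. feasible S A \<gamma> q c N d p}. objective S \<gamma> q (c 0) p)"
proof -
  define I where "I = (INF p\<in>{p. feasible S A \<gamma> q c N d p}. objective S \<gamma> q (c 0) p)"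
  obtain p0 where p0: "feasible S A \<gamma> q c N d p0" "objective S \<gamma> q (c 0) p0 < \<top>" using C2 by blast
  have "I \<le> objective S \<gamma> q (c 0) p0" unfolding I_def using p0(1) by (intro INF_lower) simp
  then have I: "I < \<top>" using p0(2) by (rule order.strict_trans1)
  have "\<exists>p. feasible S A \<gamma> q c N d p \<and> objective S \<gamma> q (c 0) p < I + ennreal (1 / real (Suc k))" for k
  proof -
    have "I < I + ennreal (1 / real (Suc k))" using I by (cases I) (auto simp: ennreal_less_iff simp flip: ennreal_plus)
    then show ?thesis unfolding I_def INF_less_iff by auto
  qed
  then obtain p where p: "\<And>k. feasible S A \<gamma> q c N d (p k)" "\<And>k. objective S \<gamma> q (c 0) (p k) < I + ennreal (1 / real (Suc k))" by metis
  \<comment> \<open>Near-minimality bounds the objective, the constraints bound the other costs. All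
    of them must be finite for the occupation sequence of \<open>p k\<close> to be
    available.\<close>
  have fin: "objective S \<gamma> q (c i) (p k) < \<top>" if "i \<le> N" for i k
  proof (cases "i = 0")
    case True
    then show ?thesis using order.strict_trans2[OF p(2)[of k] top_greatest] by simp
  next
    case False
    then have "objective S \<gamma> q (c i) (p k) \<le> ennreal (d i)" using p(1)[of k] that by (auto simp: feasible_def)
    then show ?thesis by (rule order.strict_trans1) simp
  qed
  have pol: "ctmdp_costs_policy S A \<gamma> q c N (p k)" for k
  proof -
    have "is_policy S A (p k)" using p(1) by (simp add: feasible_def)
    then show ?thesis by unfold_locales (use fin in auto)
  qed
  define \<mu> where "\<mu> k = ctmdp_costs_policy.occ_of S A \<gamma> q c N (p k)" for k
  have o: "occ (\<mu> k)" for k unfolding \<mu>_def by (rule ctmdp_costs_policy.occ_occ_of[OF pol])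
  have cost: "(\<Sum>n. \<integral>\<^sup>+z. jcost (c i) z \<partial>\<mu> k n) \<le> objective S \<gamma> q (c i) (p k)" if "i \<le> N" for i k
    unfolding \<mu>_def by (rule ctmdp_costs_policy.occ_of_cost[OF pol that])
  obtain s \<mu>' where s: "strict_mono s" "occ \<mu>'"
    "\<And>h. lsc (S \<times> A) h \<Longrightarrow> (\<Sum>n. \<integral>\<^sup>+z. h z \<partial>\<mu>' n) \<le> liminf (\<lambda>k. \<Sum>n. \<integral>\<^sup>+z. h z \<partial>\<mu> (s k) n)"
    by (rule occ_compact[of \<mu>, OF o], rule that)
  have lim: "(\<Sum>n. \<integral>\<^sup>+z. jcost (c i) z \<partial>\<mu>' n) \<le> liminf (\<lambda>k. objective S \<gamma> q (c i) (p (s k)))" if "i \<le> N" for i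
    by (rule order_trans[OF s(3)[OF lsc_jcost_c[OF that]]]) (intro Liminf_mono always_eventually allI cost that)
  have lim0: "(\<Sum>n. \<integral>\<^sup>+z. jcost (c 0) z \<partial>\<mu>' n) \<le> I"
  proof -
    have "liminf (\<lambda>k. objective S \<gamma> q (c 0) (p (s k))) \<le> liminf (\<lambda>k. I + ennreal (1 / real (Suc k)))"
    proof (intro Liminf_mono always_eventually allI)
      fix k
      have "objective S \<gamma> q (c 0) (p (s k)) \<le> I + ennreal (1 / real (Suc (s k)))" using p(2)[of "s k"] by simp
      also have "\<dots> \<le> I + ennreal (1 / real (Suc k))" using seq_suble[OF s(1), of k] by (intro add_left_mono ennreal_leI) (simp add: field_simps)
      finally show "objective S \<gamma> q (c 0) (p (s k)) \<le> I + ennreal (1 / real (Suc k))" .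
    qed
    also have "\<dots> = I"
    proof (intro lim_imp_Liminf)
      have "(\<lambda>k. I + ennreal (1 / real (Suc k))) \<longlonglongrightarrow> I + ennreal 0"
        using LIMSEQ_inverse_real_of_nat by (intro tendsto_add tendsto_const tendsto_ennrealI) (simp add: inverse_eq_divide)
      then show "(\<lambda>k. I + ennreal (1 / real (Suc k))) \<longlonglongrightarrow> I" by simp
    qed simp
    finally show ?thesis using lim[of 0] by (simp add: order_trans)
  qed
  have limj: "(\<Sum>n. \<integral>\<^sup>+z. jcost (c j) z \<partial>\<mu>' n) \<le> ennreal (d j)" if "j \<in> {1..N}" for j
  proof -
    have "liminf (\<lambda>k. objective S \<gamma> q (c j) (p (s k))) \<le> liminf (\<lambda>k. ennreal (d j))"
      using p(1) that by (intro Liminf_mono always_eventually allI) (auto simp: feasible_def)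
    also have "\<dots> = ennreal (d j)" by (rule Liminf_const) simp
    finally show ?thesis using lim[of j] that by (auto intro: order_trans)
  qed
  have "(\<Sum>n. \<integral>\<^sup>+z. jcost (c i) z \<partial>\<mu>' n) < \<top>" if "i \<le> N" for i
  proof (cases "i = 0")
    case True
    then show ?thesis using lim0 I by (simp add: order.strict_trans1)
  next
    case False
    then have "(\<Sum>n. \<integral>\<^sup>+z. jcost (c i) z \<partial>\<mu>' n) \<le> ennreal (d i)" using that by (intro limj) simp
    then show ?thesis by (rule order.strict_trans1) simp
  qed
  from stationary_of_occ[OF s(2) this] obtain pol where pol: "stationary S A pol" "is_policy S A pol"
    "\<And>i. i \<le> N \<Longrightarrow> objective S \<gamma> q (c i) pol \<le> (\<Sum>n. \<integral>\<^sup>+z. jcost (c i) z \<partial>\<mu>' n)" by blast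
  have feas: "feasible S A \<gamma> q c N d pol" unfolding feasible_def
  proof (intro conjI ballI pol(2))
    fix j assume j: "j \<in> {1..N}"
    show "objective S \<gamma> q (c j) pol \<le> ennreal (d j)" by (rule order_trans[OF pol(3) limj[OF j]]) (use j in simp)
  qed
  then have "I \<le> objective S \<gamma> q (c 0) pol" unfolding I_def by (intro INF_lower) simp
  moreover have "objective S \<gamma> q (c 0) pol \<le> I" using order_trans[OF pol(3) lim0] by simp
  ultimately show ?thesis using pol(1) feas unfolding I_def by (intro exI[of _ pol]) (simp add: antisym)
qed

end

theorem theorem6p2:
  fixes S :: "'s::polish_space set" and A :: "'b::polish_space set"
    and \<gamma> :: "'s measure" and q :: "'s \<Rightarrow> 'b \<Rightarrow> 's set \<Rightarrow> real"
    and c :: "nat \<Rightarrow> 's \<times> 'b \<Rightarrow> real" and N :: nat and d :: "nat \<Rightarrow> real"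
  assumes S: "S \<noteq> {}" "S \<in> sets borel"
    and A: "A \<noteq> {}" "A \<in> sets borel"
    and gamma: "prob_space \<gamma>" "sets \<gamma> = sets (SM S)"
    and q_kernel: "signed_kernel S A q"
    and q_nonneg: "\<forall>x\<in>S. \<forall>a\<in>A. \<forall>\<Gamma>\<in>sets (SM S). 0 \<le> qt q x a \<Gamma>"
    and q_conservative: "\<forall>x\<in>S. \<forall>a\<in>A. q x a S = 0"
    and qx_nonneg: "\<forall>x\<in>S. \<forall>a\<in>A. 0 \<le> qx q x a"
    and q_bounded: "\<forall>x\<in>S. bdd_above (qx q x ` A)"
    and c_meas: "\<forall>i\<le>N. c i \<in> borel_measurable (SM S \<Otimes>\<^sub>M SM A)"
    and c_nonneg: "\<forall>i\<le>N. \<forall>z\<in>S \<times> A. 0 \<le> c i z"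
    and d_nonneg: "\<forall>j\<in>{1..N}. 0 \<le> d j"
    \<comment> \<open>Condition 1\<close>
    and C1a: "compact A"
    and C1b: "\<forall>f :: 's \<Rightarrow> real. continuous_on S f \<and> bounded (f ` S) \<longrightarrow>
               continuous_on (S \<times> A) (\<lambda>(x,a). (\<integral>y. f y \<partial>(qtM q S x a)) / qx q x a)"
    and C1c: "continuous_on (S \<times> A) (\<lambda>(x,a). qx q x a)"
    and C1d: "\<forall>i\<le>N. lsc_on (S \<times> A) (c i)"
    \<comment> \<open>Condition 2\<close>
    and C2: "\<exists>pol. feasible S A \<gamma> q c N d pol \<and> objective S \<gamma> q (c 0) pol < \<top>"
  shows "\<exists>pol. stationary S A pol \<and> feasible S A \<gamma> q c N d pol \<and>
           objective S \<gamma> q (c 0) pol =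
             (INF p\<in>{p. feasible S A \<gamma> q c N d p}. objective S \<gamma> q (c 0) p)"
proof -
  interpret ctmdp_costs S A \<gamma> q c N
    by (intro ctmdp_costs.intro ctmdp.intro ctmdp_costs_axioms.intro) (fact S A gamma q_kernel q_nonneg q_conservative qx_nonneg q_bounded C1a C1b C1c c_meas c_nonneg C1d)+
  show ?thesis by (rule ex_stationary_optimal[OF C2])
qed

end
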